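(* Let $(\mathfrak g_1,\mathfrak g_2)$ be a matched pair of Lie algebras. Then, with the canonical action of $U(\mathfrak g_1)$ on $R(\mathfrak g_2)$ given by $\langle u\triangleright f,u'\rangle=\langle f,u'\triangleleft u\rangle$ ($u\in U(\mathfrak g_1)$, $u'\in U(\mathfrak g_2)$, $f\in R(\mathfrak g_2)$) and the canonical coaction of $R(\mathfrak g_2)$ on $U(\mathfrak g_1)$ extending $\nabla_{\rm Alg}:\mathfrak g_1\to\mathfrak g_1\otimes R(\mathfrak g_2)$, the pair $(R(\mathfrak g_2),U(\mathfrak g_1))$ is a matched pair of Hopf algebras.
   Context: Everything is over $\mathbb C$; Lie algebras are finite dimensional; Sweedler notation is used ($\Delta(u)=u_{(1)}\otimes u_{(2)}$, right coactions $\nabla(u)=u_{\langle0\rangle}\otimes u_{\langle1\rangle}$). **Matched pair of Lie algebras.** $(\mathfrak g_1,\mathfrak g_2)$ with linear maps $\mathfrak g_2\otimes\mathfrak g_1\to\mathfrak g_1$, $\xi\otimes X\mapsto\xi\triangleright X$, and $\mathfrak g_2\otimes\mathfrak g_1\to\mathfrak g_2$, $\xi\otimes X\mapsto\xi\triangleleft X$, such that for all $X,Y\in\mathfrak g_1$, $\zeta,\xi\in\mathfrak g_2$: $[\zeta,\xi]\triangleright X=\zeta\triangleright(\xi\triangleright X)-\xi\triangleright(\zeta\triangleright X)$; $\zeta\triangleleft[X,Y]=(\zeta\triangleleft X)\triangleleft Y-(\zeta\triangleleft Y)\triangleleft X$; $\zeta\triangleright[X,Y]=[\zeta\triangleright X,Y]+[X,\zeta\triangleright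 Y]+(\zeta\triangleleft X)\triangleright Y-(\zeta\triangleleft Y)\triangleright X$; $[\zeta,\xi]\triangleleft X=[\zeta\triangleleft X,\xi]+[\zeta,\xi\triangleleft X]+\zeta\triangleleft(\xi\triangleright X)-\xi\triangleleft(\zeta\triangleright X)$. The double crossed sum $\mathfrak g_1\bowtie\mathfrak g_2$ is $\mathfrak g_1\oplus\mathfrak g_2$ with the Lie bracket for which $\mathfrak g_1,\mathfrak g_2$ are subalgebras and $[\xi,X]=\xi\triangleright X+\xi\triangleleft X$. **Mutual actions of enveloping algebras.** Multiplication gives a linear isomorphism $U(\mathfrak g_1)\otimes U(\mathfrak g_2)\cong U(\mathfrak g_1\bowtie\mathfrak g_2)$. For $u'\in U(\mathfrak g_2)$, $u\in U(\mathfrak g_1)$ write $u'u=\sum_i p_iq_i$ with $p_i\in U(\mathfrak g_1)$, $q_i\in U(\mathfrak g_2)$; then $u'\triangleright u:=\sum_i p_i\varepsilon(q_i)$ (a left action of $U(\mathfrak g_2)$ on $U(\mathfrak g_1)$ preserving $\mathfrak g_1$) and $u'\triangleleft u:=\sum_i\varepsilon(p_i)q_i$ (a right action of $U(\mathfrak g_1)$ on $U(\mathfrak g_2)$). **$R(\mathfrak g)$.** For a Lie algebra $\mathfrak g$, $R(\mathfrak g)$ is the commutative Hopf algebra of those $f\in\mathrm{Hom}(U(\mathfrak g),\mathbb C)$ for which there is a two-sided ideal $I\subseteq\ker f$ of $U(\mathfrak g)$ with $\dim(\ker f/I)<\infty$; the product is $(fg)(u)=f(u_{(1)})g(u_{(2)})$,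 the unit is $\varepsilon_{U(\mathfrak g)}$, the coproduct is determined by $f_{(1)}(u^1)f_{(2)}(u^2)=f(u^1u^2)$, $\varepsilon(f)=f(1)$, $S(f)(u)=f(S(u))$. Write $\langle f,u\rangle=f(u)$. **Canonical coaction.** For a basis $X_1,\dots,X_N$ of $\mathfrak g_1$ define $f_i^j\in R(\mathfrak g_2)$ by $u'\triangleright X_i=\sum_jf_i^j(u')X_j$ for $u'\in U(\mathfrak g_2)$, and $\nabla_{\rm Alg}(X_i)=\sum_jX_j\otimes f_i^j$. It is extended to $\nabla:U(\mathfrak g_1)\to U(\mathfrak g_1)\otimes R(\mathfrak g_2)$ by $\nabla(1)=1\otimes1$ and $\nabla(uv)=u_{(1)\langle0\rangle}v_{\langle0\rangle}\otimes u_{(1)\langle1\rangle}(u_{(2)}\triangleright v_{\langle1\rangle})$. **Matched pair of Hopf algebras.** A pair $(\mathcal F,\mathcal U)$ of Hopf algebras, with a left action $\triangleright$ of $\mathcal U$ on $\mathcal F$ and a right coaction $\nabla:\mathcal U\to\mathcal U\otimes\mathcal F$, is a matched pair if $\mathcal F$ is a left $\mathcal U$-module algebra, $\mathcal U$ is a right $\mathcal F$-comodule coalgebra ($u_{\langle0\rangle(1)}\otimes u_{\langle0\rangle(2)}\otimes u_{\langle1\rangle}=u_{(1)\langle0\rangle}\otimes u_{(2)\langle0\rangle}\otimes u_{(1)\langle1\rangle}u_{(2)\langle1\rangle}$, $\varepsilon(u_{\langle0\rangle})u_{\langle1\rangle}=\varepsilon(u)1$), and for all $u,v\in\mathcal U$,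 $f\in\mathcal F$: $\varepsilon(u\triangleright f)=\varepsilon(u)\varepsilon(f)$; $\Delta(u\triangleright f)=u_{(1)\langle0\rangle}\triangleright f_{(1)}\otimes u_{(1)\langle1\rangle}(u_{(2)}\triangleright f_{(2)})$; $\nabla(1)=1\otimes1$; $\nabla(uv)=u_{(1)\langle0\rangle}v_{\langle0\rangle}\otimes u_{(1)\langle1\rangle}(u_{(2)}\triangleright v_{\langle1\rangle})$; $u_{(2)\langle0\rangle}\otimes(u_{(1)}\triangleright f)u_{(2)\langle1\rangle}=u_{(1)\langle0\rangle}\otimes u_{(1)\langle1\rangle}(u_{(2)}\triangleright f)$. *)

theory Defs
  imports
    Complex_Main
    "Jordan_Normal_Form.Missing_VectorSpace"
    "HOL-Algebra.QuotRing"
    "HOL-Library.Poly_Mapping"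
begin

section \<open>Complex vector spaces and algebras\<close>

text \<open>The field of complex numbers, as a ring of scalars and as a module over itself.
  Complex vector spaces are the \<open>V\<close> with \<open>vectorspace cpx V\<close>; the fields \<open>mult\<close> and \<open>one\<close>
  of such a record carry no meaning unless it is used as an algebra.\<close>

definition cpx :: "(complex, complex) module" where
  "cpx = \<lparr>carrier = UNIV, mult = (*), one = 1, zero = 0, add = (+), smult = (*)\<rparr>"

text \<open>The quotient of a space by a subspace. If \<open>V\<close> is an algebra and \<open>W\<close> a two-sided ideal, this
  is the ring \<open>V Quot W\<close> equipped with the induced scalar multiplication.\<close>

definition quot_space :: "(complex, 'a, 'm) module_scheme \<Rightarrow> 'a set \<Rightarrow> (complex, 'a set) module" where
  "quot_space V W =
    \<lparr>carrier = a_rcosets\<^bsub>V\<^esub> W, mult = rcoset_mult V W, one = W +>\<^bsub>V\<^esub> \<one>\<^bsub>V\<^esub>, zero = W,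
     add = set_add V, smult = (\<lambda>c X. \<Union>x\<in>X. W +>\<^bsub>V\<^esub> (c \<odot>\<^bsub>V\<^esub> x))\<rparr>"

locale complex_algebra = vectorspace cpx A + ring A for A (structure) +
  assumes smult_mult_left:
      "\<lbrakk>x \<in> carrier A; y \<in> carrier A\<rbrakk> \<Longrightarrow> (c \<odot>\<^bsub>A\<^esub> x) \<otimes>\<^bsub>A\<^esub> y = c \<odot>\<^bsub>A\<^esub> (x \<otimes>\<^bsub>A\<^esub> y)"
    and smult_mult_right:
      "\<lbrakk>x \<in> carrier A; y \<in> carrier A\<rbrakk> \<Longrightarrow> x \<otimes>\<^bsub>A\<^esub> (c \<odot>\<^bsub>A\<^esub> y) = c \<odot>\<^bsub>A\<^esub> (x \<otimes>\<^bsub>A\<^esub> y)"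

definition complex_alg_hom ::
  "(complex, 'a, 'm) module_scheme \<Rightarrow> (complex, 'b, 'n) module_scheme \<Rightarrow> ('a \<Rightarrow> 'b) set" where
  "complex_alg_hom A B = {h \<in> module_hom cpx A B. h \<one>\<^bsub>A\<^esub> = \<one>\<^bsub>B\<^esub> \<and>
     (\<forall>x\<in>carrier A. \<forall>y\<in>carrier A. h (x \<otimes>\<^bsub>A\<^esub> y) = h x \<otimes>\<^bsub>B\<^esub> h y)}"

definition opposite_alg :: "(complex, 'a, 'm) module_scheme \<Rightarrow> (complex, 'a, 'm) module_scheme" where
  "opposite_alg A = A\<lparr>mult := (\<lambda>x y. y \<otimes>\<^bsub>A\<^esub> x)\<rparr>"


section \<open>Tensor products\<close>

definition free_space :: "'s set \<Rightarrow> (complex, 's \<Rightarrow>\<^sub>0 complex) module" where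
  "free_space S =
    \<lparr>carrier = {p. Poly_Mapping.keys p \<subseteq> S}, mult = (\<lambda>_ _. 0), one = 0, zero = 0,
     add = (+), smult = (\<lambda>c. Poly_Mapping.map ((*) c))\<rparr>"

definition tensor_rels ::
  "(complex, 'a, 'm) module_scheme \<Rightarrow> (complex, 'b, 'n) module_scheme \<Rightarrow> ('a \<times> 'b \<Rightarrow>\<^sub>0 complex) set" where
  "tensor_rels V W =
    {Poly_Mapping.single (v \<oplus>\<^bsub>V\<^esub> v', w) 1 - Poly_Mapping.single (v, w) 1 - Poly_Mapping.single (v', w) 1
      | v v' w. v \<in> carrier V \<and> v' \<in> carrier V \<and> w \<in> carrier W} \<union>
    {Poly_Mapping.single (v, w \<oplus>\<^bsub>W\<^esub> w') 1 - Poly_Mapping.single (v, w) 1 - Poly_Mapping.single (v, w') 1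
      | v w w'. v \<in> carrier V \<and> w \<in> carrier W \<and> w' \<in> carrier W} \<union>
    {Poly_Mapping.single (c \<odot>\<^bsub>V\<^esub> v, w) 1 - Poly_Mapping.single (v, w) c
      | c v w. v \<in> carrier V \<and> w \<in> carrier W} \<union>
    {Poly_Mapping.single (v, c \<odot>\<^bsub>W\<^esub> w) 1 - Poly_Mapping.single (v, w) c
      | c v w. v \<in> carrier V \<and> w \<in> carrier W}"

definition tensor_null ::
  "(complex, 'a, 'm) module_scheme \<Rightarrow> (complex, 'b, 'n) module_scheme \<Rightarrow> ('a \<times> 'b \<Rightarrow>\<^sub>0 complex) set" where
  "tensor_null V W = module.span cpx (free_space (carrier V \<times> carrier W)) (tensor_rels V W)"

definition tensor ::
  "(complex, 'a, 'm) module_scheme \<Rightarrow> (complex, 'b, 'n) module_scheme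
    \<Rightarrow> (complex, ('a \<times> 'b \<Rightarrow>\<^sub>0 complex) set) module" where
  "tensor V W = quot_space (free_space (carrier V \<times> carrier W)) (tensor_null V W)"

definition pure_tensor ::
  "'a \<Rightarrow> (complex, 'a, 'm) module_scheme \<Rightarrow> (complex, 'b, 'n) module_scheme \<Rightarrow> 'b
    \<Rightarrow> ('a \<times> 'b \<Rightarrow>\<^sub>0 complex) set"
  (\<open>(_ \<boxtimes>\<^bsub>_,_\<^esub> _)\<close> [71, 0, 0, 71] 70) where
  "v \<boxtimes>\<^bsub>V,W\<^esub> w =
    tensor_null V W +>\<^bsub>free_space (carrier V \<times> carrier W)\<^esub> Poly_Mapping.single (v, w) 1"

text \<open>The linear map on the tensor product induced by a bilinear map \<open>b\<close>. Writing
  \<open>t = \<Sum>\<^sub>i v\<^sub>i \<otimes> w\<^sub>i\<close>, the term \<open>tensor_lift V W Z (\<lambda>v w. b v w) t\<close> is \<open>\<Sum>\<^sub>i b v\<^sub>i w\<^sub>i\<close>,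
  so that Sweedler notation becomes nested applications of this operator.\<close>

definition tensor_lift ::
  "(complex, 'a, 'm) module_scheme \<Rightarrow> (complex, 'b, 'n) module_scheme \<Rightarrow> (complex, 'c, 'k) module_scheme
    \<Rightarrow> ('a \<Rightarrow> 'b \<Rightarrow> 'c) \<Rightarrow> ('a \<times> 'b \<Rightarrow>\<^sub>0 complex) set \<Rightarrow> 'c" where
  "tensor_lift V W Z b = (THE h. h \<in> module_hom cpx (tensor V W) Z \<and>
     h \<in> extensional (carrier (tensor V W)) \<and>
     (\<forall>v\<in>carrier V. \<forall>w\<in>carrier W. h (v \<boxtimes>\<^bsub>V,W\<^esub> w) = b v w))"

definition tensor_alg ::
  "(complex, 'a, 'm) module_scheme \<Rightarrow> (complex, 'b, 'n) module_scheme
    \<Rightarrow> (complex, ('a \<times> 'b \<Rightarrow>\<^sub>0 complex) set) module" where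
  "tensor_alg A B = (tensor A B)
    \<lparr>mult := (\<lambda>s t. tensor_lift A B (tensor A B) (\<lambda>a b.
        tensor_lift A B (tensor A B) (\<lambda>a' b'. (a \<otimes>\<^bsub>A\<^esub> a') \<boxtimes>\<^bsub>A,B\<^esub> (b \<otimes>\<^bsub>B\<^esub> b')) t) s),
     one := \<one>\<^bsub>A\<^esub> \<boxtimes>\<^bsub>A,B\<^esub> \<one>\<^bsub>B\<^esub>\<rparr>"


section \<open>Hopf algebras\<close>

record 'a hopf = "(complex, 'a) module" +
  comult :: "'a \<Rightarrow> ('a \<times> 'a \<Rightarrow>\<^sub>0 complex) set"
  counit :: "'a \<Rightarrow> complex"
  antipode :: "'a \<Rightarrow> 'a"

text \<open>\<open>sweedler H Z b h\<close> is \<open>b h\<^sub>(\<^sub>1\<^sub>) h\<^sub>(\<^sub>2\<^sub>)\<close>, for \<open>b\<close> bilinear with values in \<open>Z\<close>.\<close>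

definition sweedler ::
  "('a, 'm) hopf_scheme \<Rightarrow> (complex, 'c, 'k) module_scheme \<Rightarrow> ('a \<Rightarrow> 'a \<Rightarrow> 'c) \<Rightarrow> 'a \<Rightarrow> 'c" where
  "sweedler H Z b h = tensor_lift H H Z b (comult H h)"

locale hopf_algebra = complex_algebra H for H :: "('a, 'm) hopf_scheme" (structure) +
  assumes comult_alg_hom: "comult H \<in> complex_alg_hom H (tensor_alg H H)"
    and counit_alg_hom: "counit H \<in> complex_alg_hom H cpx"
    and antipode_linear: "antipode H \<in> module_hom cpx H H"
    and coassociative: "h \<in> carrier H \<Longrightarrow>
      sweedler H (tensor H (tensor H H)) (\<lambda>x z. sweedler H (tensor H (tensor H H))
        (\<lambda>x' y. x' \<boxtimes>\<^bsub>H,tensor H H\<^esub> (y \<boxtimes>\<^bsub>H,H\<^esub> z)) x) h =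
      sweedler H (tensor H (tensor H H)) (\<lambda>x y. x \<boxtimes>\<^bsub>H,tensor H H\<^esub> comult H y) h"
    and counit_left: "h \<in> carrier H \<Longrightarrow> sweedler H H (\<lambda>x y. counit H x \<odot>\<^bsub>H\<^esub> y) h = h"
    and counit_right: "h \<in> carrier H \<Longrightarrow> sweedler H H (\<lambda>x y. counit H y \<odot>\<^bsub>H\<^esub> x) h = h"
    and antipode_left: "h \<in> carrier H \<Longrightarrow>
      sweedler H H (\<lambda>x y. antipode H x \<otimes>\<^bsub>H\<^esub> y) h = counit H h \<odot>\<^bsub>H\<^esub> \<one>\<^bsub>H\<^esub>"
    and antipode_right: "h \<in> carrier H \<Longrightarrow>
      sweedler H H (\<lambda>x y. x \<otimes>\<^bsub>H\<^esub> antipode H y) h = counit H h \<odot>\<^bsub>H\<^esub> \<one>\<^bsub>H\<^esub>"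

text \<open>For a map \<open>co : U \<rightarrow> U \<otimes> F\<close> and \<open>act\<close> of \<open>U\<close> on \<open>F\<close>, the element
  \<open>u\<^sub>(\<^sub>1\<^sub>)\<^sub>\<langle>\<^sub>0\<^sub>\<rangle> v\<^sub>\<langle>\<^sub>0\<^sub>\<rangle> \<otimes> u\<^sub>(\<^sub>1\<^sub>)\<^sub>\<langle>\<^sub>1\<^sub>\<rangle> (u\<^sub>(\<^sub>2\<^sub>) \<triangleright> v\<^sub>\<langle>\<^sub>1\<^sub>\<rangle>)\<close>.\<close>

definition coaction_product ::
  "('f, 'm) hopf_scheme \<Rightarrow> ('u, 'n) hopf_scheme \<Rightarrow> ('u \<Rightarrow> 'f \<Rightarrow> 'f)
    \<Rightarrow> ('u \<Rightarrow> ('u \<times> 'f \<Rightarrow>\<^sub>0 complex) set) \<Rightarrow> 'u \<Rightarrow> 'u \<Rightarrow> ('u \<times> 'f \<Rightarrow>\<^sub>0 complex) set" where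
  "coaction_product F U act co u v =
    sweedler U (tensor U F) (\<lambda>u1 u2.
      tensor_lift U F (tensor U F) (\<lambda>x f.
        tensor_lift U F (tensor U F) (\<lambda>y g.
          (x \<otimes>\<^bsub>U\<^esub> y) \<boxtimes>\<^bsub>U,F\<^esub> (f \<otimes>\<^bsub>F\<^esub> act u2 g)) (co v)) (co u1)) u"

locale matched_pair_hopf = F: hopf_algebra F + U: hopf_algebra U
  for F :: "('f, 'm) hopf_scheme" and U :: "('u, 'n) hopf_scheme" +
  fixes act :: "'u \<Rightarrow> 'f \<Rightarrow> 'f" (infixr \<open>\<triangleright>\<close> 75)
    and co :: "'u \<Rightarrow> ('u \<times> 'f \<Rightarrow>\<^sub>0 complex) set"
  assumes act_linear_right: "u \<in> carrier U \<Longrightarrow> act u \<in> module_hom cpx F F"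
    and act_linear_left: "f \<in> carrier F \<Longrightarrow> (\<lambda>u. u \<triangleright> f) \<in> module_hom cpx U F"
    and act_one: "f \<in> carrier F \<Longrightarrow> \<one>\<^bsub>U\<^esub> \<triangleright> f = f"
    and act_mult: "\<lbrakk>u \<in> carrier U; v \<in> carrier U; f \<in> carrier F\<rbrakk> \<Longrightarrow>
      (u \<otimes>\<^bsub>U\<^esub> v) \<triangleright> f = u \<triangleright> v \<triangleright> f"
    and act_on_mult: "\<lbrakk>u \<in> carrier U; f \<in> carrier F; g \<in> carrier F\<rbrakk> \<Longrightarrow>
      u \<triangleright> (f \<otimes>\<^bsub>F\<^esub> g) = sweedler U F (\<lambda>u1 u2. (u1 \<triangleright> f) \<otimes>\<^bsub>F\<^esub> (u2 \<triangleright> g)) u"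
    and act_on_one: "u \<in> carrier U \<Longrightarrow> u \<triangleright> \<one>\<^bsub>F\<^esub> = counit U u \<odot>\<^bsub>F\<^esub> \<one>\<^bsub>F\<^esub>"
    and co_linear: "co \<in> module_hom cpx U (tensor U F)"
    and co_coassociative: "u \<in> carrier U \<Longrightarrow>
      tensor_lift U F (tensor U (tensor F F)) (\<lambda>x g.
        tensor_lift U F (tensor U (tensor F F)) (\<lambda>y f.
          y \<boxtimes>\<^bsub>U,tensor F F\<^esub> (f \<boxtimes>\<^bsub>F,F\<^esub> g)) (co x)) (co u) =
      tensor_lift U F (tensor U (tensor F F)) (\<lambda>x f. x \<boxtimes>\<^bsub>U,tensor F F\<^esub> comult F f) (co u)"
    and co_counit: "u \<in> carrier U \<Longrightarrow>
      tensor_lift U F U (\<lambda>x f. counit F f \<odot>\<^bsub>U\<^esub> x) (co u) = u"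
    and co_comult: "u \<in> carrier U \<Longrightarrow>
      tensor_lift U F (tensor U (tensor U F)) (\<lambda>x f.
        sweedler U (tensor U (tensor U F)) (\<lambda>x1 x2.
          x1 \<boxtimes>\<^bsub>U,tensor U F\<^esub> (x2 \<boxtimes>\<^bsub>U,F\<^esub> f)) x) (co u) =
      sweedler U (tensor U (tensor U F)) (\<lambda>u1 u2.
        tensor_lift U F (tensor U (tensor U F)) (\<lambda>x f.
          tensor_lift U F (tensor U (tensor U F)) (\<lambda>y g.
            x \<boxtimes>\<^bsub>U,tensor U F\<^esub> (y \<boxtimes>\<^bsub>U,F\<^esub> (f \<otimes>\<^bsub>F\<^esub> g))) (co u2)) (co u1)) u"
    and co_counit_coalgebra: "u \<in> carrier U \<Longrightarrow>
      tensor_lift U F F (\<lambda>x f. counit U x \<odot>\<^bsub>F\<^esub> f) (co u) = counit U u \<odot>\<^bsub>F\<^esub> \<one>\<^bsub>F\<^esub>"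
    and counit_act: "\<lbrakk>u \<in> carrier U; f \<in> carrier F\<rbrakk> \<Longrightarrow>
      counit F (u \<triangleright> f) = counit U u * counit F f"
    and comult_act: "\<lbrakk>u \<in> carrier U; f \<in> carrier F\<rbrakk> \<Longrightarrow>
      comult F (u \<triangleright> f) =
      sweedler U (tensor F F) (\<lambda>u1 u2.
        tensor_lift U F (tensor F F) (\<lambda>x g.
          sweedler F (tensor F F) (\<lambda>f1 f2.
            (x \<triangleright> f1) \<boxtimes>\<^bsub>F,F\<^esub> (g \<otimes>\<^bsub>F\<^esub> (u2 \<triangleright> f2))) f) (co u1)) u"
    and co_one: "co \<one>\<^bsub>U\<^esub> = \<one>\<^bsub>U\<^esub> \<boxtimes>\<^bsub>U,F\<^esub> \<one>\<^bsub>F\<^esub>"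
    and co_mult: "\<lbrakk>u \<in> carrier U; v \<in> carrier U\<rbrakk> \<Longrightarrow>
      co (u \<otimes>\<^bsub>U\<^esub> v) = coaction_product F U act co u v"
    and act_co_commute: "\<lbrakk>u \<in> carrier U; f \<in> carrier F\<rbrakk> \<Longrightarrow>
      sweedler U (tensor U F) (\<lambda>u1 u2.
        tensor_lift U F (tensor U F) (\<lambda>x g. x \<boxtimes>\<^bsub>U,F\<^esub> ((u1 \<triangleright> f) \<otimes>\<^bsub>F\<^esub> g)) (co u2)) u =
      sweedler U (tensor U F) (\<lambda>u1 u2.
        tensor_lift U F (tensor U F) (\<lambda>x g. x \<boxtimes>\<^bsub>U,F\<^esub> (g \<otimes>\<^bsub>F\<^esub> (u2 \<triangleright> f))) (co u1)) u"


section \<open>Matched pairs of Lie algebras\<close>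

record 'a lie = "(complex, 'a) module" +
  bracket :: "'a \<Rightarrow> 'a \<Rightarrow> 'a"

locale lie_algebra = vectorspace cpx L for L :: "('a, 'm) lie_scheme" (structure) +
  assumes finite_dim: "vectorspace.fin_dim cpx L"
    and bracket_linear_right: "x \<in> carrier L \<Longrightarrow> bracket L x \<in> module_hom cpx L L"
    and bracket_linear_left: "y \<in> carrier L \<Longrightarrow> (\<lambda>x. bracket L x y) \<in> module_hom cpx L L"
    and bracket_self: "x \<in> carrier L \<Longrightarrow> bracket L x x = \<zero>\<^bsub>L\<^esub>"
    and jacobi: "\<lbrakk>x \<in> carrier L; y \<in> carrier L; z \<in> carrier L\<rbrakk> \<Longrightarrow>
      bracket L x (bracket L y z) \<oplus>\<^bsub>L\<^esub> bracket L y (bracket L z x) \<oplus>\<^bsub>L\<^esub> bracket L z (bracket L x y)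
        = \<zero>\<^bsub>L\<^esub>"

locale matched_pair_lie = g1: lie_algebra g1 + g2: lie_algebra g2
  for g1 :: "'a lie" and g2 :: "'b lie" +
  fixes lact :: "'b \<Rightarrow> 'a \<Rightarrow> 'a" (infixr \<open>\<triangleright>\<close> 75)
    and ract :: "'b \<Rightarrow> 'a \<Rightarrow> 'b" (infixl \<open>\<triangleleft>\<close> 75)
  assumes lact_linear_right: "\<xi> \<in> carrier g2 \<Longrightarrow> (\<lambda>X. \<xi> \<triangleright> X) \<in> module_hom cpx g1 g1"
    and lact_linear_left: "X \<in> carrier g1 \<Longrightarrow> (\<lambda>\<xi>. \<xi> \<triangleright> X) \<in> module_hom cpx g2 g1"
    and ract_linear_right: "\<xi> \<in> carrier g2 \<Longrightarrow> (\<lambda>X. \<xi> \<triangleleft> X) \<in> module_hom cpx g1 g2"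
    and ract_linear_left: "X \<in> carrier g1 \<Longrightarrow> (\<lambda>\<xi>. \<xi> \<triangleleft> X) \<in> module_hom cpx g2 g2"
    and lact_bracket: "\<lbrakk>\<zeta> \<in> carrier g2; \<xi> \<in> carrier g2; X \<in> carrier g1\<rbrakk> \<Longrightarrow>
      bracket g2 \<zeta> \<xi> \<triangleright> X = \<zeta> \<triangleright> \<xi> \<triangleright> X \<ominus>\<^bsub>g1\<^esub> \<xi> \<triangleright> \<zeta> \<triangleright> X"
    and ract_bracket: "\<lbrakk>\<zeta> \<in> carrier g2; X \<in> carrier g1; Y \<in> carrier g1\<rbrakk> \<Longrightarrow>
      \<zeta> \<triangleleft> bracket g1 X Y = \<zeta> \<triangleleft> X \<triangleleft> Y \<ominus>\<^bsub>g2\<^esub> \<zeta> \<triangleleft> Y \<triangleleft> X"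
    and lact_of_bracket: "\<lbrakk>\<zeta> \<in> carrier g2; X \<in> carrier g1; Y \<in> carrier g1\<rbrakk> \<Longrightarrow>
      \<zeta> \<triangleright> bracket g1 X Y =
        bracket g1 (\<zeta> \<triangleright> X) Y \<oplus>\<^bsub>g1\<^esub> bracket g1 X (\<zeta> \<triangleright> Y)
          \<oplus>\<^bsub>g1\<^esub> (\<zeta> \<triangleleft> X) \<triangleright> Y \<ominus>\<^bsub>g1\<^esub> (\<zeta> \<triangleleft> Y) \<triangleright> X"
    and ract_of_bracket: "\<lbrakk>\<zeta> \<in> carrier g2; \<xi> \<in> carrier g2; X \<in> carrier g1\<rbrakk> \<Longrightarrow>
      bracket g2 \<zeta> \<xi> \<triangleleft> X =
        bracket g2 (\<zeta> \<triangleleft> X) \<xi> \<oplus>\<^bsub>g2\<^esub> bracket g2 \<zeta> (\<xi> \<triangleleft> X)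
          \<oplus>\<^bsub>g2\<^esub> \<zeta> \<triangleleft> (\<xi> \<triangleright> X) \<ominus>\<^bsub>g2\<^esub> \<xi> \<triangleleft> (\<zeta> \<triangleright> X)"

text \<open>The bracket of \<open>g\<^sub>1 \<bowtie> g\<^sub>2\<close> is the one determined by
  \<open>[(0, \<xi>), (X, 0)] = (\<xi> \<triangleright> X, \<xi> \<triangleleft> X)\<close> and bilinearity.\<close>

definition double_crossed_sum ::
  "'a lie \<Rightarrow> 'b lie \<Rightarrow> ('b \<Rightarrow> 'a \<Rightarrow> 'a) \<Rightarrow> ('b \<Rightarrow> 'a \<Rightarrow> 'b) \<Rightarrow> ('a \<times> 'b) lie" where
  "double_crossed_sum g1 g2 lact ract = module.extend (direct_sum g1 g2) (lie.fields
    (\<lambda>(X, \<xi>) (Y, \<zeta>).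
      (bracket g1 X Y \<oplus>\<^bsub>g1\<^esub> lact \<xi> Y \<ominus>\<^bsub>g1\<^esub> lact \<zeta> X,
       bracket g2 \<xi> \<zeta> \<oplus>\<^bsub>g2\<^esub> ract \<xi> Y \<ominus>\<^bsub>g2\<^esub> ract \<zeta> X)))"


section \<open>Universal enveloping algebras\<close>

text \<open>Words under concatenation. The convolution product of \<^type>\<open>poly_mapping\<close> then makes
  \<open>'a word \<Rightarrow>\<^sub>0 complex\<close> the free associative unital algebra on \<open>'a\<close>.\<close>

datatype 'a word = Word (letters: "'a list")

instantiation word :: (type) monoid_add
begin

definition zero_word :: "'a word" where "0 = Word []"
definition plus_word :: "'a word \<Rightarrow> 'a word \<Rightarrow> 'a word" where "v + w = Word (letters v @ letters w)"

instance by standard (auto simp: zero_word_def plus_word_def)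

end

type_synonym 'a uea = "('a word \<Rightarrow>\<^sub>0 complex) set"

definition free_alg :: "'a set \<Rightarrow> (complex, 'a word \<Rightarrow>\<^sub>0 complex) module" where
  "free_alg X =
    \<lparr>carrier = {p. \<forall>w\<in>Poly_Mapping.keys p. set (letters w) \<subseteq> X}, mult = (*), one = 1, zero = 0,
     add = (+), smult = (\<lambda>c. Poly_Mapping.map ((*) c))\<rparr>"

definition letter :: "'a \<Rightarrow> 'a word \<Rightarrow>\<^sub>0 complex" where
  "letter x = Poly_Mapping.single (Word [x]) 1"

definition uea_rels :: "('a, 'm) lie_scheme \<Rightarrow> ('a word \<Rightarrow>\<^sub>0 complex) set" where
  "uea_rels L =
    {letter (x \<oplus>\<^bsub>L\<^esub> y) - letter x - letter y | x y. x \<in> carrier L \<and> y \<in> carrier L} \<union>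
    {letter (c \<odot>\<^bsub>L\<^esub> x) - Poly_Mapping.map ((*) c) (letter x) | c x. x \<in> carrier L} \<union>
    {letter x * letter y - letter y * letter x - letter (bracket L x y)
      | x y. x \<in> carrier L \<and> y \<in> carrier L}"

definition uea_ideal :: "('a, 'm) lie_scheme \<Rightarrow> ('a word \<Rightarrow>\<^sub>0 complex) set" where
  "uea_ideal L = genideal (free_alg (carrier L)) (uea_rels L)"

definition uea_alg :: "('a, 'm) lie_scheme \<Rightarrow> (complex, 'a uea) module" where
  "uea_alg L = quot_space (free_alg (carrier L)) (uea_ideal L)"

definition uea_incl :: "('a, 'm) lie_scheme \<Rightarrow> 'a \<Rightarrow> 'a uea" where
  "uea_incl L x = uea_ideal L +>\<^bsub>free_alg (carrier L)\<^esub> letter x"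

text \<open>The homomorphism exists and is unique when \<open>A\<close> is an algebra and \<open>\<phi> : L \<rightarrow> A\<close> is linear
  with \<open>\<phi> [x, y] = \<phi> x \<phi> y - \<phi> y \<phi> x\<close>. Mapping into the opposite algebra gives an
  anti-homomorphism, which is how the antipode of \<open>uea\<close> below arises.\<close>

definition uea_ext ::
  "('a, 'm) lie_scheme \<Rightarrow> (complex, 'b, 'n) module_scheme \<Rightarrow> ('a \<Rightarrow> 'b) \<Rightarrow> 'a uea \<Rightarrow> 'b" where
  "uea_ext L A \<phi> = (THE h. h \<in> complex_alg_hom (uea_alg L) A \<and> h \<in> extensional (carrier (uea_alg L)) \<and>
     (\<forall>x\<in>carrier L. h (uea_incl L x) = \<phi> x))"

definition uea :: "('a, 'm) lie_scheme \<Rightarrow> 'a uea hopf" where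
  "uea L = module.extend (uea_alg L) (hopf.fields
    (uea_ext L (tensor_alg (uea_alg L) (uea_alg L)) (\<lambda>x.
      uea_incl L x \<boxtimes>\<^bsub>uea_alg L,uea_alg L\<^esub> \<one>\<^bsub>uea_alg L\<^esub> \<oplus>\<^bsub>tensor (uea_alg L) (uea_alg L)\<^esub>
      \<one>\<^bsub>uea_alg L\<^esub> \<boxtimes>\<^bsub>uea_alg L,uea_alg L\<^esub> uea_incl L x))
    (uea_ext L cpx (\<lambda>x. 0))
    (uea_ext L (opposite_alg (uea_alg L)) (\<lambda>x. \<ominus>\<^bsub>uea_alg L\<^esub> uea_incl L x)))"


section \<open>The mutual actions of the enveloping algebras\<close>

definition uea_emb1 ::
  "'a lie \<Rightarrow> 'b lie \<Rightarrow> ('b \<Rightarrow> 'a \<Rightarrow> 'a) \<Rightarrow> ('b \<Rightarrow> 'a \<Rightarrow> 'b) \<Rightarrow> 'a uea \<Rightarrow> ('a \<times> 'b) uea" where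
  "uea_emb1 g1 g2 lact ract = uea_ext g1 (uea (double_crossed_sum g1 g2 lact ract))
    (\<lambda>X. uea_incl (double_crossed_sum g1 g2 lact ract) (X, \<zero>\<^bsub>g2\<^esub>))"

definition uea_emb2 ::
  "'a lie \<Rightarrow> 'b lie \<Rightarrow> ('b \<Rightarrow> 'a \<Rightarrow> 'a) \<Rightarrow> ('b \<Rightarrow> 'a \<Rightarrow> 'b) \<Rightarrow> 'b uea \<Rightarrow> ('a \<times> 'b) uea" where
  "uea_emb2 g1 g2 lact ract = uea_ext g2 (uea (double_crossed_sum g1 g2 lact ract))
    (\<lambda>\<xi>. uea_incl (double_crossed_sum g1 g2 lact ract) (\<zero>\<^bsub>g1\<^esub>, \<xi>))"

definition uea_mult_map ::
  "'a lie \<Rightarrow> 'b lie \<Rightarrow> ('b \<Rightarrow> 'a \<Rightarrow> 'a) \<Rightarrow> ('b \<Rightarrow> 'a \<Rightarrow> 'b)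
    \<Rightarrow> ('a uea \<times> 'b uea \<Rightarrow>\<^sub>0 complex) set \<Rightarrow> ('a \<times> 'b) uea" where
  "uea_mult_map g1 g2 lact ract =
    tensor_lift (uea g1) (uea g2) (uea (double_crossed_sum g1 g2 lact ract))
      (\<lambda>p q. uea_emb1 g1 g2 lact ract p \<otimes>\<^bsub>uea (double_crossed_sum g1 g2 lact ract)\<^esub>
             uea_emb2 g1 g2 lact ract q)"

text \<open>The element \<open>\<Sum>\<^sub>i p\<^sub>i \<otimes> q\<^sub>i\<close> with \<open>u' u = \<Sum>\<^sub>i p\<^sub>i q\<^sub>i\<close> in \<open>U(g\<^sub>1 \<bowtie> g\<^sub>2)\<close>;
  the multiplication map is a bijection.\<close>

definition uea_swap ::
  "'a lie \<Rightarrow> 'b lie \<Rightarrow> ('b \<Rightarrow> 'a \<Rightarrow> 'a) \<Rightarrow> ('b \<Rightarrow> 'a \<Rightarrow> 'b)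
    \<Rightarrow> 'b uea \<Rightarrow> 'a uea \<Rightarrow> ('a uea \<times> 'b uea \<Rightarrow>\<^sub>0 complex) set" where
  "uea_swap g1 g2 lact ract u' u =
    inv_into (carrier (tensor (uea g1) (uea g2))) (uea_mult_map g1 g2 lact ract)
      (uea_emb2 g1 g2 lact ract u' \<otimes>\<^bsub>uea (double_crossed_sum g1 g2 lact ract)\<^esub>
       uea_emb1 g1 g2 lact ract u)"

definition uea_lact ::
  "'a lie \<Rightarrow> 'b lie \<Rightarrow> ('b \<Rightarrow> 'a \<Rightarrow> 'a) \<Rightarrow> ('b \<Rightarrow> 'a \<Rightarrow> 'b) \<Rightarrow> 'b uea \<Rightarrow> 'a uea \<Rightarrow> 'a uea" where
  "uea_lact g1 g2 lact ract u' u =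
    tensor_lift (uea g1) (uea g2) (uea g1) (\<lambda>p q. counit (uea g2) q \<odot>\<^bsub>uea g1\<^esub> p)
      (uea_swap g1 g2 lact ract u' u)"

definition uea_ract ::
  "'a lie \<Rightarrow> 'b lie \<Rightarrow> ('b \<Rightarrow> 'a \<Rightarrow> 'a) \<Rightarrow> ('b \<Rightarrow> 'a \<Rightarrow> 'b) \<Rightarrow> 'b uea \<Rightarrow> 'a uea \<Rightarrow> 'b uea" where
  "uea_ract g1 g2 lact ract u' u =
    tensor_lift (uea g1) (uea g2) (uea g2) (\<lambda>p q. counit (uea g1) p \<odot>\<^bsub>uea g2\<^esub> q)
      (uea_swap g1 g2 lact ract u' u)"


section \<open>The Hopf algebra of representative functions\<close>

definition rep_functions :: "('a, 'm) lie_scheme \<Rightarrow> ('a uea \<Rightarrow> complex) set" where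
  "rep_functions L = {f \<in> module_hom cpx (uea L) cpx \<inter> extensional (carrier (uea L)).
     \<exists>I. ideal I (uea L) \<and> I \<subseteq> {u \<in> carrier (uea L). f u = 0} \<and>
       vectorspace.fin_dim cpx
         (quot_space ((uea L)\<lparr>carrier := {u \<in> carrier (uea L). f u = 0}\<rparr>) I)}"

definition rep_alg :: "('a, 'm) lie_scheme \<Rightarrow> (complex, 'a uea \<Rightarrow> complex) module" where
  "rep_alg L =
    \<lparr>carrier = rep_functions L,
     mult = (\<lambda>f g. \<lambda>u\<in>carrier (uea L). sweedler (uea L) cpx (\<lambda>u1 u2. f u1 * g u2) u),
     one = (\<lambda>u\<in>carrier (uea L). counit (uea L) u),
     zero = (\<lambda>u\<in>carrier (uea L). 0),
     add = (\<lambda>f g. \<lambda>u\<in>carrier (uea L). f u + g u),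
     smult = (\<lambda>c f. \<lambda>u\<in>carrier (uea L). c * f u)\<rparr>"

definition rep_hopf :: "('a, 'm) lie_scheme \<Rightarrow> ('a uea \<Rightarrow> complex) hopf" where
  "rep_hopf L = module.extend (rep_alg L) (hopf.fields
    (\<lambda>f. THE t. t \<in> carrier (tensor (rep_alg L) (rep_alg L)) \<and>
      (\<forall>u\<in>carrier (uea L). \<forall>v\<in>carrier (uea L).
        tensor_lift (rep_alg L) (rep_alg L) cpx (\<lambda>f1 f2. f1 u * f2 v) t = f (u \<otimes>\<^bsub>uea L\<^esub> v)))
    (\<lambda>f. f \<one>\<^bsub>uea L\<^esub>)
    (\<lambda>f. \<lambda>u\<in>carrier (uea L). f (antipode (uea L) u)))"


section \<open>The canonical action and coaction\<close>

definition canonical_action ::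
  "'a lie \<Rightarrow> 'b lie \<Rightarrow> ('b \<Rightarrow> 'a \<Rightarrow> 'a) \<Rightarrow> ('b \<Rightarrow> 'a \<Rightarrow> 'b)
    \<Rightarrow> 'a uea \<Rightarrow> ('b uea \<Rightarrow> complex) \<Rightarrow> ('b uea \<Rightarrow> complex)" where
  "canonical_action g1 g2 lact ract u f =
    (\<lambda>u'\<in>carrier (uea g2). f (uea_ract g1 g2 lact ract u' u))"

text \<open>For a basis \<open>B\<close> of \<open>g\<^sub>1\<close>, indexed by itself, the function \<open>coaction_coeff g\<^sub>1 g\<^sub>2 lact ract B X Y\<close>
  sends \<open>u'\<close> to the coefficient of \<open>Y\<close> in the expansion of \<open>u' \<triangleright> X\<close>.\<close>

definition coaction_coeff ::
  "'a lie \<Rightarrow> 'b lie \<Rightarrow> ('b \<Rightarrow> 'a \<Rightarrow> 'a) \<Rightarrow> ('b \<Rightarrow> 'a \<Rightarrow> 'b) \<Rightarrow> 'a set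
    \<Rightarrow> 'a \<Rightarrow> 'a \<Rightarrow> ('b uea \<Rightarrow> complex)" where
  "coaction_coeff g1 g2 lact ract B X Y = (\<lambda>u'\<in>carrier (uea g2).
    (THE a. a \<in> extensional B \<and>
      uea_lact g1 g2 lact ract u' (uea_incl g1 X) = (\<Oplus>\<^bsub>uea g1\<^esub>Z\<in>B. a Z \<odot>\<^bsub>uea g1\<^esub> uea_incl g1 Z)) Y)"

definition coaction_alg ::
  "'a lie \<Rightarrow> 'b lie \<Rightarrow> ('b \<Rightarrow> 'a \<Rightarrow> 'a) \<Rightarrow> ('b \<Rightarrow> 'a \<Rightarrow> 'b) \<Rightarrow> 'a set
    \<Rightarrow> 'a \<Rightarrow> ('a uea \<times> ('b uea \<Rightarrow> complex) \<Rightarrow>\<^sub>0 complex) set" where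
  "coaction_alg g1 g2 lact ract B X =
    (\<Oplus>\<^bsub>tensor (uea g1) (rep_hopf g2)\<^esub>Y\<in>B.
      uea_incl g1 Y \<boxtimes>\<^bsub>uea g1,rep_hopf g2\<^esub> coaction_coeff g1 g2 lact ract B X Y)"

definition is_canonical_coaction ::
  "'a lie \<Rightarrow> 'b lie \<Rightarrow> ('b \<Rightarrow> 'a \<Rightarrow> 'a) \<Rightarrow> ('b \<Rightarrow> 'a \<Rightarrow> 'b) \<Rightarrow> 'a set
    \<Rightarrow> ('a uea \<Rightarrow> ('a uea \<times> ('b uea \<Rightarrow> complex) \<Rightarrow>\<^sub>0 complex) set) \<Rightarrow> bool" where
  "is_canonical_coaction g1 g2 lact ract B co \<longleftrightarrow>
    co \<in> module_hom cpx (uea g1) (tensor (uea g1) (rep_hopf g2)) \<and>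
    co \<in> extensional (carrier (uea g1)) \<and>
    (\<forall>X\<in>B. co (uea_incl g1 X) = coaction_alg g1 g2 lact ract B X) \<and>
    co \<one>\<^bsub>uea g1\<^esub> = \<one>\<^bsub>uea g1\<^esub> \<boxtimes>\<^bsub>uea g1,rep_hopf g2\<^esub> \<one>\<^bsub>rep_hopf g2\<^esub> \<and>
    (\<forall>u\<in>carrier (uea g1). \<forall>v\<in>carrier (uea g1).
      co (u \<otimes>\<^bsub>uea g1\<^esub> v) =
        coaction_product (rep_hopf g2) (uea g1) (canonical_action g1 g2 lact ract) co u v)"

definition canonical_coaction ::
  "'a lie \<Rightarrow> 'b lie \<Rightarrow> ('b \<Rightarrow> 'a \<Rightarrow> 'a) \<Rightarrow> ('b \<Rightarrow> 'a \<Rightarrow> 'b) \<Rightarrow> 'a set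
    \<Rightarrow> 'a uea \<Rightarrow> ('a uea \<times> ('b uea \<Rightarrow> complex) \<Rightarrow>\<^sub>0 complex) set" where
  "canonical_coaction g1 g2 lact ract B = (THE co. is_canonical_coaction g1 g2 lact ract B co)"

end

theory Submission
 imports Defs
begin

abbreviation (input) in_carrier (infix "<:" 50) where "x <: V \<equiv> x \<in> carrier V"
abbreviation (input) mult_in ("_ *[_] _" [70, 0, 71] 70) where "x *[A] y \<equiv> x \<otimes>\<^bsub>A\<^esub> y"
abbreviation (input) add_in ("_ +[_] _" [65, 0, 66] 65) where "x +[V] y \<equiv> x \<oplus>\<^bsub>V\<^esub> y"
abbreviation (input) smult_in ("_ .[_] _" [70, 0, 71] 70) where "c .[V] x \<equiv> c \<odot>\<^bsub>V\<^esub> x"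
abbreviation (input) minus_in ("_ -[_] _" [65, 0, 66] 65) where "x -[V] y \<equiv> x \<ominus>\<^bsub>V\<^esub> y"
abbreviation (input) uminus_in ("-[_] _" [0, 81] 80) where "-[V] x \<equiv> \<ominus>\<^bsub>V\<^esub> x"
abbreviation (input) one_in ("1[_]") where "1[A] \<equiv> \<one>\<^bsub>A\<^esub>"
abbreviation (input) zero_in ("0[_]") where "0[V] \<equiv> \<zero>\<^bsub>V\<^esub>"
abbreviation (input) pure_tensor_in ("_ \<boxtimes>[_,_] _" [71, 0, 0, 71] 70)
 where "v \<boxtimes>[V,W] w \<equiv> v \<boxtimes>\<^bsub>V,W\<^esub> w"

section \<open>Complex vector spaces and linear maps\<close>

abbreviation "vs V \<equiv> vectorspace cpx V"
abbreviation "lin V W f \<equiv> f \<in> module_hom cpx V W"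

lemma cpx_simps [simp]:
 "carrier cpx = UNIV" "mult cpx = (*)" "one cpx = 1" "zero cpx = 0" "add cpx = (+)"
 "smult cpx = (*)"
 by (simp_all add: cpx_def)

lemma field_cpx: "field cpx"
proof -
 have "cring cpx"
  by (rule cringI[OF abelian_groupI comm_monoidI])
   (auto simp: algebra_simps intro: exI[of _ "- x" for x])
 moreover have "\<exists>y. y * x = 1 \<and> x * y = 1" if "x \<noteq> 0" for x :: complex
  using that by (intro exI[of _ "inverse x"]) simp
 ultimately show ?thesis
  by (intro cring.cring_fieldI) (auto simp: Units_def)
qed

lemma vs_iff_module: "vs V \<longleftrightarrow> module cpx V"
 using field_cpx by (simp add: vectorspace_def)

lemma vsI:
 assumes "0[V] <: V"
  and "!!x y. x <: V ==> y <: V ==> x +[V] y <: V"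
  and "!!c x. x <: V ==> c .[V] x <: V"
  and "!!x y. x <: V ==> y <: V ==> x +[V] y = y +[V] x"
  and "!!x y z. x <: V ==> y <: V ==> z <: V ==>
   (x +[V] y) +[V] z = x +[V] (y +[V] z)"
  and "!!x. x <: V ==> x +[V] 0[V] = x"
  and "!!c d x. x <: V ==> (c + d) .[V] x = c .[V] x +[V] d .[V] x"
  and "!!c x y. x <: V ==> y <: V ==>
   c .[V] (x +[V] y) = c .[V] x +[V] c .[V] y"
  and "!!c d x. x <: V ==> (c * d) .[V] x = c .[V] (d .[V] x)"
  and "!!x. x <: V ==> 1 .[V] x = x"
  and "!!x. x <: V ==> 0 .[V] x = 0[V]"
 shows "vs V"
proof (rule vs_criteria[OF field_cpx])
 show "\<forall>v\<in>carrier V. \<exists>w\<in>carrier V. v +[V] w = 0[V]"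
 proof
  fix v assume v: "v <: V"
  have "v +[V] (-1) .[V] v = (1 + - 1) .[V] v" using v assms(7)[of v 1 "-1"] assms(10) by simp
  then show "\<exists>w\<in>carrier V. v +[V] w = 0[V]" using v assms(3,11) by force
 qed
qed (use assms in auto)

context
 fixes V :: "(complex, 'a, 'm) module_scheme" (structure)
 assumes V: "vs V"
begin

interpretation vectorspace cpx V by (rule V)

lemma vs_closed:
 "\<zero> <: V"
 "x <: V ==> y <: V ==> x \<oplus> y <: V"
 "x <: V ==> c \<odot> x <: V"
 "x <: V ==> \<ominus> x <: V"
 "x <: V ==> y <: V ==> x \<ominus> y <: V"
 by (simp_all)

lemma vs_smult_zero:
 "x <: V ==> 0 \<odot> x = \<zero>"
 "c \<odot> \<zero> = \<zero>"
 "x <: V ==> 1 \<odot> x = x"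
 using smult_l_null[of x] smult_r_null[of c] smult_one[of x] by simp_all

lemma vs_smult_smult: "x <: V ==> c \<odot> (d \<odot> x) = (c * d) \<odot> x"
 using smult_assoc1[of c d x] by simp

lemma vs_smult_distrib:
 "x <: V ==> (c + d) \<odot> x = c \<odot> x \<oplus> d \<odot> x"
 "x <: V ==> y <: V ==> c \<odot> (x \<oplus> y) = c \<odot> x \<oplus> c \<odot> y"
 using smult_l_distr[of c d x] smult_r_distr[of c x y] by simp_all

lemma vs_add_zero:
 "x <: V ==> \<zero> \<oplus> x = x"
 "x <: V ==> x \<oplus> \<zero> = x"
 by simp_all

lemma vs_add_ac:
 "x <: V ==> y <: V ==> z <: V ==> (x \<oplus> y) \<oplus> z = x \<oplus> (y \<oplus> z)"
 "x <: V ==> y <: V ==> x \<oplus> y = y \<oplus> x"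
 "x <: V ==> y <: V ==> z <: V ==> x \<oplus> (y \<oplus> z) = y \<oplus> (x \<oplus> z)"
 using a_ac by simp_all

lemma vs_neg_eq:
 assumes "x <: V" shows "\<ominus> x = (-1) \<odot> x"
proof -
 have "x \<oplus> (-1) \<odot> x = (1 + -1) \<odot> x" using vs_smult_distrib(1)[of x 1 "-1"] assms vs_smult_zero(3)[of x] by simp
 also have "\<dots> = \<zero>" using assms vs_smult_zero(1)[of x] by simp
 finally have "x \<oplus> (-1) \<odot> x = \<zero>" .
 then show ?thesis using assms minus_equality[of "(-1) \<odot> x" x] by (simp add: a_comm)
qed

lemma vs_minus_eq: "y <: V ==> x \<ominus> y = x \<oplus> (-1) \<odot> y"
 by (simp add: a_minus_def vs_neg_eq)

lemma vs_minus_eq_zero_iff: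
 assumes "x <: V" "y <: V" shows "x \<ominus> y = \<zero> \<longleftrightarrow> x = y"
 using assms by simp

lemma vs_minus_add_cancel:
 assumes "x <: V" "y <: V" shows "(x \<ominus> y) \<oplus> y = x"
 using assms by (simp add: a_minus_def a_assoc l_neg)

lemma vs_add_minus_cancel:
 assumes "x <: V" "y <: V" shows "(x \<oplus> y) \<ominus> y = x"
 using assms by (simp add: a_minus_def a_assoc r_neg)

end

lemmas vs_simps = vs_closed vs_smult_zero vs_smult_smult vs_smult_distrib vs_add_zero

lemma vs_cpx [simp]: "vs cpx"
 by (rule vsI) (simp_all add: algebra_simps)

lemma minus_cpx [simp]: "a_minus cpx x y = x - y" "a_inv cpx y = - y"
 using vs_minus_eq[of cpx y x] vs_neg_eq[of cpx y] by simp_all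

lemma linI:
 assumes "!!x. x <: V ==> f x <: W"
  and "!!x y. x <: V ==> y <: V ==> f (x +[V] y) = f x +[W] f y"
  and "!!c x. x <: V ==> f (c .[V] x) = c .[W] f x"
 shows "lin V W f"
 using assms by (auto simp: module_hom_def)

lemma lin_closed: "lin V W f ==> x <: V ==> f x <: W"
 and lin_add: "lin V W f ==> x <: V ==> y <: V ==> f (x +[V] y) = f x +[W] f y"
 and lin_smult: "lin V W f ==> x <: V ==> f (c .[V] x) = c .[W] f x"
 by (auto simp: module_hom_def)

lemma lin_zero: assumes "vs V" "vs W" "lin V W f" shows "f 0[V] = 0[W]"
proof -
 note f = lin_closed[OF assms(3)] lin_smult[OF assms(3)]
 have "f (0 .[V] 0[V]) = 0 .[W] f 0[V]" by (intro f vs_closed assms)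
 then show ?thesis by (simp add: vs_simps[OF assms(1)] vs_simps[OF assms(2)] f)
qed

lemma lin_minus:
 assumes "vs V" "vs W" "lin V W f" "x <: V" "y <: V"
 shows "f (x -[V] y) = f x -[W] f y"
 using assms(4,5) by (simp add: vs_minus_eq[OF assms(1)] vs_minus_eq[OF assms(2)] lin_add[OF assms(3)]
  lin_smult[OF assms(3)] lin_closed[OF assms(3)] vs_closed[OF assms(1)])

lemma lin_neg:
 assumes "vs V" "vs W" "lin V W f" "x <: V"
 shows "f (-[V] x) = -[W] f x"
 using assms(4) by (simp add: vs_neg_eq[OF assms(1)] vs_neg_eq[OF assms(2)] lin_smult[OF assms(3)]
  lin_closed[OF assms(3)])

text \<open>The rules collected here reduce linearity of an expression in one of its variables to
 linearity of the subexpressions containing that variable.\<close>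

named_theorems lins

lemma lin_comp: assumes "lin W Z g" "lin V W f" shows "lin V Z (%x. g (f x))"
 by (rule linI) (simp_all add: lin_closed[OF assms(1)] lin_closed[OF assms(2)] lin_add[OF assms(1)]
  lin_add[OF assms(2)] lin_smult[OF assms(1)] lin_smult[OF assms(2)])

lemma lin_id [lins]: "lin V V (%x. x)" by (rule linI) auto

lemma lin_cong: assumes "!!x. x <: V ==> f x = g x" "vs V" shows "lin V W f \<longleftrightarrow> lin V W g"
 using assms vs_closed[OF assms(2)] by (auto simp: module_hom_def Pi_def)

lemma lin_pointwise_add [lins]:
 assumes "vs W" "lin V W f" "lin V W g" shows "lin V W (%x. f x +[W] g x)"
 using assms(2) by (intro linI; simp add: lin_closed[OF assms(2)] lin_add[OF assms(2)] lin_smult[OF assms(2)] lin_closed[OF assms(3)] lin_add[OF assms(3)] lin_smult[OF assms(3)]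
  vs_simps[OF assms(1)] vs_add_ac[OF assms(1)] mult.commute)

lemma lin_pointwise_smult [lins]:
 assumes "vs W" "lin V W f" shows "lin V W (%x. c .[W] f x)"
 using assms(2) by (intro linI; simp add: lin_closed[OF assms(2)] lin_add[OF assms(2)] lin_smult[OF assms(2)]
  vs_simps[OF assms(1)] vs_add_ac[OF assms(1)] mult.commute)

lemma lin_smult_left [lins]:
 assumes "vs W" "w <: W" "lin V cpx c" shows "lin V W (%x. c x .[W] w)"
 using assms(2) by (intro linI; simp add: lin_closed[OF assms(3)] lin_add[OF assms(3)] lin_smult[OF assms(3)]
  vs_simps[OF assms(1)] vs_add_ac[OF assms(1)] mult.commute)

lemma lin_pointwise_minus [lins]:
 assumes "vs W" "lin V W f" "lin V W g" shows "lin V W (%x. f x -[W] g x)"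
proof -
 have "lin V W (%x. f x +[W] (-1) .[W] g x)" using assms by (intro lins)
 then show ?thesis unfolding module_hom_def using assms by (clarsimp simp: module_hom_def vs_minus_eq Pi_iff vs_closed)
qed

lemma lin_pointwise_neg [lins]:
 assumes "vs W" "lin V W f" shows "lin V W (%x. -[W] f x)"
proof -
 have "lin V W (%x. (-1) .[W] f x)" using assms by (intro lins)
 then show ?thesis unfolding module_hom_def using assms by (clarsimp simp: module_hom_def vs_neg_eq Pi_iff vs_closed)
qed

lemma lin_cpx_mult [lins]:
 "lin V cpx f ==> lin V cpx (%x. f x * c)"
 "lin V cpx f ==> lin V cpx (%x. c * f x)"
 by (auto simp: module_hom_def algebra_simps)

lemma lin_cpx_add [lins]: "lin V cpx f ==> lin V cpx g ==> lin V cpx (%x. f x + g x)"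
 by (auto simp: module_hom_def algebra_simps)

lemma lin_zero_map: "vs W ==> lin V W (%x. 0[W])"
 by (rule linI) (simp_all add: vs_simps)

lemma lin_restrict:
 assumes "vs V" shows "lin V W (restrict f (carrier V)) \<longleftrightarrow> lin V W f"
 using assms by (intro lin_cong) auto

definition bilin ::
 "(complex, 'a, 'm) module_scheme \<Rightarrow> (complex, 'b, 'n) module_scheme \<Rightarrow> (complex, 'c, 'k) module_scheme
  \<Rightarrow> ('a \<Rightarrow> 'b \<Rightarrow> 'c) \<Rightarrow> bool" where
 "bilin V W Z b \<longleftrightarrow> (\<forall>v\<in>carrier V. lin W Z (b v)) \<and> (\<forall>w\<in>carrier W. lin V Z (%v. b v w))"

lemma bilinI [lins]:
 "(!!v. v <: V ==> lin W Z (b v)) ==> (!!w. w <: W ==> lin V Z (%v. b v w)) ==> bilin V W Z b"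
 by (simp add: bilin_def)

lemma bilinD:
 "bilin V W Z b ==> v <: V ==> lin W Z (b v)"
 "bilin V W Z b ==> w <: W ==> lin V Z (%v. b v w)"
 by (auto simp: bilin_def)

lemma bilin_closed: "bilin V W Z b ==> v <: V ==> w <: W ==> b v w <: Z"
 by (metis bilinD(1) lin_closed)


section \<open>Free vector spaces and quotients\<close>

lemma lookup_scale [simp]: "Poly_Mapping.lookup (Poly_Mapping.map ((*) c) p) k = c * Poly_Mapping.lookup p (k :: 'k)" for c :: complex
 by (simp add: map.rep_eq when_def)

lemma free_space_simps [simp]:
 "carrier (free_space S) = {p. Poly_Mapping.keys p \<subseteq> S}" "add (free_space S) = (+)"
 "zero (free_space S) = 0" "smult (free_space S) = (%c. Poly_Mapping.map ((*) c))"
 by (simp_all add: free_space_def)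

lemma keys_scale: "Poly_Mapping.keys (Poly_Mapping.map ((*) c) p) \<subseteq> Poly_Mapping.keys (p :: _ \<Rightarrow>\<^sub>0 complex)"
 by (auto simp: in_keys_iff)

lemma vs_free_space: "vs (free_space S)"
proof (rule vsI)
 fix x y :: "'a \<Rightarrow>\<^sub>0 complex" and c
 assume "x <: (free_space S)"
 then show "c .[free_space S] x <: (free_space S)" using keys_scale[of c x] by auto
 assume "y <: (free_space S)"
 then show "x +[free_space S] y <: (free_space S)"
  using \<open>x \<in> _\<close> Poly_Mapping.keys_add[of x y] by auto
qed (auto intro!: poly_mapping_eqI simp: lookup_add algebra_simps)

definition linear_extension ::
 "(complex, 'c, 'k) module_scheme \<Rightarrow> ('s \<Rightarrow> 'c) \<Rightarrow> ('s \<Rightarrow>\<^sub>0 complex) \<Rightarrow> 'c" where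
 "linear_extension Z b p = (\<Oplus>\<^bsub>Z\<^esub>k\<in>Poly_Mapping.keys p. Poly_Mapping.lookup p k .[Z] b k)"

lemma linear_extension_superset:
 assumes Z: "vs Z" and "finite A" "Poly_Mapping.keys p \<subseteq> A" "b \<in> A \<rightarrow> carrier Z"
 shows "linear_extension Z b p = (\<Oplus>\<^bsub>Z\<^esub>k\<in>A. Poly_Mapping.lookup p k .[Z] b k)"
proof -
 interpret Z: vectorspace cpx Z by (rule Z)
 show ?thesis unfolding linear_extension_def
  using assms by (intro Z.add.finprod_mono_neutral_cong_left)
   (auto simp: in_keys_iff vs_simps Pi_iff)
qed

lemma linear_extension_single [simp]:
 assumes Z: "vs Z" and "b k <: Z"
 shows "linear_extension Z b (Poly_Mapping.single k c) = c .[Z] b k"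
proof -
 interpret Z: vectorspace cpx Z by (rule Z)
 show ?thesis using assms by (simp add: linear_extension_def vs_simps)
qed

lemma lin_linear_extension:
 assumes Z: "vs Z" and b: "b \<in> S \<rightarrow> carrier Z"
 shows "lin (free_space S) Z (linear_extension Z b)"
proof -
 interpret Z: vectorspace cpx Z by (rule Z)
 show ?thesis
 proof (rule linI)
  fix x y c
  assume x: "x <: (free_space S)"
  then show "linear_extension Z b x <: Z"
   using b by (auto simp: linear_extension_def Pi_iff intro!: Z.finsum_closed vs_closed(3)[OF Z])
  have bx: "b \<in> Poly_Mapping.keys x \<rightarrow> carrier Z" using x b by auto
  have "linear_extension Z b (Poly_Mapping.map ((*) c) x)
    = (\<Oplus>\<^bsub>Z\<^esub>k\<in>Poly_Mapping.keys x. c .[Z] (Poly_Mapping.lookup x k .[Z] b k))"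
   using bx by (subst linear_extension_superset[OF Z finite_keys keys_scale])
    (auto intro!: Z.finsum_cong' simp: vs_simps[OF Z] Pi_iff)
  then show "linear_extension Z b (c .[free_space S] x) = c .[Z] linear_extension Z b x"
   using bx by (simp add: linear_extension_def Z.finsum_smult_ldistr vs_simps[OF Z] Pi_iff)
  assume y: "y <: (free_space S)"
  let ?A = "Poly_Mapping.keys x \<union> Poly_Mapping.keys y"
  have bA: "b \<in> ?A \<rightarrow> carrier Z" using x y b by auto
  have fin: "finite ?A" by simp
  have "linear_extension Z b (x + y) = (\<Oplus>\<^bsub>Z\<^esub>k\<in>?A. Poly_Mapping.lookup x k .[Z] b k +[Z] Poly_Mapping.lookup y k .[Z] b k)"
   unfolding linear_extension_superset[OF Z fin Poly_Mapping.keys_add bA]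
   using bA vs_closed[OF Z] vs_smult_distrib(1)[OF Z]
   by (intro Z.finsum_cong'[OF refl]) (simp_all add: lookup_add Pi_iff)
  also have "\<dots> = linear_extension Z b x +[Z] linear_extension Z b y"
   unfolding linear_extension_superset[OF Z fin Un_upper1 bA] linear_extension_superset[OF Z fin Un_upper2 bA]
   using bA by (intro Z.finsum_addf) (auto simp: vs_closed[OF Z] Pi_iff)
  finally show "linear_extension Z b (x +[free_space S] y) = linear_extension Z b x +[Z] linear_extension Z b y"
   by simp
 qed
qed

lemma free_space_induct [consumes 1, case_names zero step]:
 fixes p :: "'s \<Rightarrow>\<^sub>0 complex"
 assumes "Poly_Mapping.keys p \<subseteq> S" "P 0"
  and "!!k c p. k \<in> S ==> Poly_Mapping.keys p \<subseteq> S ==> P p ==> P (Poly_Mapping.single k c + p)"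
 shows "P p"
 using assms(1)
proof (induction p rule: update_induct)
 case (update f a b)
 have eq: "Poly_Mapping.update a b f = Poly_Mapping.single a b + f"
  using update.hyps(1) by (intro poly_mapping_eqI) (auto simp: lookup_update lookup_add lookup_single when_def in_keys_iff)
 have "Poly_Mapping.keys (Poly_Mapping.update a b f) = insert a (Poly_Mapping.keys f)"
  using update.hyps by (auto simp: keys_update)
 then show ?case using update assms(3)[of a f b] by (simp add: eq)
qed (use assms in auto)

lemma free_space_lin_ext:
 assumes "vs Z" "lin (free_space S) Z f" "lin (free_space S) Z g"
  and "!!k. k \<in> S ==> f (Poly_Mapping.single k 1) = g (Poly_Mapping.single k 1)"
  and "Poly_Mapping.keys p \<subseteq> S"
 shows "f p = g p"
 using assms(5)
proof (induction p rule: free_space_induct)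
 case zero
 show ?case using lin_zero[OF vs_free_space assms(1,2)] lin_zero[OF vs_free_space assms(1,3)] by simp
next
 case (step k c p)
 have eq: "Poly_Mapping.single k c = c .[free_space S] Poly_Mapping.single k 1" by simp
 have in_S: "Poly_Mapping.single k 1 <: (free_space S)" using step by simp
 have "f (Poly_Mapping.single k c) = g (Poly_Mapping.single k c)"
  unfolding eq using lin_smult[OF assms(2) in_S] lin_smult[OF assms(3) in_S] assms(4)[OF step(1)] by metis
 then show ?case using step lin_add[OF assms(2), of "Poly_Mapping.single k c" p]
   lin_add[OF assms(3), of "Poly_Mapping.single k c" p] by simp
qed

context
 fixes V :: "(complex, 'a, 'm) module_scheme" (structure) and W
 assumes V: "vs V" and W: "submodule cpx W V"
begin

interpretation V: vectorspace cpx V by (rule V)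
interpretation W: submodule cpx W V by (rule W)

lemma submodule_is_abelian_subgroup: "abelian_subgroup W V"
proof (rule abelian_subgroupI3)
 show "additive_subgroup W V"
 proof (rule additive_subgroup.intro, rule subgroup.intro)
  fix x assume "x \<in> W"
  then have "(-1) \<odot> x \<in> W" by (intro W.smult_closed) auto
  then show "inv\<^bsub>add_monoid V\<^esub> x \<in> W"
   using \<open>x \<in> W\<close> W.subset vs_neg_eq[OF V, of x] by (auto simp: a_inv_def)
 qed (use W.subset in auto)
qed (rule V.abelian_group_axioms)

interpretation W: abelian_subgroup W V by (rule submodule_is_abelian_subgroup)

lemma rcos_eq_iff:
 assumes "x <: V" "y <: V"
 shows "W +> x = W +> y \<longleftrightarrow> x \<ominus> y \<in> W"
 using assms W.a_repr_independence'[of x y] W.a_rcos_self[of x] W.a_rcos_module[of y x]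
 by (auto simp: a_minus_def)

lemma quot_space_simps:
 "carrier (quot_space V W) = (%x. W +> x) ` carrier V"
 "zero (quot_space V W) = W"
 "one (quot_space V W) = W +> \<one>"
 by (auto simp: quot_space_def A_RCOSETS_def')

lemma quot_space_add:
 assumes "x <: V" "y <: V"
 shows "(W +> x) +[quot_space V W] (W +> y) = W +> (x \<oplus> y)"
 using assms by (simp add: quot_space_def W.a_rcos_sum)

lemma quot_space_smult:
 assumes "x <: V"
 shows "c .[quot_space V W] (W +> x) = W +> (c \<odot> x)"
proof -
 have "W +> (c \<odot> y) = W +> (c \<odot> x)" if y: "y \<in> W +> x" for y
 proof -
  have yV: "y <: V" using y assms W.a_elemrcos_carrier by blast
  have "y \<ominus> x \<in> W" using y W.a_rcos_module[OF assms yV] by (simp add: a_minus_def)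
  then have "c \<odot> (y \<ominus> x) \<in> W" by (intro W.smult_closed) auto
  also have "c \<odot> (y \<ominus> x) = c \<odot> y \<ominus> c \<odot> x"
   using yV assms by (simp add: vs_minus_eq[OF V] vs_simps[OF V] mult.commute)
  finally show ?thesis using yV assms by (subst rcos_eq_iff) auto
 qed
 moreover have "W +> x \<noteq> {}" using W.a_rcos_self[OF assms] by blast
 ultimately have "(\<Union>y\<in>W +> x. W +> (c \<odot> y)) = W +> (c \<odot> x)" by (intro SUP_eq_const)
 then show ?thesis by (simp add: quot_space_def)
qed

lemma quot_space_cases:
 assumes "X <: (quot_space V W)"
 obtains x where "x <: V" "X = W +> x"
 using assms by (auto simp: quot_space_simps)

lemma vs_quot_space: "vs (quot_space V W)"
proof -
 have 0: "W = W +> \<zero>" by (simp add: W.a_rcos_const)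
 have zero: "(W +> x) +[quot_space V W] W = W +> x" if "x <: V" for x
  using quot_space_add[of x \<zero>] that 0 by simp
 show ?thesis
 proof (rule vsI)
  show "0[quot_space V W] <: (quot_space V W)"
   unfolding quot_space_simps by (subst 0) simp
 qed (elim quot_space_cases,
   simp add: quot_space_simps quot_space_add quot_space_smult vs_simps[OF V] vs_add_ac[OF V] zero flip: 0)+
qed

lemma lin_rcos: "lin V (quot_space V W) (%x. W +> x)"
 by (rule linI) (simp_all add: quot_space_simps quot_space_add quot_space_smult)

lemma quot_space_lift:
 assumes Z: "vs Z" and h: "lin V Z h" and null: "!!x. x \<in> W ==> h x = 0[Z]"
 obtains h' where "lin (quot_space V W) Z h'" "h' \<in> extensional (carrier (quot_space V W))"
  "!!x. x <: V ==> h' (W +> x) = h x"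
proof -
 define h' where "h' = (\<lambda>X\<in>carrier (quot_space V W). h (SOME x. x <: V \<and> X = W +> x))"
 have h': "h' (W +> x) = h x" if x: "x <: V" for x
 proof -
  define y where "y = (SOME y. y <: V \<and> W +> x = W +> y)"
  have y: "y <: V" "W +> x = W +> y"
   using someI[of "%y. y <: V \<and> W +> x = W +> y" x] x by (auto simp: y_def)
  then have "x \<ominus> y \<in> W" using x rcos_eq_iff by blast
  then have "h x -[Z] h y = 0[Z]" using null lin_minus[OF V Z h x y(1)] by simp
  then have hxy: "h x = h y" using vs_minus_eq_zero_iff[OF Z] lin_closed[OF h] x y by blast
  have "h' (W +> x) = h y" using x by (simp add: quot_space_simps h'_def y_def)
  then show ?thesis using hxy by simp
 qed
 have "lin (quot_space V W) Z h'"
 proof (rule linI; elim quot_space_cases; hypsubst)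
  fix x y c assume x: "x <: V"
  show "h' (W +> x) <: Z" using x by (simp add: h' lin_closed[OF h])
  show "h' (c .[quot_space V W] (W +> x)) = c .[Z] h' (W +> x)"
   using x by (simp add: quot_space_smult h' vs_closed[OF V] lin_smult[OF h])
  assume y: "y <: V"
  show "h' ((W +> x) +[quot_space V W] (W +> y)) = h' (W +> x) +[Z] h' (W +> y)"
   using x y by (simp add: quot_space_add h' vs_closed[OF V] lin_add[OF h])
 qed
 moreover have "h' \<in> extensional (carrier (quot_space V W))" by (simp add: h'_def)
 ultimately show ?thesis using h' by (rule that)
qed

end

section \<open>Calculus of tensor products\<close>

lemma free_space_minus:
 assumes "Poly_Mapping.keys p \<subseteq> S" "Poly_Mapping.keys q \<subseteq> S"
 shows "p -[free_space S] q = p - q"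
proof -
 have "p -[free_space S] q = p + Poly_Mapping.map ((*) (-1)) q"
  using assms vs_minus_eq[OF vs_free_space, of q S p] by simp
 also have "\<dots> = p - q" by (rule poly_mapping_eqI) (simp add: lookup_add lookup_minus del: mult_minus1)
 finally show ?thesis .
qed

lemma keys_diff_subset: "Poly_Mapping.keys (p - q) \<subseteq> Poly_Mapping.keys p \<union> Poly_Mapping.keys (q :: _ \<Rightarrow>\<^sub>0 complex)"
 by (auto simp: in_keys_iff lookup_minus)

lemma tensor_cong:
 assumes "carrier V = carrier V'" "add V = add V'" "smult V = smult V'"
  and "carrier W = carrier W'" "add W = add W'" "smult W = smult W'"
 shows "tensor V W = tensor V' W'" "v \<boxtimes>[V,W] w = v \<boxtimes>[V',W'] w"
  "tensor_lift V W Z = tensor_lift V' W' Z"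
proof -
 have "tensor_rels V W = tensor_rels V' W'" unfolding tensor_rels_def assms by (rule refl)
 then have n: "tensor_null V W = tensor_null V' W'" unfolding tensor_null_def assms by simp
 show t: "tensor V W = tensor V' W'" unfolding tensor_def n assms by (rule refl)
 show p: "v \<boxtimes>[V,W] w = v \<boxtimes>[V',W'] w" for v w unfolding pure_tensor_def n assms by (rule refl)
 show "tensor_lift V W Z = tensor_lift V' W' Z"
  by (intro ext) (simp add: tensor_lift_def t p assms)
qed

lemma tensor_lift_cong [cong]:
 assumes "V = V'" "W = W'" "Z = Z'" "t = t'"
  and "!!v w. v <: V' ==> w <: W' ==> b v w = b' v w"
 shows "tensor_lift V W Z b t = tensor_lift V' W' Z' b' t'"
proof -
 have "(\<forall>v\<in>carrier V'. \<forall>w\<in>carrier W'. h (v \<boxtimes>[V',W'] w) = b v w) \<longleftrightarrow>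
  (\<forall>v\<in>carrier V'. \<forall>w\<in>carrier W'. h (v \<boxtimes>[V',W'] w) = b' v w)" for h
  using assms(5) by auto
 then show ?thesis unfolding tensor_lift_def assms by simp
qed

lemmas lift_cong = tensor_lift_cong[OF refl refl refl refl]

context
 fixes V :: "(complex, 'a, 'm) module_scheme" and W :: "(complex, 'b, 'n) module_scheme"
 assumes V: "vs V" and W: "vs W"
begin

abbreviation (input) "FS \<equiv> free_space (carrier V \<times> carrier W)"

lemma tensor_rels_subset: "tensor_rels V W \<subseteq> carrier FS"
 using vs_closed[OF V] vs_closed[OF W]
 by (auto simp: tensor_rels_def dest!: subsetD[OF keys_diff_subset] split: if_splits)

lemma submodule_tensor_null: "submodule cpx (tensor_null V W) FS"
proof -
 interpret F: vectorspace cpx FS by (rule vs_free_space)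
 show ?thesis unfolding tensor_null_def by (rule F.span_is_submodule[OF tensor_rels_subset])
qed

lemma vs_tensor [simp]: "vs (tensor V W)"
 unfolding tensor_def by (rule vs_quot_space[OF vs_free_space submodule_tensor_null])

lemma pure_tensor_eqI:
 assumes "p - q \<in> tensor_rels V W" "Poly_Mapping.keys p \<subseteq> carrier V \<times> carrier W" "Poly_Mapping.keys q \<subseteq> carrier V \<times> carrier W"
 shows "tensor_null V W +>\<^bsub>FS\<^esub> p = tensor_null V W +>\<^bsub>FS\<^esub> q"
proof -
 interpret F: vectorspace cpx FS by (rule vs_free_space)
 have "p - q \<in> tensor_null V W"
  unfolding tensor_null_def using F.in_own_span[OF tensor_rels_subset] assms(1) by blast
 then show ?thesis
  using assms by (subst rcos_eq_iff[OF vs_free_space submodule_tensor_null]) (simp_all add: free_space_minus)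
qed

lemma pure_tensor_closed [simp]:
 "v <: V ==> w <: W ==> v \<boxtimes>[V,W] w <: (tensor V W)"
 unfolding pure_tensor_def tensor_def
 by (subst quot_space_simps[OF vs_free_space submodule_tensor_null]) (auto intro!: imageI)

lemma pure_tensor_add:
 assumes "v <: V" "w <: W" "v' <: V" "w' <: W"
 shows "(v +[V] v') \<boxtimes>[V,W] w = v \<boxtimes>[V,W] w +[tensor V W] v' \<boxtimes>[V,W] w"
  and "v \<boxtimes>[V,W] (w +[W] w') = v \<boxtimes>[V,W] w +[tensor V W] v \<boxtimes>[V,W] w'"
proof -
 note add = quot_space_add[OF vs_free_space submodule_tensor_null]
 have k: "Poly_Mapping.keys (Poly_Mapping.single x 1 + Poly_Mapping.single y (1::complex)) \<subseteq> carrier V \<times> carrier W"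
  if "x \<in> carrier V \<times> carrier W" "y \<in> carrier V \<times> carrier W" for x y
  using that Poly_Mapping.keys_add[of "Poly_Mapping.single x 1" "Poly_Mapping.single y (1::complex)"] by auto
 show "(v +[V] v') \<boxtimes>[V,W] w = v \<boxtimes>[V,W] w +[tensor V W] v' \<boxtimes>[V,W] w"
  unfolding pure_tensor_def tensor_def using assms
  by (subst add) (simp, simp, unfold free_space_simps, intro pure_tensor_eqI k, unfold tensor_rels_def diff_diff_eq[symmetric], blast,
   auto simp: vs_closed[OF V])
 show "v \<boxtimes>[V,W] (w +[W] w') = v \<boxtimes>[V,W] w +[tensor V W] v \<boxtimes>[V,W] w'"
  unfolding pure_tensor_def tensor_def using assms
  by (subst add) (simp, simp, unfold free_space_simps, intro pure_tensor_eqI k, unfold tensor_rels_def diff_diff_eq[symmetric], blast,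
   auto simp: vs_closed[OF W])
qed

lemma pure_tensor_smult:
 assumes "v <: V" "w <: W"
 shows "(c .[V] v) \<boxtimes>[V,W] w = c .[tensor V W] (v \<boxtimes>[V,W] w)"
  and "v \<boxtimes>[V,W] (c .[W] w) = c .[tensor V W] (v \<boxtimes>[V,W] w)"
proof -
 note smult = quot_space_smult[OF vs_free_space submodule_tensor_null]
 show "(c .[V] v) \<boxtimes>[V,W] w = c .[tensor V W] (v \<boxtimes>[V,W] w)"
  unfolding pure_tensor_def tensor_def using assms
  by (subst smult) (simp, intro pure_tensor_eqI, unfold tensor_rels_def, simp, blast, auto simp: vs_closed[OF V])
 show "v \<boxtimes>[V,W] (c .[W] w) = c .[tensor V W] (v \<boxtimes>[V,W] w)"
  unfolding pure_tensor_def tensor_def using assms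
  by (subst smult) (simp, intro pure_tensor_eqI, unfold tensor_rels_def, simp, blast, auto simp: vs_closed[OF W])
qed

lemma bilin_pure_tensor: "bilin V W (tensor V W) (%v w. v \<boxtimes>[V,W] w)"
 by (intro bilinI linI) (simp_all add: pure_tensor_add pure_tensor_smult)

lemma tensor_ext:
 assumes Z: "vs Z" and h: "lin (tensor V W) Z h" and h': "lin (tensor V W) Z h'"
  and eq: "!!v w. v <: V ==> w <: W ==> h (v \<boxtimes>[V,W] w) = h' (v \<boxtimes>[V,W] w)"
  and t: "t <: (tensor V W)"
 shows "h t = h' t"
proof -
 let ?pr = "%x. tensor_null V W +>\<^bsub>FS\<^esub> x"
 have pr: "lin FS (tensor V W) ?pr"
  unfolding tensor_def by (rule lin_rcos[OF vs_free_space submodule_tensor_null])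
 obtain p where p: "p <: FS" "t = ?pr p"
  using t unfolding tensor_def by (rule quot_space_cases[OF vs_free_space submodule_tensor_null])
 have "h (?pr p) = h' (?pr p)"
 proof (rule free_space_lin_ext[OF Z lin_comp[OF h pr] lin_comp[OF h' pr]])
  fix k assume "k \<in> carrier V \<times> carrier W"
  then show "h (?pr (Poly_Mapping.single k 1)) = h' (?pr (Poly_Mapping.single k 1))"
   using eq by (cases k) (simp add: pure_tensor_def)
 qed (use p in simp)
 then show ?thesis using p by simp
qed

lemma tensor_lift_ex1:
 assumes Z: "vs Z" and b: "bilin V W Z b"
 shows "\<exists>!h. lin (tensor V W) Z h \<and> h \<in> extensional (carrier (tensor V W)) \<and>
   (\<forall>v\<in>carrier V. \<forall>w\<in>carrier W. h (v \<boxtimes>[V,W] w) = b v w)"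
proof (rule ex_ex1I)
 let ?l = "linear_extension Z (%(v, w). b v w)"
 interpret F: vectorspace cpx FS by (rule vs_free_space)
 interpret Z: vectorspace cpx Z by (rule Z)
 have cl: "(%(v, w). b v w) \<in> carrier V \<times> carrier W \<rightarrow> carrier Z" using bilin_closed[OF b] by auto
 have l: "lin FS Z ?l" by (rule lin_linear_extension[OF Z cl])
 have single: "?l (Poly_Mapping.single (v, w) c) = c .[Z] b v w" if "v <: V" "w <: W" for v w c
  using linear_extension_single[OF Z, of "%(v, w). b v w" "(v, w)"] that bilin_closed[OF b] by simp
 interpret h: mod_hom cpx FS Z ?l
  using F.module_axioms Z.module_axioms l by (intro mod_hom.intro mod_hom_axioms.intro)
 have l_minus: "?l (p - q) = ?l p -[Z] ?l q" if "Poly_Mapping.keys p \<subseteq> carrier V \<times> carrier W" "Poly_Mapping.keys q \<subseteq> carrier V \<times> carrier W" for p q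
  using lin_minus[OF vs_free_space Z l, of p q] that by (simp add: free_space_minus)
 have kd: "Poly_Mapping.keys (Poly_Mapping.single x 1 - Poly_Mapping.single y (1::complex)) \<subseteq> carrier V \<times> carrier W"
  if "x \<in> carrier V \<times> carrier W" "y \<in> carrier V \<times> carrier W" for x y
  using that keys_diff_subset[of "Poly_Mapping.single x 1" "Poly_Mapping.single y 1"] by auto
 have minus0: "a +[Z] c -[Z] a -[Z] c = 0[Z]" "a -[Z] a = 0[Z]" if "a <: Z" "c <: Z" for a c
  using that Z.r_neg[of a] Z.r_neg[of c] by (simp_all add: a_minus_def Z.a_ac(1) Z.a_lcomm[of c "-[Z] a"])
 note bl = lin_add[OF bilinD(1)[OF b]] lin_add[OF bilinD(2)[OF b]]
  lin_smult[OF bilinD(1)[OF b]] lin_smult[OF bilinD(2)[OF b]]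
 have "?l p = 0[Z]" if "p \<in> tensor_rels V W" for p
  using that unfolding tensor_rels_def
  by (auto simp: l_minus kd single vs_closed[OF V] vs_closed[OF W] bl minus0 vs_simps[OF Z] bilin_closed[OF b])
 then have rels: "tensor_rels V W \<subseteq> h.ker"
  using tensor_rels_subset by (auto simp: h.ker_def simp del: free_space_simps)
 have null: "?l x = 0[Z]" if "x \<in> tensor_null V W" for x
 proof -
  have "x \<in> h.ker" using that F.span_is_subset[OF rels h.ker_is_submodule] unfolding tensor_null_def by (rule subsetD[rotated])
  then show ?thesis by (simp add: h.ker_def)
 qed
 obtain h where h: "lin (tensor V W) Z h" "h \<in> extensional (carrier (tensor V W))"
   "!!x. x <: FS ==> h (tensor_null V W +>\<^bsub>FS\<^esub> x) = ?l x"
  unfolding tensor_def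
  apply (rule quot_space_lift[OF vs_free_space submodule_tensor_null Z l null], assumption)
  subgoal premises prems for h by (rule prems(1)[OF prems(2-4)])
  done
 have hb: "h (v \<boxtimes>[V,W] w) = b v w" if "v <: V" "w <: W" for v w
  unfolding pure_tensor_def using h(3)[of "Poly_Mapping.single (v, w) 1"] single[OF that] that
   vs_simps[OF Z] bilin_closed[OF b that] by simp
 show "\<exists>h. lin (tensor V W) Z h \<and> h \<in> extensional (carrier (tensor V W)) \<and>
   (\<forall>v\<in>carrier V. \<forall>w\<in>carrier W. h (v \<boxtimes>[V,W] w) = b v w)"
  by (intro exI[of _ h] conjI ballI h(1,2) hb)
next
 fix h h'
 assume h: "lin (tensor V W) Z h \<and> h \<in> extensional (carrier (tensor V W)) \<and>
   (\<forall>v\<in>carrier V. \<forall>w\<in>carrier W. h (v \<boxtimes>[V,W] w) = b v w)"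
  and h': "lin (tensor V W) Z h' \<and> h' \<in> extensional (carrier (tensor V W)) \<and>
   (\<forall>v\<in>carrier V. \<forall>w\<in>carrier W. h' (v \<boxtimes>[V,W] w) = b v w)"
 note h = conjunct1[OF h] conjunct1[OF conjunct2[OF h]] bspec[OF bspec[OF conjunct2[OF conjunct2[OF h]]]]
 note h' = conjunct1[OF h'] conjunct1[OF conjunct2[OF h']] bspec[OF bspec[OF conjunct2[OF conjunct2[OF h']]]]
 have "h (v \<boxtimes>[V,W] w) = h' (v \<boxtimes>[V,W] w)" if "v <: V" "w <: W" for v w
  using h(3)[OF that] h'(3)[OF that] by (rule HOL.trans[OF _ HOL.sym])
 then have "h t = h' t" if "t <: (tensor V W)" for t
  using tensor_ext[OF Z h(1) h'(1) _ that] by blast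
 then show "h = h'" by (rule extensionalityI[OF h(2) h'(2)])
qed

lemma tensor_lift_lin [simp]: "vs Z ==> bilin V W Z b ==> lin (tensor V W) Z (tensor_lift V W Z b)"
 and tensor_lift_pure: "vs Z ==> bilin V W Z b ==> v <: V ==> w <: W ==>
  tensor_lift V W Z b (v \<boxtimes>[V,W] w) = b v w"
 using theI'[OF tensor_lift_ex1[of Z b]] unfolding tensor_lift_def by blast+

lemma tensor_lift_closed:
 "vs Z ==> bilin V W Z b ==> t <: (tensor V W) ==> tensor_lift V W Z b t <: Z"
 using lin_closed[OF tensor_lift_lin] by blast

lemma tensor_lift_unique:
 assumes "vs Z" "bilin V W Z b" "lin (tensor V W) Z h"
  and "!!v w. v <: V ==> w <: W ==> h (v \<boxtimes>[V,W] w) = b v w"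
  and "t <: (tensor V W)"
 shows "tensor_lift V W Z b t = h t"
 by (rule tensor_ext[OF assms(1) tensor_lift_lin[OF assms(1,2)] assms(3) _ assms(5)])
  (simp only: tensor_lift_pure[OF assms(1,2)] assms(4))

lemma tensor_lift_natural:
 assumes Z: "vs Z" and Z': "vs Z'" and g: "lin Z Z' g" and b: "bilin V W Z b" and t: "t <: (tensor V W)"
 shows "g (tensor_lift V W Z b t) = tensor_lift V W Z' (%v w. g (b v w)) t"
proof -
 have gb: "bilin V W Z' (%v w. g (b v w))"
  by (intro bilinI lin_comp[OF g] bilinD[OF b])
 show ?thesis
  by (rule sym, rule tensor_lift_unique[OF Z' gb _ _ t])
   (auto intro!: lin_comp[OF g] simp: Z b tensor_lift_pure)
qed

lemma tensor_lift_pure_self: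
 "t <: (tensor V W) ==> tensor_lift V W (tensor V W) (%v w. v \<boxtimes>[V,W] w) t = t"
 using bilin_pure_tensor by (intro tensor_lift_unique[of _ _ "%t. t"]) (auto intro: lin_id)

lemma lin_tensor_lift_arg [lins]:
 "vs Z ==> bilin V W Z b ==> lin X (tensor V W) t ==> lin X Z (%x. tensor_lift V W Z b (t x))"
 by (rule lin_comp[OF tensor_lift_lin])

lemma lin_tensor_lift_fun [lins]:
 assumes X: "vs X" and Z: "vs Z" and t: "t <: (tensor V W)"
  and b: "!!x. x <: X ==> bilin V W Z (b x)"
  and l: "!!v w. v <: V ==> w <: W ==> lin X Z (%x. b x v w)"
 shows "lin X Z (%x. tensor_lift V W Z (b x) t)"
proof (rule linI)
 fix x y c assume x: "x <: X"
 show "tensor_lift V W Z (b x) t <: Z" by (rule tensor_lift_closed[OF Z b[OF x] t])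
 show "tensor_lift V W Z (b (c .[X] x)) t = c .[Z] tensor_lift V W Z (b x) t"
  by (rule tensor_lift_unique[OF Z b _ _ t])
   (use x in \<open>auto intro!: lin_pointwise_smult tensor_lift_lin simp: vs_closed[OF X] Z b tensor_lift_pure lin_smult[OF l]\<close>)
 assume y: "y <: X"
 show "tensor_lift V W Z (b (x +[X] y)) t = tensor_lift V W Z (b x) t +[Z] tensor_lift V W Z (b y) t"
  by (rule tensor_lift_unique[OF Z b _ _ t])
   (use x y in \<open>auto intro!: lin_pointwise_add tensor_lift_lin simp: vs_closed[OF X] Z b tensor_lift_pure lin_add[OF l]\<close>)
qed

lemma tensor_lift_add:
 assumes Z: "vs Z" and b: "bilin V W Z b" "bilin V W Z b'" and t: "t <: (tensor V W)"
 shows "tensor_lift V W Z (%v w. b v w +[Z] b' v w) t = tensor_lift V W Z b t +[Z] tensor_lift V W Z b' t"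
 by (rule tensor_lift_unique[OF Z _ _ _ t])
  (use b in \<open>auto intro!: bilinI lin_pointwise_add tensor_lift_lin simp: Z tensor_lift_pure bilin_def\<close>)

lemma lin_pure_tensor [lins]:
 "w <: W ==> lin X V f ==> lin X (tensor V W) (%x. f x \<boxtimes>[V,W] w)"
 "v <: V ==> lin X W g ==> lin X (tensor V W) (%x. v \<boxtimes>[V,W] g x)"
 by (rule lin_comp[OF bilinD(2)[OF bilin_pure_tensor]]; assumption)
  (rule lin_comp[OF bilinD(1)[OF bilin_pure_tensor]]; assumption)

lemma tensor_induct [consumes 1, case_names zero add pure]:
 assumes t: "t <: (tensor V W)"
  and 0: "P 0[tensor V W]"
  and add: "!!s t. s <: (tensor V W) ==> t <: (tensor V W) ==> P s ==> P t ==> P (s +[tensor V W] t)"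
  and pure: "!!v w. v <: V ==> w <: W ==> P (v \<boxtimes>[V,W] w)"
 shows "P t"
proof -
 let ?pr = "%x. tensor_null V W +>\<^bsub>FS\<^esub> x"
 have pr: "lin FS (tensor V W) ?pr"
  unfolding tensor_def by (rule lin_rcos[OF vs_free_space submodule_tensor_null])
 obtain p where p: "p <: FS" "t = ?pr p"
  using t unfolding tensor_def by (rule quot_space_cases[OF vs_free_space submodule_tensor_null])
 from p(1) have "Poly_Mapping.keys p \<subseteq> carrier V \<times> carrier W" by simp
 then have "P (?pr p)"
 proof (induction p rule: free_space_induct)
  case zero
  show ?case using lin_zero[OF vs_free_space vs_tensor pr] 0 by simp
 next
  case (step k c p)
  obtain v w where k: "k = (v, w)" "v <: V" "w <: W" using step(1) by auto
  have s: "?pr (Poly_Mapping.single k c) = (c .[V] v) \<boxtimes>[V,W] w"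
   unfolding pure_tensor_smult(1)[OF k(2) k(3)] using lin_smult[OF pr, of "Poly_Mapping.single k 1" c] k
   by (simp add: pure_tensor_def)
  have "?pr (Poly_Mapping.single k c + p) = ?pr (Poly_Mapping.single k c) +[tensor V W] ?pr p"
   using lin_add[OF pr, of "Poly_Mapping.single k c" p] step k by simp
  moreover have "P (?pr (Poly_Mapping.single k c))" unfolding s using k by (intro pure vs_closed V)
  moreover have "?pr (Poly_Mapping.single k c) <: (tensor V W)"
   unfolding s using k by (intro pure_tensor_closed vs_closed V)
  moreover have "?pr p <: (tensor V W)" using lin_closed[OF pr, of p] step by simp
  ultimately show ?case using step add by simp
 qed
 then show ?thesis using p by simp
qed

end

lemma tensor_lift_swap:
 assumes V: "vs V" and W: "vs W" and V': "vs V'" and W': "vs W'" and Z: "vs Z"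
  and t: "t <: (tensor V W)" and t': "t' <: (tensor V' W')"
  and b: "!!v w. v <: V ==> w <: W ==> bilin V' W' Z (b v w)"
  and b': "!!v' w'. v' <: V' ==> w' <: W' ==> bilin V W Z (%v w. b v w v' w')"
 shows "tensor_lift V W Z (%v w. tensor_lift V' W' Z (b v w) t') t =
  tensor_lift V' W' Z (%v' w'. tensor_lift V W Z (%v w. b v w v' w') t) t'"
proof (rule tensor_lift_unique[OF V W Z _ _ _ t])
 show "bilin V W Z (%v w. tensor_lift V' W' Z (b v w) t')"
  by (rule bilinI; rule lin_tensor_lift_fun[OF V' W' _ Z t'])
   (use V W b bilinD[OF b'] in auto)
 show "lin (tensor V W) Z (%t. tensor_lift V' W' Z (%v' w'. tensor_lift V W Z (%v w. b v w v' w') t) t')"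
 proof (rule lin_tensor_lift_fun[OF V' W' vs_tensor[OF V W] Z t'])
  fix t assume t: "t <: (tensor V W)"
  show "bilin V' W' Z (%v' w'. tensor_lift V W Z (%v w. b v w v' w') t)"
   by (rule bilinI; rule lin_tensor_lift_fun[OF V W _ Z t]) (use V' W' b' bilinD[OF b] in auto)
 next
  fix v' w' assume "v' <: V'" "w' <: W'"
  then show "lin (tensor V W) Z (tensor_lift V W Z (%v w. b v w v' w'))"
   by (intro tensor_lift_lin V W Z b')
 qed
qed (simp add: tensor_lift_pure[OF V W Z b'])

text \<open>A tensor over a space whose points are separated by linear functionals vanishes as soon as
 all its contractions with these functionals do. In a representation \<open>\<Sum>\<^sub>i v\<^sub>i \<otimes> w\<^sub>i\<close> some
 functional does not vanish at the first nonzero \<open>w\<^sub>0\<close>; its contraction expresses \<open>v\<^sub>0\<close> by the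
 remaining \<open>v\<^sub>i\<close>, so that the sum can be shortened.\<close>

definition list_contraction ::
 "(complex, 'c, 'k) module_scheme \<Rightarrow> ('a \<Rightarrow> 'b \<Rightarrow> 'c) \<Rightarrow> ('a \<times> 'b) list \<Rightarrow> 'c" where
 "list_contraction Z b ps = foldr (%(v, w) s. b v w +[Z] s) ps 0[Z]"

lemma list_contraction_simps [simp]:
 "list_contraction Z b [] = 0[Z]"
 "list_contraction Z b ((v, w) # ps) = b v w +[Z] list_contraction Z b ps"
 by (simp_all add: list_contraction_def)

lemma list_contraction_closed:
 assumes Z: "vs Z" and b: "bilin V W Z b" and ps: "set ps \<subseteq> carrier V \<times> carrier W"
 shows "list_contraction Z b ps <: Z"
 using ps
proof (induction ps)
 case (Cons p ps)
 then show ?case using bilin_closed[OF b] by (cases p) (simp add: vs_closed[OF Z])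
qed (simp add: vs_closed[OF Z])

lemma list_contraction_append:
 assumes Z: "vs Z" and b: "bilin V W Z b"
  and ps: "set ps \<subseteq> carrier V \<times> carrier W" and qs: "set qs \<subseteq> carrier V \<times> carrier W"
 shows "list_contraction Z b (ps @ qs) = list_contraction Z b ps +[Z] list_contraction Z b qs"
 using ps
proof (induction ps)
 case Nil
 show ?case using list_contraction_closed[OF Z b qs] by (simp add: vs_simps[OF Z])
next
 case (Cons p ps)
 obtain v w where p: "p = (v, w)" by (cases p)
 have m: "b v w <: Z" using Cons.prems p bilin_closed[OF b] by simp
 have ps: "list_contraction Z b ps <: Z" using Cons.prems list_contraction_closed[OF Z b] by simp
 have IH: "list_contraction Z b (ps @ qs) = list_contraction Z b ps +[Z] list_contraction Z b qs"
  using Cons.IH Cons.prems by simp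
 show ?case unfolding p append_Cons list_contraction_simps IH
  using vs_add_ac(1)[OF Z m ps list_contraction_closed[OF Z b qs]] by simp
qed

lemma list_contraction_map:
 assumes Z: "vs Z" and Z': "vs Z'" and b: "bilin V W Z b" and h: "lin Z Z' h" and ps: "set ps \<subseteq> carrier V \<times> carrier W"
  and b': "!!v w. v <: V ==> w <: W ==> h (b v w) = b' v w"
 shows "h (list_contraction Z b ps) = list_contraction Z' b' ps"
 using ps
proof (induction ps)
 case Nil show ?case by (simp add: lin_zero[OF Z Z' h])
next
 case (Cons p ps)
 obtain v w where p: "p = (v, w)" by (cases p)
 have m: "b v w <: Z" "h (b v w) = b' v w" using Cons.prems p bilin_closed[OF b] b' by simp_all
 have ps: "list_contraction Z b ps <: Z" "set ps \<subseteq> carrier V \<times> carrier W"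
  using Cons.prems list_contraction_closed[OF Z b] by simp_all
 show ?case unfolding p list_contraction_simps lin_add[OF h m(1) ps(1)] Cons.IH[OF ps(2)] m(2) by (rule refl)
qed

lemma list_contraction_shift:
 assumes V: "vs V" and W: "vs W" and Z: "vs Z" and b: "bilin V W Z b"
  and ps: "set ps \<subseteq> carrier V \<times> carrier W" and w0: "w0 <: W"
 shows "list_contraction Z b (map (%(v, w). (v, w +[W] r w .[W] w0)) ps) =
  list_contraction Z b ps +[Z] b (list_contraction V (%v w. r w .[V] v) ps) w0"
  and "list_contraction V (%v w. r w .[V] v) ps <: V"
proof -
 have "list_contraction V (%v w. r w .[V] v) ps <: V \<and>
  list_contraction Z b (map (%(v, w). (v, w +[W] r w .[W] w0)) ps) =
  list_contraction Z b ps +[Z] b (list_contraction V (%v w. r w .[V] v) ps) w0"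
  using ps
 proof (induction ps)
  case Nil
  then show ?case using lin_zero[OF V Z bilinD(2)[OF b w0]] by (simp add: vs_simps[OF V] vs_simps[OF Z])
 next
  case (Cons p ps)
  obtain v w where p: "p = (v, w)" by (cases p)
  have v: "v <: V" and w: "w <: W" and ps: "set ps \<subseteq> carrier V \<times> carrier W"
   using Cons.prems p by simp_all
  let ?N = "list_contraction V (%v w. r w .[V] v) ps" and ?B = "list_contraction Z b ps"
  have N: "?N <: V" and IH: "list_contraction Z b (map (%(v, w). (v, w +[W] r w .[W] w0)) ps) = ?B +[Z] b ?N w0"
   using Cons.IH[OF ps] by simp_all
  have B: "?B <: Z" by (rule list_contraction_closed[OF Z b ps])
  have rv: "r w .[V] v <: V" using v by (rule vs_closed(3)[OF V])
  have rw: "r w .[W] w0 <: W" using w0 by (rule vs_closed(3)[OF W])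
  have 1: "b v (w +[W] r w .[W] w0) = b v w +[Z] b (r w .[V] v) w0"
   using lin_add[OF bilinD(1)[OF b v] w rw] lin_smult[OF bilinD(1)[OF b v] w0] lin_smult[OF bilinD(2)[OF b w0] v]
   by simp
  have 2: "b (r w .[V] v +[V] ?N) w0 = b (r w .[V] v) w0 +[Z] b ?N w0"
   by (rule lin_add[OF bilinD(2)[OF b w0] rv N])
  note cl = bilin_closed[OF b v w] bilin_closed[OF b rv w0] bilin_closed[OF b N w0] B
  show ?case unfolding p list.map prod.case list_contraction_simps IH 1 2
   using cl by (simp add: vs_closed[OF V] rv N vs_closed[OF Z] vs_add_ac[OF Z])
 qed
 then show "list_contraction Z b (map (%(v, w). (v, w +[W] r w .[W] w0)) ps) =
  list_contraction Z b ps +[Z] b (list_contraction V (%v w. r w .[V] v) ps) w0"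
  "list_contraction V (%v w. r w .[V] v) ps <: V" by simp_all
qed

lemma tensor_eq_list_contraction:
 assumes V: "vs V" and W: "vs W" and t: "t <: (tensor V W)"
 shows "\<exists>ps. set ps \<subseteq> carrier V \<times> carrier W \<and> t = list_contraction (tensor V W) (%v w. v \<boxtimes>[V,W] w) ps"
 using t
proof (induction rule: tensor_induct[OF V W, consumes 1, case_names zero add pure])
 case zero show ?case by (rule exI[of _ "[]"]) simp
next
 case (add s t)
 then obtain ps qs where "set ps \<subseteq> carrier V \<times> carrier W" "s = list_contraction (tensor V W) (%v w. v \<boxtimes>[V,W] w) ps"
  "set qs \<subseteq> carrier V \<times> carrier W" "t = list_contraction (tensor V W) (%v w. v \<boxtimes>[V,W] w) qs" by blast
 then show ?case
  using list_contraction_append[OF vs_tensor[OF V W] bilin_pure_tensor[OF V W], of ps qs]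
  by (intro exI[of _ "ps @ qs"]) simp
next
 case (pure v w)
 then show ?case
  by (intro exI[of _ "[(v, w)]"]) (simp add: vs_add_zero[OF vs_tensor[OF V W]] pure_tensor_closed[OF V W])
qed

lemma list_contraction_separate:
 assumes V: "vs V" and W: "vs W" and Z: "vs Z" and b: "bilin V W Z b"
  and \<Phi>: "!!\<phi>. \<phi> \<in> \<Phi> ==> lin W cpx \<phi>"
  and sep: "!!w. w <: W ==> (!!\<phi>. \<phi> \<in> \<Phi> ==> \<phi> w = 0) ==> w = 0[W]"
 shows "set ps \<subseteq> carrier V \<times> carrier W ==>
  (!!\<phi>. \<phi> \<in> \<Phi> ==> list_contraction V (%v w. \<phi> w .[V] v) ps = 0[V]) ==>
  list_contraction Z b ps = 0[Z]"
proof (induction "length ps" arbitrary: ps)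
 case 0 then show ?case by simp
next
 case (Suc n)
 then obtain v0 w0 ps' where ps: "ps = (v0, w0) # ps'" and n: "n = length ps'" by (cases ps) auto
 have v0: "v0 <: V" and w0: "w0 <: W" and ps': "set ps' \<subseteq> carrier V \<times> carrier W"
  using Suc.prems(1) ps by simp_all
 have e: "bilin V W V (%v w. \<phi> w .[V] v)" if "\<phi> \<in> \<Phi>" for \<phi>
  by (rule bilinI; intro lin_smult_left[OF V] lin_pointwise_smult[OF V] lin_id \<Phi>[OF that])
 note e_closed = list_contraction_closed[OF V e ps']
 have hyp: "\<phi> w0 .[V] v0 +[V] list_contraction V (%v w. \<phi> w .[V] v) ps' = 0[V]" if "\<phi> \<in> \<Phi>" for \<phi>
  using Suc.prems(2)[OF that] by (simp add: ps)
 have B: "list_contraction Z b ps' <: Z" by (rule list_contraction_closed[OF Z b ps'])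
 show ?case
 proof (cases "\<forall>\<phi>\<in>\<Phi>. \<phi> w0 = 0")
  case True
  then have w0_0: "w0 = 0[W]" using sep[OF w0] by blast
  have "list_contraction V (%v w. \<phi> w .[V] v) ps' = 0[V]" if "\<phi> \<in> \<Phi>" for \<phi>
  proof -
   have "\<phi> w0 = 0" using True that by blast
   then show ?thesis using hyp[OF that]
    by (simp add: vs_smult_zero(1)[OF V v0] vs_add_zero(1)[OF V e_closed[OF that]])
  qed
  then have "list_contraction Z b ps' = 0[Z]" using Suc.hyps(1)[OF n ps'] by blast
  moreover have "b v0 w0 = 0[Z]" unfolding w0_0 by (rule lin_zero[OF W Z bilinD(1)[OF b v0]])
  ultimately show ?thesis by (simp add: ps vs_simps[OF Z])
 next
  case False
  then obtain \<phi>0 where \<phi>0: "\<phi>0 \<in> \<Phi>" and nz: "\<phi>0 w0 \<noteq> 0" by blast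
  obtain k where k: "k * \<phi>0 w0 = - 1" using nz that[of "- 1 / \<phi>0 w0"] by simp
  define r where "r w = k * \<phi>0 w" for w
  define qs where "qs = map (%(v, w). (v, w +[W] r w .[W] w0)) ps'"
  let ?N = "list_contraction V (%v w. r w .[V] v) ps'"
  let ?E = "list_contraction V (%v w. \<phi>0 w .[V] v) ps'"
  note E = e_closed[OF \<phi>0]
  have N_eq: "k .[V] ?E = ?N"
   by (rule list_contraction_map[OF V V e[OF \<phi>0] _ ps'])
    (auto intro!: lin_pointwise_smult[OF V] lin_id simp: vs_smult_smult[OF V] r_def)
  have "?N = k .[V] (\<phi>0 w0 .[V] v0 +[V] ?E) +[V] v0"
  proof -
   have "k .[V] (\<phi>0 w0 .[V] v0 +[V] ?E) +[V] v0
     = ((-1) .[V] v0 +[V] v0) +[V] ?N"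
    using E v0
    by (simp add: vs_smult_distrib(2)[OF V] vs_smult_smult[OF V] N_eq k vs_closed[OF V]
     list_contraction_shift(2)[OF V W Z b ps' w0] vs_add_ac[OF V])
   also have "\<dots> = ?N"
    using list_contraction_shift(2)[OF V W Z b ps' w0, of r] vs_smult_distrib(1)[OF V v0, of "- 1" 1, symmetric]
    by (simp add: vs_smult_zero[OF V] v0 vs_add_zero[OF V])
   finally show ?thesis ..
  qed
  then have N: "?N = v0" using v0 by (simp add: hyp[OF \<phi>0] vs_simps[OF V])
  have qs: "set qs \<subseteq> carrier V \<times> carrier W"
   using ps' w0 by (auto simp: qs_def intro!: vs_closed[OF W])
  have "list_contraction V (%v w. \<phi> w .[V] v) qs = 0[V]" if "\<phi> \<in> \<Phi>" for \<phi>
   unfolding qs_def list_contraction_shift(1)[OF V W V e[OF that] ps' w0] N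
   using hyp[OF that] v0 e_closed[OF that] by (simp add: vs_add_ac(2)[OF V] vs_closed[OF V])
  moreover have "n = length qs" by (simp add: n qs_def)
  ultimately have "list_contraction Z b qs = 0[Z]" using Suc.hyps(1) qs by blast
  then show ?thesis
   unfolding qs_def list_contraction_shift(1)[OF V W Z b ps' w0] N ps list_contraction_simps
   using B bilin_closed[OF b v0 w0] by (simp add: vs_add_ac(2)[OF Z])
 qed
qed

lemma tensor_separate:
 assumes V: "vs V" and W: "vs W" and t: "t <: (tensor V W)" and s: "s <: (tensor V W)"
  and \<Phi>: "!!\<phi>. \<phi> \<in> \<Phi> ==> lin W cpx \<phi>"
  and sep: "!!w. w <: W ==> (!!\<phi>. \<phi> \<in> \<Phi> ==> \<phi> w = 0) ==> w = 0[W]"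
  and eq: "!!\<phi>. \<phi> \<in> \<Phi> ==> tensor_lift V W V (%v w. \<phi> w .[V] v) t = tensor_lift V W V (%v w. \<phi> w .[V] v) s"
 shows "t = s"
proof -
 let ?T = "tensor V W"
 note T = vs_tensor[OF V W]
 have ts: "t -[?T] s <: ?T" using t s by (rule vs_closed(5)[OF T])
 obtain ps where ps: "set ps \<subseteq> carrier V \<times> carrier W" "t -[?T] s = list_contraction ?T (%v w. v \<boxtimes>[V,W] w) ps"
  using tensor_eq_list_contraction[OF V W ts] by blast
 have "list_contraction ?T (%v w. v \<boxtimes>[V,W] w) ps = 0[?T]"
 proof (rule list_contraction_separate[OF V W T bilin_pure_tensor[OF V W] \<Phi> sep ps(1)])
  fix \<phi> assume \<phi>: "\<phi> \<in> \<Phi>"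
  have e: "bilin V W V (%v w. \<phi> w .[V] v)"
   by (rule bilinI; intro lin_smult_left[OF V] lin_pointwise_smult[OF V] lin_id \<Phi>[OF \<phi>])
  let ?h = "tensor_lift V W V (%v w. \<phi> w .[V] v)"
  note h = tensor_lift_lin[OF V W V e]
  have "?h (t -[?T] s) = ?h t -[V] ?h s" by (rule lin_minus[OF T V h t s])
  also have "\<dots> = 0[V]"
   unfolding eq[OF \<phi>] using vs_minus_eq_zero_iff[OF V] lin_closed[OF h s] by blast
  finally show "list_contraction V (%v w. \<phi> w .[V] v) ps = 0[V]"
   unfolding ps(2) by (subst (asm) list_contraction_map[OF T V bilin_pure_tensor[OF V W] h ps(1) tensor_lift_pure[OF V W V e]])
 qed
 then show ?thesis using ps(2) vs_minus_eq_zero_iff[OF T t s] by simp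
qed


section \<open>Algebras\<close>

lemma complex_algebraI:
 assumes A: "vs A" and one: "1[A] <: A" and b: "bilin A A A (%x y. x *[A] y)"
  and assoc: "!!x y z. x <: A ==> y <: A ==> z <: A ==>
   (x *[A] y) *[A] z = x *[A] (y *[A] z)"
  and unit: "!!x. x <: A ==> 1[A] *[A] x = x" "!!x. x <: A ==> x *[A] 1[A] = x"
 shows "complex_algebra A"
proof -
 interpret vectorspace cpx A by (rule A)
 note l = bilinD(2)[OF b] and r = bilinD(1)[OF b]
 have "ring A"
  by (rule ringI[OF abelian_group_axioms monoidI];
   (intro bilin_closed[OF b] one assoc unit lin_add[OF l] lin_add[OF r]; assumption)?)
 then show ?thesis
  by (intro complex_algebra.intro A complex_algebra_axioms.intro lin_smult[OF l] lin_smult[OF r])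
qed

context
 fixes A :: "(complex, 'a, 'm) module_scheme" (structure)
 assumes A: "complex_algebra A"
begin

interpretation complex_algebra A by (rule A)

lemma alg_vs [simp]: "vectorspace cpx A" ..

lemma alg_ring: "ring A" ..

lemma alg_closed [simp]:
 "\<one> <: A"
 "x <: A ==> y <: A ==> x \<otimes> y <: A"
 by simp_all

lemma alg_assoc: "x <: A ==> y <: A ==> z <: A ==> (x \<otimes> y) \<otimes> z = x \<otimes> (y \<otimes> z)"
 by (rule m_assoc)

lemma alg_unit [simp]:
 "x <: A ==> \<one> \<otimes> x = x"
 "x <: A ==> x \<otimes> \<one> = x"
 by simp_all

lemma alg_mult_bilin: "bilin A A A (%x y. x \<otimes> y)"
 by (intro bilinI linI) (simp_all add: r_distr l_distr smult_mult_left smult_mult_right)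

lemma lin_alg_mult [lins]:
 "a <: A ==> lin X A f ==> lin X A (%x. f x \<otimes> a)"
 "a <: A ==> lin X A f ==> lin X A (%x. a \<otimes> f x)"
 by (rule lin_comp[OF bilinD(2)[OF alg_mult_bilin]]; assumption)
  (rule lin_comp[OF bilinD(1)[OF alg_mult_bilin]]; assumption)

lemma alg_smult_mult:
 "x <: A ==> y <: A ==> (c \<odot> x) \<otimes> y = c \<odot> (x \<otimes> y)"
 "x <: A ==> y <: A ==> x \<otimes> (c \<odot> y) = c \<odot> (x \<otimes> y)"
 by (fact smult_mult_left smult_mult_right)+

lemma alg_distrib:
 "x <: A ==> y <: A ==> z <: A ==> (x \<oplus> y) \<otimes> z = x \<otimes> z \<oplus> y \<otimes> z"
 "x <: A ==> y <: A ==> z <: A ==> z \<otimes> (x \<oplus> y) = z \<otimes> x \<oplus> z \<otimes> y"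
 by (simp_all add: l_distr r_distr)

end

lemma vs_field_cong:
 assumes "carrier V = carrier V'" "add V = add V'" "zero V = zero V'" "smult V = smult V'"
 shows "vs V \<longleftrightarrow> vs V'"
proof -
 have *: "vs X'" if X: "vs X" and eq: "carrier X = carrier X'" "add X = add X'" "zero X = zero X'" "smult X = smult X'"
  for X :: "(complex, 'x, 'y) module_scheme" and X' :: "(complex, 'x, 'z) module_scheme"
  by (rule vsI; (unfold eq[symmetric])?; (intro vs_closed[OF X] vs_add_ac[OF X] vs_smult_distrib[OF X]
   vs_smult_zero[OF X] vs_add_zero[OF X] vs_smult_smult[OF X, symmetric])?; assumption?)
 show ?thesis using *[of V V'] *[of V' V] assms by metis
qed

lemma lin_field_cong:
 assumes "carrier V = carrier V'" "add V = add V'" "smult V = smult V'"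
  "carrier W = carrier W'" "add W = add W'" "smult W = smult W'"
 shows "lin V W f \<longleftrightarrow> lin V' W' f"
 unfolding module_hom_def assms by (rule refl)

lemma complex_algebra_cong:
 assumes V: "complex_algebra V" and eq: "carrier V = carrier V'" "add V = add V'" "zero V = zero V'" "smult V = smult V'"
  "mult V = mult V'" "one V = one V'"
 shows "complex_algebra V'"
proof (rule complex_algebraI)
 show "vs V'" using alg_vs[OF V] vs_field_cong[OF eq(1-4)] by simp
 show "bilin V' V' V' (%x y. x *[V'] y)"
  using alg_mult_bilin[OF V] lin_field_cong[OF eq(1,2,4) eq(1,2,4)] unfolding bilin_def eq by simp
qed (unfold eq[symmetric], intro alg_closed[OF V] alg_assoc[OF V] alg_unit[OF V]; assumption)+

lemma complex_algebra_cpx [simp]: "complex_algebra cpx"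
 by (rule complex_algebraI) (auto intro!: lins)

lemma complex_algebra_opposite:
 assumes A: "complex_algebra A" shows "complex_algebra (opposite_alg A)"
proof (rule complex_algebraI)
 have eq: "carrier (opposite_alg A) = carrier A" "add (opposite_alg A) = add A" "zero (opposite_alg A) = zero A"
  "smult (opposite_alg A) = smult A" "mult (opposite_alg A) = (%x y. y *[A] x)" "one (opposite_alg A) = one A"
  by (simp_all add: opposite_alg_def)
 show "vs (opposite_alg A)" using alg_vs[OF A] vs_field_cong[OF eq(1-4)] by simp
 show "bilin (opposite_alg A) (opposite_alg A) (opposite_alg A) (%x y. x *[opposite_alg A] y)"
  using alg_mult_bilin[OF A] lin_field_cong[OF eq(1,2,4) eq(1,2,4)] unfolding bilin_def eq by simp
qed (simp_all add: opposite_alg_def A alg_assoc[OF A])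

lemma tensor_alg_simps [simp]:
 "carrier (tensor_alg A B) = carrier (tensor A B)" "add (tensor_alg A B) = add (tensor A B)"
 "smult (tensor_alg A B) = smult (tensor A B)" "zero (tensor_alg A B) = zero (tensor A B)"
 "one (tensor_alg A B) = 1[A] \<boxtimes>[A,B] 1[B]"
 by (simp_all add: tensor_alg_def)

lemma tensor_alg_mult:
 "s *[tensor_alg A B] t = tensor_lift A B (tensor A B) (%a b.
    tensor_lift A B (tensor A B) (%a' b'. (a *[A] a') \<boxtimes>[A,B] (b *[B] b')) t) s"
 by (simp add: tensor_alg_def)

lemma lin_tensor_alg_iff: "lin V (tensor_alg A B) f \<longleftrightarrow> lin V (tensor A B) f" "lin (tensor_alg A B) V g \<longleftrightarrow> lin (tensor A B) V g"
 by (rule lin_field_cong; simp)+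

lemma complex_algebra_tensor:
 assumes A: "complex_algebra A" and B: "complex_algebra B"
 shows "complex_algebra (tensor_alg A B)"
  and "a <: A ==> b <: B ==> a' <: A ==> b' <: B ==>
   (a \<boxtimes>[A,B] b) *[tensor_alg A B] (a' \<boxtimes>[A,B] b') = (a *[A] a') \<boxtimes>[A,B] (b *[B] b')"
proof -
 let ?T = "tensor A B" and ?m = "mult (tensor_alg A B)"
 note vA = alg_vs[OF A] and vB = alg_vs[OF B]
 note T = vs_tensor[OF vA vB] and cl = pure_tensor_closed[OF vA vB]
 have in1: "bilin A B ?T (%a' b'. (a *[A] a') \<boxtimes>[A,B] (b *[B] b'))" if "a <: A" "b <: B" for a b
  using that by (intro lins vA vB A B alg_closed)
 have out1: "bilin A B ?T (%a b. tensor_lift A B ?T (%a' b'. (a *[A] a') \<boxtimes>[A,B] (b *[B] b')) t)"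
  if "t <: ?T" for t
  using that by (intro lins vA vB A B T alg_closed)
 have b: "bilin ?T ?T ?T ?m"
  unfolding tensor_alg_mult[abs_def] by (intro lins vA vB A B T alg_closed)
 show pure: "?m (a \<boxtimes>[A,B] b) (a' \<boxtimes>[A,B] b') = (a *[A] a') \<boxtimes>[A,B] (b *[B] b')"
  if "a <: A" "b <: B" "a' <: A" "b' <: B" for a b a' b'
  unfolding tensor_alg_mult tensor_lift_pure[OF vA vB T out1[OF cl[OF that(3,4)]] that(1,2)]
  by (rule tensor_lift_pure[OF vA vB T in1[OF that(1,2)] that(3,4)])
 have one: "1[tensor_alg A B] <: ?T" using A B by (simp add: cl)
 note l = bilinD(2)[OF b] and r = bilinD(1)[OF b]
 note mc = bilin_closed[OF b]
 have "?m (?m s t) u = ?m s (?m t u)" if s: "s <: ?T" and t: "t <: ?T" and u: "u <: ?T" for s t u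
 proof (rule tensor_ext[OF vA vB T _ _ _ s])
  show "lin ?T ?T (%s. ?m (?m s t) u)" by (rule lin_comp[OF l[OF u] l[OF t]])
  show "lin ?T ?T (%s. ?m s (?m t u))" by (rule l[OF mc[OF t u]])
  fix a b assume ab: "a <: A" "b <: B"
  note s = cl[OF this]
  show "?m (?m (a \<boxtimes>[A,B] b) t) u = ?m (a \<boxtimes>[A,B] b) (?m t u)"
  proof (rule tensor_ext[OF vA vB T _ _ _ t])
   show "lin ?T ?T (%t. ?m (?m (a \<boxtimes>[A,B] b) t) u)" by (rule lin_comp[OF l[OF u] r[OF s]])
   show "lin ?T ?T (%t. ?m (a \<boxtimes>[A,B] b) (?m t u))" by (rule lin_comp[OF r[OF s] l[OF u]])
   fix a' b' assume a'b': "a' <: A" "b' <: B"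
   note t = cl[OF this]
   show "?m (?m (a \<boxtimes>[A,B] b) (a' \<boxtimes>[A,B] b')) u = ?m (a \<boxtimes>[A,B] b) (?m (a' \<boxtimes>[A,B] b') u)"
   proof (rule tensor_ext[OF vA vB T _ _ _ u])
    show "lin ?T ?T (%u. ?m (?m (a \<boxtimes>[A,B] b) (a' \<boxtimes>[A,B] b')) u)" by (rule r[OF mc[OF s t]])
    show "lin ?T ?T (%u. ?m (a \<boxtimes>[A,B] b) (?m (a' \<boxtimes>[A,B] b') u))" by (rule lin_comp[OF r[OF s] r[OF t]])
   qed (use ab a'b' in \<open>simp add: pure alg_closed[OF A] alg_closed[OF B] alg_assoc[OF A] alg_assoc[OF B]\<close>)
  qed
 qed
 moreover have "?m 1[tensor_alg A B] t = t" if t: "t <: ?T" for t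
  by (rule tensor_ext[OF vA vB T r[OF one] lin_id _ t]) (simp add: pure alg_closed[OF A] alg_closed[OF B] alg_unit[OF A] alg_unit[OF B])
 moreover have "?m t 1[tensor_alg A B] = t" if t: "t <: ?T" for t
  by (rule tensor_ext[OF vA vB T l[OF one] lin_id _ t]) (simp add: pure alg_closed[OF A] alg_closed[OF B] alg_unit[OF A] alg_unit[OF B])
 moreover have "vs (tensor_alg A B)" using T by (subst vs_field_cong[of _ ?T]) simp_all
 moreover have "bilin (tensor_alg A B) (tensor_alg A B) (tensor_alg A B) ?m"
  using b by (simp add: bilin_def lin_tensor_alg_iff)
 ultimately show "complex_algebra (tensor_alg A B)" using one by (intro complex_algebraI) simp_all
qed

lemma alg_homI:
 assumes "lin A B h" "h 1[A] = 1[B]"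
  "!!x y. x <: A ==> y <: A ==> h (x *[A] y) = h x *[B] h y"
 shows "h \<in> complex_alg_hom A B"
 using assms by (simp add: complex_alg_hom_def)

lemma alg_homD:
 assumes "h \<in> complex_alg_hom A B"
 shows "lin A B h" "h 1[A] = 1[B]"
  "x <: A ==> y <: A ==> h (x *[A] y) = h x *[B] h y"
 using assms by (simp_all add: complex_alg_hom_def)

text \<open>Representations of an algebra on a space are homomorphisms to the algebra of its endomorphisms.\<close>

definition end_alg :: "(complex, 'a, 'm) module_scheme \<Rightarrow> (complex, 'a \<Rightarrow> 'a) module" where
 "end_alg V = \<lparr>carrier = {f \<in> extensional (carrier V). lin V V f},
   mult = (%f g. \<lambda>x\<in>carrier V. f (g x)), one = (\<lambda>x\<in>carrier V. x), zero = (\<lambda>x\<in>carrier V. 0[V]),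
   add = (%f g. \<lambda>x\<in>carrier V. f x +[V] g x), smult = (%c f. \<lambda>x\<in>carrier V. c .[V] f x)\<rparr>"

lemma end_alg_simps:
 "f <: (end_alg V) \<longleftrightarrow> f \<in> extensional (carrier V) \<and> lin V V f"
 "f *[end_alg V] g = (\<lambda>x\<in>carrier V. f (g x))" "1[end_alg V] = (\<lambda>x\<in>carrier V. x)"
 "0[end_alg V] = (\<lambda>x\<in>carrier V. 0[V])" "f +[end_alg V] g = (\<lambda>x\<in>carrier V. f x +[V] g x)"
 "c .[end_alg V] f = (\<lambda>x\<in>carrier V. c .[V] f x)"
 by (simp_all add: end_alg_def)

lemma end_algI: "vs V ==> lin V V f ==> (\<lambda>x\<in>carrier V. f x) <: (end_alg V)"
 by (simp add: end_alg_simps lin_restrict)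

lemma end_alg_eqI:
 assumes "f \<in> extensional (carrier V)" "g \<in> extensional (carrier V)" "!!x. x <: V ==> f x = g x"
 shows "f = g"
 using assms by (rule extensionalityI)

lemma vs_end_alg: assumes V: "vs V" shows "vs (end_alg V)"
proof (rule vsI)
 fix f g c assume f: "f <: (end_alg V)"
 then have fc: "f x <: V" if "x <: V" for x using lin_closed[of f V V x] that by (simp add: end_alg_simps)
 show "c .[end_alg V] f <: (end_alg V)" using f
  unfolding end_alg_simps(6) by (intro end_algI V lin_pointwise_smult) (simp add: end_alg_simps)
 show "f +[end_alg V] 0[end_alg V] = f" "1 .[end_alg V] f = f" "0 .[end_alg V] f = 0[end_alg V]"
  using f fc by (auto intro!: end_alg_eqI simp: end_alg_simps vs_simps[OF V])
 fix d
 show "(c + d) .[end_alg V] f = c .[end_alg V] f +[end_alg V] d .[end_alg V] f"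
  "(c * d) .[end_alg V] f = c .[end_alg V] (d .[end_alg V] f)"
  using fc by (auto intro!: end_alg_eqI simp: end_alg_simps vs_simps[OF V])
 assume g: "g <: (end_alg V)"
 then have gc: "g x <: V" if "x <: V" for x using lin_closed[of g V V x] that by (simp add: end_alg_simps)
 show "f +[end_alg V] g <: (end_alg V)" using f g
  unfolding end_alg_simps(5) by (intro end_algI V lin_pointwise_add) (simp_all add: end_alg_simps)
 show "f +[end_alg V] g = g +[end_alg V] f" "c .[end_alg V] (f +[end_alg V] g) = c .[end_alg V] f +[end_alg V] c .[end_alg V] g"
  using fc gc by (auto intro!: end_alg_eqI simp: end_alg_simps vs_simps[OF V] vs_add_ac(2)[OF V])
 fix h assume "h <: (end_alg V)"
 then have "h x <: V" if "x <: V" for x using lin_closed[of h V V x] that by (simp add: end_alg_simps)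
 then show "(f +[end_alg V] g) +[end_alg V] h = f +[end_alg V] (g +[end_alg V] h)"
  using fc gc by (auto intro!: end_alg_eqI simp: end_alg_simps vs_simps[OF V] vs_add_ac(1)[OF V])
qed (auto simp: end_alg_simps lin_restrict[OF V] lin_zero_map[OF V])

lemma complex_algebra_end_alg: assumes V: "vs V" shows "complex_algebra (end_alg V)"
proof (rule complex_algebraI[OF vs_end_alg[OF V]])
 note [simp] = end_alg_simps lin_restrict[OF V]
 have cl: "f x <: V" if "f <: (end_alg V)" "x <: V" for f x
  using that lin_closed[of f V V x] by simp
 show "bilin (end_alg V) (end_alg V) (end_alg V) (%x y. x *[end_alg V] y)"
 proof (intro bilinI linI)
  fix f g h c assume f: "f <: (end_alg V)" and g: "g <: (end_alg V)"
  have lf: "lin V V f" and lg: "lin V V g" using f g by simp_all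
  show fg: "f *[end_alg V] g <: (end_alg V)" using lin_comp[OF lf lg] by simp
  then show "f *[end_alg V] g <: (end_alg V)" .
  show "f *[end_alg V] (c .[end_alg V] g) = c .[end_alg V] (f *[end_alg V] g)"
   using cl[OF g] by (intro end_alg_eqI[where V = V]) (simp_all add: lin_smult[OF lf])
  show "(c .[end_alg V] f) *[end_alg V] g = c .[end_alg V] (f *[end_alg V] g)"
   using cl[OF g] by (intro end_alg_eqI[where V = V]) simp_all
  assume h: "h <: (end_alg V)"
  show "f *[end_alg V] (g +[end_alg V] h) = f *[end_alg V] g +[end_alg V] f *[end_alg V] h"
   using cl[OF g] cl[OF h] by (intro end_alg_eqI[where V = V]) (simp_all add: lin_add[OF lf])
  show "(f +[end_alg V] g) *[end_alg V] h = f *[end_alg V] h +[end_alg V] g *[end_alg V] h"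
   using cl[OF h] by (intro end_alg_eqI[where V = V]) simp_all
 qed
qed (auto intro!: end_alg_eqI[where V = V] simp: end_alg_simps lin_restrict[OF V] lin_id lin_closed[where V = V and W = V])

section \<open>Universal enveloping algebras\<close>

subsection \<open>Free and quotient algebras\<close>

lemma free_alg_simps [simp]:
 "carrier (free_alg X) = {p. Poly_Mapping.keys p \<subseteq> {w. set (letters w) \<subseteq> X}}"
 "add (free_alg X) = (+)" "zero (free_alg X) = 0" "mult (free_alg X) = (*)" "one (free_alg X) = 1"
 "smult (free_alg X) = (%c. Poly_Mapping.map ((*) c))"
 by (auto simp: free_alg_def)

lemma lin_free_alg_iff: "lin (free_alg X) Z h \<longleftrightarrow> lin (free_space {w. set (letters w) \<subseteq> X}) Z h"
 by (rule lin_field_cong) simp_all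

lemma free_alg_lin_ext:
 assumes "vs Z" "lin (free_alg X) Z f" "lin (free_alg X) Z g"
  and "!!w. set (letters w) \<subseteq> X ==> f (Poly_Mapping.single w 1) = g (Poly_Mapping.single w 1)"
  and "p <: (free_alg X)"
 shows "f p = g p"
 using free_space_lin_ext[where S = "{w. set (letters w) \<subseteq> X}" and f = f and g = g and p = p, OF assms(1)] assms(2-5) by (simp add: lin_free_alg_iff)

lemma letters_zero [simp]: "letters 0 = []" and letters_plus [simp]: "letters (v + w) = letters v @ letters w"
 by (simp_all add: zero_word_def plus_word_def)

lemma single_zero_commute:
 "p * Poly_Mapping.single 0 c = Poly_Mapping.single 0 c * (p :: 'a word \<Rightarrow>\<^sub>0 complex)"
proof -
 have "Poly_Mapping.keys p \<subseteq> UNIV" by simp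
 then show ?thesis
  by (induction p rule: free_space_induct) (simp_all add: distrib_left distrib_right mult_single mult.commute)
qed

lemma complex_algebra_free_alg: "complex_algebra (free_alg X)"
proof (rule complex_algebraI)
 show "vs (free_alg X)"
  by (subst vs_field_cong[of _ "free_space {w. set (letters w) \<subseteq> X}"]) (simp_all add: vs_free_space)
 show "bilin (free_alg X) (free_alg X) (free_alg X) (%x y. x *[free_alg X] y)"
 proof (intro bilinI linI)
  fix p q assume "p <: (free_alg X)" "q <: (free_alg X)"
  then show "p *[free_alg X] q <: (free_alg X)" "p *[free_alg X] q <: (free_alg X)"
   using keys_mult[of p q] by fastforce+
 qed (simp_all add: distrib_left distrib_right mult_map_scale_conv_mult mult.assoc,
   metis mult.assoc single_zero_commute)
qed (auto simp: mult.assoc)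

lemma complex_algebra_quot:
 assumes A: "complex_algebra A" and I: "ideal I A"
 shows "complex_algebra (quot_space A I)" "submodule cpx I A"
  "!!x y. x <: A ==> y <: A ==>
   (I +>\<^bsub>A\<^esub> x) *[quot_space A I] (I +>\<^bsub>A\<^esub> y) = I +>\<^bsub>A\<^esub> (x *[A] y)"
proof -
 interpret ideal I A by (rule I)
 note V = alg_vs[OF A]
 show sub: "submodule cpx I A"
 proof (rule submodule.intro)
  fix c v assume v: "v \<in> I"
  then have "(c .[A] 1[A]) *[A] v \<in> I" using vs_closed(3)[OF V alg_closed(1)[OF A]] by (rule I_l_closed)
  then show "c .[A] v \<in> I" using v by (simp add: alg_smult_mult[OF A])
 qed (use V in \<open>simp_all add: vs_iff_module a_subset\<close>)
 show m: "(I +>\<^bsub>A\<^esub> x) *[quot_space A I] (I +>\<^bsub>A\<^esub> y) = I +>\<^bsub>A\<^esub> (x *[A] y)"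
  if "x <: A" "y <: A" for x y
  using rcoset_mult_add[OF that] by (simp add: quot_space_def)
 note cases = quot_space_cases[OF V sub] and simps = quot_space_simps[OF V sub] quot_space_add[OF V sub] quot_space_smult[OF V sub] m
 show "complex_algebra (quot_space A I)"
 proof (rule complex_algebraI[OF vs_quot_space[OF V sub]])
  show "1[quot_space A I] <: (quot_space A I)" by (simp add: simps)
  show "bilin (quot_space A I) (quot_space A I) (quot_space A I) (%x y. x *[quot_space A I] y)"
   by (intro bilinI linI; elim cases) (simp_all add: simps vs_closed[OF V] alg_distrib[OF A] alg_smult_mult[OF A] alg_closed[OF A])
 qed (elim cases, simp add: simps alg_assoc[OF A])+
qed


subsection \<open>The universal property\<close>

text \<open>Neither antisymmetry nor the Jacobi identity matter for the universal property and the Hopf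
 algebra structure; they enter only in the injectivity of \<open>L \<rightarrow> U(L)\<close>.\<close>

locale bracket_space =
 fixes L :: "('a, 'm) lie_scheme" (structure)
 assumes vs_L: "vs L"
  and bracket_closed: "x <: L ==> y <: L ==> bracket L x y <: L"

definition bracket_hom ::
 "('a, 'm) lie_scheme \<Rightarrow> (complex, 'b, 'n) module_scheme \<Rightarrow> ('a \<Rightarrow> 'b) \<Rightarrow> bool" where
 "bracket_hom L A \<phi> \<longleftrightarrow> lin L A \<phi> \<and> (\<forall>x\<in>carrier L. \<forall>y\<in>carrier L.
  \<phi> (bracket L x y) = \<phi> x *[A] \<phi> y -[A] \<phi> y *[A] \<phi> x)"

lemma bracket_homI:
 "lin L A \<phi> ==> (!!x y. x <: L ==> y <: L ==>
  \<phi> (bracket L x y) = \<phi> x *[A] \<phi> y -[A] \<phi> y *[A] \<phi> x) ==> bracket_hom L A \<phi>"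
 by (simp add: bracket_hom_def)

lemma bracket_homD:
 assumes "bracket_hom L A \<phi>"
 shows "lin L A \<phi>" "x <: L ==> y <: L ==>
  \<phi> (bracket L x y) = \<phi> x *[A] \<phi> y -[A] \<phi> y *[A] \<phi> x"
 using assms by (simp_all add: bracket_hom_def)

definition word_map :: "(complex, 'b, 'n) module_scheme \<Rightarrow> ('a \<Rightarrow> 'b) \<Rightarrow> 'a word \<Rightarrow> 'b" where
 "word_map A \<phi> w = foldr (%x a. \<phi> x *[A] a) (letters w) 1[A]"

context bracket_space
begin

abbreviation "FA \<equiv> free_alg (carrier L)"
abbreviation "UL \<equiv> uea_alg L"

lemma uea_relsI:
 "x <: L ==> y <: L ==> letter (x \<oplus> y) - letter x - letter y \<in> uea_rels L"
 "x <: L ==> letter (c \<odot> x) - Poly_Mapping.map ((*) c) (letter x) \<in> uea_rels L"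
 "x <: L ==> y <: L ==>
  letter x * letter y - letter y * letter x - letter (bracket L x y) \<in> uea_rels L"
 unfolding uea_rels_def by blast+

lemma uea_rels_cases:
 assumes "p \<in> uea_rels L"
 obtains x y where "x <: L" "y <: L" "p = letter (x \<oplus> y) - letter x - letter y"
 | c x where "x <: L" "p = letter (c \<odot> x) - Poly_Mapping.map ((*) c) (letter x)"
 | x y where "x <: L" "y <: L" "p = letter x * letter y - letter y * letter x - letter (bracket L x y)"
 using assms unfolding uea_rels_def by (elim UnE CollectE exE conjE) simp_all

lemma letter_closed: "x <: L ==> letter x <: FA"
 by (simp add: letter_def)

lemma fa_closed:
 "p <: FA ==> q <: FA ==> p - q <: FA"
 "p <: FA ==> q <: FA ==> p * q <: FA"
 "p <: FA ==> q <: FA ==> p + q <: FA"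
 "p <: FA ==> Poly_Mapping.map ((*) c) p <: FA"
proof -
 note F = complex_algebra_free_alg[of "carrier L"]
 show "p - q <: FA" if "p <: FA" "q <: FA"
  using that keys_diff_subset[of p q] by auto
 show "p * q <: FA" if "p <: FA" "q <: FA" using alg_closed(2)[OF F that] by simp
 show "p + q <: FA" if "p <: FA" "q <: FA" using vs_closed(2)[OF alg_vs[OF F] that] by simp
 show "Poly_Mapping.map ((*) c) p <: FA" if "p <: FA" using vs_closed(3)[OF alg_vs[OF F] that, of c] by simp
qed

lemma uea_rels_subset: "uea_rels L \<subseteq> carrier FA"
proof
 fix p assume "p \<in> uea_rels L"
 then show "p <: FA"
  by (cases rule: uea_rels_cases) (simp_all only: fa_closed letter_closed vs_closed[OF vs_L] bracket_closed)
qed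

lemma ideal_uea_ideal: "ideal (uea_ideal L) FA"
 unfolding uea_ideal_def
 by (rule ring.genideal_ideal[OF alg_ring[OF complex_algebra_free_alg] uea_rels_subset])

lemma complex_algebra_uea_alg: "complex_algebra UL"
 unfolding uea_alg_def by (rule complex_algebra_quot[OF complex_algebra_free_alg ideal_uea_ideal])

lemma rels_in_uea_ideal: "uea_rels L \<subseteq> uea_ideal L"
 unfolding uea_ideal_def
 by (rule ring.genideal_self[OF alg_ring[OF complex_algebra_free_alg] uea_rels_subset])

lemmas fa_vs = alg_vs[OF complex_algebra_free_alg, of "carrier L"]
lemmas uea_sub = complex_algebra_quot(2)[OF complex_algebra_free_alg ideal_uea_ideal]

abbreviation "uea_proj p \<equiv> uea_ideal L +>\<^bsub>FA\<^esub> p"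

lemma lin_uea_proj: "lin FA UL uea_proj"
 unfolding uea_alg_def by (rule lin_rcos[OF fa_vs uea_sub])

lemma uea_proj_mult: "p <: FA ==> q <: FA ==> uea_proj p *[UL] uea_proj q = uea_proj (p * q)"
 unfolding uea_alg_def using complex_algebra_quot(3)[OF complex_algebra_free_alg ideal_uea_ideal] by simp

lemma uea_one: "1[UL] = uea_proj 1"
 unfolding uea_alg_def quot_space_simps(3)[OF fa_vs uea_sub] by simp

lemma fa_minus: assumes "p <: FA" "q <: FA" shows "p -[FA] q = p - q"
proof -
 have "p -[FA] q = p + Poly_Mapping.map ((*) (-1)) q"
  using assms vs_minus_eq[OF fa_vs, of q p] by simp
 also have "\<dots> = p - q" by (rule poly_mapping_eqI) (simp add: lookup_add lookup_minus del: mult_minus1)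
 finally show ?thesis .
qed

lemma uea_proj_eqI:
 assumes "p <: FA" "q <: FA" "p - q \<in> uea_rels L"
 shows "uea_proj p = uea_proj q"
 using subsetD[OF rels_in_uea_ideal assms(3)]
 unfolding rcos_eq_iff[OF fa_vs uea_sub assms(1,2)] fa_minus[OF assms(1,2)] .

lemma bracket_hom_uea_incl: "bracket_hom L UL (uea_incl L)"
proof (rule bracket_homI)
 note fa = vs_closed[OF fa_vs] letter_closed
 show lin: "lin L UL (uea_incl L)"
 proof (rule linI)
  fix x y c assume x: "x <: L"
  note lx = letter_closed[OF x]
  show "uea_incl L x <: UL" unfolding uea_incl_def by (rule lin_closed[OF lin_uea_proj lx])
  have "uea_incl L (c .[L] x) = uea_proj (Poly_Mapping.map ((*) c) (letter x))"
   unfolding uea_incl_def using x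
   by (intro uea_proj_eqI fa_closed letter_closed vs_closed[OF vs_L] uea_relsI)
  then show "uea_incl L (c .[L] x) = c .[UL] uea_incl L x"
   using lin_smult[OF lin_uea_proj lx, of c] by (simp add: uea_incl_def)
  assume y: "y <: L"
  note ly = letter_closed[OF y]
  have "letter (x +[L] y) - (letter x + letter y) \<in> uea_rels L"
   using uea_relsI(1)[OF x y] by (simp only: diff_diff_eq)
  then have "uea_incl L (x +[L] y) = uea_proj (letter x + letter y)"
   unfolding uea_incl_def using x y
   by (intro uea_proj_eqI fa_closed letter_closed vs_closed[OF vs_L])
  then show "uea_incl L (x +[L] y) = uea_incl L x +[UL] uea_incl L y"
   using lin_add[OF lin_uea_proj lx ly] by (simp add: uea_incl_def)
 qed
 fix x y assume x: "x <: L" and y: "y <: L"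
 note lx = letter_closed[OF x] and ly = letter_closed[OF y]
 note A = complex_algebra_free_alg[of "carrier L"]
 have xy: "letter x * letter y <: FA" using alg_closed(2)[OF A lx ly] by simp
 have yx: "letter y * letter x <: FA" using alg_closed(2)[OF A ly lx] by simp
 have d: "letter x * letter y - letter y * letter x <: FA"
  using vs_closed(5)[OF fa_vs xy yx] fa_minus[OF xy yx] by simp
 have "uea_proj (letter x * letter y - letter y * letter x) = uea_incl L (bracket L x y)"
  unfolding uea_incl_def using x y d
  by (intro uea_proj_eqI letter_closed bracket_closed uea_relsI)
 moreover have "uea_proj (letter x * letter y - letter y * letter x) = uea_proj (letter x * letter y) -[UL] uea_proj (letter y * letter x)"
  using lin_minus[OF fa_vs alg_vs[OF complex_algebra_uea_alg] lin_uea_proj xy yx] fa_minus[OF xy yx] by simp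
 ultimately show "uea_incl L (bracket L x y) = uea_incl L x *[UL] uea_incl L y -[UL] uea_incl L y *[UL] uea_incl L x"
  using uea_proj_mult[OF lx ly] uea_proj_mult[OF ly lx] by (simp add: uea_incl_def)
qed

lemmas lin_uea_incl = bracket_homD(1)[OF bracket_hom_uea_incl]

lemma uea_incl_closed: "x <: L ==> uea_incl L x <: UL"
 by (rule lin_closed[OF lin_uea_incl])

lemma uea_alg_word_induct:
 assumes u: "u <: UL"
  and add: "!!u v. u <: UL ==> v <: UL ==> P u ==> P v ==> P (u +[UL] v)"
  and smult: "!!c u. u <: UL ==> P u ==> P (c .[UL] u)"
  and word: "!!w. set (letters w) \<subseteq> carrier L ==> P (uea_proj (Poly_Mapping.single w 1))"
 shows "P u"
proof -
 note V = alg_vs[OF complex_algebra_uea_alg]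
 obtain p where p: "p <: FA" "u = uea_proj p"
  using u unfolding uea_alg_def by (rule quot_space_cases[OF fa_vs uea_sub])
 have "Poly_Mapping.keys p \<subseteq> {w. set (letters w) \<subseteq> carrier L}" using p(1) by simp
 then have "P (uea_proj p)"
 proof (induction p rule: free_space_induct)
  case zero
  have one: "Poly_Mapping.single 0 1 <: FA" by simp
  have "P (0 .[UL] uea_proj (Poly_Mapping.single 0 1))"
   by (intro smult word lin_closed[OF lin_uea_proj one]) simp
  also have "0 .[UL] uea_proj (Poly_Mapping.single 0 1) = uea_proj 0"
   using lin_zero[OF fa_vs V lin_uea_proj] vs_smult_zero(1)[OF V lin_closed[OF lin_uea_proj one]]
   by (simp only: free_alg_simps)
  finally show ?case .
 next
  case (step k c p)
  have k: "Poly_Mapping.single k 1 <: FA" "Poly_Mapping.single k c <: FA" and p: "p <: FA"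
   using step by simp_all
  have eq: "uea_proj (Poly_Mapping.single k c) = c .[UL] uea_proj (Poly_Mapping.single k 1)"
   using lin_smult[OF lin_uea_proj k(1), of c] by simp
  have "P (uea_proj (Poly_Mapping.single k c))"
   unfolding eq using step(1) by (intro smult word lin_closed[OF lin_uea_proj k(1)]) simp
  then have "P (uea_proj (Poly_Mapping.single k c) +[UL] uea_proj p)"
   by (intro add lin_closed[OF lin_uea_proj] k p step(3))
  then show ?case using lin_add[OF lin_uea_proj k(2) p] by simp
 qed
 then show ?thesis using p by simp
qed

lemma uea_proj_word:
 assumes "set xs \<subseteq> carrier L" "set ys \<subseteq> carrier L"
 shows "uea_proj (Poly_Mapping.single (Word (xs @ ys)) 1) =
  uea_proj (Poly_Mapping.single (Word xs) 1) *[UL] uea_proj (Poly_Mapping.single (Word ys) 1)"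
 using assms by (subst uea_proj_mult) (simp_all add: mult_single plus_word_def)

lemma uea_proj_nil: "uea_proj (Poly_Mapping.single (Word []) 1) = 1[UL]"
 by (simp add: uea_one single_one flip: zero_word_def)

lemma uea_alg_induct:
 assumes u: "u <: UL"
  and one: "P 1[UL]"
  and add: "!!u v. u <: UL ==> v <: UL ==> P u ==> P v ==> P (u +[UL] v)"
  and smult: "!!c u. u <: UL ==> P u ==> P (c .[UL] u)"
  and step: "!!x u. x <: L ==> u <: UL ==> P u ==> P (uea_incl L x *[UL] u)"
 shows "P u"
proof (rule uea_alg_word_induct[OF u add smult])
 have "set xs \<subseteq> carrier L ==> P (uea_proj (Poly_Mapping.single (Word xs) 1))" for xs
 proof (induction xs)
  case (Cons x xs)
  have "uea_proj (Poly_Mapping.single (Word (x # xs)) 1) = uea_incl L x *[UL] uea_proj (Poly_Mapping.single (Word xs) 1)"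
   using uea_proj_word[of "[x]" xs] Cons.prems by (simp add: uea_incl_def letter_def)
  moreover have "uea_proj (Poly_Mapping.single (Word xs) 1) <: UL"
   using Cons.prems by (intro lin_closed[OF lin_uea_proj]) simp
  ultimately show ?case using Cons step by simp
 qed (use one uea_proj_nil in simp)
 then show "P (uea_proj (Poly_Mapping.single w 1))" if "set (letters w) \<subseteq> carrier L" for w
  using that by (metis word.collapse)
qed

lemma uea_alg_induct_right:
 assumes u: "u <: UL"
  and one: "P 1[UL]"
  and add: "!!u v. u <: UL ==> v <: UL ==> P u ==> P v ==> P (u +[UL] v)"
  and smult: "!!c u. u <: UL ==> P u ==> P (c .[UL] u)"
  and step: "!!x u. x <: L ==> u <: UL ==> P u ==> P (u *[UL] uea_incl L x)"
 shows "P u"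
proof (rule uea_alg_word_induct[OF u add smult])
 have "set xs \<subseteq> carrier L ==> P (uea_proj (Poly_Mapping.single (Word xs) 1))" for xs
 proof (induction xs rule: rev_induct)
  case (snoc x xs)
  have "uea_proj (Poly_Mapping.single (Word (xs @ [x])) 1) = uea_proj (Poly_Mapping.single (Word xs) 1) *[UL] uea_incl L x"
   using uea_proj_word[of xs "[x]"] snoc.prems by (simp add: uea_incl_def letter_def)
  moreover have "uea_proj (Poly_Mapping.single (Word xs) 1) <: UL"
   using snoc.prems by (intro lin_closed[OF lin_uea_proj]) simp
  ultimately show ?case using snoc step by simp
 qed (use one uea_proj_nil in simp)
 then show "P (uea_proj (Poly_Mapping.single w 1))" if "set (letters w) \<subseteq> carrier L" for w
  using that by (metis word.collapse)
qed

lemma uea_alg_lin_ext: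
 assumes Z: "vs Z" and f: "lin UL Z f" and g: "lin UL Z g" and one: "f 1[UL] = g 1[UL]"
  and step: "!!x u. x <: L ==> u <: UL ==> f u = g u ==>
   f (uea_incl L x *[UL] u) = g (uea_incl L x *[UL] u)"
  and u: "u <: UL"
 shows "f u = g u"
 by (rule uea_alg_induct[where P = "%u. f u = g u", OF u one])
  (simp_all add: lin_add[OF f] lin_add[OF g] lin_smult[OF f] lin_smult[OF g] step)

text \<open>The algebra homomorphism from the free algebra attached to \<open>\<phi>\<close>; its kernel is an ideal
 containing the defining relations of \<open>U(L)\<close>.\<close>

context
 fixes A :: "(complex, 'b, 'n) module_scheme" and \<phi>
 assumes A: "complex_algebra A" and \<phi>: "bracket_hom L A \<phi>"
begin

private abbreviation "wm \<equiv> word_map A \<phi>"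
private abbreviation "h \<equiv> linear_extension A wm"

private lemma \<phi>_closed: "x <: L ==> \<phi> x <: A"
 using bracket_homD(1)[OF \<phi>] by (rule lin_closed)

private lemma wm_closed: "set (letters w) \<subseteq> carrier L ==> wm w <: A"
proof -
 have "set xs \<subseteq> carrier L ==> foldr (%x a. \<phi> x *[A] a) xs 1[A] <: A" for xs
  by (induction xs) (simp_all add: A \<phi>_closed)
 then show "set (letters w) \<subseteq> carrier L ==> wm w <: A" by (simp add: word_map_def)
qed

private lemma wm_plus:
 assumes "set (letters v) \<subseteq> carrier L" "set (letters w) \<subseteq> carrier L"
 shows "wm (v + w) = wm v *[A] wm w"
proof -
 have w: "foldr (%x a. \<phi> x *[A] a) (letters w) 1[A] <: A" using wm_closed[OF assms(2)] by (simp add: word_map_def)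
 have "set xs \<subseteq> carrier L ==> foldr (%x a. \<phi> x *[A] a) xs 1[A] <: A \<and>
   foldr (%x a. \<phi> x *[A] a) (xs @ letters w) 1[A] = foldr (%x a. \<phi> x *[A] a) xs 1[A] *[A] wm w" for xs
  by (induction xs) (simp_all add: A \<phi>_closed w word_map_def alg_assoc[OF A])
 then show ?thesis using assms(1) by (simp add: word_map_def)
qed

private lemma lin_h: "lin FA A h"
 unfolding lin_free_alg_iff by (rule lin_linear_extension[OF alg_vs[OF A]]) (use wm_closed in auto)

private lemma h_single: "set (letters w) \<subseteq> carrier L ==> h (Poly_Mapping.single w c) = c .[A] wm w"
 by (rule linear_extension_single[OF alg_vs[OF A]]) (rule wm_closed)

private lemma h_mult: assumes p: "p <: FA" and q: "q <: FA" shows "h (p * q) = h p *[A] h q"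
proof -
 note F = complex_algebra_free_alg[of "carrier L"]
 have F_eq: "p * q = p *[FA] q" for p q by simp
 show ?thesis unfolding F_eq
 proof (rule free_alg_lin_ext[OF alg_vs[OF A] _ _ _ p])
  show "lin FA A (%p. h (p *[FA] q))" by (intro lin_comp[OF lin_h] lin_alg_mult F q lin_id)
  show "lin FA A (%p. h p *[A] h q)" by (intro lin_alg_mult A lin_closed[OF lin_h q] lin_h)
  fix v :: "'a word" assume v: "set (letters v) \<subseteq> carrier L"
  then have sv: "Poly_Mapping.single v 1 <: FA" by simp
  show "h (Poly_Mapping.single v 1 *[FA] q) = h (Poly_Mapping.single v 1) *[A] h q"
  proof (rule free_alg_lin_ext[OF alg_vs[OF A] _ _ _ q])
   show "lin FA A (%q. h (Poly_Mapping.single v 1 *[FA] q))" by (intro lin_comp[OF lin_h] lin_alg_mult F sv lin_id)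
   show "lin FA A (%q. h (Poly_Mapping.single v 1) *[A] h q)" by (intro lin_alg_mult A lin_closed[OF lin_h sv] lin_h)
   fix w :: "'a word" assume w: "set (letters w) \<subseteq> carrier L"
   have "h (Poly_Mapping.single (v + w) 1) = wm v *[A] wm w"
    using v w by (simp add: h_single wm_plus wm_closed vs_smult_zero(3)[OF alg_vs[OF A]] A)
   moreover have "h (Poly_Mapping.single v 1) = wm v" "h (Poly_Mapping.single w 1) = wm w"
    using v w by (simp_all add: h_single wm_closed vs_smult_zero(3)[OF alg_vs[OF A]])
   ultimately show "h (Poly_Mapping.single v 1 *[FA] Poly_Mapping.single w 1) = h (Poly_Mapping.single v 1) *[A] h (Poly_Mapping.single w 1)"
    by (simp add: mult_single)
  qed
 qed
qed

private lemma h_one: "h 1 = 1[A]"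
 using h_single[of 0 1] by (simp add: word_map_def vs_smult_zero(3)[OF alg_vs[OF A]] A)

private lemma h_letter: "x <: L ==> h (letter x) = \<phi> x"
 using h_single[of "Word [x]" 1] \<phi>_closed[of x] by (simp add: letter_def word_map_def vs_smult_zero(3)[OF alg_vs[OF A]] A)

private lemma h_null: assumes "p \<in> uea_ideal L" shows "h p = 0[A]"
proof -
 note F = complex_algebra_free_alg[of "carrier L"]
 interpret h: ring_hom_ring FA A h
  by (rule ring_hom_ringI[OF alg_ring[OF F] alg_ring[OF A]])
   (simp_all only: lin_closed[OF lin_h] lin_add[OF lin_h] free_alg_simps(4,5) h_mult h_one)
 have lx: "letter x <: FA" if "x <: L" for x by (rule letter_closed[OF that])
 have d: "h (p - q) = h p -[A] h q" if "p <: FA" "q <: FA" for p q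
  using lin_minus[OF fa_vs alg_vs[OF A] lin_h that] fa_minus[OF that] by simp
 have dc: "p - q <: FA" if "p <: FA" "q <: FA" for p q
  using vs_closed(5)[OF fa_vs that] fa_minus[OF that] by simp
 have z: "a -[A] a = 0[A]" if "a <: A" for a using vs_minus_eq_zero_iff[OF alg_vs[OF A] that that] by simp
 note l\<phi> = bracket_homD(1)[OF \<phi>]
 have 1: "h (letter (x +[L] y) - letter x - letter y) = 0[A]" if x: "x <: L" and y: "y <: L" for x y
 proof -
  have "h (letter (x +[L] y) - letter x - letter y) = (\<phi> x +[A] \<phi> y) -[A] \<phi> x -[A] \<phi> y"
   using x y by (simp only: d dc lx vs_closed[OF vs_L] h_letter lin_add[OF l\<phi>])
  also have "\<dots> = 0[A]"
   unfolding vs_add_ac(2)[OF alg_vs[OF A] \<phi>_closed[OF x] \<phi>_closed[OF y]]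
   using \<phi>_closed[OF x] \<phi>_closed[OF y]
   by (simp add: vs_add_minus_cancel[OF alg_vs[OF A]] z)
  finally show ?thesis .
 qed
 have 2: "h (letter (c .[L] x) - Poly_Mapping.map ((*) c) (letter x)) = 0[A]" if x: "x <: L" for c x
 proof -
  have m: "Poly_Mapping.map ((*) c) (letter x) <: FA" using vs_closed(3)[OF fa_vs lx[OF x], of c] by simp
  have "h (Poly_Mapping.map ((*) c) (letter x)) = c .[A] \<phi> x" using lin_smult[OF lin_h lx[OF x], of c] h_letter[OF x] by simp
  then show ?thesis
   using x m by (simp only: d lx vs_closed[OF vs_L] h_letter lin_smult[OF l\<phi>] z vs_closed[OF alg_vs[OF A]] \<phi>_closed)
 qed
 have 3: "h (letter x * letter y - letter y * letter x - letter (bracket L x y)) = 0[A]"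
  if x: "x <: L" and y: "y <: L" for x y
 proof -
  have m: "letter x * letter y <: FA" "letter y * letter x <: FA"
   using alg_closed(2)[OF F lx[OF x] lx[OF y]] alg_closed(2)[OF F lx[OF y] lx[OF x]] by simp_all
  have "h (letter x * letter y - letter y * letter x - letter (bracket L x y)) =
    \<phi> (bracket L x y) -[A] \<phi> (bracket L x y)"
   using bracket_homD(2)[OF \<phi> x y] m bracket_closed[OF x y]
   by (simp only: d dc h_mult lx x y h_letter)
  then show ?thesis using z[OF \<phi>_closed[OF bracket_closed[OF x y]]] by simp
 qed
 have "h p = 0[A]" if "p \<in> uea_rels L" for p
  using that by (cases rule: uea_rels_cases) (simp_all only: 1 2 3)
 then have "uea_rels L \<subseteq> a_kernel FA A h"
  using uea_rels_subset unfolding a_kernel_def' by blast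
 then have "uea_ideal L \<subseteq> a_kernel FA A h"
  unfolding uea_ideal_def by (rule ring.genideal_minimal[OF alg_ring[OF F] h.kernel_is_ideal])
 then have "p \<in> a_kernel FA A h" using assms by (rule subsetD)
 then show ?thesis unfolding a_kernel_def' mem_Collect_eq by (rule conjunct2)
qed

lemma uea_ext_ex1:
 "\<exists>!g. g \<in> complex_alg_hom UL A \<and> g \<in> extensional (carrier UL) \<and> (\<forall>x\<in>carrier L. g (uea_incl L x) = \<phi> x)"
proof (rule ex_ex1I)
 obtain g where g: "lin UL A g" "g \<in> extensional (carrier UL)" "!!p. p <: FA ==> g (uea_proj p) = h p"
  unfolding uea_alg_def
  apply (rule quot_space_lift[OF fa_vs uea_sub alg_vs[OF A] lin_h h_null], assumption)
  subgoal premises prems for g by (rule prems(1)[OF prems(2-4)])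
  done
 note F = complex_algebra_free_alg[of "carrier L"]
 have "g \<in> complex_alg_hom UL A"
 proof (rule alg_homI[OF g(1)])
  show "g 1[UL] = 1[A]" using g(3)[of 1] by (simp add: uea_one h_one)
  fix u v assume u: "u <: UL" and v: "v <: UL"
  obtain p where p: "p <: FA" "u = uea_proj p"
   using u unfolding uea_alg_def by (rule quot_space_cases[OF fa_vs uea_sub])
  obtain q where q: "q <: FA" "v = uea_proj q"
   using v unfolding uea_alg_def by (rule quot_space_cases[OF fa_vs uea_sub])
  have pq: "p * q <: FA" using alg_closed(2)[OF F p(1) q(1)] by simp
  show "g (u *[UL] v) = g u *[A] g v"
   unfolding p(2) q(2) uea_proj_mult[OF p(1) q(1)] g(3)[OF pq] g(3)[OF p(1)] g(3)[OF q(1)] by (rule h_mult[OF p(1) q(1)])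
 qed
 moreover have "g (uea_incl L x) = \<phi> x" if "x <: L" for x
  unfolding uea_incl_def g(3)[OF letter_closed[OF that]] by (rule h_letter[OF that])
 ultimately show "\<exists>g. g \<in> complex_alg_hom UL A \<and> g \<in> extensional (carrier UL) \<and> (\<forall>x\<in>carrier L. g (uea_incl L x) = \<phi> x)"
  using g(2) by (intro exI[of _ g] conjI ballI)
next
 fix g g'
 assume 1: "g \<in> complex_alg_hom UL A \<and> g \<in> extensional (carrier UL) \<and> (\<forall>x\<in>carrier L. g (uea_incl L x) = \<phi> x)"
  and 2: "g' \<in> complex_alg_hom UL A \<and> g' \<in> extensional (carrier UL) \<and> (\<forall>x\<in>carrier L. g' (uea_incl L x) = \<phi> x)"
 note g = conjunct1[OF 1] conjunct1[OF conjunct2[OF 1]] bspec[OF conjunct2[OF conjunct2[OF 1]]]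
  and g' = conjunct1[OF 2] conjunct1[OF conjunct2[OF 2]] bspec[OF conjunct2[OF conjunct2[OF 2]]]
 show "g = g'"
 proof (rule extensionalityI[OF g(2) g'(2)])
  fix u assume "u <: UL"
  then show "g u = g' u"
   by (rule uea_alg_lin_ext[OF alg_vs[OF A] alg_homD(1)[OF g(1)] alg_homD(1)[OF g'(1)], rotated 2])
    (simp_all add: alg_homD(2)[OF g(1)] alg_homD(2)[OF g'(1)] alg_homD(3)[OF g(1)] alg_homD(3)[OF g'(1)]
     uea_incl_closed g(3) g'(3))
 qed
qed

lemma uea_ext_hom: "uea_ext L A \<phi> \<in> complex_alg_hom UL A"
 and uea_ext_extensional: "uea_ext L A \<phi> \<in> extensional (carrier UL)"
 and uea_ext_incl: "x <: L ==> uea_ext L A \<phi> (uea_incl L x) = \<phi> x"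
proof -
 note t = theI'[OF uea_ext_ex1, folded uea_ext_def]
 show "uea_ext L A \<phi> \<in> complex_alg_hom UL A" by (rule conjunct1[OF t])
 show "uea_ext L A \<phi> \<in> extensional (carrier UL)" by (rule conjunct1[OF conjunct2[OF t]])
 show "x <: L ==> uea_ext L A \<phi> (uea_incl L x) = \<phi> x" by (rule bspec[OF conjunct2[OF conjunct2[OF t]]])
qed

end

end

subsection \<open>The Hopf algebra structure\<close>

text \<open>Closure rules, used together with the rules for linearity.\<close>

named_theorems cls

lemmas [cls] = vs_tensor pure_tensor_closed alg_vs alg_closed vs_cpx complex_algebra_cpx

lemma bilin_comp:
 assumes "bilin V W Z b"
 shows "w <: W ==> lin X V f ==> lin X Z (%x. b (f x) w)"
  and "v <: V ==> lin X W g ==> lin X Z (%x. b v (g x))"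
 by (rule lin_comp[OF bilinD(2)[OF assms]]; assumption) (rule lin_comp[OF bilinD(1)[OF assms]]; assumption)

definition trilin ::
 "(complex, 'a, 'm) module_scheme \<Rightarrow> (complex, 'c, 'k) module_scheme \<Rightarrow> ('a \<Rightarrow> 'a \<Rightarrow> 'a \<Rightarrow> 'c) \<Rightarrow> bool" where
 "trilin V Z b \<longleftrightarrow> (\<forall>x\<in>carrier V. bilin V V Z (b x)) \<and> (\<forall>y\<in>carrier V. \<forall>z\<in>carrier V. lin V Z (%x. b x y z))"

lemma trilinI:
 assumes "!!x y. x <: V ==> y <: V ==> lin V Z (%z. b x y z)"
  "!!x z. x <: V ==> z <: V ==> lin V Z (%y. b x y z)"
  "!!y z. y <: V ==> z <: V ==> lin V Z (%x. b x y z)"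
 shows "trilin V Z b"
 using assms by (simp add: trilin_def bilin_def)

lemma trilin_comp:
 assumes "trilin V Z b"
 shows "y <: V ==> z <: V ==> lin X V f ==> lin X Z (%x. b (f x) y z)"
  and "x <: V ==> z <: V ==> lin X V f ==> lin X Z (%y. b x (f y) z)"
  and "x <: V ==> y <: V ==> lin X V f ==> lin X Z (%z. b x y (f z))"
proof -
 have 1: "lin V Z (%x. b x y z)" if "y <: V" "z <: V" for y z using assms that by (simp add: trilin_def)
 have 2: "lin V Z (%y. b x y z)" "lin V Z (%z. b x y z)" if "x <: V" "y <: V" "z <: V" for x y z
  using assms that by (simp_all add: trilin_def bilin_def)
 have 3: "lin V Z (%y. b x y z)" if "x <: V" "z <: V" for x z
  using assms that by (simp add: trilin_def bilin_def)
 have 4: "lin V Z (%z. b x y z)" if "x <: V" "y <: V" for x y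
  using assms that by (simp add: trilin_def bilin_def)
 show "y <: V ==> z <: V ==> lin X V f ==> lin X Z (%x. b (f x) y z)" by (rule lin_comp[OF 1])
 show "x <: V ==> z <: V ==> lin X V f ==> lin X Z (%y. b x (f y) z)" by (rule lin_comp[OF 3])
 show "x <: V ==> y <: V ==> lin X V f ==> lin X Z (%z. b x y (f z))" by (rule lin_comp[OF 4])
qed

lemma tensor_lift_zero:
 assumes "vs V" "vs W" "vs Z" "t <: (tensor V W)"
 shows "tensor_lift V W Z (%v w. 0[Z]) t = 0[Z]"
 using assms by (intro tensor_lift_unique[where h = "%t. 0[Z]"] bilinI lin_zero_map refl)

lemma vs_minus_eqI:
 assumes "vs V" "y <: V" "z <: V" "x = z +[V] y" shows "x -[V] y = z"
 unfolding assms(4) by (rule vs_add_minus_cancel[OF assms(1,3,2)])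

lemma tensor_lift_mult:
 assumes A: "complex_algebra A" and B: "complex_algebra B" and Z: "vs Z" and b: "bilin A B Z b"
  and s: "s <: (tensor A B)" and t: "t <: (tensor A B)"
 shows "tensor_lift A B Z b (s *[tensor_alg A B] t) =
  tensor_lift A B Z (%a a'. tensor_lift A B Z (%c c'. b (a *[A] c) (a' *[B] c')) t) s"
proof -
 let ?T = "tensor A B"
 note vA = alg_vs[OF A] and vB = alg_vs[OF B]
 note L = tensor_lift_lin[OF vA vB Z b]
 have "tensor_lift A B Z b (s *[tensor_alg A B] t) = tensor_lift A B Z (%a a'. tensor_lift A B Z b
   (tensor_lift A B ?T (%c c'. (a *[A] c) \<boxtimes>[A,B] (a' *[B] c')) t)) s"
  unfolding tensor_alg_mult
  by (rule tensor_lift_natural[OF vA vB _ Z L]) ((assumption | rule A B t s lins cls)+)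
 also have "\<dots> = tensor_lift A B Z (%a a'. tensor_lift A B Z (%c c'. b (a *[A] c) (a' *[B] c')) t) s"
 proof (rule lift_cong)
  fix a a' assume a: "a <: A" and a': "a' <: B"
  have "tensor_lift A B Z b (tensor_lift A B ?T (%c c'. (a *[A] c) \<boxtimes>[A,B] (a' *[B] c')) t) =
    tensor_lift A B Z (%c c'. tensor_lift A B Z b ((a *[A] c) \<boxtimes>[A,B] (a' *[B] c'))) t"
   by (rule tensor_lift_natural[OF vA vB _ Z L]) ((assumption | rule A B t s a a' lins cls)+)
  also have "\<dots> = tensor_lift A B Z (%c c'. b (a *[A] c) (a' *[B] c')) t"
   by (rule lift_cong)
    (rule tensor_lift_pure[OF vA vB Z b]; (assumption | rule a a' alg_closed[OF A] alg_closed[OF B])+)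
  finally show "tensor_lift A B Z b (tensor_lift A B ?T (%c c'. (a *[A] c) \<boxtimes>[A,B] (a' *[B] c')) t) =
    tensor_lift A B Z (%c c'. b (a *[A] c) (a' *[B] c')) t" .
 qed
 finally show ?thesis .
qed

context bracket_space
begin

abbreviation "U \<equiv> uea L"

lemma uea_fields:
 "carrier (uea L) = carrier UL" "add (uea L) = add UL" "zero (uea L) = zero UL" "smult (uea L) = smult UL"
 "mult (uea L) = mult UL" "one (uea L) = one UL"
 by (simp_all add: uea_def module.extend_def hopf.fields_def)

lemma comult_def': "comult (uea L) = uea_ext L (tensor_alg UL UL) (%x.
   uea_incl L x \<boxtimes>[UL,UL] 1[UL] +[tensor UL UL] 1[UL] \<boxtimes>[UL,UL] uea_incl L x)"
 and counit_def': "counit (uea L) = uea_ext L cpx (%x. 0)"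
 and antipode_def': "antipode (uea L) = uea_ext L (opposite_alg UL) (%x. -[UL] uea_incl L x)"
 by (simp_all add: uea_def module.extend_def hopf.fields_def)

lemma algU [simp, cls]: "complex_algebra U"
 by (rule complex_algebra_cong[OF complex_algebra_uea_alg]) (simp_all only: uea_fields)

lemma vsU [simp, cls]: "vs U" by (rule alg_vs[OF algU])

lemma module_hom_uea:
 "module_hom cpx UL Z = module_hom cpx U Z" "module_hom cpx Z UL = module_hom cpx Z U"
 unfolding module_hom_def uea_fields by (rule refl)+

lemma tensor_uea: "tensor UL UL = tensor U U" "v \<boxtimes>[UL,UL] w = v \<boxtimes>[U,U] w" "tensor_lift UL UL Z = tensor_lift U U Z"
 by (rule tensor_cong; simp only: uea_fields)+

lemma tensor_alg_uea: "tensor_alg UL UL = tensor_alg U U"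
 unfolding tensor_alg_def tensor_uea uea_fields by (rule refl)

lemma a_inv_uea: "x <: U ==> -[UL] x = -[U] x"
 by (simp add: vs_neg_eq[OF alg_vs[OF complex_algebra_uea_alg]] vs_neg_eq[OF vsU] uea_fields)

lemma a_minus_uea: "y <: U ==> x -[UL] y = x -[U] y"
 by (simp add: vs_minus_eq[OF alg_vs[OF complex_algebra_uea_alg]] vs_minus_eq[OF vsU] uea_fields)

lemma alg_hom_uea: "complex_alg_hom UL A = complex_alg_hom U A"
 unfolding complex_alg_hom_def uea_fields module_hom_uea by (rule refl)

lemmas uea_induct = uea_alg_induct[folded uea_fields]
lemmas uea_lin_ext = uea_alg_lin_ext[folded uea_fields, unfolded module_hom_uea]
lemmas uea_ext_U = uea_ext_hom[unfolded alg_hom_uea]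
lemmas incl_closed [cls] = uea_incl_closed[folded uea_fields]

lemma lin_incl [lins]: "lin X L f ==> lin X U (%x. uea_incl L (f x))"
 by (rule lin_comp[OF lin_uea_incl[unfolded module_hom_uea]])

lemma incl_bracket:
 assumes x: "x <: L" and y: "y <: L"
 shows "uea_incl L (bracket L x y) = uea_incl L x *[U] uea_incl L y -[U] uea_incl L y *[U] uea_incl L x"
 using bracket_homD(2)[OF bracket_hom_uea_incl x y] a_minus_uea[OF alg_closed(2)[OF algU incl_closed[OF y] incl_closed[OF x]]]
 by (simp add: uea_fields)

lemma bracket_hom_U: "bracket_hom L U (uea_incl L)"
 using incl_bracket lin_uea_incl[unfolded module_hom_uea] by (intro bracket_homI) simp_all

definition "\<Delta>L x = uea_incl L x \<boxtimes>[U,U] 1[U] +[tensor U U] 1[U] \<boxtimes>[U,U] uea_incl L x"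

lemma algUU [simp, cls]: "complex_algebra (tensor_alg U U)" by (rule complex_algebra_tensor(1)[OF algU algU])
lemma vsUU [simp, cls]: "vs (tensor U U)" by (rule vs_tensor[OF vsU vsU])

lemma lin_\<Delta>L: "lin L (tensor U U) \<Delta>L"
 unfolding \<Delta>L_def by ((assumption | rule vsUU lins cls)+)

lemma bracket_hom_\<Delta>L: "bracket_hom L (tensor_alg U U) \<Delta>L"
proof (rule bracket_homI)
 show "lin L (tensor_alg U U) \<Delta>L" using lin_\<Delta>L by (simp add: lin_tensor_alg_iff)
 fix x y assume x: "x <: L" and y: "y <: L"
 define X Y where "X = uea_incl L x" and "Y = uea_incl L y"
 have X: "X <: U" and Y: "Y <: U" using x y by (simp_all add: X_def Y_def incl_closed)
 let ?T = "tensor U U"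
 note c = pure_tensor_closed[OF vsU vsU] alg_closed[OF algU] X Y
 have m: "\<Delta>L x *[tensor_alg U U] \<Delta>L y = ((X *[U] Y) \<boxtimes>[U,U] 1[U] +[?T] Y \<boxtimes>[U,U] X) +[?T]
   (X \<boxtimes>[U,U] Y +[?T] 1[U] \<boxtimes>[U,U] (X *[U] Y))"
  if x: "x <: L" and y: "y <: L" and X: "X = uea_incl L x" and Y: "Y = uea_incl L y" for x y X Y
 proof -
  have c: "X <: U" "Y <: U" using x y by (simp_all add: X Y incl_closed)
  note c = c alg_closed[OF algU]
  have e: "\<Delta>L x = X \<boxtimes>[U,U] 1[U] +[?T] 1[U] \<boxtimes>[U,U] X" "\<Delta>L y = Y \<boxtimes>[U,U] 1[U] +[?T] 1[U] \<boxtimes>[U,U] Y"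
   by (simp_all add: \<Delta>L_def X Y)
  have cl: "p \<boxtimes>[U,U] q <: (tensor_alg U U)" if "p <: U" "q <: U" for p q
   using that pure_tensor_closed[OF vsU vsU] by simp
  have add: "add ?T = add (tensor_alg U U)" by simp
  show ?thesis unfolding e add
   using c by (simp add: alg_distrib[OF algUU] cl vs_closed[OF alg_vs[OF algUU]] complex_algebra_tensor(2)[OF algU algU] alg_unit[OF algU] del: tensor_alg_simps)
 qed
 have mn: "a -[tensor_alg U U] b = a -[?T] b" if "b <: ?T" for a b
  using that by (simp add: vs_minus_eq[OF alg_vs[OF algUU]] vs_minus_eq[OF vsUU])
 let ?P = "X *[U] Y" and ?Q = "Y *[U] X"
 let ?p = "?P -[U] ?Q"
 have PQ: "?P <: U" "?Q <: U" "?p <: U" using X Y by (simp_all add: vs_closed[OF vsU])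
 have P: "?P = ?p +[U] ?Q" using PQ by (simp add: vs_minus_add_cancel[OF vsU])
 have "\<Delta>L x *[tensor_alg U U] \<Delta>L y -[tensor_alg U U] \<Delta>L y *[tensor_alg U U] \<Delta>L x = \<Delta>L (bracket L x y)"
  unfolding m[OF x y X_def Y_def] m[OF y x Y_def X_def]
 proof (subst mn)
  let ?b = "((Y *[U] X) \<boxtimes>[U,U] 1[U] +[?T] X \<boxtimes>[U,U] Y) +[?T] (Y \<boxtimes>[U,U] X +[?T] 1[U] \<boxtimes>[U,U] (Y *[U] X))"
  show b: "?b <: ?T" by (intro vs_closed[OF vsUU] c)
  have B: "\<Delta>L (bracket L x y) = ?p \<boxtimes>[U,U] 1[U] +[?T] 1[U] \<boxtimes>[U,U] ?p"
   unfolding \<Delta>L_def incl_bracket[OF x y] X_def Y_def by (rule refl)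
  show "((?P \<boxtimes>[U,U] 1[U] +[?T] Y \<boxtimes>[U,U] X) +[?T] (X \<boxtimes>[U,U] Y +[?T] 1[U] \<boxtimes>[U,U] ?P)) -[?T] ?b = \<Delta>L (bracket L x y)"
  proof (rule vs_minus_eqI[OF vsUU b])
   show "\<Delta>L (bracket L x y) <: ?T" unfolding B by (intro vs_closed[OF vsUU] c PQ)
   have "?P \<boxtimes>[U,U] 1[U] = ?p \<boxtimes>[U,U] 1[U] +[?T] ?Q \<boxtimes>[U,U] 1[U]"
    by (subst P, rule pure_tensor_add(1)[OF vsU vsU PQ(3) _ PQ(2)]) (rule c)+
   moreover have "1[U] \<boxtimes>[U,U] ?P = 1[U] \<boxtimes>[U,U] ?p +[?T] 1[U] \<boxtimes>[U,U] ?Q"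
    by (subst P, rule pure_tensor_add(2)[OF vsU vsU _ PQ(3) _ PQ(2)]) (rule c)+
   ultimately show "((?P \<boxtimes>[U,U] 1[U] +[?T] Y \<boxtimes>[U,U] X) +[?T] (X \<boxtimes>[U,U] Y +[?T] 1[U] \<boxtimes>[U,U] ?P)) = \<Delta>L (bracket L x y) +[?T] ?b"
    unfolding B using PQ X Y by (simp add: vs_add_ac[OF vsUU] vs_closed[OF vsUU] pure_tensor_closed[OF vsU vsU] algU)
  qed
 qed
 then show "\<Delta>L (bracket L x y) = \<Delta>L x *[tensor_alg U U] \<Delta>L y -[tensor_alg U U] \<Delta>L y *[tensor_alg U U] \<Delta>L x" ..
qed

lemma comult_eq: "comult U = uea_ext L (tensor_alg U U) \<Delta>L"
 unfolding comult_def' tensor_alg_uea tensor_uea \<Delta>L_def[abs_def] uea_fields by (rule refl)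

lemma comult_hom: "comult U \<in> complex_alg_hom U (tensor_alg U U)"
 unfolding comult_eq by (rule uea_ext_U[OF algUU bracket_hom_\<Delta>L])

lemma comult_incl: "x <: L ==> comult U (uea_incl L x) = \<Delta>L x"
 unfolding comult_eq by (rule uea_ext_incl[OF algUU bracket_hom_\<Delta>L])

lemma comult_one: "comult U 1[U] = 1[U] \<boxtimes>[U,U] 1[U]"
 using alg_homD(2)[OF comult_hom] by simp

lemma lin_comult [lins]: "lin X U f ==> lin X (tensor U U) (%x. comult U (f x))"
 by (rule lin_comp[OF alg_homD(1)[OF comult_hom, unfolded lin_tensor_alg_iff]])

lemma comult_closed [cls]: "u <: U ==> comult U u <: (tensor U U)"
 by (rule lin_closed[OF lin_comult[OF lin_id]])

lemma bracket_hom_zero: "bracket_hom L cpx (%x. 0)"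
 by (rule bracket_homI) (use lin_zero_map[OF vs_cpx] in simp_all)

lemma counit_hom: "counit U \<in> complex_alg_hom U cpx"
 unfolding counit_def' by (rule uea_ext_U[OF complex_algebra_cpx bracket_hom_zero])

lemma counit_simps:
 "counit U 1[U] = 1"
 "u <: U ==> v <: U ==> counit U (u *[U] v) = counit U u * counit U v"
 "x <: L ==> counit U (uea_incl L x) = 0"
 using alg_homD(2,3)[OF counit_hom] uea_ext_incl[OF complex_algebra_cpx bracket_hom_zero]
 by (simp_all add: counit_def')

lemma lin_counit [lins]: "lin X U f ==> lin X cpx (%x. counit U (f x))"
 by (rule lin_comp[OF alg_homD(1)[OF counit_hom]])

lemma bracket_hom_neg: "bracket_hom L (opposite_alg UL) (%x. -[UL] uea_incl L x)"
proof (rule bracket_homI)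
 let ?O = "opposite_alg UL"
 note AL = complex_algebra_uea_alg
 note V = alg_vs[OF AL] and VO = alg_vs[OF complex_algebra_opposite[OF AL]]
 have O: "carrier ?O = carrier UL" "add ?O = add UL" "smult ?O = smult UL" "mult ?O = (%x y. y *[UL] x)"
  by (simp_all add: opposite_alg_def)
 have "lin L UL (%x. -[UL] uea_incl L x)" by (rule lin_pointwise_neg[OF V lin_uea_incl])
 then show "lin L ?O (%x. -[UL] uea_incl L x)" by (simp add: module_hom_def O)
 fix x y assume x: "x <: L" and y: "y <: L"
 note X = uea_incl_closed[OF x] and Y = uea_incl_closed[OF y]
 have mn: "a -[?O] b = a -[UL] b" if "b <: UL" for a b
  using that vs_minus_eq[OF VO, of b a] vs_minus_eq[OF V, of b a] by (simp add: O)
 have nn: "(-[UL] a) *[UL] (-[UL] b) = a *[UL] b" if "a <: UL" "b <: UL" for a b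
  using that by (simp add: vs_neg_eq[OF V] alg_smult_mult[OF AL] vs_simps[OF V] AL)
 have nm: "-[UL] (a -[UL] b) = b -[UL] a" if "a <: UL" "b <: UL" for a b
  using that by (simp add: vs_neg_eq[OF V] vs_minus_eq[OF V] vs_simps[OF V] vs_add_ac(2)[OF V])
 show "-[UL] uea_incl L (bracket L x y) = (-[UL] uea_incl L x) *[?O] (-[UL] uea_incl L y) -[?O] (-[UL] uea_incl L y) *[?O] (-[UL] uea_incl L x)"
  unfolding bracket_homD(2)[OF bracket_hom_uea_incl x y] O(4) nn[OF X Y] nn[OF Y X] mn[OF alg_closed(2)[OF AL X Y]]
  by (rule nm[OF alg_closed(2)[OF AL X Y] alg_closed(2)[OF AL Y X]])
qed

lemma antipode_hom: "antipode U \<in> complex_alg_hom U (opposite_alg UL)"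
 unfolding antipode_def' by (rule uea_ext_U[OF complex_algebra_opposite[OF complex_algebra_uea_alg] bracket_hom_neg])

lemma lin_antipode [lins]: "lin X U f ==> lin X U (%x. antipode U (f x))"
proof -
 have "lin U U (antipode U)" using alg_homD(1)[OF antipode_hom] by (simp add: module_hom_def opposite_alg_def uea_fields)
 then show "lin X U f ==> lin X U (%x. antipode U (f x))" by (rule lin_comp)
qed

lemma antipode_closed [cls]: "u <: U ==> antipode U u <: U"
 by (rule lin_closed[OF lin_antipode[OF lin_id]])

lemma antipode_simps:
 "antipode U 1[U] = 1[U]"
 "u <: U ==> v <: U ==> antipode U (u *[U] v) = antipode U v *[U] antipode U u"
 "x <: L ==> antipode U (uea_incl L x) = -[U] uea_incl L x"
proof -
 show "antipode U 1[U] = 1[U]" using alg_homD(2)[OF antipode_hom] by (simp add: opposite_alg_def uea_fields)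
 show "antipode U (u *[U] v) = antipode U v *[U] antipode U u" if "u <: U" "v <: U"
  using alg_homD(3)[OF antipode_hom that] by (simp add: opposite_alg_def uea_fields)
 show "antipode U (uea_incl L x) = -[U] uea_incl L x" if "x <: L"
  using uea_ext_incl[OF complex_algebra_opposite[OF complex_algebra_uea_alg] bracket_hom_neg that] a_inv_uea[OF incl_closed[OF that]]
  by (simp add: antipode_def')
qed

abbreviation "Sw \<equiv> tensor_lift U U"

lemma Sw_lin [lins]:
 "vs Z ==> bilin U U Z b ==> lin X U f ==> lin X Z (%x. Sw Z b (comult U (f x)))"
 by (rule lin_tensor_lift_arg[OF vsU vsU _ _ lin_comult])

lemma Sw_one: "vs Z ==> bilin U U Z b ==> Sw Z b (comult U 1[U]) = b 1[U] 1[U]"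
 unfolding comult_one by (rule tensor_lift_pure[OF vsU vsU]) (simp_all)

lemma Sw_mult:
 assumes "vs Z" "bilin U U Z b" "u <: U" "v <: U"
 shows "Sw Z b (comult U (u *[U] v)) =
  Sw Z (%u1 u2. Sw Z (%v1 v2. b (u1 *[U] v1) (u2 *[U] v2)) (comult U v)) (comult U u)"
 unfolding alg_homD(3)[OF comult_hom assms(3,4)]
 by (rule tensor_lift_mult[OF algU algU assms(1,2)]) (rule comult_closed assms)+

lemma Sw_incl:
 assumes Z: "vs Z" and b: "bilin U U Z b" and x: "x <: L"
 shows "Sw Z b (comult U (uea_incl L x)) = b (uea_incl L x) 1[U] +[Z] b 1[U] (uea_incl L x)"
proof -
 note X = incl_closed[OF x] and one = alg_closed(1)[OF algU]
 note c = pure_tensor_closed[OF vsU vsU]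
 show ?thesis unfolding comult_incl[OF x] \<Delta>L_def
  unfolding lin_add[OF tensor_lift_lin[OF vsU vsU Z b] c[OF X one] c[OF one X]]
  unfolding tensor_lift_pure[OF vsU vsU Z b X one] tensor_lift_pure[OF vsU vsU Z b one X] by (rule refl)
qed

text \<open>The coproduct is compatible with left multiplication by primitive elements as a derivation.
 Identities in Sweedler notation are proved by induction over the algebra with this rule,
 quantified over all multilinear maps into which the Sweedler components are inserted.\<close>

lemma Sw_step:
 assumes Z: "vs Z" and b: "bilin U U Z b" and x: "x <: L" and u: "u <: U"
 shows "Sw Z b (comult U (uea_incl L x *[U] u)) =
  Sw Z (%u1 u2. b (uea_incl L x *[U] u1) u2) (comult U u) +[Z]
  Sw Z (%u1 u2. b u1 (uea_incl L x *[U] u2)) (comult U u)"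
proof -
 note X = incl_closed[OF x] and one = alg_closed(1)[OF algU]
 have "Sw Z b (comult U (uea_incl L x *[U] u)) =
   Sw Z (%v1 v2. b (uea_incl L x *[U] v1) (1[U] *[U] v2)) (comult U u) +[Z]
   Sw Z (%v1 v2. b (1[U] *[U] v1) (uea_incl L x *[U] v2)) (comult U u)"
  unfolding Sw_mult[OF Z b X u]
  by (rule Sw_incl[OF Z _ x]) ((assumption | rule Z u lins cls bilin_comp[OF b])+)
 also have "Sw Z (%v1 v2. b (uea_incl L x *[U] v1) (1[U] *[U] v2)) (comult U u) = Sw Z (%v1 v2. b (uea_incl L x *[U] v1) v2) (comult U u)"
  by (rule lift_cong) (simp only: alg_unit[OF algU])
 also have "Sw Z (%v1 v2. b (1[U] *[U] v1) (uea_incl L x *[U] v2)) (comult U u) = Sw Z (%v1 v2. b v1 (uea_incl L x *[U] v2)) (comult U u)"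
  by (rule lift_cong) (simp only: alg_unit[OF algU])
 finally show ?thesis .
qed

lemma cocommutative:
 assumes Z: "vs Z" and b: "bilin U U Z b" and u: "u <: U"
 shows "Sw Z b (comult U u) = Sw Z (%x y. b y x) (comult U u)"
proof -
 have flip: "bilin U U Z (%x y. b y x)" if "bilin U U Z b" for b
  using that by (simp add: bilin_def)
 have lin: "lin U Z (%u. Sw Z b (comult U u))" if "bilin U U Z b" for b
  using that by (intro Sw_lin Z lin_id)
 have "\<forall>b. bilin U U Z b \<longrightarrow> Sw Z b (comult U u) = Sw Z (%x y. b y x) (comult U u)"
 proof (rule uea_induct[OF u]; intro allI impI)
  fix b assume b: "bilin U U Z b"
  show "Sw Z b (comult U 1[U]) = Sw Z (%x y. b y x) (comult U 1[U])"
   by (simp only: Sw_one[OF Z b] Sw_one[OF Z flip[OF b]])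
 next
  fix u v b assume b: "bilin U U Z b" and u: "u <: U" and v: "v <: U"
   and "\<forall>b. bilin U U Z b \<longrightarrow> Sw Z b (comult U u) = Sw Z (%x y. b y x) (comult U u)"
    "\<forall>b. bilin U U Z b \<longrightarrow> Sw Z b (comult U v) = Sw Z (%x y. b y x) (comult U v)"
  then show "Sw Z b (comult U (u +[U] v)) = Sw Z (%x y. b y x) (comult U (u +[U] v))"
   unfolding lin_add[OF lin[OF b] u v] lin_add[OF lin[OF flip[OF b]] u v] by metis
 next
  fix c u b assume b: "bilin U U Z b" and u: "u <: U"
   and "\<forall>b. bilin U U Z b \<longrightarrow> Sw Z b (comult U u) = Sw Z (%x y. b y x) (comult U u)"
  then show "Sw Z b (comult U (c .[U] u)) = Sw Z (%x y. b y x) (comult U (c .[U] u))"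
   unfolding lin_smult[OF lin[OF b] u] lin_smult[OF lin[OF flip[OF b]] u] by metis
 next
  fix x u b assume x: "x <: L" and u: "u <: U" and b: "bilin U U Z b"
   and IH: "\<forall>b. bilin U U Z b \<longrightarrow> Sw Z b (comult U u) = Sw Z (%x y. b y x) (comult U u)"
  have 1: "bilin U U Z (%u1 u2. b (uea_incl L x *[U] u1) u2)" "bilin U U Z (%u1 u2. b u1 (uea_incl L x *[U] u2))"
   by (assumption | rule x lins cls bilin_comp[OF b])+
  show "Sw Z b (comult U (uea_incl L x *[U] u)) = Sw Z (%x y. b y x) (comult U (uea_incl L x *[U] u))"
   unfolding Sw_step[OF Z b x u] Sw_step[OF Z flip[OF b] x u]
    IH[rule_format, OF 1(1)] IH[rule_format, OF 1(2)]
   by (rule vs_add_ac(2)[OF Z]) (rule tensor_lift_closed[OF vsU vsU Z flip] 1 comult_closed u)+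
 qed
 then show ?thesis using b by blast
qed

lemma coassociative_general:
 assumes Z: "vs Z" and b: "trilin U Z b" and u: "u <: U"
 shows "Sw Z (%x z. Sw Z (%x' y. b x' y z) (comult U x)) (comult U u) =
  Sw Z (%x y. Sw Z (%y' z. b x y' z) (comult U y)) (comult U u)"
proof -
 let ?l = "%b u. Sw Z (%x z. Sw Z (%x' y. b x' y z) (comult U x)) (comult U u)"
 let ?r = "%b u. Sw Z (%x y. Sw Z (%y' z. b x y' z) (comult U y)) (comult U u)"
 have bl: "bilin U U Z (%x z. Sw Z (%x' y. b x' y z) (comult U x))" if "trilin U Z b" for b
  by (assumption | rule Z lins cls trilin_comp[OF that])+
 have br: "bilin U U Z (%x y. Sw Z (%y' z. b x y' z) (comult U y))" if "trilin U Z b" for b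
  by (assumption | rule Z lins cls trilin_comp[OF that])+
 have il: "bilin U U Z (%x' y. b x' y z)" if "trilin U Z b" "z <: U" for b z
  by (assumption | rule Z lins cls trilin_comp[OF that(1)] that(2))+
 have ir: "bilin U U Z (%y' z. b x y' z)" if "trilin U Z b" "x <: U" for b x
  by (assumption | rule Z lins cls trilin_comp[OF that(1)] that(2))+
 have linl: "lin U Z (?l b)" if "trilin U Z b" for b by (intro Sw_lin Z lin_id bl that)
 have linr: "lin U Z (?r b)" if "trilin U Z b" for b by (intro Sw_lin Z lin_id br that)
 have "\<forall>b. trilin U Z b \<longrightarrow> ?l b u = ?r b u"
 proof (rule uea_induct[OF u]; intro allI impI)
  fix b assume b: "trilin U Z b"
  note one = alg_closed(1)[OF algU]
  show "?l b 1[U] = ?r b 1[U]"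
   by (simp only: Sw_one[OF Z bl[OF b]] Sw_one[OF Z br[OF b]] Sw_one[OF Z il[OF b one]] Sw_one[OF Z ir[OF b one]])
 next
  fix u v b assume b: "trilin U Z b" and u: "u <: U" and v: "v <: U"
   and IH: "\<forall>b. trilin U Z b \<longrightarrow> ?l b u = ?r b u" "\<forall>b. trilin U Z b \<longrightarrow> ?l b v = ?r b v"
  show "?l b (u +[U] v) = ?r b (u +[U] v)"
   unfolding lin_add[OF linl[OF b] u v] lin_add[OF linr[OF b] u v]
   by (simp only: IH(1)[rule_format, OF b] IH(2)[rule_format, OF b])
 next
  fix c u b assume b: "trilin U Z b" and u: "u <: U" and IH: "\<forall>b. trilin U Z b \<longrightarrow> ?l b u = ?r b u"
  show "?l b (c .[U] u) = ?r b (c .[U] u)"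
   unfolding lin_smult[OF linl[OF b] u] lin_smult[OF linr[OF b] u] by (simp only: IH[rule_format, OF b])
 next
  fix x u b assume x: "x <: L" and u: "u <: U" and b: "trilin U Z b"
   and IH: "\<forall>b. trilin U Z b \<longrightarrow> ?l b u = ?r b u"
  define X where "X = uea_incl L x"
  have X: "X <: U" using x by (simp add: X_def incl_closed)
  let ?b1 = "%p q r. b (X *[U] p) q r" and ?b2 = "%p q r. b p (X *[U] q) r" and ?b3 = "%p q r. b p q (X *[U] r)"
  have t: "trilin U Z ?b1" "trilin U Z ?b2" "trilin U Z ?b3"
   by (assumption | rule X trilinI lins cls trilin_comp[OF b])+
  have dist: "Sw Z (%x z. f x z +[Z] g x z) (comult U u) = Sw Z f (comult U u) +[Z] Sw Z g (comult U u)"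
   if "bilin U U Z f" "bilin U U Z g" for f g
   by (rule tensor_lift_add[OF vsU vsU Z that comult_closed[OF u]])
  have "?l b (X *[U] u) = Sw Z (%p r. Sw Z (%x' y. b x' y r) (comult U (X *[U] p))) (comult U u) +[Z] ?l ?b3 u"
   unfolding X_def by (rule Sw_step[OF Z bl[OF b] x u])
  also have "Sw Z (%p r. Sw Z (%x' y. b x' y r) (comult U (X *[U] p))) (comult U u) =
    Sw Z (%p r. Sw Z (%x' y. ?b1 x' y r) (comult U p) +[Z] Sw Z (%x' y. ?b2 x' y r) (comult U p)) (comult U u)"
   unfolding X_def by (rule lift_cong) (rule Sw_step[OF Z il[OF b] x])
  also have "\<dots> = ?l ?b1 u +[Z] ?l ?b2 u" by (rule dist[OF bl[OF t(1)] bl[OF t(2)]])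
  finally have l: "?l b (X *[U] u) = (?r ?b1 u +[Z] ?r ?b2 u) +[Z] ?r ?b3 u"
   unfolding IH[rule_format, OF t(1)] IH[rule_format, OF t(2)] IH[rule_format, OF t(3)] .
  have "?r b (X *[U] u) = ?r ?b1 u +[Z] Sw Z (%p r. Sw Z (%x' y. b p x' y) (comult U (X *[U] r))) (comult U u)"
   unfolding X_def by (rule Sw_step[OF Z br[OF b] x u])
  also have "Sw Z (%p r. Sw Z (%x' y. b p x' y) (comult U (X *[U] r))) (comult U u) =
    Sw Z (%p r. Sw Z (%x' y. ?b2 p x' y) (comult U r) +[Z] Sw Z (%x' y. ?b3 p x' y) (comult U r)) (comult U u)"
   unfolding X_def by (rule lift_cong) (rule Sw_step[OF Z ir[OF b] x])
  also have "\<dots> = ?r ?b2 u +[Z] ?r ?b3 u" by (rule dist[OF br[OF t(2)] br[OF t(3)]])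
  finally have r: "?r b (X *[U] u) = ?r ?b1 u +[Z] (?r ?b2 u +[Z] ?r ?b3 u)" .
  note rc = lin_closed[OF linr u]
  show "?l b (uea_incl L x *[U] u) = ?r b (uea_incl L x *[U] u)"
   unfolding X_def[symmetric] l r by (rule vs_add_ac(1)[OF Z rc[OF t(1)] rc[OF t(2)] rc[OF t(3)]])
 qed
 then show ?thesis using b by blast
qed

lemma counit_left_U: assumes u: "u <: U" shows "Sw U (%x y. counit U x .[U] y) (comult U u) = u"
proof -
 have b: "bilin U U U (%x y. counit U x .[U] y)" by (assumption | rule lins cls)+
 show ?thesis
 proof (rule uea_lin_ext[OF vsU _ lin_id _ _ u])
  show "lin U U (%u. Sw U (%x y. counit U x .[U] y) (comult U u))" by (intro Sw_lin vsU b lin_id)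
  show "Sw U (%x y. counit U x .[U] y) (comult U 1[U]) = 1[U]"
   by (simp add: Sw_one[OF vsU b] counit_simps vs_simps[OF vsU])
  fix x u assume x: "x <: L" and u: "u <: U" and IH: "Sw U (%x y. counit U x .[U] y) (comult U u) = u"
  note X = incl_closed[OF x]
  have "Sw U (%u1 u2. counit U (uea_incl L x *[U] u1) .[U] u2) (comult U u) = Sw U (%u1 u2. 0[U]) (comult U u)"
   by (rule lift_cong) (simp add: counit_simps X x vs_simps[OF vsU])
  also have "\<dots> = 0[U]" by (rule tensor_lift_zero[OF vsU vsU vsU comult_closed[OF u]])
  finally have 1: "Sw U (%u1 u2. counit U (uea_incl L x *[U] u1) .[U] u2) (comult U u) = 0[U]" .
  have "Sw U (%u1 u2. counit U u1 .[U] (uea_incl L x *[U] u2)) (comult U u) =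
    Sw U (%u1 u2. uea_incl L x *[U] (counit U u1 .[U] u2)) (comult U u)"
   by (rule lift_cong) (simp only: alg_smult_mult[OF algU] X)
  also have "\<dots> = uea_incl L x *[U] Sw U (%x y. counit U x .[U] y) (comult U u)"
   by (rule tensor_lift_natural[OF vsU vsU vsU vsU _ b comult_closed[OF u], symmetric]) (intro lin_alg_mult algU X lin_id)
  finally have 2: "Sw U (%u1 u2. counit U u1 .[U] (uea_incl L x *[U] u2)) (comult U u) = uea_incl L x *[U] u"
   unfolding IH .
  show "Sw U (%x y. counit U x .[U] y) (comult U (uea_incl L x *[U] u)) = uea_incl L x *[U] u"
   unfolding Sw_step[OF vsU b x u] 1 2 by (intro vs_add_zero[OF vsU] alg_closed[OF algU] X u)
 qed
qed

lemma counit_right_U: assumes u: "u <: U" shows "Sw U (%x y. counit U y .[U] x) (comult U u) = u"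
proof -
 have b: "bilin U U U (%x y. counit U x .[U] y)" by (assumption | rule lins cls)+
 show ?thesis using cocommutative[OF vsU b u] counit_left_U[OF u] by simp
qed

lemma antipode_left_U:
 assumes u: "u <: U" shows "Sw U (%x y. antipode U x *[U] y) (comult U u) = counit U u .[U] 1[U]"
proof -
 have b: "bilin U U U (%x y. antipode U x *[U] y)" by (assumption | rule lins cls)+
 show ?thesis
 proof (rule uea_lin_ext[OF vsU _ _ _ _ u])
  show "lin U U (%u. Sw U (%x y. antipode U x *[U] y) (comult U u))" by (intro Sw_lin vsU b lin_id)
  show "lin U U (%u. counit U u .[U] 1[U])" by (assumption | rule lins cls)+
  show "Sw U (%x y. antipode U x *[U] y) (comult U 1[U]) = counit U 1[U] .[U] 1[U]"
   by (simp add: Sw_one[OF vsU b] counit_simps antipode_simps vs_simps[OF vsU])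
  fix x u assume x: "x <: L" and u: "u <: U"
  note X = incl_closed[OF x]
  have b1: "bilin U U U (%u1 u2. antipode U (uea_incl L x *[U] u1) *[U] u2)"
   and b2: "bilin U U U (%u1 u2. antipode U u1 *[U] (uea_incl L x *[U] u2))"
   by (assumption | rule X lins cls)+
  have "Sw U (%x y. antipode U x *[U] y) (comult U (uea_incl L x *[U] u)) =
    Sw U (%u1 u2. antipode U (uea_incl L x *[U] u1) *[U] u2 +[U] antipode U u1 *[U] (uea_incl L x *[U] u2)) (comult U u)"
   unfolding Sw_step[OF vsU b x u] tensor_lift_add[OF vsU vsU vsU b1 b2 comult_closed[OF u]] by (rule refl)
  also have "\<dots> = Sw U (%u1 u2. 0[U]) (comult U u)"
  proof (rule lift_cong)
   fix p q assume p: "p <: U" and q: "q <: U"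
   have s: "antipode U p <: U" by (rule antipode_closed[OF p])
   have "antipode U (uea_incl L x *[U] p) *[U] q = (-1) .[U] (antipode U p *[U] (uea_incl L x *[U] q))"
    using X p q s by (simp add: antipode_simps x vs_neg_eq[OF vsU] alg_smult_mult[OF algU] alg_assoc[OF algU] algU)
   then show "antipode U (uea_incl L x *[U] p) *[U] q +[U] antipode U p *[U] (uea_incl L x *[U] q) = 0[U]"
    using X q s vs_smult_distrib(1)[OF vsU, of "antipode U p *[U] (uea_incl L x *[U] q)" "-1" 1]
    by (simp add: vs_simps(6,8)[OF vsU] algU)
  qed
  also have "\<dots> = 0[U]" by (rule tensor_lift_zero[OF vsU vsU vsU comult_closed[OF u]])
  finally show "Sw U (%x y. antipode U x *[U] y) (comult U (uea_incl L x *[U] u)) = counit U (uea_incl L x *[U] u) .[U] 1[U]"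
   by (simp add: counit_simps x X u vs_simps[OF vsU])
 qed
qed

lemma antipode_right_U:
 assumes u: "u <: U" shows "Sw U (%x y. x *[U] antipode U y) (comult U u) = counit U u .[U] 1[U]"
proof -
 have b: "bilin U U U (%x y. x *[U] antipode U y)" by (assumption | rule lins cls)+
 show ?thesis
 proof (rule uea_lin_ext[OF vsU _ _ _ _ u])
  show "lin U U (%u. Sw U (%x y. x *[U] antipode U y) (comult U u))" by (intro Sw_lin vsU b lin_id)
  show "lin U U (%u. counit U u .[U] 1[U])" by (assumption | rule lins cls)+
  show "Sw U (%x y. x *[U] antipode U y) (comult U 1[U]) = counit U 1[U] .[U] 1[U]"
   by (simp add: Sw_one[OF vsU b] counit_simps antipode_simps vs_simps[OF vsU])
  fix x u assume x: "x <: L" and u: "u <: U"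
   and IH: "Sw U (%x y. x *[U] antipode U y) (comult U u) = counit U u .[U] 1[U]"
  define X where "X = uea_incl L x"
  have X: "X <: U" using x by (simp add: X_def incl_closed)
  note N = vs_closed(4)[OF vsU X]
  have "Sw U (%u1 u2. (X *[U] u1) *[U] antipode U u2) (comult U u) = Sw U (%u1 u2. X *[U] (u1 *[U] antipode U u2)) (comult U u)"
   by (rule lift_cong) (rule alg_assoc[OF algU X], assumption, rule antipode_closed)
  also have "\<dots> = X *[U] Sw U (%u1 u2. u1 *[U] antipode U u2) (comult U u)"
   by (rule tensor_lift_natural[OF vsU vsU vsU vsU _ b comult_closed[OF u], symmetric]) (intro lin_alg_mult algU X lin_id)
  also have "\<dots> = counit U u .[U] X" unfolding IH using X by (simp add: alg_smult_mult[OF algU] algU)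
  finally have 1: "Sw U (%u1 u2. (X *[U] u1) *[U] antipode U u2) (comult U u) = counit U u .[U] X" .
  have "Sw U (%u1 u2. u1 *[U] antipode U (X *[U] u2)) (comult U u) = Sw U (%u1 u2. (u1 *[U] antipode U u2) *[U] (-[U] X)) (comult U u)"
  proof (rule lift_cong)
   fix p q assume p: "p <: U" and q: "q <: U"
   have "antipode U (X *[U] q) = antipode U q *[U] (-[U] X)"
    using antipode_simps(2)[OF X q] antipode_simps(3)[OF x] by (simp add: X_def)
   then show "p *[U] antipode U (X *[U] q) = (p *[U] antipode U q) *[U] (-[U] X)"
    using alg_assoc[OF algU p antipode_closed[OF q] N] by simp
  qed
  also have "\<dots> = Sw U (%u1 u2. u1 *[U] antipode U u2) (comult U u) *[U] (-[U] X)"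
   by (rule tensor_lift_natural[OF vsU vsU vsU vsU _ b comult_closed[OF u], symmetric]) (intro lin_alg_mult algU N lin_id)
  also have "\<dots> = counit U u .[U] (-[U] X)" unfolding IH using N by (simp add: alg_smult_mult[OF algU] algU)
  finally have 2: "Sw U (%u1 u2. u1 *[U] antipode U (X *[U] u2)) (comult U u) = counit U u .[U] (-[U] X)" .
  have "Sw U (%x y. x *[U] antipode U y) (comult U (uea_incl L x *[U] u)) = counit U u .[U] X +[U] counit U u .[U] (-[U] X)"
   unfolding Sw_step[OF vsU b x u] unfolding X_def[symmetric] 1 2 by (rule refl)
  also have "\<dots> = 0[U]"
   using X vs_smult_distrib(1)[OF vsU X, of "counit U u" "- counit U u"] by (simp add: vs_neg_eq[OF vsU] vs_smult_smult[OF vsU] vs_smult_zero[OF vsU])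
  finally show "Sw U (%x y. x *[U] antipode U y) (comult U (uea_incl L x *[U] u)) = counit U (uea_incl L x *[U] u) .[U] 1[U]"
   using X by (simp add: X_def counit_simps x u vs_simps[OF vsU])
 qed
qed

lemma hopf_algebra_uea: "hopf_algebra U"
proof (intro hopf_algebra.intro hopf_algebra_axioms.intro)
 show "complex_algebra U" by (rule algU)
 show "comult U \<in> complex_alg_hom U (tensor_alg U U)" by (rule comult_hom)
 show "counit U \<in> complex_alg_hom U cpx" by (rule counit_hom)
 show "lin U U (antipode U)" by (rule lin_antipode[OF lin_id])
 let ?Z = "tensor U (tensor U U)"
 fix h assume h: "h <: U"
 have Z: "vs ?Z" by (rule vs_tensor[OF vsU vsUU])
 have t: "trilin U ?Z (%x y z. x \<boxtimes>[U,tensor U U] (y \<boxtimes>[U,U] z))"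
  by (assumption | rule trilinI lins cls)+
 show "sweedler U ?Z (%x z. sweedler U ?Z (%x' y. x' \<boxtimes>[U,tensor U U] (y \<boxtimes>[U,U] z)) x) h =
   sweedler U ?Z (%x y. x \<boxtimes>[U,tensor U U] comult U y) h"
  unfolding sweedler_def coassociative_general[OF Z t h]
 proof (rule lift_cong)
  fix x y assume x: "x <: U" and y: "y <: U"
  have "x \<boxtimes>[U,tensor U U] Sw (tensor U U) (%y z. y \<boxtimes>[U,U] z) (comult U y) =
    Sw ?Z (%y' z. x \<boxtimes>[U,tensor U U] (y' \<boxtimes>[U,U] z)) (comult U y)"
   by (rule tensor_lift_natural[OF vsU vsU vsUU Z _ bilin_pure_tensor[OF vsU vsU] comult_closed[OF y]])
    ((assumption | rule x lins cls)+)
  then show "Sw ?Z (%y' z. x \<boxtimes>[U,tensor U U] (y' \<boxtimes>[U,U] z)) (comult U y) = x \<boxtimes>[U,tensor U U] comult U y"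
   unfolding tensor_lift_pure_self[OF vsU vsU comult_closed[OF y]] by (rule sym)
 qed
qed (unfold sweedler_def, (rule counit_left_U counit_right_U antipode_left_U antipode_right_U, assumption)+)

end

section \<open>The Hopf algebra of representative functions\<close>

subsection \<open>Functions of finite rank\<close>

definition rank_sum :: "(('x \<Rightarrow> complex) \<times> ('y \<Rightarrow> complex)) list \<Rightarrow> 'x \<Rightarrow> 'y \<Rightarrow> complex" where
 "rank_sum ps x y = (\<Sum>(a, b)\<leftarrow>ps. a x * b y)"

lemma rank_sum_simps [simp]:
 "rank_sum [] x y = 0" "rank_sum ((a, b) # ps) x y = a x * b y + rank_sum ps x y"
 "rank_sum (ps @ qs) x y = rank_sum ps x y + rank_sum qs x y"
 by (simp_all add: rank_sum_def)

text \<open>In a function of two variables that is a finite sum of products, the second factors can be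
 replaced by partial functions \<open>F x\<^sub>0\<close>: unless the first factor \<open>a\<close> vanishes identically, a point
 with \<open>a x\<^sub>0 \<noteq> 0\<close> allows to eliminate the partner of \<open>a\<close> in favour of \<open>F x\<^sub>0\<close>. The new first
 factors are linear combinations of the old ones, which is what the predicate \<open>P\<close> records.\<close>

lemma finite_rank_points:
 assumes P0: "P (%x. 0)" and P: "!!a b c. P a ==> P b ==> P (%x. a x + c * b x)"
 shows "(!!x y. x \<in> X ==> y \<in> Y ==> F x y = rank_sum ps x y) ==> (!!a b. (a, b) \<in> set ps ==> P a) ==>
  \<exists>qs. (\<forall>(x0, g)\<in>set qs. x0 \<in> X \<and> P g) \<and> (\<forall>x\<in>X. \<forall>y\<in>Y. F x y = (\<Sum>(x0, g)\<leftarrow>qs. g x * F x0 y))"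
proof (induction "length ps" arbitrary: ps F)
 case 0
 then show ?case by (intro exI[of _ "[]"]) simp
next
 case (Suc n)
 then obtain a b ps' where ps: "ps = (a, b) # ps'" and n: "n = length ps'" by (cases ps) auto
 show ?case
 proof (cases "\<forall>x\<in>X. a x = 0")
  case True
  then have "F x y = rank_sum ps' x y" if "x \<in> X" "y \<in> Y" for x y using Suc.prems(1)[OF that] that ps by simp
  then show ?thesis using Suc.hyps(1)[OF n, of F] Suc.prems(2) ps by force
 next
  case False
  then obtain x0 where x0: "x0 \<in> X" "a x0 \<noteq> 0" by blast
  have Pa: "P a" and P': "!!a' b'. (a', b') \<in> set ps' ==> P a'" using Suc.prems(2) ps by auto
  define t where "t = 1 / a x0"
  have t: "t * a x0 = 1" using x0 by (simp add: t_def)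
  define qs where "qs = map (%(a', b'). (%x. a' x + (- (t * a' x0)) * a x, b')) ps'"
  define F' where "F' x y = F x y - t * a x * F x0 y" for x y
  have qs_eq: "rank_sum qs x y = rank_sum ps' x y - t * a x * rank_sum ps' x0 y" for x y
   unfolding qs_def by (induction ps') (auto simp: algebra_simps)
  have "F' x y = rank_sum qs x y" if "x \<in> X" "y \<in> Y" for x y
  proof -
   have "t * a x * (a x0 * b y) = a x * b y" using t by (simp add: algebra_simps)
   then show ?thesis using Suc.prems(1)[OF that] Suc.prems(1)[OF x0(1) that(2)]
    by (simp add: F'_def qs_eq ps distrib_left)
  qed
  moreover have "P a'" if "(a', b') \<in> set qs" for a' b'
  proof -
   obtain a2 where a2: "(a2, b') \<in> set ps'" "a' = (%x. a2 x + (- (t * a2 x0)) * a x)"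
    using \<open>(a', b') \<in> set qs\<close> by (auto simp: qs_def)
   show ?thesis unfolding a2(2) by (rule P[OF P'[OF a2(1)] Pa])
  qed
  ultimately obtain rs where rs: "\<forall>(x1, g)\<in>set rs. x1 \<in> X \<and> P g"
   "!!x y. x \<in> X ==> y \<in> Y ==> F' x y = (\<Sum>(x1, g)\<leftarrow>rs. g x * F' x1 y)"
   using Suc.hyps(1)[of qs F'] n by (auto simp: qs_def)
  define k where "k x = (\<Sum>(x1, g)\<leftarrow>rs. (- (t * a x1)) * g x)" for x
  have sum_eq: "(\<Sum>(x1, g)\<leftarrow>rs. g x * F' x1 y) = (\<Sum>(x1, g)\<leftarrow>rs. g x * F x1 y) + k x * F x0 y" for x y
   unfolding k_def F'_def by (induction rs) (auto simp: algebra_simps)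
  have Pk: "P k"
   using rs(1) unfolding k_def
  proof (induction rs)
   case Nil show ?case using P0 by simp
  next
   case (Cons p rs)
   obtain x1 g where p: "p = (x1, g)" by (cases p)
   have "P (%x. (\<Sum>(x1, g)\<leftarrow>rs. (- (t * a x1)) * g x) + (- (t * a x1)) * g x)"
    using Cons p by (intro P) auto
   then show ?case by (simp add: p algebra_simps)
  qed
  have F_eq: "F x y = (\<Sum>(x1, g)\<leftarrow>(x0, %x. k x + t * a x) # rs. g x * F x1 y)" if "x \<in> X" "y \<in> Y" for x y
  proof -
   have "F x y = F' x y + t * a x * F x0 y" by (simp add: F'_def)
   then show ?thesis unfolding rs(2)[OF that] sum_eq by (simp add: algebra_simps)
  qed
  have "\<forall>(x1, g)\<in>set ((x0, %x. k x + t * a x) # rs). x1 \<in> X \<and> P g"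
   using rs(1) x0(1) P[OF Pk Pa, of t] by simp
  moreover have "\<forall>x\<in>X. \<forall>y\<in>Y. F x y = (\<Sum>(x1, g)\<leftarrow>(x0, %x. k x + t * a x) # rs. g x * F x1 y)"
   by (intro ballI F_eq)
  ultimately show ?thesis by (intro exI[of _ "(x0, %x. k x + t * a x) # rs"] conjI)
 qed
qed

text \<open>A space on which finitely many linear functionals have only common zeros in a subset \<open>I\<close>
 is spanned by finitely many elements modulo \<open>I\<close>.\<close>

lemma finite_functionals_spanning:
 assumes V: "vs V"
 shows "(!!d. d \<in> set ds ==> lin V cpx d) ==> \<exists>E. finite E \<and> E \<subseteq> carrier V \<and>
  (\<forall>S. submodule cpx S V \<longrightarrow> E \<subseteq> S \<longrightarrow> (\<forall>x\<in>carrier V. \<exists>y\<in>S. \<forall>d\<in>set ds. d (x -[V] y) = 0))"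
proof (induction ds)
 case Nil
 have "0[V] \<in> S" if "submodule cpx S V" for S using that by (rule submodule.zero_closed)
 then show ?case by (intro exI[of _ "{}"]) auto
next
 case (Cons d ds)
 then obtain E where E: "finite E" "E \<subseteq> carrier V"
  "!!S x. submodule cpx S V ==> E \<subseteq> S ==> x <: V ==> \<exists>y\<in>S. \<forall>d\<in>set ds. d (x -[V] y) = 0"
  by (auto simp: Ball_def)
 have d: "lin V cpx d" and ds: "!!d'. d' \<in> set ds ==> lin V cpx d'" using Cons.prems by auto
 show ?case
 proof (cases "\<forall>x\<in>carrier V. (\<forall>d'\<in>set ds. d' x = 0) \<longrightarrow> d x = 0")
  case True
  have "\<exists>y\<in>S. \<forall>d'\<in>set (d # ds). d' (x -[V] y) = 0"
   if S: "submodule cpx S V" and ES: "E \<subseteq> S" and x: "x <: V" for S x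
  proof -
   obtain y where y: "y \<in> S" "\<forall>d\<in>set ds. d (x -[V] y) = 0" using E(3)[OF S ES x] by blast
   have "y <: V" using submodule.subset[OF S] y(1) by blast
   then have "x -[V] y <: V" using x by (intro vs_closed[OF V])
   then show ?thesis using True y by (intro bexI[of _ y]) auto
  qed
  then show ?thesis using E(1,2) by (intro exI[of _ E]) auto
 next
  case False
  then obtain e where e: "e <: V" "\<forall>d'\<in>set ds. d' e = 0" "d e \<noteq> 0" by blast
  have "\<exists>y\<in>S. \<forall>d'\<in>set (d # ds). d' (x -[V] y) = 0"
   if S: "submodule cpx S V" and ES: "insert e E \<subseteq> S" and x: "x <: V" for S x
  proof -
   obtain y where y: "y \<in> S" "\<forall>d\<in>set ds. d (x -[V] y) = 0" using E(3)[OF S _ x] ES by blast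
   have yV: "y <: V" using submodule.subset[OF S] y(1) by blast
   define c where "c = d (x -[V] y) / d e"
   define z where "z = y +[V] c .[V] e"
   have zS: "z \<in> S" unfolding z_def using ES
    by (intro submodule.m_closed[OF S] submodule.smult_closed[OF S] y) auto
   have dz: "d' (x -[V] z) = d' (x -[V] y) - c * d' e" if d': "lin V cpx d'" for d'
   proof -
    have ce: "c .[V] e <: V" and zV: "z <: V" using e yV by (simp_all add: z_def vs_closed[OF V])
    show ?thesis
     using lin_minus[OF V vs_cpx d' x zV] lin_minus[OF V vs_cpx d' x yV] lin_add[OF d' yV ce] lin_smult[OF d' e(1), of c]
     by (simp add: z_def)
   qed
   have "d (x -[V] z) = 0" using dz[OF d] e(3) by (simp add: c_def)
   moreover have "d' (x -[V] z) = 0" if "d' \<in> set ds" for d'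
    using dz[OF ds[OF that]] bspec[OF y(2) that] bspec[OF e(2) that] by simp
   ultimately show ?thesis using zS by (intro bexI[of _ z]) auto
  qed
  then show ?thesis using E(1,2) e(1) by (intro exI[of _ "insert e E"]) auto
 qed
qed

lemma list_contraction_cpx: "list_contraction cpx b ps = (\<Sum>(v, w)\<leftarrow>ps. b v w)"
 by (induction ps) (auto simp: list_contraction_def)

lemma list_contraction_cpx_rank: "list_contraction cpx (%f g. f u * g v) ps = rank_sum ps u v"
 by (simp add: list_contraction_cpx rank_sum_def)

lemma sum_list_product:
 "(\<Sum>(p, q)\<leftarrow>List.product ps qs. f p q) = (\<Sum>p\<leftarrow>ps. \<Sum>q\<leftarrow>qs. (f p q :: complex))"
 by (induction ps) (simp_all add: o_def)

context bracket_space
begin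

subsection \<open>Representative functions are the functions with finite-rank translates\<close>

definition RF :: "('a uea \<Rightarrow> complex) set" where
 "RF = {f \<in> module_hom cpx U cpx \<inter> extensional (carrier U).
  \<exists>ps. \<forall>u\<in>carrier U. \<forall>v\<in>carrier U. f (u *[U] v) = rank_sum ps u v}"

lemma RF_I:
 assumes "lin U cpx f" "!!u v. u <: U ==> v <: U ==> f (u *[U] v) = rank_sum ps u v"
 shows "restrict f (carrier U) \<in> RF"
 unfolding RF_def using assms lin_restrict[OF vsU, where W = cpx and f = f]
 by (simp add: algU) (blast intro: exI[of _ ps])

lemma RF_D:
 assumes "f \<in> RF"
 shows "lin U cpx f" "f \<in> extensional (carrier U)"
  "\<exists>ps. \<forall>u\<in>carrier U. \<forall>v\<in>carrier U. f (u *[U] v) = rank_sum ps u v"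
 using assms by (auto simp: RF_def)

lemma RF_restrict: "f \<in> RF ==> restrict f (carrier U) = f"
 using RF_D(2) by (rule extensional_restrict)

lemma RF_zero: "(\<lambda>u\<in>carrier U. 0) \<in> RF"
 by (rule RF_I[where ps = "[]"]) (use lin_zero_map[OF vs_cpx] in simp_all)

lemma RF_combine:
 assumes f: "f \<in> RF" and g: "g \<in> RF" shows "(\<lambda>u\<in>carrier U. f u + c * g u) \<in> RF"
proof -
 obtain ps qs where ps: "!!u v. u <: U ==> v <: U ==> f (u *[U] v) = rank_sum ps u v"
  and qs: "!!u v. u <: U ==> v <: U ==> g (u *[U] v) = rank_sum qs u v"
  using RF_D(3)[OF f] RF_D(3)[OF g] by blast
 have m: "rank_sum (map (%(a, b). (%x. c * a x, b)) qs) u v = c * rank_sum qs u v" for u v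
  by (induction qs) (auto simp: algebra_simps)
 show ?thesis
 proof (rule RF_I)
  show "lin U cpx (%u. f u + c * g u)" by (intro lin_cpx_add lin_cpx_mult RF_D(1) f g)
  show "f (u *[U] v) + c * g (u *[U] v) = rank_sum (ps @ map (%(a, b). (%x. c * a x, b)) qs) u v"
   if "u <: U" "v <: U" for u v using that by (simp add: ps qs m)
 qed
qed

lemma RF_translate:
 assumes f: "f \<in> RF" and w: "w <: U"
 shows "(\<lambda>u\<in>carrier U. f (w *[U] u)) \<in> RF" "(\<lambda>u\<in>carrier U. f (u *[U] w)) \<in> RF"
proof -
 obtain ps where ps: "!!u v. u <: U ==> v <: U ==> f (u *[U] v) = rank_sum ps u v"
  using RF_D(3)[OF f] by blast
 have m: "rank_sum (map (%(a, b). (%u. a (h u), %v. b (k v))) ps) u v = rank_sum ps (h u) (k v)"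
  for h k :: "'a uea \<Rightarrow> 'a uea" and u v
  by (induction ps) auto
 show "(\<lambda>u\<in>carrier U. f (w *[U] u)) \<in> RF"
 proof (rule RF_I)
  show "lin U cpx (%u. f (w *[U] u))" by (intro lin_comp[OF RF_D(1)[OF f]] lin_alg_mult algU w lin_id)
  fix u v assume "u <: U" "v <: U"
  then show "f (w *[U] (u *[U] v)) = rank_sum (map (%(a, b). (%u. a (w *[U] u), %v. b (id v))) ps) u v"
   using w unfolding m by (simp add: alg_assoc[OF algU, symmetric] ps algU)
 qed
 show "(\<lambda>u\<in>carrier U. f (u *[U] w)) \<in> RF"
 proof (rule RF_I)
  show "lin U cpx (%u. f (u *[U] w))" by (intro lin_comp[OF RF_D(1)[OF f]] lin_alg_mult algU w lin_id)
  fix u v assume "u <: U" "v <: U"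
  then show "f ((u *[U] v) *[U] w) = rank_sum (map (%(a, b). (%u. a (id u), %v. b (v *[U] w))) ps) u v"
   using w unfolding m by (simp add: alg_assoc[OF algU] ps algU)
 qed
qed

lemma RF_decompose:
 assumes f: "f \<in> RF"
 shows "\<exists>ps. set ps \<subseteq> RF \<times> RF \<and> (\<forall>u\<in>carrier U. \<forall>v\<in>carrier U. f (u *[U] v) = rank_sum ps u v)"
proof -
 obtain ps0 where ps0: "!!u v. u <: U ==> v <: U ==> f (u *[U] v) = rank_sum ps0 u v"
  using RF_D(3)[OF f] by blast
 obtain qs where qs: "\<forall>(x0, g)\<in>set qs. x0 <: U"
  "!!u v. u <: U ==> v <: U ==> f (u *[U] v) = (\<Sum>(x0, g)\<leftarrow>qs. g u * f (x0 *[U] v))"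
  using finite_rank_points[of "%_. True" "carrier U" "carrier U" "%u v. f (u *[U] v)" ps0] ps0 by auto
 define ps1 where "ps1 = map (%(x0, g). (%v. f (x0 *[U] v), g)) qs"
 have 1: "f (u *[U] v) = rank_sum ps1 v u" if "v <: U" "u <: U" for u v
  unfolding qs(2)[OF that(2,1)] ps1_def rank_sum_def
  by (simp add: o_def case_prod_unfold mult.commute)
 let ?P = "%h. restrict h (carrier U) \<in> RF"
 have "\<exists>rs. (\<forall>(y, h)\<in>set rs. y <: U \<and> ?P h) \<and>
   (\<forall>v\<in>carrier U. \<forall>u\<in>carrier U. f (u *[U] v) = (\<Sum>(y, h)\<leftarrow>rs. h v * f (u *[U] y)))"
 proof (rule finite_rank_points[where P = ?P and F = "%v u. f (u *[U] v)"])
  show "?P (%x. 0)" by (rule RF_zero)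
  fix a b c assume "?P a" "?P b"
  from RF_combine[OF this, of c] show "?P (%x. a x + c * b x)" by (simp cong: restrict_cong)
 next
  fix a b assume "(a, b) \<in> set ps1"
  then show "?P a" using qs(1) RF_translate(1)[OF f] by (auto simp: ps1_def)
 qed (rule 1)
 then obtain rs where rs: "\<forall>(y, h)\<in>set rs. y <: U \<and> ?P h"
  "!!u v. u <: U ==> v <: U ==> f (u *[U] v) = (\<Sum>(y, h)\<leftarrow>rs. h v * f (u *[U] y))" by blast
 define ps where "ps = map (%(y, h). (\<lambda>u\<in>carrier U. f (u *[U] y), restrict h (carrier U))) rs"
 have "set ps \<subseteq> RF \<times> RF" using rs(1) RF_translate(2)[OF f] by (auto simp: ps_def)
 moreover have "f (u *[U] v) = rank_sum ps u v" if "u <: U" "v <: U" for u v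
  unfolding rs(2)[OF that] ps_def rank_sum_def using that by (simp add: o_def case_prod_unfold mult.commute)
 ultimately show ?thesis by (intro exI[of _ ps] conjI ballI)
qed

lemma kernel_space:
 assumes f: "lin U cpx f"
 defines "K \<equiv> U\<lparr>carrier := {u \<in> carrier U. f u = 0}\<rparr>"
 shows "vs K" "carrier K = {u \<in> carrier U. f u = 0}" "add K = add U" "smult K = smult U" "zero K = zero U"
  "!!x y. y <: K ==> x -[K] y = x -[U] y"
proof -
 show eq: "carrier K = {u \<in> carrier U. f u = 0}" "add K = add U" "smult K = smult U" "zero K = zero U"
  by (simp_all add: K_def)
 show vK: "vs K"
  by (rule vsI; (unfold eq)?; clarsimp?)
   (simp_all add: vs_simps[OF vsU] vs_add_ac[OF vsU] lin_add[OF f] lin_smult[OF f] lin_zero[OF vsU vs_cpx f])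
 show "x -[K] y = x -[U] y" if "y <: K" for x y
  using that vs_minus_eq[OF vK that, of x] by (simp add: eq vs_minus_eq[OF vsU])
qed

lemma ideal_submodule_kernel:
 assumes f: "lin U cpx f" and I: "ideal I U" and IK: "I \<subseteq> {u \<in> carrier U. f u = 0}"
 shows "submodule cpx I (U\<lparr>carrier := {u \<in> carrier U. f u = 0}\<rparr>)"
proof -
 note K = kernel_space[OF f]
 interpret s: submodule cpx I U by (rule complex_algebra_quot(2)[OF algU I])
 show ?thesis
  by (rule submodule.intro) (use K IK s.m_closed s.smult_closed s.zero_closed in \<open>simp_all add: vs_iff_module\<close>)
qed

lemma RF_subset_rep_functions: "RF \<subseteq> rep_functions L"
proof
 fix f assume f: "f \<in> RF"
 note lf = RF_D(1)[OF f]
 let ?K = "U\<lparr>carrier := {u \<in> carrier U. f u = 0}\<rparr>"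
 note K = kernel_space[OF lf]
 define I where "I = {x \<in> carrier U. \<forall>u\<in>carrier U. \<forall>v\<in>carrier U. f (u *[U] (x *[U] v)) = 0}"
 have two: "lin U cpx (%x. f (u *[U] (x *[U] v)))" if "u <: U" "v <: U" for u v
  by (intro lin_comp[OF lf] lin_alg_mult algU that lin_id)
 have I: "ideal I U"
 proof (rule idealI[OF alg_ring[OF algU]])
  show "subgroup I (add_monoid U)"
  proof (rule subgroup.intro)
   fix x assume x: "x \<in> I"
   then have "-[U] x \<in> I"
    using lin_neg[OF vsU vs_cpx two] by (simp add: I_def vs_closed[OF vsU])
   then show "inv\<^bsub>add_monoid U\<^esub> x \<in> I" by (simp add: a_inv_def)
  qed (auto simp: I_def vs_closed[OF vsU] lin_add[OF two] lin_zero[OF vsU vs_cpx two])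
  fix a x assume a: "a \<in> I" and x: "x <: U"
  have "f (u *[U] ((x *[U] a) *[U] v)) = f ((u *[U] x) *[U] (a *[U] v))"
   "f (u *[U] ((a *[U] x) *[U] v)) = f (u *[U] (a *[U] (x *[U] v)))"
   if "u <: U" "v <: U" for u v
   using that a x by (simp_all add: I_def alg_assoc[OF algU] algU)
  then show "x *[U] a \<in> I" "a *[U] x \<in> I" using a x by (simp_all add: I_def algU)
 qed
 have IK: "I \<subseteq> {u \<in> carrier U. f u = 0}"
 proof
  fix x assume "x \<in> I"
  then have x: "x <: U" "f (1[U] *[U] (x *[U] 1[U])) = 0"
   using alg_closed(1)[OF algU] unfolding I_def by blast+
  then show "x \<in> {u \<in> carrier U. f u = 0}" by (simp add: alg_unit[OF algU])
 qed
 obtain ps where ps0: "set ps \<subseteq> RF \<times> RF \<and> (\<forall>u\<in>carrier U. \<forall>v\<in>carrier U. f (u *[U] v) = rank_sum ps u v)"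
  using RF_decompose[OF f] by (rule exE)
 note ps = conjunct1[OF ps0] bspec[OF bspec[OF conjunct2[OF ps0]]]
 define Q where "Q g = (SOME qs. set qs \<subseteq> RF \<times> RF \<and>
  (\<forall>u\<in>carrier U. \<forall>v\<in>carrier U. g (u *[U] v) = rank_sum qs u v))" for g
 have Q0: "set (Q g) \<subseteq> RF \<times> RF \<and> (\<forall>u\<in>carrier U. \<forall>v\<in>carrier U. g (u *[U] v) = rank_sum (Q g) u v)"
  if g: "g \<in> RF" for g
  unfolding Q_def by (rule someI_ex[OF RF_decompose[OF g]])
 note Q = conjunct1[OF Q0] bspec[OF bspec[OF conjunct2[OF Q0]]]
 define ds where "ds = concat (map (%pq. map fst (Q (snd pq))) ps)"
 have set_ds: "set ds = (\<Union>pq\<in>set ps. fst ` set (Q (snd pq)))" by (simp add: ds_def)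
 have ds_RF: "d \<in> RF" if d: "d \<in> set ds" for d
 proof -
  obtain pq z where pq: "pq \<in> set ps" and z: "z \<in> set (Q (snd pq))" and dz: "d = fst z"
   using d unfolding set_ds by (elim UN_E imageE)
  have "snd pq \<in> RF" using subsetD[OF ps(1) pq] by (simp add: mem_Times_iff)
  from subsetD[OF Q(1)[OF this] z] show ?thesis by (simp add: dz mem_Times_iff)
 qed
 have ds_mem: "a \<in> set ds" if "(p, q) \<in> set ps" "(a, b) \<in> set (Q q)" for a b p q
  unfolding set_ds by (rule UN_I[OF that(1)]) (use that(2) in \<open>simp add: rev_image_eqI\<close>)
 have rank0: "rank_sum zs x y = 0" if "!!a b. (a, b) \<in> set zs ==> a x * b y = 0" for zs :: "(('a uea \<Rightarrow> complex) \<times> ('a uea \<Rightarrow> complex)) list" and x y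
  using that by (induction zs) auto
 have null: "x \<in> I" if x: "x <: U" and d: "\<forall>d\<in>set ds. d x = 0" for x
 proof -
  have "f (u *[U] (x *[U] v)) = 0" if u: "u <: U" and v: "v <: U" for u v
   unfolding ps(2)[OF u alg_closed(2)[OF algU x v]]
  proof (rule rank0)
   fix p q assume pq: "(p, q) \<in> set ps"
   have q: "q \<in> RF" using subsetD[OF ps(1) pq] by (simp add: mem_Times_iff)
   have "rank_sum (Q q) x v = 0"
   proof (rule rank0)
    fix a b assume "(a, b) \<in> set (Q q)"
    then show "a x * b v = 0" using bspec[OF d ds_mem[OF pq]] by simp
   qed
   then show "p u * q (x *[U] v) = 0" using Q(2)[OF q x v] by simp
  qed
  then show ?thesis using x by (simp add: I_def)
 qed
 have dK: "lin ?K cpx d" if "d \<in> set ds" for d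
 proof (rule linI)
  note l = RF_D(1)[OF ds_RF[OF that]]
  fix x y c assume "x <: ?K" "y <: ?K"
  then have xy: "x <: U" "y <: U" by simp_all
  show "d (x +[?K] y) = d x +[cpx] d y" using lin_add[OF l xy] by simp
 next
  note l = RF_D(1)[OF ds_RF[OF that]]
  fix x c assume "x <: ?K"
  then have x: "x <: U" by simp
  show "d (c .[?K] x) = c .[cpx] d x" using lin_smult[OF l x] by simp
 qed simp
 obtain E where E0: "finite E \<and> E \<subseteq> carrier ?K \<and> (\<forall>S. submodule cpx S ?K \<longrightarrow> E \<subseteq> S \<longrightarrow>
   (\<forall>x\<in>carrier ?K. \<exists>y\<in>S. \<forall>d\<in>set ds. d (x -[?K] y) = 0))"
  using finite_functionals_spanning[OF K(1), of ds, OF dK] by (rule exE)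
 note E = conjunct1[OF E0] conjunct1[OF conjunct2[OF E0]]
  bspec[OF conjunct2[OF conjunct2[OF E0], THEN spec, THEN mp, THEN mp]]
 note sub = ideal_submodule_kernel[OF lf I IK]
 let ?Q = "quot_space ?K I" and ?pr = "%x. I +>\<^bsub>?K\<^esub> x"
 interpret Q: vectorspace cpx ?Q by (rule vs_quot_space[OF K(1) sub])
 have prE: "?pr ` E \<subseteq> carrier ?Q" using E(2) unfolding quot_space_simps(1)[OF K(1) sub] by blast
 interpret sp: submodule cpx "Q.span (?pr ` E)" ?Q by (rule Q.span_is_submodule[OF prE])
 define S where "S = {y \<in> carrier ?K. ?pr y \<in> Q.span (?pr ` E)}"
 note prl = lin_rcos[OF K(1) sub]
 have S: "submodule cpx S ?K"
 proof (rule submodule.intro)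
  show "module cpx ?K" using K(1) by (simp add: vs_iff_module)
  show "S \<subseteq> carrier ?K" unfolding S_def by blast
  show "0[?K] \<in> S" unfolding S_def mem_Collect_eq lin_zero[OF K(1) Q.vectorspace_axioms prl]
   by (intro conjI vs_closed(1)[OF K(1)] sp.zero_closed)
  fix v w c assume "v \<in> S"
  then have v: "v <: ?K" "?pr v \<in> Q.span (?pr ` E)" unfolding S_def by blast+
  have c: "c <: cpx" by simp
  show "c .[?K] v \<in> S" unfolding S_def mem_Collect_eq lin_smult[OF prl v(1)]
   by (intro conjI vs_closed(3)[OF K(1)] v sp.smult_closed c)
  assume "w \<in> S"
  then have w: "w <: ?K" "?pr w \<in> Q.span (?pr ` E)" unfolding S_def by blast+
  show "v +[?K] w \<in> S" unfolding S_def mem_Collect_eq lin_add[OF prl v(1) w(1)]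
   by (intro conjI vs_closed(2)[OF K(1)] v w sp.m_closed)
 qed
 have ES: "E \<subseteq> S"
 proof
  fix x assume x: "x \<in> E"
  show "x \<in> S" unfolding S_def mem_Collect_eq
   by (intro conjI subsetD[OF E(2) x] subsetD[OF Q.in_own_span[OF prE]] imageI x)
 qed
 have "carrier ?Q \<subseteq> Q.span (?pr ` E)"
 proof
  fix X assume "X <: ?Q"
  then obtain x where x: "x <: ?K" "X = ?pr x" by (rule quot_space_cases[OF K(1) sub])
  obtain y where y: "y \<in> S" "\<forall>d\<in>set ds. d (x -[?K] y) = 0" using E(3)[OF S ES x(1)] by blast
  have yK: "y <: ?K" using y(1) unfolding S_def by blast
  have "x -[?K] y <: ?K" by (rule vs_closed(5)[OF K(1) x(1) yK])
  then have "x -[?K] y \<in> I" using y(2) by (intro null) simp_all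
  then have "?pr x = ?pr y" using rcos_eq_iff[OF K(1) sub x(1) yK] by blast
  moreover have "?pr y \<in> Q.span (?pr ` E)" using y(1) unfolding S_def by blast
  ultimately show "X \<in> Q.span (?pr ` E)" unfolding x(2) by simp
 qed
 then have span: "Q.span (?pr ` E) = carrier ?Q" using Q.span_is_subset2[OF prE] by (intro subset_antisym)
 have fd: "Q.fin_dim" unfolding Q.fin_dim_def
  by (intro exI[of _ "?pr ` E"] conjI finite_imageI E(1) prE span)
 show "f \<in> rep_functions L"
  unfolding rep_functions_def by (intro CollectI IntI conjI exI[of _ I] lf RF_D(2)[OF f] I IK fd)
qed

lemma rep_functions_subset_RF: "rep_functions L \<subseteq> RF"
proof
 fix f assume fr: "f \<in> rep_functions L"
 let ?K = "U\<lparr>carrier := {u \<in> carrier U. f u = 0}\<rparr>"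
 have lf: "lin U cpx f" and fe: "f \<in> extensional (carrier U)" using fr by (simp_all add: rep_functions_def)
 obtain I where I: "ideal I U" and IK: "I \<subseteq> {u \<in> carrier U. f u = 0}" and fd: "vectorspace.fin_dim cpx (quot_space ?K I)"
  using fr unfolding rep_functions_def mem_Collect_eq by (elim conjE exE) (rule that)
 note K = kernel_space[OF lf]
 note sub = ideal_submodule_kernel[OF lf I IK]
 let ?Q = "quot_space ?K I" and ?pr = "%x. I +>\<^bsub>?K\<^esub> x"
 interpret Q: vectorspace cpx ?Q by (rule vs_quot_space[OF K(1) sub])
 obtain A where A: "finite A" "A \<subseteq> carrier ?Q" "Q.span A = carrier ?Q"
  using fd unfolding Q.fin_dim_def by (elim exE conjE) (rule that)
 have H_ex: "\<exists>h. lin ?Q cpx h \<and> (\<forall>x\<in>carrier ?K. h (?pr x) = f (u *[U] x))" if u: "u <: U" for u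
 proof -
  have "lin U cpx (%x. f (u *[U] x))" by (intro lin_comp[OF lf] lin_alg_mult algU u lin_id)
  then have l: "lin ?K cpx (%x. f (u *[U] x))" by (auto simp: module_hom_def)
  have n: "f (u *[U] x) = 0[cpx]" if "x \<in> I" for x
   using ideal.I_l_closed[OF I that u] IK by auto
  show ?thesis
   apply (rule quot_space_lift[OF K(1) sub vs_cpx l n], assumption)
   subgoal premises prems for h
    by (rule exI[of _ h], rule conjI[OF prems(1)], rule ballI, rule prems(3))
   done
 qed
 define H where "H u = (SOME h. lin ?Q cpx h \<and> (\<forall>x\<in>carrier ?K. h (?pr x) = f (u *[U] x)))" for u
 have H0: "lin ?Q cpx (H u) \<and> (\<forall>x\<in>carrier ?K. H u (?pr x) = f (u *[U] x))" if "u <: U" for u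
  unfolding H_def by (rule someI_ex[OF H_ex[OF that]])
 note H = conjunct1[OF H0] bspec[OF conjunct2[OF H0]]
 define S where "S = {X \<in> carrier ?Q. \<exists>c. \<forall>u\<in>carrier U. H u X = (\<Sum>Y\<in>A. c Y * H u Y)}"
 have SI: "X \<in> S" if "X <: ?Q" "!!u. u <: U ==> H u X = (\<Sum>Y\<in>A. c Y * H u Y)" for X c
  unfolding S_def using that by (intro CollectI conjI exI[of _ c] ballI)
 have SD: "X <: ?Q" "\<exists>c. \<forall>u\<in>carrier U. H u X = (\<Sum>Y\<in>A. c Y * H u Y)" if "X \<in> S" for X
  using that unfolding S_def by blast+
 have S: "submodule cpx S ?Q"
 proof (rule submodule.intro)
  show "module cpx ?Q" by (rule Q.module_axioms)
  show "S \<subseteq> carrier ?Q" unfolding S_def by blast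
  show "0[?Q] \<in> S"
   by (rule SI[of _ "%_. 0"]) (simp_all only: lin_zero[OF Q.vectorspace_axioms vs_cpx H(1)] Q.M.zero_closed mult_zero_left sum.neutral_const cpx_simps)
  fix X Y k assume X: "X \<in> S"
  obtain a where a: "\<forall>u\<in>carrier U. H u X = (\<Sum>Y\<in>A. a Y * H u Y)" using SD(2)[OF X] by (rule exE)
  note XQ = SD(1)[OF X]
  show "k .[?Q] X \<in> S"
  proof (rule SI[of _ "%Y. k * a Y"])
   show "k .[?Q] X <: ?Q" by (rule vs_closed(3)[OF Q.vectorspace_axioms XQ])
   fix u assume u: "u <: U"
   have "H u (k .[?Q] X) = k * (\<Sum>Y\<in>A. a Y * H u Y)" using lin_smult[OF H(1)[OF u] XQ, of k] bspec[OF a u] by simp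
   then show "H u (k .[?Q] X) = (\<Sum>Y\<in>A. k * a Y * H u Y)" by (simp only: sum_distrib_left mult.assoc)
  qed
  assume Y: "Y \<in> S"
  obtain b where b: "\<forall>u\<in>carrier U. H u Y = (\<Sum>Y\<in>A. b Y * H u Y)" using SD(2)[OF Y] by (rule exE)
  note YQ = SD(1)[OF Y]
  show "X +[?Q] Y \<in> S"
  proof (rule SI[of _ "%Y. a Y + b Y"])
   show "X +[?Q] Y <: ?Q" by (rule vs_closed(2)[OF Q.vectorspace_axioms XQ YQ])
   fix u assume u: "u <: U"
   have "H u (X +[?Q] Y) = (\<Sum>Y\<in>A. a Y * H u Y) + (\<Sum>Y\<in>A. b Y * H u Y)"
    using lin_add[OF H(1)[OF u] XQ YQ] bspec[OF a u] bspec[OF b u] by simp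
   then show "H u (X +[?Q] Y) = (\<Sum>Z\<in>A. (a Z + b Z) * H u Z)" by (simp only: sum.distrib distrib_right)
  qed
 qed
 have "A \<subseteq> S"
 proof
  fix X assume X: "X \<in> A"
  show "X \<in> S"
  proof (rule SI[of _ "%Y. if Y = X then 1 else 0"])
   show "X <: ?Q" using A(2) X by blast
   fix u
   have "(\<Sum>Y\<in>A. (if Y = X then 1 else 0) * H u Y) = (\<Sum>Y\<in>A. if Y = X then H u Y else 0)"
    by (rule sum.cong) auto
   then show "H u X = (\<Sum>Y\<in>A. (if Y = X then 1 else 0) * H u Y)"
    using X A(1) by (simp add: sum.delta')
  qed
 qed
 then have QS: "carrier ?Q \<subseteq> S" using Q.span_is_subset[OF _ S] A(3) by blast
 define c where "c x = (SOME c. \<forall>u\<in>carrier U. H u (?pr x) = (\<Sum>Y\<in>A. c Y * H u Y))" for x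
 have c: "f (u *[U] x) = (\<Sum>Y\<in>A. c x Y * H u Y)" if x: "x <: ?K" and u: "u <: U" for x u
 proof -
  have "?pr x <: ?Q" unfolding quot_space_simps(1)[OF K(1) sub] using x by (rule imageI)
  then have "?pr x \<in> S" by (rule subsetD[OF QS])
  from someI_ex[OF SD(2)[OF this]] have "\<forall>u\<in>carrier U. H u (?pr x) = (\<Sum>Y\<in>A. c x Y * H u Y)" unfolding c_def .
  from bspec[OF this u] show ?thesis unfolding H(2)[OF u x] .
 qed
 obtain l where l: "set l = A" "distinct l" using finite_distinct_list[OF A(1)] by blast
 have "\<exists>ps. \<forall>u\<in>carrier U. \<forall>v\<in>carrier U. f (u *[U] v) = rank_sum ps u v"
 proof (cases "\<forall>u\<in>carrier U. f u = 0")
  case True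
  then show ?thesis by (intro exI[of _ "[]"]) (simp add: algU)
 next
  case False
  then obtain e0 where e0: "e0 <: U" "f e0 \<noteq> 0" by blast
  define e where "e = (1 / f e0) .[U] e0"
  have e: "e <: U" "f e = 1" using e0 by (simp_all add: e_def vs_closed[OF vsU] lin_smult[OF lf])
  define r where "r v = v -[U] f v .[U] e" for v
  have fe: "f v .[U] e <: U" for v using e by (simp add: vs_closed[OF vsU])
  have r: "r v <: ?K" if "v <: U" for v
   using lin_minus[OF vsU vs_cpx lf that fe] lin_smult[OF lf e(1)] that fe e
   by (simp add: r_def vs_closed[OF vsU])
  have "f (u *[U] v) = f (u *[U] e) * f v + (\<Sum>Y\<in>A. H u Y * c (r v) Y)" if u: "u <: U" and v: "v <: U" for u v
  proof -
   have lu: "lin U cpx (%x. f (u *[U] x))" by (intro lin_comp[OF lf] lin_alg_mult algU u lin_id)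
   have rv: "r v <: U" using r[OF v] by simp
   have "v = r v +[U] f v .[U] e" unfolding r_def using vs_minus_add_cancel[OF vsU v fe] by simp
   then have "f (u *[U] v) = f (u *[U] (r v +[U] f v .[U] e))"
    by (rule arg_cong[of v _ "%x. f (u *[U] x)"])
   also have "\<dots> = f (u *[U] r v) + f (u *[U] (f v .[U] e))"
    using lin_add[OF lu rv fe[of v]] by (simp only: cpx_simps)
   also have "f (u *[U] (f v .[U] e)) = f v * f (u *[U] e)"
    using lin_smult[OF lu e(1), of "f v"] by (simp only: cpx_simps)
   also have "f (u *[U] r v) = (\<Sum>Y\<in>A. c (r v) Y * H u Y)" by (rule c[OF r[OF v] u])
   finally show ?thesis by (simp add: mult.commute)
  qed
  moreover have "rank_sum (map (%Y. (%u. H u Y, %v. c (r v) Y)) l) u v = (\<Sum>Y\<in>A. H u Y * c (r v) Y)" for u v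
   using l by (simp add: rank_sum_def o_def sum.distinct_set_conv_list[symmetric])
  ultimately show ?thesis
   by (intro exI[of _ "(%u. f (u *[U] e), f) # map (%Y. (%u. H u Y, %v. c (r v) Y)) l"]) simp
 qed
 then show "f \<in> RF" using lf fe by (simp add: RF_def)
qed

lemma rep_functions_eq: "rep_functions L = RF"
 using RF_subset_rep_functions rep_functions_subset_RF by blast

end

subsection \<open>The Hopf algebra structure\<close>

lemma tensor_lift_sum_list:
 assumes V: "vs V" and W: "vs W" and t: "t <: (tensor V W)"
 shows "(!!z. z \<in> set zs ==> bilin V W cpx (B z)) ==>
  tensor_lift V W cpx (%v w. \<Sum>z\<leftarrow>zs. B z v w) t = (\<Sum>z\<leftarrow>zs. tensor_lift V W cpx (B z) t) \<and>
  bilin V W cpx (%v w. \<Sum>z\<leftarrow>zs. B z v w)"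
proof (induction zs)
 case Nil
 then show ?case using tensor_lift_zero[OF V W vs_cpx t] by (simp add: bilin_def lin_zero_map[OF vs_cpx, simplified])
next
 case (Cons z zs)
 have z: "bilin V W cpx (B z)" and IH: "tensor_lift V W cpx (%v w. \<Sum>z\<leftarrow>zs. B z v w) t = (\<Sum>z\<leftarrow>zs. tensor_lift V W cpx (B z) t)"
  "bilin V W cpx (%v w. \<Sum>z\<leftarrow>zs. B z v w)" using Cons by simp_all
 have "bilin V W cpx (%v w. B z v w + (\<Sum>z\<leftarrow>zs. B z v w))"
  using bilinD[OF z] bilinD[OF IH(2)] by (intro bilinI lin_cpx_add)
 then show ?case using tensor_lift_add[OF V W vs_cpx z IH(2) t] IH(1) by simp
qed

lemma rank_sum_mult:
 "rank_sum ps u1 v1 * rank_sum qs u2 v2 = (\<Sum>z\<leftarrow>List.product ps qs.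
  (fst (fst z) u1 * fst (snd z) u2) * (snd (fst z) v1 * snd (snd z) v2))"
proof (induction ps)
 case (Cons p ps)
 have "fst p u1 * snd p v1 * rank_sum qs u2 v2 =
   (\<Sum>z\<leftarrow>map (Pair p) qs. (fst (fst z) u1 * fst (snd z) u2) * (snd (fst z) v1 * snd (snd z) v2))"
  by (induction qs) (auto simp: algebra_simps)
 moreover have "rank_sum (p # ps) u1 v1 = fst p u1 * snd p v1 + rank_sum ps u1 v1" by (cases p) simp
 ultimately show ?case using Cons by (simp add: distrib_right)
qed simp

lemma rank_sum_map: "rank_sum (map (%z. (f z, g z)) zs) u v = (\<Sum>z\<leftarrow>zs. f z u * g z v)"
 by (simp add: rank_sum_def o_def)

context bracket_space
begin

abbreviation "H \<equiv> rep_hopf L"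

lemma H_carrier: "carrier H = RF"
 by (simp add: rep_hopf_def rep_alg_def module.extend_def hopf.fields_def rep_functions_eq)

lemma rep_fields:
 "carrier (rep_alg L) = carrier H" "add (rep_alg L) = add H" "smult (rep_alg L) = smult H"
 by (simp_all add: rep_hopf_def module.extend_def hopf.fields_def)

lemma H_ops:
 "f *[H] g = (\<lambda>u\<in>carrier U. Sw cpx (%u1 u2. f u1 * g u2) (comult U u))"
 "1[H] = (\<lambda>u\<in>carrier U. counit U u)"
 "0[H] = (\<lambda>u\<in>carrier U. 0)"
 "f +[H] g = (\<lambda>u\<in>carrier U. f u + g u)"
 "c .[H] f = (\<lambda>u\<in>carrier U. c * f u)"
 by (simp_all add: rep_hopf_def rep_alg_def module.extend_def hopf.fields_def sweedler_def)

lemma H_hopf_ops: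
 "counit H f = f 1[U]"
 "antipode H f = (\<lambda>u\<in>carrier U. f (antipode U u))"
 by (simp_all add: rep_hopf_def module.extend_def hopf.fields_def)

lemma comult_H_def:
 "comult H f = (THE t. t <: (tensor H H) \<and> (\<forall>u\<in>carrier U. \<forall>v\<in>carrier U.
   tensor_lift H H cpx (%f1 f2. f1 u * f2 v) t = f (u *[U] v)))"
proof -
 have "comult H f = (THE t. t <: (tensor (rep_alg L) (rep_alg L)) \<and> (\<forall>u\<in>carrier U. \<forall>v\<in>carrier U.
   tensor_lift (rep_alg L) (rep_alg L) cpx (%f1 f2. f1 u * f2 v) t = f (u *[U] v)))"
  by (simp add: rep_hopf_def module.extend_def hopf.fields_def)
 then show ?thesis unfolding tensor_cong(1,3)[OF rep_fields rep_fields] .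
qed

lemma H_eval:
 assumes u: "u <: U"
 shows "(f *[H] g) u = Sw cpx (%u1 u2. f u1 * g u2) (comult U u)"
  "1[H] u = counit U u" "0[H] u = 0" "(f +[H] g) u = f u + g u" "(c .[H] f) u = c * f u"
  "antipode H f u = f (antipode U u)"
 using u by (simp_all only: H_ops H_hopf_ops restrict_apply' if_True)

lemma H_lin: "f <: H ==> lin X U g ==> lin X cpx (%x. f (g x))"
 unfolding H_carrier by (rule lin_comp[OF RF_D(1)])

lemma H_eqI:
 assumes "f <: H" "g <: H" "!!u. u <: U ==> f u = g u" shows "f = g"
 using assms unfolding H_carrier by (intro extensionalityI[OF RF_D(2) RF_D(2)])

lemma RF_smult: assumes f: "f \<in> RF" shows "(\<lambda>u\<in>carrier U. c * f u) \<in> RF"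
 using RF_combine[OF RF_zero f, of c] by (simp cong: restrict_cong)

lemma RF_add: assumes f: "f \<in> RF" and g: "g \<in> RF" shows "(\<lambda>u\<in>carrier U. f u + g u) \<in> RF"
 using RF_combine[OF f g, of 1] by simp

lemma vsH [simp, cls]: "vs H"
proof (rule vsI)
 show 0: "0[H] <: H" unfolding H_carrier H_ops by (rule RF_zero)
 fix f g c assume f: "f <: H"
 show s: "c .[H] f <: H" for c using f unfolding H_carrier H_ops by (rule RF_smult)
 show "f +[H] 0[H] = f" "1 .[H] f = f" "0 .[H] f = 0[H]"
  using f RF_restrict[of f] unfolding H_carrier by (simp_all add: H_ops cong: restrict_cong)
 show "(c + d) .[H] f = c .[H] f +[H] d .[H] f" "(c * d) .[H] f = c .[H] (d .[H] f)" for d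
  by (simp_all add: H_ops algebra_simps cong: restrict_cong)
 assume g: "g <: H"
 show "f +[H] g <: H" using f g unfolding H_carrier H_ops by (rule RF_add)
 show "f +[H] g = g +[H] f" "c .[H] (f +[H] g) = c .[H] f +[H] c .[H] g"
  by (simp_all add: H_ops algebra_simps cong: restrict_cong)
 show "(f +[H] g) +[H] h = f +[H] (g +[H] h)" for h
  by (simp add: H_ops algebra_simps cong: restrict_cong)
qed

lemma lin_eval:
 assumes u: "u <: U" and F: "lin X H F" shows "lin X cpx (%x. F x u)"
 by (rule linI) (simp_all only: lin_add[OF F] lin_smult[OF F] H_eval[OF u] cpx_simps UNIV_I)

lemma lin_HI:
 assumes "!!x. x <: X ==> F x <: H" "!!u. u <: U ==> lin X cpx (%x. F x u)" "vs X"
 shows "lin X H F"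
proof (rule linI)
 fix x y c assume x: "x <: X"
 show "F x <: H" by (rule assms(1)[OF x])
 show "F (c .[X] x) = c .[H] F x"
  by (rule H_eqI[OF assms(1)[OF vs_closed(3)[OF assms(3) x]] vs_closed(3)[OF vsH assms(1)[OF x]]])
   (simp only: H_eval lin_smult[OF assms(2) x] cpx_simps)
 assume y: "y <: X"
 show "F (x +[X] y) = F x +[H] F y"
  by (rule H_eqI[OF assms(1)[OF vs_closed(2)[OF assms(3) x y]] vs_closed(2)[OF vsH assms(1)[OF x] assms(1)[OF y]]])
   (simp only: H_eval lin_add[OF assms(2) x y] cpx_simps)
qed

lemma bilin_H_product: "f <: H ==> g <: H ==> bilin U U cpx (%u1 u2. f u1 * g u2)"
 by (intro bilinI lin_cpx_mult H_lin lin_id)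

lemma rank_product:
 assumes f: "f <: H" and g: "g <: H"
  and ps: "set ps \<subseteq> carrier H \<times> carrier H" "!!u v. u <: U ==> v <: U ==> f (u *[U] v) = rank_sum ps u v"
  and qs: "set qs \<subseteq> carrier H \<times> carrier H" "!!u v. u <: U ==> v <: U ==> g (u *[U] v) = rank_sum qs u v"
  and u: "u <: U" and v: "v <: U"
 shows "Sw cpx (%x y. f x * g y) (comult U (u *[U] v)) =
  rank_sum (map (%z. (fst (fst z) *[H] fst (snd z), snd (fst z) *[H] snd (snd z))) (List.product ps qs)) u v"
proof -
 let ?zs = "List.product ps qs"
 have zs: "fst (fst z) <: H" "fst (snd z) <: H" "snd (fst z) <: H" "snd (snd z) <: H"
  if "z \<in> set ?zs" for z using that ps(1) qs(1) by (auto simp: mem_Times_iff)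
 note bu = bilin_H_product[OF zs(1,2)] and bv = bilin_H_product[OF zs(3,4)]
 note cu = comult_closed[OF u] and cv = comult_closed[OF v]
 have "Sw cpx (%x y. f x * g y) (comult U (u *[U] v)) =
   Sw cpx (%u1 u2. Sw cpx (%v1 v2. f (u1 *[U] v1) * g (u2 *[U] v2)) (comult U v)) (comult U u)"
  by (rule Sw_mult[OF vs_cpx bilin_H_product[OF f g] u v])
 also have "\<dots> = Sw cpx (%u1 u2. \<Sum>z\<leftarrow>?zs. (fst (fst z) u1 * fst (snd z) u2) *
   (snd (fst z) *[H] snd (snd z)) v) (comult U u)"
 proof (rule lift_cong)
  fix u1 u2 assume u1: "u1 <: U" and u2: "u2 <: U"
  have "Sw cpx (%v1 v2. f (u1 *[U] v1) * g (u2 *[U] v2)) (comult U v) =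
    Sw cpx (%v1 v2. \<Sum>z\<leftarrow>?zs. (fst (fst z) u1 * fst (snd z) u2) * (snd (fst z) v1 * snd (snd z) v2)) (comult U v)"
   by (rule lift_cong) (simp only: ps(2)[OF u1] qs(2)[OF u2] rank_sum_mult)
  also have "\<dots> = (\<Sum>z\<leftarrow>?zs. Sw cpx (%v1 v2. (fst (fst z) u1 * fst (snd z) u2) * (snd (fst z) v1 * snd (snd z) v2)) (comult U v))"
   proof (rule conjunct1[OF tensor_lift_sum_list[OF vsU vsU cv]])
   fix z assume z: "z \<in> set ?zs"
   show "bilin U U cpx (%v1 v2. (fst (fst z) u1 * fst (snd z) u2) * (snd (fst z) v1 * snd (snd z) v2))"
    by (rule bilinI; rule lin_cpx_mult(2)) (rule bilinD(1)[OF bv[OF z z]] bilinD(2)[OF bv[OF z z]], assumption)+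
  qed
  also have "\<dots> = (\<Sum>z\<leftarrow>?zs. (fst (fst z) u1 * fst (snd z) u2) * (snd (fst z) *[H] snd (snd z)) v)"
  proof (rule arg_cong[of _ _ sum_list], rule map_cong[OF refl])
   fix z assume z: "z \<in> set ?zs"
   show "Sw cpx (%v1 v2. (fst (fst z) u1 * fst (snd z) u2) * (snd (fst z) v1 * snd (snd z) v2)) (comult U v) =
     (fst (fst z) u1 * fst (snd z) u2) * (snd (fst z) *[H] snd (snd z)) v"
    unfolding H_eval(1)[OF v]
    by (rule tensor_lift_natural[OF vsU vsU vs_cpx vs_cpx _ bv[OF z z] cv, symmetric]) (rule lin_cpx_mult(2)[OF lin_id])
  qed
  finally show "Sw cpx (%v1 v2. f (u1 *[U] v1) * g (u2 *[U] v2)) (comult U v) =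
   (\<Sum>z\<leftarrow>?zs. (fst (fst z) u1 * fst (snd z) u2) * (snd (fst z) *[H] snd (snd z)) v)" .
 qed
 also have "\<dots> = (\<Sum>z\<leftarrow>?zs. Sw cpx (%u1 u2. (fst (fst z) u1 * fst (snd z) u2) * (snd (fst z) *[H] snd (snd z)) v) (comult U u))"
  proof (rule conjunct1[OF tensor_lift_sum_list[OF vsU vsU cu]])
  fix z assume z: "z \<in> set ?zs"
  show "bilin U U cpx (%u1 u2. (fst (fst z) u1 * fst (snd z) u2) * (snd (fst z) *[H] snd (snd z)) v)"
   by (rule bilinI; rule lin_cpx_mult(1)) (rule bilinD(1)[OF bu[OF z z]] bilinD(2)[OF bu[OF z z]], assumption)+
 qed
 also have "\<dots> = (\<Sum>z\<leftarrow>?zs. (fst (fst z) *[H] fst (snd z)) u * (snd (fst z) *[H] snd (snd z)) v)"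
 proof (rule arg_cong[of _ _ sum_list], rule map_cong[OF refl])
  fix z assume z: "z \<in> set ?zs"
  show "Sw cpx (%u1 u2. (fst (fst z) u1 * fst (snd z) u2) * (snd (fst z) *[H] snd (snd z)) v) (comult U u) =
    (fst (fst z) *[H] fst (snd z)) u * (snd (fst z) *[H] snd (snd z)) v"
   unfolding H_eval(1)[OF u]
   by (rule tensor_lift_natural[OF vsU vsU vs_cpx vs_cpx _ bu[OF z z] cu, symmetric]) (rule lin_cpx_mult(1)[OF lin_id])
 qed
 finally show ?thesis unfolding rank_sum_map .
qed

lemma H_decompose:
 assumes f: "f <: H"
 shows "\<exists>ps. set ps \<subseteq> carrier H \<times> carrier H \<and> (\<forall>u\<in>carrier U. \<forall>v\<in>carrier U. f (u *[U] v) = rank_sum ps u v)"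
 using RF_decompose f unfolding H_carrier .

lemma H_I:
 assumes "lin U cpx f" "!!u v. u <: U ==> v <: U ==> f (u *[U] v) = rank_sum ps u v"
 shows "restrict f (carrier U) <: H"
 unfolding H_carrier using assms by (rule RF_I)

lemma H_mult_closed: assumes f: "f <: H" and g: "g <: H" shows "f *[H] g <: H"
proof -
 obtain ps where ps: "set ps \<subseteq> carrier H \<times> carrier H \<and> (\<forall>u\<in>carrier U. \<forall>v\<in>carrier U. f (u *[U] v) = rank_sum ps u v)"
  using H_decompose[OF f] by (rule exE)
 obtain qs where qs: "set qs \<subseteq> carrier H \<times> carrier H \<and> (\<forall>u\<in>carrier U. \<forall>v\<in>carrier U. g (u *[U] v) = rank_sum qs u v)"
  using H_decompose[OF g] by (rule exE)
 note ps = conjunct1[OF ps] bspec[OF bspec[OF conjunct2[OF ps]]] and qs = conjunct1[OF qs] bspec[OF bspec[OF conjunct2[OF qs]]]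
 show ?thesis unfolding H_ops
  by (rule H_I[OF Sw_lin[OF vs_cpx bilin_H_product[OF f g] lin_id] rank_product[OF f g ps qs]])
qed

lemma H_one_closed: "1[H] <: H"
 unfolding H_ops by (rule H_I[OF lin_counit[OF lin_id], of "[(counit U, counit U)]"]) (simp add: counit_simps)

lemma algH [simp, cls]: "complex_algebra H"
proof (rule complex_algebraI[OF vsH H_one_closed])
 show "bilin H H H (%f g. f *[H] g)"
 proof (rule bilinI)
  fix f assume f: "f <: H"
  show "lin H H (%g. f *[H] g)"
  proof (rule lin_HI[OF H_mult_closed[OF f] _ vsH])
   fix u assume u: "u <: U"
   show "lin H cpx (%g. (f *[H] g) u)" unfolding H_eval(1)[OF u]
    by (rule lin_tensor_lift_fun[OF vsU vsU vsH vs_cpx comult_closed[OF u] bilin_H_product[OF f]])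
     (assumption | rule lin_cpx_mult(2) lin_eval lin_id)+
  qed
  show "lin H H (%g. g *[H] f)"
  proof (rule lin_HI[OF H_mult_closed[OF _ f] _ vsH])
   fix u assume u: "u <: U"
   show "lin H cpx (%g. (g *[H] f) u)" unfolding H_eval(1)[OF u]
    by (rule lin_tensor_lift_fun[OF vsU vsU vsH vs_cpx comult_closed[OF u] bilin_H_product[OF _ f]])
     (assumption | rule lin_cpx_mult(1) lin_eval lin_id)+
  qed
 qed
 fix f g h assume f: "f <: H"
 have b1: "bilin U U U (%x y. counit U x .[U] y)" "bilin U U U (%x y. counit U y .[U] x)" by (assumption | rule lins cls)+
 note lf = H_lin[OF f lin_id]
 show "1[H] *[H] f = f"
 proof (rule H_eqI[OF H_mult_closed[OF H_one_closed f] f])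
  fix u assume u: "u <: U"
  have "Sw cpx (%u1 u2. 1[H] u1 * f u2) (comult U u) = Sw cpx (%u1 u2. f (counit U u1 .[U] u2)) (comult U u)"
   by (rule lift_cong) (simp only: H_eval lin_smult[OF lf] cpx_simps)
  also have "\<dots> = f (Sw U (%u1 u2. counit U u1 .[U] u2) (comult U u))"
   by (rule tensor_lift_natural[OF vsU vsU vsU vs_cpx lf b1(1) comult_closed[OF u], symmetric])
  finally show "(1[H] *[H] f) u = f u" unfolding H_eval(1)[OF u] counit_left_U[OF u] .
 qed
 show "f *[H] 1[H] = f"
 proof (rule H_eqI[OF H_mult_closed[OF f H_one_closed] f])
  fix u assume u: "u <: U"
  have "Sw cpx (%u1 u2. f u1 * 1[H] u2) (comult U u) = Sw cpx (%u1 u2. f (counit U u2 .[U] u1)) (comult U u)"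
   by (rule lift_cong) (simp only: H_eval lin_smult[OF lf] cpx_simps mult.commute)
  also have "\<dots> = f (Sw U (%u1 u2. counit U u2 .[U] u1) (comult U u))"
   by (rule tensor_lift_natural[OF vsU vsU vsU vs_cpx lf b1(2) comult_closed[OF u], symmetric])
  finally show "(f *[H] 1[H]) u = f u" unfolding H_eval(1)[OF u] counit_right_U[OF u] .
 qed
 assume g: "g <: H" and h: "h <: H"
 show "(f *[H] g) *[H] h = f *[H] (g *[H] h)"
 proof (rule H_eqI[OF H_mult_closed[OF H_mult_closed[OF f g] h] H_mult_closed[OF f H_mult_closed[OF g h]]])
  fix u assume u: "u <: U"
  have t: "trilin U cpx (%x y z. f x * g y * h z)"
   by (assumption | rule trilinI lin_cpx_mult H_lin[OF f] H_lin[OF g] H_lin[OF h] lin_id)+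
  have "((f *[H] g) *[H] h) u = Sw cpx (%x z. Sw cpx (%x' y. f x' * g y * h z) (comult U x)) (comult U u)"
   unfolding H_eval(1)[OF u]
  proof (rule lift_cong)
   fix x z assume x: "x <: U" and z: "z <: U"
   show "(f *[H] g) x * h z = Sw cpx (%x' y. f x' * g y * h z) (comult U x)"
    unfolding H_eval(1)[OF x]
    by (rule tensor_lift_natural[OF vsU vsU vs_cpx vs_cpx _ bilin_H_product[OF f g] comult_closed[OF x]])
     (rule lin_cpx_mult(1)[OF lin_id])
  qed
  also have "\<dots> = Sw cpx (%x y. Sw cpx (%y' z. f x * g y' * h z) (comult U y)) (comult U u)"
   by (rule coassociative_general[OF vs_cpx t u])
  also have "\<dots> = (f *[H] (g *[H] h)) u"
   unfolding H_eval(1)[OF u]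
  proof (rule lift_cong)
   fix x y assume x: "x <: U" and y: "y <: U"
   show "Sw cpx (%y' z. f x * g y' * h z) (comult U y) = f x * (g *[H] h) y"
    unfolding H_eval(1)[OF y] mult.assoc
    by (rule tensor_lift_natural[OF vsU vsU vs_cpx vs_cpx _ bilin_H_product[OF g h] comult_closed[OF y], symmetric])
     (rule lin_cpx_mult(2)[OF lin_id])
  qed
  finally show "((f *[H] g) *[H] h) u = (f *[H] (g *[H] h)) u" .
 qed
qed

abbreviation "RH \<equiv> tensor_lift H H"

lemma vsHH [simp, cls]: "vs (tensor H H)" by (rule vs_tensor[OF vsH vsH])

lemma bilin_ev2: "u <: U ==> v <: U ==> bilin H H cpx (%f g. f u * g v)"
 by (intro bilinI lin_cpx_mult lin_eval lin_id)

definition "ev2 u v = RH cpx (%f g. f u * g v)"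

lemma lin_ev2 [lins]: "u <: U ==> v <: U ==> lin X (tensor H H) F ==> lin X cpx (%x. ev2 u v (F x))"
 unfolding ev2_def by (rule lin_tensor_lift_arg[OF vsH vsH vs_cpx bilin_ev2])

text \<open>Elements of \<open>V \<otimes> R(L)\<close> are determined by their evaluations at the elements of \<open>U(L)\<close>.\<close>

lemma tensor_H_eqI:
 assumes V: "vs V" and s: "s <: (tensor V H)" and t: "t <: (tensor V H)"
  and eq: "!!u. u <: U ==> tensor_lift V H V (%x f. f u .[V] x) s = tensor_lift V H V (%x f. f u .[V] x) t"
 shows "s = t"
proof (rule tensor_separate[OF V vsH s t, of "(%u f. f u) ` carrier U"])
 show "lin H cpx \<phi>" if "\<phi> \<in> (%u f. f u) ` carrier U" for \<phi> using that by (auto intro: lin_eval[OF _ lin_id])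
 show "f = 0[H]" if f: "f <: H" and z: "!!\<phi>. \<phi> \<in> (%u f. f u) ` carrier U ==> \<phi> f = 0" for f
  by (rule H_eqI[OF f vs_closed(1)[OF vsH]]) (simp add: H_eval z[OF imageI])
qed (use eq in auto)

lemma ev2_eqI:
 assumes s: "s <: (tensor H H)" and t: "t <: (tensor H H)"
  and eq: "!!u v. u <: U ==> v <: U ==> ev2 u v s = ev2 u v t"
 shows "s = t"
proof (rule tensor_H_eqI[OF vsH s t])
 fix v assume v: "v <: U"
 have b: "bilin H H H (%x f. f v .[H] x)"
  by (intro bilinI lin_smult_left[OF vsH] lin_pointwise_smult[OF vsH] lin_eval v lin_id)
 have e: "RH H (%x f. f v .[H] x) r u = ev2 u v r" if r: "r <: (tensor H H)" and u: "u <: U" for r u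
 proof -
  have "RH H (%x f. f v .[H] x) r u = RH cpx (%x f. (f v .[H] x) u) r"
   by (rule tensor_lift_natural[OF vsH vsH vsH vs_cpx lin_eval[OF u lin_id] b r])
  also have "\<dots> = ev2 u v r" unfolding ev2_def
   by (rule lift_cong) (simp only: H_eval[OF u] mult.commute)
  finally show ?thesis .
 qed
 show "RH H (%x f. f v .[H] x) s = RH H (%x f. f v .[H] x) t"
  by (rule H_eqI[OF tensor_lift_closed[OF vsH vsH vsH b s] tensor_lift_closed[OF vsH vsH vsH b t]])
   (simp only: e[OF s] e[OF t] eq v)
qed

lemma tensor_HH_eqI:
 assumes V: "vs V" and s: "s <: (tensor V (tensor H H))" and t: "t <: (tensor V (tensor H H))"
  and eq: "!!u v. u <: U ==> v <: U ==> tensor_lift V (tensor H H) V (%x r. ev2 u v r .[V] x) s =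
   tensor_lift V (tensor H H) V (%x r. ev2 u v r .[V] x) t"
 shows "s = t"
proof (rule tensor_separate[OF V vsHH s t, of "(%(u, v). ev2 u v) ` (carrier U \<times> carrier U)"])
 show "lin (tensor H H) cpx \<phi>" if "\<phi> \<in> (%(u, v). ev2 u v) ` (carrier U \<times> carrier U)" for \<phi>
  using that by (auto intro: lin_ev2[OF _ _ lin_id])
 show "r = 0[tensor H H]" if r: "r <: (tensor H H)"
  and z: "!!\<phi>. \<phi> \<in> (%(u, v). ev2 u v) ` (carrier U \<times> carrier U) ==> \<phi> r = 0" for r
 proof (rule ev2_eqI[OF r vs_closed(1)[OF vsHH]])
  fix u v assume "u <: U" "v <: U"
  then have "ev2 u v r = 0" "ev2 u v 0[tensor H H] = 0"
   using z[OF image_eqI[of _ _ "(u, v)"]] lin_zero[OF vsHH vs_cpx lin_ev2[OF _ _ lin_id]] by auto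
  then show "ev2 u v r = ev2 u v 0[tensor H H]" by (rule HOL.trans[OF _ HOL.sym])
 qed
qed (use eq in auto)

lemma comult_H_eqI:
 assumes t: "t <: (tensor H H)" and eq: "!!u v. u <: U ==> v <: U ==> ev2 u v t = f (u *[U] v)"
 shows "comult H f = t"
 unfolding comult_H_def
proof (rule the_equality)
 show "t <: (tensor H H) \<and> (\<forall>u\<in>carrier U. \<forall>v\<in>carrier U. RH cpx (%f1 f2. f1 u * f2 v) t = f (u *[U] v))"
  using t eq by (simp add: ev2_def)
 fix s assume s: "s <: (tensor H H) \<and> (\<forall>u\<in>carrier U. \<forall>v\<in>carrier U. RH cpx (%f1 f2. f1 u * f2 v) s = f (u *[U] v))"
 show "s = t"
  by (rule ev2_eqI[OF conjunct1[OF s] t]) (simp only: eq, simp only: ev2_def bspec[OF bspec[OF conjunct2[OF s]]])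
qed

lemma list_contraction_HH:
 assumes ps: "set ps \<subseteq> carrier H \<times> carrier H"
 shows "list_contraction (tensor H H) (%f g. f \<boxtimes>[H,H] g) ps <: (tensor H H)"
  and "vs Z ==> bilin H H Z b ==> RH Z b (list_contraction (tensor H H) (%f g. f \<boxtimes>[H,H] g) ps) = list_contraction Z b ps"
 by (rule list_contraction_closed[OF vsHH bilin_pure_tensor[OF vsH vsH] ps])
  (rule list_contraction_map[OF vsHH _ bilin_pure_tensor[OF vsH vsH] tensor_lift_lin[OF vsH vsH] ps tensor_lift_pure[OF vsH vsH]])

lemma comult_H_rank:
 assumes ps: "set ps \<subseteq> carrier H \<times> carrier H" and eq: "!!u v. u <: U ==> v <: U ==> f (u *[U] v) = rank_sum ps u v"
 shows "comult H f = list_contraction (tensor H H) (%f g. f \<boxtimes>[H,H] g) ps"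
proof (rule comult_H_eqI[OF list_contraction_HH(1)[OF ps]])
 fix u v assume u: "u <: U" and v: "v <: U"
 show "ev2 u v (list_contraction (tensor H H) (%f g. f \<boxtimes>[H,H] g) ps) = f (u *[U] v)"
  unfolding ev2_def list_contraction_HH(2)[OF ps vs_cpx bilin_ev2[OF u v]] list_contraction_cpx_rank eq[OF u v] by (rule refl)
qed

lemma comult_H:
 assumes f: "f <: H"
 shows "comult H f <: (tensor H H)" "u <: U ==> v <: U ==> ev2 u v (comult H f) = f (u *[U] v)"
proof -
 obtain ps where ps: "set ps \<subseteq> carrier H \<times> carrier H \<and> (\<forall>u\<in>carrier U. \<forall>v\<in>carrier U. f (u *[U] v) = rank_sum ps u v)"
  using H_decompose[OF f] by (rule exE)
 have ps: "set ps \<subseteq> carrier H \<times> carrier H" "!!u v. u <: U ==> v <: U ==> f (u *[U] v) = rank_sum ps u v"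
  using ps by simp_all
 have c: "comult H f = list_contraction (tensor H H) (%f g. f \<boxtimes>[H,H] g) ps" by (rule comult_H_rank[OF ps])
 show "comult H f <: (tensor H H)" unfolding c by (rule list_contraction_HH(1)[OF ps(1)])
 show "ev2 u v (comult H f) = f (u *[U] v)" if u: "u <: U" and v: "v <: U"
  unfolding c ev2_def list_contraction_HH(2)[OF ps(1) vs_cpx bilin_ev2[OF u v]] list_contraction_cpx_rank ps(2)[OF u v]
  by (rule refl)
qed

lemmas comult_H_closed [cls] = comult_H(1)

lemma lin_comult_H [lins]: assumes F: "lin X H F" shows "lin X (tensor H H) (%x. comult H (F x))"
proof (rule lin_comp[OF _ F], rule linI)
 fix f g c assume f: "f <: H"
 note cf = comult_H[OF f]
 show "comult H f <: (tensor H H)" by (rule cf)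
 show "comult H (c .[H] f) = c .[tensor H H] comult H f"
 proof (rule comult_H_eqI[OF vs_closed(3)[OF vsHH cf(1)]])
  fix u v assume u: "u <: U" and v: "v <: U"
  show "ev2 u v (c .[tensor H H] comult H f) = (c .[H] f) (u *[U] v)"
   by (simp only: lin_smult[OF lin_ev2[OF u v lin_id] cf(1)] cf(2)[OF u v] H_eval alg_closed[OF algU] u v cpx_simps)
 qed
 assume g: "g <: H"
 note cg = comult_H[OF g]
 show "comult H (f +[H] g) = comult H f +[tensor H H] comult H g"
 proof (rule comult_H_eqI[OF vs_closed(2)[OF vsHH cf(1) cg(1)]])
  fix u v assume u: "u <: U" and v: "v <: U"
  show "ev2 u v (comult H f +[tensor H H] comult H g) = (f +[H] g) (u *[U] v)"
   by (simp only: lin_add[OF lin_ev2[OF u v lin_id] cf(1) cg(1)] cf(2)[OF u v] cg(2)[OF u v] H_eval alg_closed[OF algU] u v cpx_simps)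
 qed
qed

lemma ev2_pure: "u <: U ==> v <: U ==> f <: H ==> g <: H ==> ev2 u v (f \<boxtimes>[H,H] g) = f u * g v"
 unfolding ev2_def by (rule tensor_lift_pure[OF vsH vsH vs_cpx bilin_ev2])

text \<open>Evaluation of a bilinear expression in the components of the coproduct.\<close>

lemma RH_comult_cpx:
 "f <: H ==> u <: U ==> v <: U ==> RH cpx (%f1 f2. f1 u * f2 v) (comult H f) = f (u *[U] v)"
 using comult_H(2) unfolding ev2_def by blast

lemma H_lift_eval:
 assumes V: "vs V" and W: "vs W" and b: "bilin V W H b" and t: "t <: (tensor V W)" and u: "u <: U"
 shows "tensor_lift V W H b t u = tensor_lift V W cpx (%v w. b v w u) t"
 by (rule tensor_lift_natural[OF V W vsH vs_cpx lin_eval[OF u lin_id] b t])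

lemma antipode_H_closed: assumes f: "f <: H" shows "antipode H f <: H"
proof -
 obtain ps where ps: "set ps \<subseteq> carrier H \<times> carrier H \<and> (\<forall>u\<in>carrier U. \<forall>v\<in>carrier U. f (u *[U] v) = rank_sum ps u v)"
  using H_decompose[OF f] by (rule exE)
 note ps = bspec[OF bspec[OF conjunct2[OF ps]]]
 have m: "rank_sum (map (%(a, b). (%u. b (antipode U u), %v. a (antipode U v))) ps) u v = rank_sum ps (antipode U v) (antipode U u)" for u v
  by (induction ps) (auto simp: mult.commute)
 show ?thesis unfolding H_hopf_ops
  by (rule H_I[OF H_lin[OF f lin_antipode[OF lin_id]]])
   (simp only: antipode_simps ps antipode_closed m[symmetric])
qed

lemma lin_antipode_H [lins]: assumes F: "lin X H F" shows "lin X H (%x. antipode H (F x))"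
proof (rule lin_comp[OF lin_HI[OF antipode_H_closed _ vsH] F])
 fix u assume u: "u <: U"
 show "lin H cpx (%f. antipode H f u)" unfolding H_eval(6)[OF u] by (rule lin_eval[OF antipode_closed[OF u] lin_id])
qed

lemma comult_H_mult:
 assumes f: "f <: H" and g: "g <: H"
 shows "comult H (f *[H] g) = comult H f *[tensor_alg H H] comult H g"
proof -
 obtain ps where ps: "set ps \<subseteq> carrier H \<times> carrier H \<and> (\<forall>u\<in>carrier U. \<forall>v\<in>carrier U. f (u *[U] v) = rank_sum ps u v)"
  using H_decompose[OF f] by (rule exE)
 obtain qs where qs: "set qs \<subseteq> carrier H \<times> carrier H \<and> (\<forall>u\<in>carrier U. \<forall>v\<in>carrier U. g (u *[U] v) = rank_sum qs u v)"
  using H_decompose[OF g] by (rule exE)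
 have ps: "set ps \<subseteq> carrier H \<times> carrier H" "!!u v. u <: U ==> v <: U ==> f (u *[U] v) = rank_sum ps u v"
  using ps by simp_all
 have qs: "set qs \<subseteq> carrier H \<times> carrier H" "!!u v. u <: U ==> v <: U ==> g (u *[U] v) = rank_sum qs u v"
  using qs by simp_all
 have cf: "comult H f = list_contraction (tensor H H) (%f g. f \<boxtimes>[H,H] g) ps" by (rule comult_H_rank[OF ps])
 have cg: "comult H g = list_contraction (tensor H H) (%f g. f \<boxtimes>[H,H] g) qs" by (rule comult_H_rank[OF qs])
 have rp: "Sw cpx (%x y. f x * g y) (comult U (u *[U] v)) =
  rank_sum (map (%z. (fst (fst z) *[H] fst (snd z), snd (fst z) *[H] snd (snd z))) (List.product ps qs)) u v"
  if "u <: U" "v <: U" for u v by (rule rank_product[OF f g ps qs that])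
 note algHH = complex_algebra_tensor(1)[OF algH algH]
 have mc: "comult H f *[tensor_alg H H] comult H g <: (tensor H H)"
  using alg_closed(2)[OF algHH] comult_H(1)[OF f] comult_H(1)[OF g] by simp
 show ?thesis
 proof (rule comult_H_eqI[OF mc])
  fix u v assume u: "u <: U" and v: "v <: U"
  have b2: "bilin H H cpx (%c c'. (a *[H] c) u * (a' *[H] c') v)" if "a <: H" "a' <: H" for a a'
   by (assumption | rule that u v bilinI lin_cpx_mult lin_eval lin_alg_mult algH lin_id)+
  have b3: "bilin H H cpx (%a a'. RH cpx (%c c'. (a *[H] c) u * (a' *[H] c') v) (comult H g))"
   by (assumption | rule b2 u v g bilinI lin_tensor_lift_fun[OF vsH vsH] cls lin_cpx_mult lin_eval lin_alg_mult lin_id)+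
  have rank: "list_contraction cpx (%c c'. h c * k c') qs = (\<Sum>q\<leftarrow>qs. h (fst q) * k (snd q))" for h k and qs :: "(('a uea \<Rightarrow> complex) \<times> ('a uea \<Rightarrow> complex)) list"
   by (simp add: list_contraction_cpx case_prod_unfold)
  have "ev2 u v (comult H f *[tensor_alg H H] comult H g) =
    RH cpx (%a a'. RH cpx (%c c'. (a *[H] c) u * (a' *[H] c') v) (comult H g)) (comult H f)"
   unfolding ev2_def
   by (rule tensor_lift_mult[OF algH algH vs_cpx bilin_ev2[OF u v] comult_H(1)[OF f] comult_H(1)[OF g]])
  also have "\<dots> = list_contraction cpx (%a a'. RH cpx (%c c'. (a *[H] c) u * (a' *[H] c') v) (comult H g)) ps"
   unfolding cf by (rule list_contraction_HH(2)[OF ps(1) vs_cpx b3])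
  also have "\<dots> = (\<Sum>p\<leftarrow>ps. RH cpx (%c c'. (fst p *[H] c) u * (snd p *[H] c') v) (comult H g))"
   by (simp add: list_contraction_cpx case_prod_unfold)
  also have "\<dots> = (\<Sum>p\<leftarrow>ps. \<Sum>q\<leftarrow>qs. (fst p *[H] fst q) u * (snd p *[H] snd q) v)"
  proof (rule arg_cong[of _ _ sum_list], rule map_cong[OF refl])
   fix p assume "p \<in> set ps"
   then have p: "fst p <: H" "snd p <: H" using subsetD[OF ps(1)] by (simp_all add: mem_Times_iff)
   show "RH cpx (%c c'. (fst p *[H] c) u * (snd p *[H] c') v) (comult H g) =
     (\<Sum>q\<leftarrow>qs. (fst p *[H] fst q) u * (snd p *[H] snd q) v)"
    unfolding cg list_contraction_HH(2)[OF qs(1) vs_cpx b2[OF p]] list_contraction_cpx case_prod_unfold by (rule refl)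
  qed
  also have "\<dots> = (\<Sum>z\<leftarrow>List.product ps qs. (fst (fst z) *[H] fst (snd z)) u * (snd (fst z) *[H] snd (snd z)) v)"
   using sum_list_product[of "%p q. (fst p *[H] fst q) u * (snd p *[H] snd q) v" ps qs] by (simp add: case_prod_unfold)
  also have "\<dots> = (f *[H] g) (u *[U] v)"
   unfolding H_eval(1)[OF alg_closed(2)[OF algU u v]] rp[OF u v] rank_sum_map by (rule refl)
  finally show "ev2 u v (comult H f *[tensor_alg H H] comult H g) = (f *[H] g) (u *[U] v)" .
 qed
qed

lemma counit_H_hom: "counit H \<in> complex_alg_hom H cpx"
proof (rule alg_homI)
 show "lin H cpx (counit H)" unfolding H_hopf_ops[abs_def] by (rule lin_eval[OF alg_closed(1)[OF algU] lin_id])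
 show "counit H 1[H] = 1[cpx]" by (simp add: H_hopf_ops H_eval counit_simps algU)
 fix f g assume f: "f <: H" and g: "g <: H"
 show "counit H (f *[H] g) = counit H f *[cpx] counit H g"
  unfolding H_hopf_ops H_eval(1)[OF alg_closed(1)[OF algU]] Sw_one[OF vs_cpx bilin_H_product[OF f g]] by simp
qed

lemma hopf_algebra_rep: "hopf_algebra H"
proof (intro hopf_algebra.intro hopf_algebra_axioms.intro)
 note one = alg_closed(1)[OF algU]
 show "complex_algebra H" by (rule algH)
 show "comult H \<in> complex_alg_hom H (tensor_alg H H)"
 proof (rule alg_homI)
  show "lin H (tensor_alg H H) (comult H)" unfolding lin_tensor_alg_iff by (rule lin_comult_H[OF lin_id])
  have "comult H 1[H] = 1[H] \<boxtimes>[H,H] 1[H]"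
   by (rule comult_H_eqI[OF pure_tensor_closed[OF vsH vsH H_one_closed H_one_closed]])
    (simp add: ev2_pure H_one_closed H_eval counit_simps algU)
  then show "comult H 1[H] = 1[tensor_alg H H]" by simp
 qed (rule comult_H_mult)
 show "counit H \<in> complex_alg_hom H cpx" by (rule counit_H_hom)
 show "lin H H (antipode H)" by (rule lin_antipode_H[OF lin_id])
 fix f assume f: "f <: H"
 note cf = comult_H(1)[OF f]
 let ?Z = "tensor H (tensor H H)"
 have Z: "vs ?Z" by (rule vs_tensor[OF vsH vsHH])
 have i: "bilin H H ?Z (%x' y. x' \<boxtimes>[H,tensor H H] (y \<boxtimes>[H,H] z))" if "z <: H" for z
  by (assumption | rule that lins cls)+
 have l: "bilin H H ?Z (%x z. RH ?Z (%x' y. x' \<boxtimes>[H,tensor H H] (y \<boxtimes>[H,H] z)) (comult H x))"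
  by (assumption | rule lins cls)+
 have r: "bilin H H ?Z (%x y. x \<boxtimes>[H,tensor H H] comult H y)" by (assumption | rule lins cls)+
 show "sweedler H ?Z (%x z. sweedler H ?Z (%x' y. x' \<boxtimes>[H,tensor H H] (y \<boxtimes>[H,H] z)) x) f =
   sweedler H ?Z (%x y. x \<boxtimes>[H,tensor H H] comult H y) f"
  unfolding sweedler_def
 proof (rule tensor_HH_eqI[OF vsH tensor_lift_closed[OF vsH vsH Z l cf] tensor_lift_closed[OF vsH vsH Z r cf]])
  fix v w assume v: "v <: U" and w: "w <: U"
  let ?e = "%x r. ev2 v w r .[H] x" and ?E = "tensor_lift H (tensor H H) H (%x r. ev2 v w r .[H] x)"
  have e: "bilin H (tensor H H) H ?e" by (assumption | rule v w lins cls)+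
  note E = tensor_lift_lin[OF vsH vsHH vsH e]
  have "?E (RH ?Z (%x z. RH ?Z (%x' y. x' \<boxtimes>[H,tensor H H] (y \<boxtimes>[H,H] z)) (comult H x)) (comult H f)) =
    RH H (%x z. ?E (RH ?Z (%x' y. x' \<boxtimes>[H,tensor H H] (y \<boxtimes>[H,H] z)) (comult H x))) (comult H f)"
   by (rule tensor_lift_natural[OF vsH vsH Z vsH E l cf])
  also have "\<dots> = RH H (%x z. RH H (%x' y. (y v * z w) .[H] x') (comult H x)) (comult H f)"
  proof (rule lift_cong)
   fix x z assume x: "x <: H" and z: "z <: H"
   have "?E (RH ?Z (%x' y. x' \<boxtimes>[H,tensor H H] (y \<boxtimes>[H,H] z)) (comult H x)) =
     RH H (%x' y. ?E (x' \<boxtimes>[H,tensor H H] (y \<boxtimes>[H,H] z))) (comult H x)"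
    by (rule tensor_lift_natural[OF vsH vsH Z vsH E i[OF z] comult_H(1)[OF x]])
   also have "\<dots> = RH H (%x' y. (y v * z w) .[H] x') (comult H x)"
    by (rule lift_cong)
     (simp only: tensor_lift_pure[OF vsH vsHH vsH e] pure_tensor_closed[OF vsH vsH] z ev2_pure v w)
   finally show "?E (RH ?Z (%x' y. x' \<boxtimes>[H,tensor H H] (y \<boxtimes>[H,H] z)) (comult H x)) =
    RH H (%x' y. (y v * z w) .[H] x') (comult H x)" .
  qed
  finally have L: "?E (RH ?Z (%x z. RH ?Z (%x' y. x' \<boxtimes>[H,tensor H H] (y \<boxtimes>[H,H] z)) (comult H x)) (comult H f)) =
   RH H (%x z. RH H (%x' y. (y v * z w) .[H] x') (comult H x)) (comult H f)" .
  have R: "?E (RH ?Z (%x y. x \<boxtimes>[H,tensor H H] comult H y) (comult H f)) = RH H (%x y. y (v *[U] w) .[H] x) (comult H f)"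
   unfolding tensor_lift_natural[OF vsH vsH Z vsH E r cf]
   by (rule lift_cong)
    (simp only: tensor_lift_pure[OF vsH vsHH vsH e] comult_H v w)
  have bl: "bilin H H H (%x z. RH H (%x' y. (y v * z w) .[H] x') (comult H x))"
   by (assumption | rule v w lins cls lin_eval)+
  have bi: "bilin H H H (%x' y. (y v * z w) .[H] x')" for z by (assumption | rule v w lins cls lin_eval)+
  have br: "bilin H H H (%x y. y (v *[U] w) .[H] x)" by (assumption | rule v w lins cls lin_eval)+
  have "RH H (%x z. RH H (%x' y. (y v * z w) .[H] x') (comult H x)) (comult H f) = RH H (%x y. y (v *[U] w) .[H] x) (comult H f)"
  proof (rule H_eqI[OF tensor_lift_closed[OF vsH vsH vsH bl cf] tensor_lift_closed[OF vsH vsH vsH br cf]])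
   fix u assume u: "u <: U"
   have "RH H (%x z. RH H (%x' y. (y v * z w) .[H] x') (comult H x)) (comult H f) u = RH cpx (%x z. x (u *[U] v) * z w) (comult H f)"
    unfolding H_lift_eval[OF vsH vsH bl cf u]
   proof (rule lift_cong)
    fix x z assume x: "x <: H" and z: "z <: H"
    have "RH H (%x' y. (y v * z w) .[H] x') (comult H x) u = RH cpx (%x' y. (x' u * y v) * z w) (comult H x)"
     unfolding H_lift_eval[OF vsH vsH bi comult_H(1)[OF x] u]
     by (rule lift_cong) (simp add: H_eval[OF u])
    also have "\<dots> = RH cpx (%x' y. x' u * y v) (comult H x) * z w"
     by (rule tensor_lift_natural[OF vsH vsH vs_cpx vs_cpx lin_cpx_mult(1)[OF lin_id] bilin_ev2[OF u v] comult_H(1)[OF x], symmetric])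
    finally show "RH H (%x' y. (y v * z w) .[H] x') (comult H x) u = x (u *[U] v) * z w"
     unfolding RH_comult_cpx[OF x u v] .
   qed
   also have "\<dots> = f ((u *[U] v) *[U] w)" by (rule RH_comult_cpx[OF f alg_closed(2)[OF algU u v] w])
   also have "\<dots> = f (u *[U] (v *[U] w))" by (simp only: alg_assoc[OF algU u v w])
   also have "\<dots> = RH cpx (%x y. x u * y (v *[U] w)) (comult H f)" by (rule RH_comult_cpx[OF f u alg_closed(2)[OF algU v w], symmetric])
   also have "\<dots> = RH H (%x y. y (v *[U] w) .[H] x) (comult H f) u"
    unfolding H_lift_eval[OF vsH vsH br cf u]
    by (rule lift_cong) (simp add: H_eval[OF u])
   finally show "RH H (%x z. RH H (%x' y. (y v * z w) .[H] x') (comult H x)) (comult H f) u =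
    RH H (%x y. y (v *[U] w) .[H] x) (comult H f) u" .
  qed
  then show "?E (RH ?Z (%x z. RH ?Z (%x' y. x' \<boxtimes>[H,tensor H H] (y \<boxtimes>[H,H] z)) (comult H x)) (comult H f)) =
   ?E (RH ?Z (%x y. x \<boxtimes>[H,tensor H H] comult H y) (comult H f))" unfolding L R .
 qed
 have b1: "bilin H H H (%x y. counit H x .[H] y)" and b2: "bilin H H H (%x y. counit H y .[H] x)"
  unfolding H_hopf_ops by (assumption | rule one lins cls lin_eval)+
 have b3: "bilin H H H (%x y. antipode H x *[H] y)" and b4: "bilin H H H (%x y. x *[H] antipode H y)"
  by ((assumption | rule bilinI lin_alg_mult algH antipode_H_closed lin_antipode_H lin_id)+)
 show "sweedler H H (%x y. counit H x .[H] y) f = f" unfolding sweedler_def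
 proof (rule H_eqI[OF tensor_lift_closed[OF vsH vsH vsH b1 cf] f])
  fix u assume u: "u <: U"
  have "RH H (%x y. counit H x .[H] y) (comult H f) u = RH cpx (%x y. x 1[U] * y u) (comult H f)"
   unfolding H_lift_eval[OF vsH vsH b1 cf u]
   by (rule lift_cong) (simp only: H_eval[OF u] H_hopf_ops)
  also have "\<dots> = f (1[U] *[U] u)" by (rule RH_comult_cpx[OF f one u])
  finally show "RH H (%x y. counit H x .[H] y) (comult H f) u = f u" unfolding alg_unit(1)[OF algU u] .
 qed
 show "sweedler H H (%x y. counit H y .[H] x) f = f" unfolding sweedler_def
 proof (rule H_eqI[OF tensor_lift_closed[OF vsH vsH vsH b2 cf] f])
  fix u assume u: "u <: U"
  have "RH H (%x y. counit H y .[H] x) (comult H f) u = RH cpx (%x y. x u * y 1[U]) (comult H f)"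
   unfolding H_lift_eval[OF vsH vsH b2 cf u]
   by (rule lift_cong) (simp only: H_eval[OF u] H_hopf_ops mult.commute)
  also have "\<dots> = f (u *[U] 1[U])" by (rule RH_comult_cpx[OF f u one])
  finally show "RH H (%x y. counit H y .[H] x) (comult H f) u = f u" unfolding alg_unit(2)[OF algU u] .
 qed
 note lf = H_lin[OF f lin_id]
 have ev: "(counit H f .[H] 1[H]) u = f (counit U u .[U] 1[U])" if u: "u <: U" for u
  by (simp only: H_eval[OF u] H_hopf_ops lin_smult[OF lf one] cpx_simps mult.commute)
 have c1: "counit H f .[H] 1[H] <: H" by (intro vs_closed[OF vsH] H_one_closed)
 have bS: "bilin U U U (%x y. antipode U x *[U] y)" "bilin U U U (%x y. x *[U] antipode U y)"
  by (assumption | rule lins cls)+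
 show "sweedler H H (%x y. antipode H x *[H] y) f = counit H f .[H] 1[H]" unfolding sweedler_def
 proof (rule H_eqI[OF tensor_lift_closed[OF vsH vsH vsH b3 cf] c1])
  fix u assume u: "u <: U"
  note cu = comult_closed[OF u]
  have "RH H (%x y. antipode H x *[H] y) (comult H f) u = RH cpx (%x y. Sw cpx (%u1 u2. x (antipode U u1) * y u2) (comult U u)) (comult H f)"
   unfolding H_lift_eval[OF vsH vsH b3 cf u]
  proof (rule lift_cong)
   fix x y
   show "(antipode H x *[H] y) u = Sw cpx (%u1 u2. x (antipode U u1) * y u2) (comult U u)"
    unfolding H_eval(1)[OF u] by (rule lift_cong) (simp only: H_eval)
  qed
  also have "\<dots> = Sw cpx (%u1 u2. RH cpx (%x y. x (antipode U u1) * y u2) (comult H f)) (comult U u)"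
   by (rule tensor_lift_swap[OF vsH vsH vsU vsU vs_cpx cf cu])
    ((assumption | rule bilinI lin_cpx_mult lin_eval lin_id antipode_closed lin_antipode H_lin)+)
  also have "\<dots> = Sw cpx (%u1 u2. f (antipode U u1 *[U] u2)) (comult U u)"
   by (rule lift_cong) (rule RH_comult_cpx[OF f antipode_closed])
  also have "\<dots> = f (Sw U (%u1 u2. antipode U u1 *[U] u2) (comult U u))"
   by (rule tensor_lift_natural[OF vsU vsU vsU vs_cpx lf bS(1) cu, symmetric])
  finally show "RH H (%x y. antipode H x *[H] y) (comult H f) u = (counit H f .[H] 1[H]) u"
   unfolding ev[OF u] antipode_left_U[OF u] .
 qed
 show "sweedler H H (%x y. x *[H] antipode H y) f = counit H f .[H] 1[H]" unfolding sweedler_def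
 proof (rule H_eqI[OF tensor_lift_closed[OF vsH vsH vsH b4 cf] c1])
  fix u assume u: "u <: U"
  note cu = comult_closed[OF u]
  have "RH H (%x y. x *[H] antipode H y) (comult H f) u = RH cpx (%x y. Sw cpx (%u1 u2. x u1 * y (antipode U u2)) (comult U u)) (comult H f)"
   unfolding H_lift_eval[OF vsH vsH b4 cf u]
  proof (rule lift_cong)
   fix x y
   show "(x *[H] antipode H y) u = Sw cpx (%u1 u2. x u1 * y (antipode U u2)) (comult U u)"
    unfolding H_eval(1)[OF u] by (rule lift_cong) (simp only: H_eval)
  qed
  also have "\<dots> = Sw cpx (%u1 u2. RH cpx (%x y. x u1 * y (antipode U u2)) (comult H f)) (comult U u)"
   by (rule tensor_lift_swap[OF vsH vsH vsU vsU vs_cpx cf cu])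
    ((assumption | rule bilinI lin_cpx_mult lin_eval lin_id antipode_closed lin_antipode H_lin)+)
  also have "\<dots> = Sw cpx (%u1 u2. f (u1 *[U] antipode U u2)) (comult U u)"
   by (rule lift_cong) (rule RH_comult_cpx[OF f _ antipode_closed])
  also have "\<dots> = f (Sw U (%u1 u2. u1 *[U] antipode U u2) (comult U u))"
   by (rule tensor_lift_natural[OF vsU vsU vsU vs_cpx lf bS(2) cu, symmetric])
  finally show "RH H (%x y. x *[H] antipode H y) (comult H f) u = (counit H f .[H] 1[H]) u"
   unfolding ev[OF u] antipode_right_U[OF u] .
 qed
qed

end

section \<open>Coordinates survive in the enveloping algebra\<close>

fun inversions :: "nat list \<Rightarrow> nat" where
 "inversions [] = 0"
| "inversions (x # xs) = length (filter (%y. y < x) xs) + inversions xs"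

lemma inversions_swap: "b < a ==> inversions (u @ b # a # v) < inversions (u @ a # b # v)"
 by (induction u) auto

definition descent :: "nat list \<Rightarrow> nat list \<times> nat \<times> nat \<times> nat list \<Rightarrow> bool" where
 "descent w = (%(u, a, b, v). w = u @ a # b # v \<and> b < a)"

lemma descent_smaller:
 assumes "descent w (u, a, b, v)"
 shows "length (u @ b # a # v) = length w" "inversions (u @ b # a # v) < inversions w" "length (u @ c # v) < length w"
 using assms inversions_swap[of b a u v] by (auto simp: descent_def)

locale structure_constants =
 fixes \<gamma> :: "nat \<Rightarrow> nat \<Rightarrow> nat \<Rightarrow> complex" and N :: nat
 assumes antisym: "\<gamma> b a c = - \<gamma> a b c"
  and jac: "(\<Sum>d<N. \<gamma> a b d * \<gamma> d c e + \<gamma> b c d * \<gamma> d a e + \<gamma> c a d * \<gamma> d b e) = 0"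
begin

function lam :: "nat \<Rightarrow> nat list \<Rightarrow> complex" where
 "lam k w = (if Ex (descent w) then (case Eps (descent w) of (u, a, b, v) \<Rightarrow>
   if descent w (u, a, b, v) then lam k (u @ b # a # v) + (\<Sum>c<N. \<gamma> a b c * lam k (u @ c # v)) else 0)
  else if w = [k] then 1 else 0)"
 by auto
termination
 by (relation "measures [%(k, w). length w, %(k, w). inversions w]")
  (simp_all only: wf_measures in_measures prod.case descent_smaller less_irrefl simp_thms, metis descent_smaller(3))

declare lam.simps [simp del]

abbreviation "red k u a b v \<equiv> lam k (u @ b # a # v) + (\<Sum>c<N. \<gamma> a b c * lam k (u @ c # v))"

lemma lam_descent:
 assumes d: "descent w p" and q: "Eps (descent w) = (u, a, b, v)"
 shows "w = u @ a # b # v" "b < a" "lam k w = red k u a b v"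
proof -
 have e: "Ex (descent w)" using d by (rule exI)
 have "descent w (u, a, b, v)" using someI_ex[OF e] unfolding q .
 then show "w = u @ a # b # v" "b < a" "lam k w = red k u a b v"
  unfolding lam.simps[of k w] if_P[OF e] q by (simp_all add: descent_def)
qed

lemma lam_single: "lam k [i] = (if i = k then 1 else 0)"
proof -
 have "\<not> Ex (descent [i])" by (auto simp: descent_def Cons_eq_append_conv)
 then show ?thesis unfolding lam.simps[of k "[i]"] by simp
qed

definition smaller :: "nat list \<Rightarrow> nat list \<Rightarrow> bool" where
 "smaller w' w \<longleftrightarrow> (w', w) \<in> measures [length, inversions]"

lemma smaller_iff: "smaller w' w \<longleftrightarrow> length w' < length w \<or> length w' = length w \<and> inversions w' < inversions w"
 by (auto simp: smaller_def)

definition confluent_below :: "nat \<Rightarrow> nat list \<Rightarrow> bool" where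
 "confluent_below k w \<longleftrightarrow> (\<forall>u a b v. b < a \<longrightarrow> smaller (u @ a # b # v) w \<longrightarrow> lam k (u @ a # b # v) = red k u a b v)"

lemma confluent_belowD:
 "confluent_below k w ==> b < a ==> smaller (u @ a # b # v) w ==> lam k (u @ a # b # v) = red k u a b v"
 by (simp add: confluent_below_def)

lemma red_any_order:
 assumes "!!a b. b < a ==> P a b ==> lam k (u @ a # b # v) = red k u a b v" "P a b" "P b a"
 shows "lam k (u @ a # b # v) = red k u a b v"
proof (cases a b rule: linorder_cases)
 case less
 then have "lam k (u @ b # a # v) = red k u b a v" using assms(1,3) by simp
 moreover have "(\<Sum>c<N. \<gamma> b a c * lam k (u @ c # v)) = - (\<Sum>c<N. \<gamma> a b c * lam k (u @ c # v))"
  by (simp add: antisym[of b a] sum_negf)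
 ultimately show ?thesis by simp
next
 case equal
 have "\<gamma> b b c = 0" for c using antisym[of b b c] by simp
 then show ?thesis using equal by simp
qed (use assms(1,2) in simp)

lemma confluent_below_shorter:
 assumes "confluent_below k w" "length (u @ a # b # v) < length w" shows "lam k (u @ a # b # v) = red k u a b v"
 by (rule red_any_order[where P = "%a b. length (u @ a # b # v) < length w"])
  (use assms confluent_belowD[OF assms(1)] in \<open>auto simp: smaller_iff\<close>)

lemma red_disjoint:
 assumes c: "confluent_below k w" and w: "w = u @ a # b # m @ a' # b' # v" and ab: "b < a" "b' < a'"
 shows "red k u a b (m @ a' # b' # v) = red k (u @ a # b # m) a' b' v"
proof -
 have s: "smaller (u @ b # a # m @ a' # b' # v) w" "smaller (u @ a # b # m @ b' # a' # v) w"
  using inversions_swap[OF ab(1), of u "m @ a' # b' # v"] inversions_swap[OF ab(2), of "u @ a # b # m" v]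
  by (simp_all add: smaller_iff w)
 have 1: "lam k (u @ b # a # m @ a' # b' # v) = red k (u @ b # a # m) a' b' v"
  using confluent_belowD[OF c ab(2), of "u @ b # a # m" v] s(1) by simp
 have 2: "lam k (u @ d # m @ a' # b' # v) = red k (u @ d # m) a' b' v" for d
  using confluent_below_shorter[OF c, of "u @ d # m" a' b' v] by (simp add: w)
 have 3: "lam k (u @ a # b # m @ b' # a' # v) = red k u a b (m @ b' # a' # v)"
  using confluent_belowD[OF c ab(1), of u "m @ b' # a' # v"] s(2) by simp
 have 4: "lam k (u @ a # b # m @ d # v) = red k u a b (m @ d # v)" for d
  using confluent_below_shorter[OF c, of u a b "m @ d # v"] by (simp add: w)
 have "(\<Sum>c<N. \<Sum>d<N. \<gamma> a b c * (\<gamma> a' b' d * lam k (u @ c # m @ d # v))) =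
   (\<Sum>d<N. \<Sum>c<N. \<gamma> a' b' d * (\<gamma> a b c * lam k (u @ c # m @ d # v)))"
  by (subst sum.swap) (simp only: mult.left_commute)
 then show ?thesis
  by (simp add: 1 2 3 4 distrib_left sum.distrib sum_distrib_left)
qed

text \<open>The only place where the Jacobi identity enters: a word \<open>a b c\<close> with \<open>a > b > c\<close> can be
 sorted starting with either pair of neighbours.\<close>

lemma red_overlap:
 assumes cf: "confluent_below k w" and w: "w = u @ a # b # c # v" and ab: "b < a" "c < b"
 shows "red k u a b (c # v) = red k (u @ [a]) b c v"
proof -
 let ?l = "%xs. lam k (u @ xs @ v)"
 have ca: "c < a" using ab by simp
 note i = inversions_swap[OF ab(1), of u "c # v"] inversions_swap[OF ca, of "u @ [b]" v]
  inversions_swap[OF ab(2), of "u @ [a]" v] inversions_swap[OF ca, of u "b # v"]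
 have 1: "?l [b, a, c] = ?l [b, c, a] + (\<Sum>d<N. \<gamma> a c d * ?l [b, d])"
  using confluent_belowD[OF cf ca, of "u @ [b]" v] i by (simp add: smaller_iff w)
 have 2: "?l [b, c, a] = ?l [c, b, a] + (\<Sum>d<N. \<gamma> b c d * ?l [d, a])"
  using confluent_belowD[OF cf ab(2), of u "a # v"] i by (simp add: smaller_iff w)
 have 3: "?l [a, c, b] = ?l [c, a, b] + (\<Sum>d<N. \<gamma> a c d * ?l [d, b])"
  using confluent_belowD[OF cf ca, of u "b # v"] i by (simp add: smaller_iff w)
 have 4: "?l [c, a, b] = ?l [c, b, a] + (\<Sum>d<N. \<gamma> a b d * ?l [c, d])"
  using confluent_belowD[OF cf ab(1), of "u @ [c]" v] i by (simp add: smaller_iff w)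
 have 5: "?l [x, y] - ?l [y, x] = (\<Sum>e<N. \<gamma> x y e * ?l [e])" for x y
  using confluent_below_shorter[OF cf, of u x y v] by (simp add: w)
 have "(\<Sum>d<N. \<gamma> a b d * (?l [d, c] - ?l [c, d]) + \<gamma> b c d * (?l [d, a] - ?l [a, d]) + \<gamma> c a d * (?l [d, b] - ?l [b, d])) =
   (\<Sum>d<N. \<Sum>e<N. (\<gamma> a b d * \<gamma> d c e + \<gamma> b c d * \<gamma> d a e + \<gamma> c a d * \<gamma> d b e) * ?l [e])"
  unfolding 5 by (simp add: sum_distrib_left sum.distrib[symmetric] algebra_simps)
 also have "\<dots> = (\<Sum>e<N. (\<Sum>d<N. \<gamma> a b d * \<gamma> d c e + \<gamma> b c d * \<gamma> d a e + \<gamma> c a d * \<gamma> d b e) * ?l [e])"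
  by (subst sum.swap) (simp only: sum_distrib_right)
 also have "\<dots> = 0" by (simp only: jac mult_zero_left sum.neutral_const)
 finally have J: "(\<Sum>d<N. \<gamma> a b d * (?l [d, c] - ?l [c, d])) + (\<Sum>d<N. \<gamma> b c d * (?l [d, a] - ?l [a, d])) +
   (\<Sum>d<N. \<gamma> a c d * (?l [b, d] - ?l [d, b])) = 0"
  unfolding antisym[of c a] by (simp add: sum.distrib sum_subtractf algebra_simps)
 then have "?l [b, a, c] + (\<Sum>d<N. \<gamma> a b d * ?l [d, c]) = ?l [a, c, b] + (\<Sum>d<N. \<gamma> b c d * ?l [a, d])"
  unfolding 1 2 3 4 by (simp add: right_diff_distrib sum_subtractf algebra_simps)
 then show ?thesis by simp
qed

lemma descent_positions:
 assumes "u @ a # b # v = u' @ a' # b' # v'" "length u < length u'"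
 shows "u' = u @ [a] \<and> a' = b \<and> v = b' # v' \<or> (\<exists>m. u' = u @ a # b # m \<and> v = m @ a' # b' # v')"
proof -
 have "length u \<le> length u'" using assms(2) by simp
 then have x: "u = take (length u) u'" "a # b # v = drop (length u) u' @ a' # b' # v'"
  using assms(1) by (simp_all add: append_eq_append_conv_if)
 define x where "x = drop (length u) u'"
 have x: "u' = u @ x" "a # b # v = x @ a' # b' # v'"
  using append_take_drop_id[of "length u" u'] unfolding x(1)[symmetric] x(2) x_def by simp_all
 then obtain y where y: "x = a # y" using assms(2) by (cases x) auto
 show ?thesis using x y by (cases y) auto
qed

lemma red_independent:
 assumes c: "confluent_below k w" and w: "w = u @ a # b # v" "w = u' @ a' # b' # v'" and ab: "b < a" "b' < a'"
 shows "red k u a b v = red k u' a' b' v'"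
proof -
 have less: "red k u a b v = red k u' a' b' v'"
  if "length u < length u'" "w = u @ a # b # v" "w = u' @ a' # b' # v'" "b < a" "b' < a'" for u a b v u' a' b' v'
 proof -
  have "u @ a # b # v = u' @ a' # b' # v'" using that(2,3) by simp
  from descent_positions[OF this that(1)] show ?thesis
  proof (elim disjE conjE exE)
   assume "u' = u @ [a]" "a' = b" "v = b' # v'"
   then show ?thesis using red_overlap[OF c _ that(4), of u b' v'] that by simp
  next
   fix m assume "u' = u @ a # b # m" "v = m @ a' # b' # v'"
   then show ?thesis using red_disjoint[OF c _ that(4,5), of u m v'] that by simp
  qed
 qed
 show ?thesis
 proof (cases "length u" "length u'" rule: linorder_cases)
  case equal then show ?thesis using w by simp
 next
  case sm: less show ?thesis by (rule less[OF sm w ab])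
 next
  case greater show ?thesis by (rule less[OF greater w(2,1) ab(2,1), symmetric])
 qed
qed

lemma lam_relation: "lam k (u @ a # b # v) = red k u a b v"
proof -
 have "b < a \<longrightarrow> w = u @ a # b # v \<longrightarrow> lam k w = red k u a b v" for w u a b v
 proof (induction w arbitrary: u a b v rule: wf_induct_rule[OF wf_measures, of "[length, inversions]"])
  case (1 w)
  then have c: "confluent_below k w" unfolding confluent_below_def smaller_def by blast
  show ?case
  proof (intro impI)
   assume ab: "b < a" and w: "w = u @ a # b # v"
   have "descent w (u, a, b, v)" using ab w by (simp add: descent_def)
   moreover obtain u' a' b' v' where "Eps (descent w) = (u', a', b', v')" by (cases "Eps (descent w)")
   ultimately have w': "w = u' @ a' # b' # v'" "b' < a'" "lam k w = red k u' a' b' v'" by (rule lam_descent)+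
   show "lam k w = red k u a b v" unfolding w'(3) by (rule red_independent[OF c w'(1) w w'(2) ab])
  qed
 qed
 note m = mp[OF mp[OF this] refl]
 show ?thesis by (rule red_any_order[where P = "%a b. True"]; (rule TrueI | rule m, assumption))
qed

text \<open>Functions on words that respect the relations of the enveloping algebra, i.e. its dual space.\<close>

definition dual_space :: "(complex, nat list \<Rightarrow> complex) module" where
 "dual_space = \<lparr>carrier = {m. \<forall>u a b v. m (u @ a # b # v) = m (u @ b # a # v) + (\<Sum>c<N. \<gamma> a b c * m (u @ c # v))},
  mult = undefined, one = undefined, zero = (%_. 0), add = (%m n w. m w + n w), smult = (%c m w. c * m w)\<rparr>"

lemma dual_space_iff:
 "m <: dual_space \<longleftrightarrow> (\<forall>u a b v. m (u @ a # b # v) = m (u @ b # a # v) + (\<Sum>c<N. \<gamma> a b c * m (u @ c # v)))"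
 by (simp add: dual_space_def)

lemma dual_space_simps [simp]:
 "0[dual_space] = (%_. 0)" "m +[dual_space] n = (%w. m w + n w)" "c .[dual_space] m = (%w. c * m w)"
 by (simp_all add: dual_space_def)

lemma dual_space_combine:
 assumes m: "m <: dual_space" and n: "n <: dual_space" shows "(%w. c * m w + d * n w) <: dual_space"
proof -
 have "c * m (u @ a # b # v) + d * n (u @ a # b # v) = (c * m (u @ b # a # v) + d * n (u @ b # a # v)) +
   (\<Sum>e<N. \<gamma> a b e * (c * m (u @ e # v) + d * n (u @ e # v)))" for u a b v
 proof -
  have e: "m (u @ a # b # v) = m (u @ b # a # v) + (\<Sum>c<N. \<gamma> a b c * m (u @ c # v))"
   "n (u @ a # b # v) = n (u @ b # a # v) + (\<Sum>c<N. \<gamma> a b c * n (u @ c # v))"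
   by (rule m[unfolded dual_space_iff, rule_format], rule n[unfolded dual_space_iff, rule_format])
  have "(\<Sum>e<N. \<gamma> a b e * (c * m (u @ e # v) + d * n (u @ e # v))) =
    c * (\<Sum>e<N. \<gamma> a b e * m (u @ e # v)) + d * (\<Sum>e<N. \<gamma> a b e * n (u @ e # v))"
   by (simp add: sum_distrib_left sum.distrib[symmetric] algebra_simps)
  then show ?thesis unfolding e by (simp add: distrib_left)
 qed
 then show ?thesis unfolding dual_space_iff by (intro allI)
qed

lemma vs_dual_space: "vs dual_space"
proof (rule vsI)
 fix m n assume m: "m <: dual_space"
 show "c .[dual_space] m <: dual_space" for c using dual_space_combine[OF m m, of c 0] by simp
 assume n: "n <: dual_space"
 show "m +[dual_space] n <: dual_space" using dual_space_combine[OF m n, of 1 1] by simp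
 fix l show "m +[dual_space] n +[dual_space] l = m +[dual_space] (n +[dual_space] l)"
  by (simp add: algebra_simps)
qed (simp_all add: algebra_simps dual_space_iff)

lemma lam_dual: "lam k <: dual_space"
 unfolding dual_space_iff by (intro allI) (rule lam_relation)

end

lemma lin_finsum:
 assumes V: "vs V" and W: "vs W" and h: "lin V W h" and f: "f \<in> B \<rightarrow> carrier V"
 shows "h (\<Oplus>\<^bsub>V\<^esub>b\<in>B. f b) = (\<Oplus>\<^bsub>W\<^esub>b\<in>B. h (f b))"
proof -
 interpret V: vectorspace cpx V by (rule V)
 interpret W: vectorspace cpx W by (rule W)
 show ?thesis
 proof (cases "finite B")
  case True
  then show ?thesis using f
  proof (induction B)
   case empty then show ?case by (simp add: lin_zero[OF V W h])
  next
   case (insert b B)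
   have "(\<Oplus>\<^bsub>V\<^esub>b\<in>B. f b) <: V" using insert.prems by (intro V.M.finsum_closed) auto
   moreover have "(%b. h (f b)) \<in> B \<rightarrow> carrier W" using insert.prems by (auto intro: lin_closed[OF h])
   ultimately show ?case using insert by (simp add: lin_add[OF h] lin_closed[OF h] Pi_iff)
  qed
 qed (simp add: V.M.finsum_infinite W.M.finsum_infinite lin_zero[OF V W h])
qed

lemma finsum_cpx: "finite B ==> (\<Oplus>\<^bsub>cpx\<^esub>b\<in>B. f b) = sum f B"
proof -
 interpret C: vectorspace cpx cpx by (rule vs_cpx)
 show "finite B ==> (\<Oplus>\<^bsub>cpx\<^esub>b\<in>B. f b) = sum f B" by (induction B rule: finite_induct) auto
qed

lemma coordinates_exist:
 assumes V: "vs V" and B: "vectorspace.basis cpx V B" and fin: "finite B"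
 shows "\<exists>cf. (\<forall>b\<in>B. lin V cpx (cf b)) \<and> (\<forall>x\<in>carrier V. x = (\<Oplus>\<^bsub>V\<^esub>b\<in>B. cf b x .[V] b)) \<and>
  (\<forall>b\<in>B. \<forall>c\<in>B. cf b c = (if b = c then 1 else 0))"
proof -
 interpret V: vectorspace cpx V by (rule V)
 have BV: "B \<subseteq> carrier V" using B by (simp add: V.basis_def)
 have ex: "\<exists>!a. a \<in> B \<rightarrow>\<^sub>E carrier cpx \<and> V.lincomb a B = v" if "v <: V" for v
  using V.basis_criterion[OF fin BV] B that by blast
 define co where "co v = (THE a. a \<in> B \<rightarrow>\<^sub>E carrier cpx \<and> V.lincomb a B = v)" for v
 have c1: "co v \<in> B \<rightarrow>\<^sub>E carrier cpx" "V.lincomb (co v) B = v" if "v <: V" for v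
  using theI'[OF ex[OF that]] unfolding co_def by blast+
 have c2: "co v b = a b" if "v <: V" "V.lincomb a B = v" "b \<in> B" for v a b
 proof -
  have "V.lincomb (restrict a B) B = v"
   unfolding that(2)[symmetric] V.lincomb_def using BV by (intro V.M.finsum_cong') (auto simp: vs_closed[OF V])
  then have "restrict a B \<in> B \<rightarrow>\<^sub>E carrier cpx \<and> V.lincomb (restrict a B) B = v" by simp
  with c1[OF that(1)] ex[OF that(1)] have "co v = restrict a B" by (blast elim: ex1E)
  then show ?thesis using that(3) by simp
 qed
 have fc: "(%b. a b .[V] b) \<in> B \<rightarrow> carrier V" for a using BV by (auto simp: vs_closed[OF V])
 have lin: "lin V cpx (%v. co v b)" if b: "b \<in> B" for b
 proof (rule linI)
  fix v w c assume v: "v <: V"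
  have "V.lincomb (%b. c * co v b) B = c .[V] V.lincomb (co v) B"
   unfolding V.lincomb_def V.finsum_smult[of c, simplified, OF fc]
   using BV by (intro V.M.finsum_cong') (auto simp: vs_simps[OF V] subset_iff)
  then show "co (c .[V] v) b = c .[cpx] co v b"
   using c1(2)[OF v] by (subst c2[OF vs_closed(3)[OF V v] _ b]) auto
  assume w: "w <: V"
  have "V.lincomb (%b. co v b + co w b) B = V.lincomb (co v) B +[V] V.lincomb (co w) B"
   unfolding V.lincomb_def V.M.finsum_addf[OF fc fc, symmetric]
   using BV by (intro V.M.finsum_cong') (auto simp: vs_simps[OF V] subset_iff)
  then show "co (v +[V] w) b = co v b +[cpx] co w b"
   using c1(2)[OF v] c1(2)[OF w] by (subst c2[OF vs_closed(2)[OF V v w] _ b]) auto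
 qed simp
 have unit: "co c b = (if b = c then 1 else 0)" if "b \<in> B" "c \<in> B" for b c
 proof (rule c2[OF _ _ that(1)])
  show c: "c <: V" using that BV by blast
  have "(%b. (if b = c then 1 else 0) .[V] b) = (%b. if c = b then 1 .[V] b else 0 .[V] b)" by auto
  have "V.lincomb (%b. if b = c then 1 else 0) B = (\<Oplus>\<^bsub>V\<^esub>b\<in>B. if c = b then b else 0[V])"
   unfolding V.lincomb_def using BV by (intro V.M.finsum_cong') (auto simp: vs_simps[OF V] subset_iff)
  also have "\<dots> = c" using V.M.finsum_singleton[OF that(2) fin, of "%b. b"] BV by auto
  finally show "V.lincomb (%b. if b = c then 1 else 0) B = c" .
 qed
 show ?thesis
  using lin unit c1(2) unfolding V.lincomb_def
  by (intro exI[of _ "%b v. co v b"] conjI ballI) (auto simp del: if_split)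
qed

lemma (in lie_algebra) bracket_space: "bracket_space L"
 by (rule bracket_space.intro[OF vectorspace_axioms]) (rule lin_closed[OF bracket_linear_right])

lemma (in lie_algebra) finite_basis: assumes "basis B" shows "finite B"
 using assms finite_dim fin_dim_li_fin unfolding basis_def by blast

lemma (in lie_algebra) structure_constants:
 assumes B: "basis B" and e: "bij_betw e {..<N} B"
  and cf: "!!b. b \<in> B ==> lin L cpx (cf b)" "!!x. x <: L ==> x = (\<Oplus>\<^bsub>L\<^esub>b\<in>B. cf b x .[L] b)"
 shows "structure_constants (%a b c. if a < N \<and> b < N \<and> c < N then cf (e c) (bracket L (e a) (e b)) else 0) N"
  and "x <: L ==> lin L cpx h ==> h x = (\<Sum>i<N. cf (e i) x * h (e i))"
proof -
 note V = vectorspace_axioms and fin = finite_basis[OF B]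
 have BL: "B \<subseteq> carrier L" using B by (simp add: basis_def)
 have eB: "e i \<in> B" "e i <: L" if "i < N" for i using e BL that by (auto simp: bij_betw_def)
 show expand: "h x = (\<Sum>i<N. cf (e i) x * h (e i))" if x: "x <: L" and h: "lin L cpx h" for x h
 proof -
  have f: "(%b. cf b x .[L] b) \<in> B \<rightarrow> carrier L" using BL vs_closed(3)[OF V] by blast
  have "h x = h (\<Oplus>\<^bsub>L\<^esub>b\<in>B. cf b x .[L] b)" by (rule arg_cong[of _ _ h, OF cf(2)[OF x]])
  also have "\<dots> = (\<Sum>b\<in>B. h (cf b x .[L] b))" unfolding lin_finsum[OF V vs_cpx h f] by (rule finsum_cpx[OF fin])
  also have "\<dots> = (\<Sum>b\<in>B. cf b x * h b)" using lin_smult[OF h] BL by (intro sum.cong) auto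
  also have "\<dots> = (\<Sum>i<N. cf (e i) x * h (e i))" by (rule sum.reindex_bij_betw[OF e, symmetric])
  finally show ?thesis .
 qed
 have cl: "bracket L x y <: L" if "x <: L" "y <: L" for x y
  by (rule lin_closed[OF bracket_linear_right]) (rule that)+
 have anti: "h (bracket L y x) = - h (bracket L x y)" if x: "x <: L" and y: "y <: L" and h: "lin L cpx h" for x y h
 proof -
  note xy = vs_closed(2)[OF V x y]
  have "h (bracket L (x +[L] y) (x +[L] y)) = h (bracket L x y) + h (bracket L y x)"
   unfolding lin_add[OF bracket_linear_right[OF xy] x y] lin_add[OF bracket_linear_left[OF x] x y] lin_add[OF bracket_linear_left[OF y] x y]
    bracket_self[OF x] bracket_self[OF y]
   using x y by (simp add: lin_add[OF h] cl vs_simps[OF V])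
  moreover have "h (bracket L (x +[L] y) (x +[L] y)) = 0" unfolding bracket_self[OF xy] using lin_zero[OF V vs_cpx h] by simp
  ultimately show ?thesis by (simp add: add_eq_0_iff)
 qed
 show "structure_constants (%a b c. if a < N \<and> b < N \<and> c < N then cf (e c) (bracket L (e a) (e b)) else 0) N"
  (is "structure_constants ?g N")
 proof
  fix a b c show "?g b a c = - ?g a b c" using anti[OF eB(2) eB(2) cf(1)[OF eB(1)], of a b c] by simp
  fix d
  show "(\<Sum>i<N. ?g a b i * ?g i c d + ?g b c i * ?g i a d + ?g c a i * ?g i b d) = 0"
  proof (cases "a < N \<and> b < N \<and> c < N \<and> d < N")
   case True
   let ?h = "cf (e d)" and ?br = "bracket L"
   have h: "lin L cpx ?h" using cf(1) eB(1) True by blast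
   have *: "(\<Sum>i<N. ?g x y i * ?g i z d) = ?h (?br (?br (e x) (e y)) (e z))" if "x < N" "y < N" "z < N" for x y z
    using True that expand[OF cl[OF eB(2) eB(2)] lin_comp[OF h bracket_linear_left[OF eB(2)]], of x y z] by simp
   note E = eB(2)[of a] eB(2)[of b] eB(2)[of c]
   have "?h (?br (?br (e a) (e b)) (e c)) + ?h (?br (?br (e b) (e c)) (e a)) + ?h (?br (?br (e c) (e a)) (e b)) =
     - ?h (?br (e a) (?br (e b) (e c)) +[L] ?br (e b) (?br (e c) (e a)) +[L] ?br (e c) (?br (e a) (e b)))"
    using E True by (simp add: lin_add[OF h] cl vs_closed(2)[OF V] anti[OF _ cl h, of "e a" "e b" "e c"]
     anti[OF _ cl h, of "e b" "e c" "e a"] anti[OF _ cl h, of "e c" "e a" "e b"])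
   also have "\<dots> = 0" using jacobi[OF E] True lin_zero[OF V vs_cpx h] by simp
   finally show ?thesis using *[of a b c] *[of b c a] *[of c a b] True by (simp only: sum.distrib)
  qed auto
 qed
qed

lemma (in lie_algebra) dual_functionals:
 assumes B: "basis B"
 shows "\<exists>\<delta>. \<forall>b\<in>B. lin (uea L) cpx (\<delta> b) \<and> (\<forall>c\<in>B. \<delta> b (uea_incl L c) = (if b = c then 1 else 0))"
proof -
 note V = vectorspace_axioms and fin = finite_basis[OF B]
 interpret bracket_space L by (rule bracket_space)
 obtain cf where cf0: "(\<forall>b\<in>B. lin L cpx (cf b)) \<and> (\<forall>x\<in>carrier L. x = (\<Oplus>\<^bsub>L\<^esub>b\<in>B. cf b x .[L] b)) \<and>
  (\<forall>b\<in>B. \<forall>c\<in>B. cf b c = (if b = c then 1 else 0))" using coordinates_exist[OF V B fin] by (rule exE)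
 have cf: "lin L cpx (cf b)" if "b \<in> B" for b using cf0 that by blast
 have cf_exp: "x = (\<Oplus>\<^bsub>L\<^esub>b\<in>B. cf b x .[L] b)" if "x <: L" for x
  using conjunct1[OF conjunct2[OF cf0]] that by (rule bspec)
 have cf_unit: "cf b c = (if b = c then 1 else 0)" if "b \<in> B" "c \<in> B" for b c
  using conjunct2[OF conjunct2[OF cf0]] that by simp
 obtain e where e0: "bij_betw e {0..<card B} B" using ex_bij_betw_nat_finite[OF fin] by (rule exE)
 define N where "N = card B"
 have e: "bij_betw e {..<N} B" using e0 by (simp add: N_def atLeast0LessThan)
 have eB: "e i \<in> B" if "i < N" for i using bij_betwE[OF e] that by blast
 define g where "g = (%a b c. if a < N \<and> b < N \<and> c < N then cf (e c) (bracket L (e a) (e b)) else 0)"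
 interpret structure_constants g N unfolding g_def by (rule structure_constants(1)[OF B e cf cf_exp])
 have expand: "h x = (\<Sum>i<N. cf (e i) x * h (e i))" if "x <: L" "lin L cpx h" for x h
  by (rule structure_constants(2)[OF B e cf cf_exp that])
 have BL: "B \<subseteq> carrier L" using B by (simp add: basis_def)
 have eL: "e i <: L" if "i < N" for i using eB[OF that] BL by blast
 let ?D = "dual_space"
 define act where "act x m = (%w. \<Sum>i<N. cf (e i) x * m (w @ [i]))" for x and m :: "nat list \<Rightarrow> complex"
 have act_closed: "act x m <: ?D" if m: "m <: ?D" for x m
  unfolding dual_space_iff
 proof (intro allI)
  fix u a b v
  have *: "m (u @ a # b # v @ [i]) = m (u @ b # a # v @ [i]) + (\<Sum>c<N. g a b c * m (u @ c # v @ [i]))" for i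
   by (rule m[unfolded dual_space_iff, rule_format])
  have "(\<Sum>i<N. cf (e i) x * (\<Sum>c<N. g a b c * m (u @ c # v @ [i]))) = (\<Sum>c<N. g a b c * (\<Sum>i<N. cf (e i) x * m (u @ c # v @ [i])))"
   unfolding sum_distrib_left by (subst sum.swap) (simp only: mult.left_commute)
  then show "act x m (u @ a # b # v) = act x m (u @ b # a # v) + (\<Sum>c<N. g a b c * act x m (u @ c # v))"
   unfolding act_def append_assoc append_Cons * by (simp add: distrib_left sum.distrib)
 qed
 have act_lin: "lin ?D ?D (act x)" for x
  by (rule linI[OF act_closed]) (simp_all add: act_def distrib_left sum.distrib sum_distrib_left mult.left_commute)
 define R where "R x = restrict (act x) (carrier ?D)" for x
 have RE: "R x <: (end_alg ?D)" for x unfolding R_def by (rule end_algI[OF vs_dual_space act_lin])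
 have "bracket_hom L (end_alg ?D) R"
 proof (rule bracket_homI)
  show "lin L (end_alg ?D) R"
  proof (rule linI[OF RE])
   fix x y c assume x: "x <: L"
   show "R (c .[L] x) = c .[end_alg ?D] R x"
    unfolding R_def end_alg_simps
    by (rule restrict_ext) (simp add: act_def lin_smult[OF cf[OF eB] x] sum_distrib_left mult.assoc)
   assume y: "y <: L"
   show "R (x +[L] y) = R x +[end_alg ?D] R y"
    unfolding R_def end_alg_simps
    by (rule restrict_ext) (simp add: act_def lin_add[OF cf[OF eB] x y] sum.distrib distrib_right)
  qed
  fix x y assume x: "x <: L" and y: "y <: L"
  note E = complex_algebra_end_alg[OF vs_dual_space]
  have xy: "bracket L x y <: L" by (rule bracket_closed[OF x y])
  have br: "cf b (bracket L x y) = (\<Sum>i<N. \<Sum>j<N. (cf (e i) x * cf (e j) y) * cf b (bracket L (e i) (e j)))" if b: "b \<in> B" for b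
  proof -
   have "cf b (bracket L x y) = (\<Sum>i<N. cf (e i) x * cf b (bracket L (e i) y))"
    by (rule expand[OF x lin_comp[OF cf[OF b] bracket_linear_left[OF y]]])
   also have "\<dots> = (\<Sum>i<N. cf (e i) x * (\<Sum>j<N. cf (e j) y * cf b (bracket L (e i) (e j))))"
   proof (rule sum.cong[OF refl], rule arg_cong[of _ _ "(*) _"])
    fix i assume "i \<in> {..<N}"
    then have i: "i < N" by simp
    show "cf b (bracket L (e i) y) = (\<Sum>j<N. cf (e j) y * cf b (bracket L (e i) (e j)))"
     by (rule expand[OF y lin_comp[OF cf[OF b] bracket_linear_right[OF eL[OF i]]]])
   qed
   finally show ?thesis by (simp only: sum_distrib_left mult.assoc)
  qed
  have "act x (act y m) w = act (bracket L x y) m w + act y (act x m) w" if m: "m <: ?D" for m w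
  proof -
   have *: "m (w @ [i, j]) = m (w @ [j, i]) + (\<Sum>c<N. g i j c * m (w @ [c]))" for i j
    by (rule m[unfolded dual_space_iff, rule_format])
   have st: "cf (e i) x * (cf (e j) y * m (w @ [i, j])) = cf (e i) x * (cf (e j) y * m (w @ [j, i])) +
     (\<Sum>c<N. (cf (e i) x * cf (e j) y * g i j c) * m (w @ [c]))" for i j
    by (subst *[of i j]) (simp add: distrib_left sum_distrib_left mult.assoc)
   have "act x (act y m) w = (\<Sum>i<N. \<Sum>j<N. cf (e i) x * (cf (e j) y * m (w @ [i, j])))"
    by (simp add: act_def sum_distrib_left)
   also have "\<dots> = (\<Sum>i<N. \<Sum>j<N. cf (e i) x * (cf (e j) y * m (w @ [j, i]))) +
     (\<Sum>i<N. \<Sum>j<N. \<Sum>c<N. (cf (e i) x * cf (e j) y * g i j c) * m (w @ [c]))"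
    by (simp only: st sum.distrib)
   also have "(\<Sum>i<N. \<Sum>j<N. cf (e i) x * (cf (e j) y * m (w @ [j, i]))) = act y (act x m) w"
    unfolding act_def sum_distrib_left by (subst sum.swap) (simp add: mult.left_commute)
   also have "(\<Sum>i<N. \<Sum>j<N. \<Sum>c<N. (cf (e i) x * cf (e j) y * g i j c) * m (w @ [c])) =
     (\<Sum>i<N. \<Sum>c<N. \<Sum>j<N. (cf (e i) x * cf (e j) y * g i j c) * m (w @ [c]))"
    by (rule sum.cong[OF refl], rule sum.swap)
   also have "\<dots> = (\<Sum>c<N. \<Sum>i<N. \<Sum>j<N. (cf (e i) x * cf (e j) y * g i j c) * m (w @ [c]))" by (rule sum.swap)
   also have "\<dots> = act (bracket L x y) m w"
    unfolding act_def using br[OF eB] by (simp add: sum_distrib_right g_def)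
   finally show ?thesis by (simp only: add.commute)
  qed
  note ac = this
  have "R x *[end_alg ?D] R y = R (bracket L x y) +[end_alg ?D] R y *[end_alg ?D] R x"
   unfolding R_def end_alg_simps by (rule restrict_ext, rule ext) (simp only: restrict_apply' act_closed dual_space_simps, rule ac)
  then show "R (bracket L x y) = R x *[end_alg ?D] R y -[end_alg ?D] R y *[end_alg ?D] R x"
   by (intro vs_minus_eqI[OF alg_vs[OF E], symmetric] alg_closed(2)[OF E] RE)
 qed
 note Rh = uea_ext_U[OF complex_algebra_end_alg[OF vs_dual_space] this] uea_ext_incl[OF complex_algebra_end_alg[OF vs_dual_space] this]
 define k where "k b = (SOME i. i < N \<and> e i = b)" for b
 have k: "k b < N \<and> e (k b) = b" if "b \<in> B" for b
 proof -
  have "\<exists>i. i < N \<and> e i = b" using that bij_betw_imp_surj_on[OF e] by auto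
  then show ?thesis unfolding k_def by (rule someI_ex)
 qed
 show ?thesis
 proof (intro exI[of _ "%b u. uea_ext L (end_alg ?D) R u (lam (k b)) []"] ballI conjI)
  fix b assume b: "b \<in> B"
  show "lin (uea L) cpx (%u. uea_ext L (end_alg ?D) R u (lam (k b)) [])"
   by (rule linI) (simp_all add: lin_add[OF alg_homD(1)[OF Rh(1)]] lin_smult[OF alg_homD(1)[OF Rh(1)]] end_alg_simps lam_dual)
  fix c assume c: "c \<in> B"
  have cL: "c <: L" using c BL by blast
  have ek: "cf (e i) c * (if i = k b then 1 else 0) = (if i = k b then cf b c else 0)" for i using k[OF b] by simp
  have "uea_ext L (end_alg ?D) R (uea_incl L c) (lam (k b)) [] = (\<Sum>i<N. cf (e i) c * (if i = k b then 1 else 0))"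
   unfolding Rh(2)[OF cL] by (simp add: R_def lam_dual act_def lam_single)
  also have "\<dots> = cf b c" unfolding ek using k[OF b] by simp
  finally show "uea_ext L (end_alg ?D) R (uea_incl L c) (lam (k b)) [] = (if b = c then 1 else 0)"
   unfolding cf_unit[OF b c] .
 qed
qed

section \<open>Modules over the double crossed sum\<close>

lemma vs_sum_shuffle:
 assumes V: "vs V"
  and c: "a1 <: V" "a2 <: V" "b1 <: V" "b2 <: V" "c1 <: V" "c2 <: V"
   "d <: V" "e <: V" "f <: V" "g1 <: V" "g2 <: V" "h1 <: V" "h2 <: V"
  and eq: "h1 +[V] h2 = (a1 +[V] b1) +[V] e"
 shows "(a1 +[V] a2) +[V] ((b1 +[V] b2) +[V] (c1 +[V] c2) +[V] d) +[V] (e +[V] f +[V] (g1 +[V] g2)) =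
  (h1 +[V] c1 +[V] g1) +[V] (b2 +[V] (a2 +[V] c2 +[V] f) +[V] (h2 +[V] d +[V] g2))"
proof -
 note ac = vs_add_ac[OF V] vs_closed(2)[OF V] c
 have "(a1 +[V] a2) +[V] ((b1 +[V] b2) +[V] (c1 +[V] c2) +[V] d) +[V] (e +[V] f +[V] (g1 +[V] g2)) =
  ((a1 +[V] b1) +[V] e) +[V] (a2 +[V] b2 +[V] c1 +[V] c2 +[V] d +[V] f +[V] g1 +[V] g2)"
  by (simp only: ac)
 also have "\<dots> = (h1 +[V] h2) +[V] (a2 +[V] b2 +[V] c1 +[V] c2 +[V] d +[V] f +[V] g1 +[V] g2)"
  unfolding eq by (rule refl)
 also have "\<dots> = (h1 +[V] c1 +[V] g1) +[V] (b2 +[V] (a2 +[V] c2 +[V] f) +[V] (h2 +[V] d +[V] g2))"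
  by (simp only: ac)
 finally show ?thesis .
qed

lemma bracket_homI_add:
 assumes A: "complex_algebra A" and l: "lin L A \<phi>"
  and eq: "!!x y. x <: L ==> y <: L ==> \<phi> x *[A] \<phi> y = \<phi> (bracket L x y) +[A] \<phi> y *[A] \<phi> x"
  and cl: "!!x y. x <: L ==> y <: L ==> bracket L x y <: L"
 shows "bracket_hom L A \<phi>"
proof (rule bracket_homI[OF l])
 fix x y assume x: "x <: L" and y: "y <: L"
 show "\<phi> (bracket L x y) = \<phi> x *[A] \<phi> y -[A] \<phi> y *[A] \<phi> x"
  by (rule vs_minus_eqI[OF alg_vs[OF A] _ _ eq[OF x y], symmetric])
   (intro alg_closed[OF A] lin_closed[OF l] x y cl)+
qed

lemma (in bracket_space) bracket_hom_commute:
 assumes A: "complex_algebra A" and h: "bracket_hom L A \<phi>" and x: "x <: L" and y: "y <: L"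
 shows "\<phi> x *[A] \<phi> y = \<phi> (bracket L x y) +[A] \<phi> y *[A] \<phi> x"
 unfolding bracket_homD(2)[OF h x y]
 by (rule vs_minus_add_cancel[OF alg_vs[OF A], symmetric])
  (intro alg_closed[OF A] lin_closed[OF bracket_homD(1)[OF h]] x y)+

locale matched_brackets = P: bracket_space P + Q: bracket_space Q
 for P :: "'a lie" and Q :: "'b lie" +
 fixes lact :: "'b \<Rightarrow> 'a \<Rightarrow> 'a" (infixr \<open>\<triangleright>\<close> 75)
  and ract :: "'b \<Rightarrow> 'a \<Rightarrow> 'b" (infixl \<open>\<triangleleft>\<close> 75)
 assumes bilin_brackets: "bilin P P P (bracket P)" "bilin Q Q Q (bracket Q)"
  and bilin_lact: "bilin Q P P lact" and bilin_ract: "bilin Q P Q ract"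
  and lact_bracket: "\<zeta> <: Q ==> \<xi> <: Q ==> X <: P ==>
   \<zeta> \<triangleright> \<xi> \<triangleright> X = bracket Q \<zeta> \<xi> \<triangleright> X +[P] \<xi> \<triangleright> \<zeta> \<triangleright> X"
  and ract_bracket: "\<zeta> <: Q ==> X <: P ==> Y <: P ==>
   \<zeta> \<triangleleft> X \<triangleleft> Y = \<zeta> \<triangleleft> bracket P X Y +[Q] \<zeta> \<triangleleft> Y \<triangleleft> X"
  and lact_of_bracket: "\<zeta> <: Q ==> X <: P ==> Y <: P ==>
   \<zeta> \<triangleright> bracket P X Y +[P] (\<zeta> \<triangleleft> Y) \<triangleright> X =
    (bracket P (\<zeta> \<triangleright> X) Y +[P] bracket P X (\<zeta> \<triangleright> Y)) +[P] (\<zeta> \<triangleleft> X) \<triangleright> Y"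
  and ract_of_bracket: "\<zeta> <: Q ==> \<xi> <: Q ==> X <: P ==>
   bracket Q \<zeta> \<xi> \<triangleleft> X +[Q] \<xi> \<triangleleft> (\<zeta> \<triangleright> X) =
    (bracket Q (\<zeta> \<triangleleft> X) \<xi> +[Q] bracket Q \<zeta> (\<xi> \<triangleleft> X)) +[Q] \<zeta> \<triangleleft> (\<xi> \<triangleright> X)"
begin

abbreviation "UP \<equiv> uea P"
abbreviation "UQ \<equiv> uea Q"
abbreviation "\<iota> \<equiv> uea_incl P"
abbreviation "\<kappa> \<equiv> uea_incl Q"

lemma lact_closed [cls]: "\<xi> <: Q ==> X <: P ==> \<xi> \<triangleright> X <: P"
 by (rule bilin_closed[OF bilin_lact])

lemma ract_closed [cls]: "\<xi> <: Q ==> X <: P ==> \<xi> \<triangleleft> X <: Q"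
 by (rule bilin_closed[OF bilin_ract])

lemmas lin_lact [lins] = bilin_comp[OF bilin_lact]
lemmas lin_ract [lins] = bilin_comp[OF bilin_ract]
lemmas [cls] = P.bracket_closed Q.bracket_closed P.vs_L Q.vs_L

definition jet_space :: "(complex, 'a uea \<times> ('b \<Rightarrow> 'a uea)) module" where
 "jet_space = \<lparr>carrier = carrier UP \<times> {\<phi> \<in> extensional (carrier Q). lin Q UP \<phi>},
   mult = undefined, one = undefined, zero = (0[UP], \<lambda>\<xi>\<in>carrier Q. 0[UP]),
   add = (%x y. (fst x +[UP] fst y, \<lambda>\<xi>\<in>carrier Q. snd x \<xi> +[UP] snd y \<xi>)),
   smult = (%c x. (c .[UP] fst x, \<lambda>\<xi>\<in>carrier Q. c .[UP] snd x \<xi>))\<rparr>"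

abbreviation "J \<equiv> jet_space"

lemma jet_iff: "x <: J \<longleftrightarrow> fst x <: UP \<and> snd x \<in> extensional (carrier Q) \<and> lin Q UP (snd x)"
 by (auto simp: jet_space_def mem_Times_iff)

lemma jet_ops:
 "0[J] = (0[UP], \<lambda>\<xi>\<in>carrier Q. 0[UP])"
 "x +[J] y = (fst x +[UP] fst y, \<lambda>\<xi>\<in>carrier Q. snd x \<xi> +[UP] snd y \<xi>)"
 "c .[J] x = (c .[UP] fst x, \<lambda>\<xi>\<in>carrier Q. c .[UP] snd x \<xi>)"
 by (simp_all add: jet_space_def)

lemma jetI: "p <: UP ==> lin Q UP \<phi> ==> (p, \<lambda>\<xi>\<in>carrier Q. \<phi> \<xi>) <: J"
 by (simp add: jet_iff lin_restrict[OF Q.vs_L])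

lemma jetD:
 assumes "x <: J"
 shows "fst x <: UP" "lin Q UP (snd x)" "\<xi> <: Q ==> snd x \<xi> <: UP" "snd x \<in> extensional (carrier Q)"
 using assms lin_closed[of "snd x" Q UP \<xi>] by (simp_all add: jet_iff)

lemma jet_eqI:
 assumes "x <: J" "y <: J" "fst x = fst y" "!!\<xi>. \<xi> <: Q ==> snd x \<xi> = snd y \<xi>"
 shows "x = y"
 by (rule prod_eqI[OF assms(3) extensionalityI[OF jetD(4)[OF assms(1)] jetD(4)[OF assms(2)] assms(4)]])

lemma vsJ [cls]: "vs J"
proof -
 note [simp] = vs_simps[OF P.vsU] jet_ops
 have add: "x +[J] y <: J" and smult: "c .[J] x <: J" if x: "x <: J" and y: "y <: J" for x y c
  unfolding jet_ops by (rule jetI; (assumption | rule jetD[OF x] jetD[OF y] vs_closed[OF P.vsU] P.vsU lins)+)+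
 have zero: "0[J] <: J" unfolding jet_ops by (rule jetI[OF vs_closed(1)[OF P.vsU] lin_zero_map[OF P.vsU]])
 show ?thesis
 proof (rule vsI[OF zero])
  fix x y z c d assume x: "x <: J"
  note [simp] = jetD(1,3)[OF x]
  show "c .[J] x <: J" for c by (rule smult[OF x x])
  show "x +[J] 0[J] = x" by (rule jet_eqI[OF add[OF x zero] x]) simp_all
  show "1 .[J] x = x" by (rule jet_eqI[OF smult[OF x x] x]) simp_all
  show "0 .[J] x = 0[J]" by (rule jet_eqI[OF smult[OF x x] zero]) simp_all
  show "(c + d) .[J] x = c .[J] x +[J] d .[J] x" for c d
   by (rule jet_eqI[OF smult[OF x x] add[OF smult[OF x x] smult[OF x x]]]) simp_all
  show "(c * d) .[J] x = c .[J] (d .[J] x)" for c d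
   by (rule jet_eqI[OF smult[OF x x] smult[OF smult[OF x x] x]]) simp_all
  assume y: "y <: J"
  note [simp] = jetD(1,3)[OF y]
  show "x +[J] y <: J" by (rule add[OF x y])
  show "x +[J] y = y +[J] x" by (rule jet_eqI[OF add[OF x y] add[OF y x]]) (simp_all add: vs_add_ac(2)[OF P.vsU])
  show "c .[J] (x +[J] y) = c .[J] x +[J] c .[J] y" for c
   by (rule jet_eqI[OF smult[OF add[OF x y] x] add[OF smult[OF x x] smult[OF y y]]]) simp_all
  assume z: "z <: J"
  note [simp] = jetD(1,3)[OF z]
  show "(x +[J] y) +[J] z = x +[J] (y +[J] z)"
   by (rule jet_eqI[OF add[OF add[OF x y] z] add[OF x add[OF y z]]]) (simp_all add: vs_add_ac(1)[OF P.vsU])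
 qed
qed

definition jet_act :: "'a \<Rightarrow> 'a uea \<times> ('b \<Rightarrow> 'a uea) \<Rightarrow> 'a uea \<times> ('b \<Rightarrow> 'a uea)" where
 "jet_act X x = (\<iota> X *[UP] fst x, \<lambda>\<xi>\<in>carrier Q. \<iota> (\<xi> \<triangleright> X) *[UP] fst x +[UP] \<iota> X *[UP] snd x \<xi> +[UP] snd x (\<xi> \<triangleleft> X))"

lemma jet_act_simps:
 "fst (jet_act X x) = \<iota> X *[UP] fst x"
 "\<xi> <: Q ==> snd (jet_act X x) \<xi> = \<iota> (\<xi> \<triangleright> X) *[UP] fst x +[UP] \<iota> X *[UP] snd x \<xi> +[UP] snd x (\<xi> \<triangleleft> X)"
 by (simp_all add: jet_act_def)

lemma jet_act_closed:
 assumes X: "X <: P" and x: "x <: J" shows "jet_act X x <: J"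
proof -
 show ?thesis unfolding jet_act_def
  by (rule jetI) ((assumption | rule X jetD(1,2)[OF x] P.vsU lins cls lin_comp[OF jetD(2)[OF x]])+)
qed

lemma jet_simps:
 "fst (x +[J] y) = fst x +[UP] fst y" "fst (c .[J] x) = c .[UP] fst x"
 "\<xi> <: Q ==> snd (x +[J] y) \<xi> = snd x \<xi> +[UP] snd y \<xi>" "\<xi> <: Q ==> snd (c .[J] x) \<xi> = c .[UP] snd x \<xi>"
 by (simp_all add: jet_ops)

lemma lin_jetI:
 assumes X: "vs X" and cl: "!!x. x <: X ==> f x <: J" and f: "lin X UP (%x. fst (f x))"
  and s: "!!\<xi>. \<xi> <: Q ==> lin X UP (%x. snd (f x) \<xi>)"
 shows "lin X J f"
proof (rule linI[OF cl])
 fix x y c assume x: "x <: X"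
 show "f (c .[X] x) = c .[J] f x"
  by (rule jet_eqI[OF cl[OF vs_closed(3)[OF X x]] vs_closed(3)[OF vsJ cl[OF x]]])
   (simp_all only: jet_simps lin_smult[OF f x] lin_smult[OF s x])
 assume y: "y <: X"
 show "f (x +[X] y) = f x +[J] f y"
  by (rule jet_eqI[OF cl[OF vs_closed(2)[OF X x y]] vs_closed(2)[OF vsJ cl[OF x] cl[OF y]]])
   (simp_all only: jet_simps lin_add[OF f x y] lin_add[OF s x y])
qed

lemma lin_jet: "lin J UP fst" "\<xi> <: Q ==> lin J UP (%x. snd x \<xi>)"
 by (rule linI; simp only: jet_simps jetD)+

lemma lin_jet_act: "X <: P ==> lin J J (jet_act X)" "x <: J ==> lin P J (%X. jet_act X x)"
proof -
 show "lin J J (jet_act X)" if X: "X <: P"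
  by (rule lin_jetI[OF vsJ jet_act_closed[OF X]]; (unfold jet_act_simps)?)
   ((assumption | rule X P.vsU lin_jet lins cls)+)
 show "lin P J (%X. jet_act X x)" if x: "x <: J"
  by (rule lin_jetI[OF P.vs_L jet_act_closed[OF _ x]]; (unfold jet_act_simps)?)
   ((assumption | rule P.vsU jetD[OF x] lins cls lin_comp[OF jetD(2)[OF x]])+)
qed

lemma incl_commute:
 assumes "X <: P" "Y <: P" "p <: UP"
 shows "\<iota> X *[UP] (\<iota> Y *[UP] p) = \<iota> (bracket P X Y) *[UP] p +[UP] \<iota> Y *[UP] (\<iota> X *[UP] p)"
 using P.bracket_hom_commute[OF P.algU P.bracket_hom_U assms(1,2)] assms
 by (simp add: alg_assoc[OF P.algU, symmetric] P.incl_closed P.bracket_closed alg_closed[OF P.algU] alg_distrib[OF P.algU])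

lemma jet_act_commute:
 assumes X: "X <: P" and Y: "Y <: P" and x: "x <: J"
 shows "jet_act X (jet_act Y x) = jet_act (bracket P X Y) x +[J] jet_act Y (jet_act X x)"
proof (rule jet_eqI)
 note b = P.bracket_closed[OF X Y]
 show "jet_act X (jet_act Y x) <: J" "jet_act (bracket P X Y) x +[J] jet_act Y (jet_act X x) <: J"
  by (intro jet_act_closed vs_closed(2)[OF vsJ] X Y x b)+
 show "fst (jet_act X (jet_act Y x)) = fst (jet_act (bracket P X Y) x +[J] jet_act Y (jet_act X x))"
  unfolding jet_simps jet_act_simps by (rule incl_commute[OF X Y jetD(1)[OF x]])
 fix \<xi> assume xi: "\<xi> <: Q"
 let ?p = "fst x" and ?\<phi> = "snd x"
 note p = jetD(1)[OF x] and \<phi> = jetD(3)[OF x]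
 note l = lact_closed[OF xi X] lact_closed[OF xi Y] ract_closed[OF xi X] ract_closed[OF xi Y] ract_closed[OF xi b]
 note ll = lact_closed[OF l(3) Y] lact_closed[OF l(4) X] lact_closed[OF xi b] P.bracket_closed[OF l(1) Y] P.bracket_closed[OF X l(2)]
  ract_closed[OF l(4) X]
 have E: "\<iota> (\<xi> \<triangleright> bracket P X Y) *[UP] ?p +[UP] \<iota> ((\<xi> \<triangleleft> Y) \<triangleright> X) *[UP] ?p =
   (\<iota> (bracket P (\<xi> \<triangleright> X) Y) *[UP] ?p +[UP] \<iota> (bracket P X (\<xi> \<triangleright> Y)) *[UP] ?p) +[UP] \<iota> ((\<xi> \<triangleleft> X) \<triangleright> Y) *[UP] ?p"
 proof -
  have lp: "lin P UP (%Z. \<iota> Z *[UP] ?p)" by ((assumption | rule p lins cls)+)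
  show ?thesis
   using arg_cong[OF lact_of_bracket[OF xi X Y], of "%Z. \<iota> Z *[UP] ?p"] ll
   by (simp only: lin_add[OF lp] vs_closed(2)[OF P.vs_L])
 qed
 have s: "snd (jet_act X (jet_act Y x)) \<xi> =
   \<iota> (\<xi> \<triangleright> X) *[UP] (\<iota> Y *[UP] ?p) +[UP]
   (\<iota> X *[UP] (\<iota> (\<xi> \<triangleright> Y) *[UP] ?p) +[UP] \<iota> X *[UP] (\<iota> Y *[UP] ?\<phi> \<xi>) +[UP] \<iota> X *[UP] ?\<phi> (\<xi> \<triangleleft> Y)) +[UP]
   (\<iota> ((\<xi> \<triangleleft> X) \<triangleright> Y) *[UP] ?p +[UP] \<iota> Y *[UP] ?\<phi> (\<xi> \<triangleleft> X) +[UP] ?\<phi> (\<xi> \<triangleleft> X \<triangleleft> Y))"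
  if "X <: P" "Y <: P" for X Y
  using that xi p by (simp only: jet_act_simps ract_closed lact_closed alg_distrib[OF P.algU] alg_closed[OF P.algU] P.incl_closed \<phi> vs_closed(2)[OF P.vsU])
 have r: "?\<phi> (\<xi> \<triangleleft> X \<triangleleft> Y) = ?\<phi> (\<xi> \<triangleleft> bracket P X Y) +[UP] ?\<phi> (\<xi> \<triangleleft> Y \<triangleleft> X)"
  unfolding ract_bracket[OF xi X Y] by (rule lin_add[OF jetD(2)[OF x] l(5) ll(6)])
 show "snd (jet_act X (jet_act Y x)) \<xi> = snd (jet_act (bracket P X Y) x +[J] jet_act Y (jet_act X x)) \<xi>"
  unfolding jet_simps(3)[OF xi] s[OF X Y] s[OF Y X] jet_act_simps(2)[OF xi, of "bracket P X Y"] r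
   incl_commute[OF l(1) Y p] incl_commute[OF X l(2) p] incl_commute[OF X Y \<phi>[OF xi]]
  by (rule vs_sum_shuffle[OF P.vsU]) ((intro alg_closed[OF P.algU] P.incl_closed p \<phi> X Y xi l ll b | rule E)+)
qed

lemma bracket_hom_jet: "bracket_hom P (end_alg J) (%X. \<lambda>x\<in>carrier J. jet_act X x)"
proof (rule bracket_homI_add[OF complex_algebra_end_alg[OF vsJ]])
 show "lin P (end_alg J) (%X. \<lambda>x\<in>carrier J. jet_act X x)"
 proof (rule linI)
  fix X Y c assume X: "X <: P"
  show "(\<lambda>x\<in>carrier J. jet_act X x) <: (end_alg J)" by (rule end_algI[OF vsJ lin_jet_act(1)[OF X]])
  show "(\<lambda>x\<in>carrier J. jet_act (c .[P] X) x) = c .[end_alg J] (\<lambda>x\<in>carrier J. jet_act X x)"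
   unfolding end_alg_simps by (rule restrict_ext) (simp only: restrict_apply' lin_smult[OF lin_jet_act(2) X])
  assume Y: "Y <: P"
  show "(\<lambda>x\<in>carrier J. jet_act (X +[P] Y) x) = (\<lambda>x\<in>carrier J. jet_act X x) +[end_alg J] (\<lambda>x\<in>carrier J. jet_act Y x)"
   unfolding end_alg_simps by (rule restrict_ext) (simp only: restrict_apply' lin_add[OF lin_jet_act(2) X Y])
 qed
 fix X Y assume X: "X <: P" and Y: "Y <: P"
 show "bracket P X Y <: P" by (rule P.bracket_closed[OF X Y])
 show "(\<lambda>x\<in>carrier J. jet_act X x) *[end_alg J] (\<lambda>x\<in>carrier J. jet_act Y x) =
   (\<lambda>x\<in>carrier J. jet_act (bracket P X Y) x) +[end_alg J] (\<lambda>x\<in>carrier J. jet_act Y x) *[end_alg J] (\<lambda>x\<in>carrier J. jet_act X x)"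
  unfolding end_alg_simps by (rule restrict_ext) (simp only: restrict_apply' jet_act_closed X Y, rule jet_act_commute[OF X Y])
qed

definition jet :: "'a uea \<Rightarrow> 'a uea \<times> ('b \<Rightarrow> 'a uea)" where
 "jet p = uea_ext P (end_alg J) (%X. \<lambda>x\<in>carrier J. jet_act X x) p (1[UP], \<lambda>\<xi>\<in>carrier Q. 0[UP])"

lemma jet_one_closed: "(1[UP], \<lambda>\<xi>\<in>carrier Q. 0[UP]) <: J"
 by (rule jetI[OF alg_closed(1)[OF P.algU] lin_zero_map[OF P.vsU]])

lemma eval_end_alg:
 assumes h: "h \<in> complex_alg_hom A (end_alg V)" and v: "v <: V"
 shows "lin A V (%x. h x v)" "h 1[A] v = v" "x <: A ==> y <: A ==> h (x *[A] y) v = h x (h y v)"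
  "x <: A ==> lin V V (h x)"
proof -
 note l = alg_homD(1)[OF h]
 show lx: "lin V V (h x)" if "x <: A" for x using lin_closed[OF l that] unfolding end_alg_simps by (rule conjunct2)
 show "lin A V (%x. h x v)"
  by (rule linI) (simp_all only: lin_closed[OF lx] v lin_add[OF l] lin_smult[OF l] end_alg_simps restrict_apply')
 show "h 1[A] v = v" by (simp only: alg_homD(2)[OF h] end_alg_simps restrict_apply' v)
 show "h (x *[A] y) v = h x (h y v)" if "x <: A" "y <: A"
  by (simp only: alg_homD(3)[OF h that] end_alg_simps restrict_apply' v)
qed

lemmas jet_hom = P.uea_ext_U[OF complex_algebra_end_alg[OF vsJ] bracket_hom_jet]
 and jet_incl = P.uea_ext_incl[OF complex_algebra_end_alg[OF vsJ] bracket_hom_jet]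

lemma lin_jet_map: "lin UP J jet"
 unfolding jet_def[abs_def] by (rule eval_end_alg(1)[OF jet_hom jet_one_closed])

lemma jet_closed: "p <: UP ==> jet p <: J" by (rule lin_closed[OF lin_jet_map])

lemma jet_one: "jet 1[UP] = (1[UP], \<lambda>\<xi>\<in>carrier Q. 0[UP])"
 unfolding jet_def by (rule eval_end_alg(2)[OF jet_hom jet_one_closed])

lemma jet_step: "X <: P ==> p <: UP ==> jet (\<iota> X *[UP] p) = jet_act X (jet p)"
 using jet_closed[of p] unfolding jet_def
 by (simp only: eval_end_alg(3)[OF jet_hom jet_one_closed] P.incl_closed jet_incl restrict_apply')

lemma fst_jet: assumes p: "p <: UP" shows "fst (jet p) = p"
 by (rule P.uea_lin_ext[OF P.vsU lin_comp[OF lin_jet(1) lin_jet_map] lin_id _ _ p])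
  (simp_all only: jet_one fst_conv jet_step jet_act_simps)

definition der :: "'b \<Rightarrow> 'a uea \<Rightarrow> 'a uea" where "der \<xi> p = snd (jet p) \<xi>"

lemma der_one: "\<xi> <: Q ==> der \<xi> 1[UP] = 0[UP]"
 by (simp add: der_def jet_one)

lemma der_step:
 "\<xi> <: Q ==> X <: P ==> p <: UP ==>
  der \<xi> (\<iota> X *[UP] p) = \<iota> (\<xi> \<triangleright> X) *[UP] p +[UP] \<iota> X *[UP] der \<xi> p +[UP] der (\<xi> \<triangleleft> X) p"
 by (simp only: der_def jet_step jet_act_simps fst_jet)

lemma lin_der [lins]:
 "\<xi> <: Q ==> lin X UP f ==> lin X UP (%x. der \<xi> (f x))"
 "p <: UP ==> lin X Q g ==> lin X UP (%x. der (g x) p)"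
 unfolding der_def
 by (rule lin_comp[OF lin_comp[OF lin_jet(2) lin_jet_map]]; assumption)
  (rule lin_comp[OF jetD(2)[OF jet_closed]]; assumption)

lemma der_closed [cls]: "\<xi> <: Q ==> p <: UP ==> der \<xi> p <: UP"
 by (rule lin_closed[OF lin_der(1)[OF _ lin_id]])

lemma vs_sum_shuffle2:
 assumes V: "vs V"
  and c: "a1 <: V" "a2 <: V" "b <: V" "c1 <: V" "e <: V" "f1 <: V" "f2 <: V"
   "g1 <: V" "g2 <: V" "h1 <: V" "h2 <: V" "k1 <: V" "k2 <: V"
  and eq: "k1 +[V] k2 = (g1 +[V] h1) +[V] c1"
 shows "((a1 +[V] a2) +[V] b +[V] c1) +[V] (e +[V] (f1 +[V] f2) +[V] (g1 +[V] g2)) +[V] (h1 +[V] h2) =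
  (a1 +[V] f1 +[V] k1) +[V] ((a2 +[V] e +[V] k2) +[V] (b +[V] f2 +[V] h2) +[V] g2)"
proof -
 note ac = vs_add_ac[OF V] vs_closed(2)[OF V] c
 let ?r = "a1 +[V] a2 +[V] b +[V] e +[V] f1 +[V] f2 +[V] g2 +[V] h2"
 have "((a1 +[V] a2) +[V] b +[V] c1) +[V] (e +[V] (f1 +[V] f2) +[V] (g1 +[V] g2)) +[V] (h1 +[V] h2) =
  ((g1 +[V] h1) +[V] c1) +[V] ?r" by (simp only: ac)
 also have "\<dots> = (k1 +[V] k2) +[V] ?r" unfolding eq by (rule refl)
 also have "\<dots> = (a1 +[V] f1 +[V] k1) +[V] ((a2 +[V] e +[V] k2) +[V] (b +[V] f2 +[V] h2) +[V] g2)" by (simp only: ac)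
 finally show ?thesis .
qed

lemma der_commute:
 assumes p: "p <: UP"
 shows "\<forall>\<zeta>\<in>carrier Q. \<forall>\<xi>\<in>carrier Q. der \<zeta> (der \<xi> p) = der (bracket Q \<zeta> \<xi>) p +[UP] der \<xi> (der \<zeta> p)"
proof -
 let ?P = "%p. \<forall>\<zeta>\<in>carrier Q. \<forall>\<xi>\<in>carrier Q. der \<zeta> (der \<xi> p) = der (bracket Q \<zeta> \<xi>) p +[UP] der \<xi> (der \<zeta> p)"
 have L1: "lin UP UP (%p. der \<zeta> (der \<xi> p))" and L2: "lin UP UP (%p. der (bracket Q \<zeta> \<xi>) p +[UP] der \<xi> (der \<zeta> p))"
  if "\<zeta> <: Q" "\<xi> <: Q" for \<zeta> \<xi>
  by ((assumption | rule that P.vsU lins cls)+)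
 have zero: "der \<zeta> 0[UP] = 0[UP]" if "\<zeta> <: Q" for \<zeta>
  by (rule lin_zero[OF P.vsU P.vsU lin_der(1)[OF that lin_id]])
 show ?thesis
 proof (rule P.uea_induct[of p ?P, OF p])
  show "?P 1[UP]"
   by (intro ballI) (simp only: der_one zero Q.bracket_closed vs_simps[OF P.vsU])
  show "?P (u +[UP] v)" if u: "u <: UP" and v: "v <: UP" and hu: "?P u" and hv: "?P v" for u v
  proof (intro ballI)
   fix \<zeta> \<xi> assume z: "\<zeta> <: Q" and x: "\<xi> <: Q"
   show "der \<zeta> (der \<xi> (u +[UP] v)) = der (bracket Q \<zeta> \<xi>) (u +[UP] v) +[UP] der \<xi> (der \<zeta> (u +[UP] v))"
    unfolding lin_add[OF L1[OF z x] u v] lin_add[OF L2[OF z x] u v] bspec[OF bspec[OF hu z] x] bspec[OF bspec[OF hv z] x]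
    by (rule refl)
  qed
  show "?P (c .[UP] u)" if u: "u <: UP" and hu: "?P u" for c u
  proof (intro ballI)
   fix \<zeta> \<xi> assume z: "\<zeta> <: Q" and x: "\<xi> <: Q"
   show "der \<zeta> (der \<xi> (c .[UP] u)) = der (bracket Q \<zeta> \<xi>) (c .[UP] u) +[UP] der \<xi> (der \<zeta> (c .[UP] u))"
    unfolding lin_smult[OF L1[OF z x] u] lin_smult[OF L2[OF z x] u] bspec[OF bspec[OF hu z] x] by (rule refl)
  qed
  fix X p assume X: "X <: P" and p: "p <: UP" and IH: "?P p"
  show "?P (\<iota> X *[UP] p)"
  proof (intro ballI)
   fix \<zeta> \<xi> assume z: "\<zeta> <: Q" and x: "\<xi> <: Q"
   note c = lact_closed ract_closed Q.bracket_closed der_closed alg_closed[OF P.algU] P.incl_closed vs_closed(2)[OF P.vsU]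
   have s: "der \<zeta> (der \<xi> (\<iota> X *[UP] p)) =
     (\<iota> (\<zeta> \<triangleright> \<xi> \<triangleright> X) *[UP] p +[UP] \<iota> (\<xi> \<triangleright> X) *[UP] der \<zeta> p +[UP] der (\<zeta> \<triangleleft> (\<xi> \<triangleright> X)) p) +[UP]
     (\<iota> (\<zeta> \<triangleright> X) *[UP] der \<xi> p +[UP] \<iota> X *[UP] der \<zeta> (der \<xi> p) +[UP] der (\<zeta> \<triangleleft> X) (der \<xi> p)) +[UP]
     der \<zeta> (der (\<xi> \<triangleleft> X) p)"
    if "\<zeta> <: Q" "\<xi> <: Q" for \<zeta> \<xi>
    using that X p by (simp only: der_step c lin_add[OF lin_der(1)[OF that(1) lin_id]])
   have IH': "der \<zeta> (der \<xi> p) = der (bracket Q \<zeta> \<xi>) p +[UP] der \<xi> (der \<zeta> p)"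
    if "\<zeta> <: Q" "\<xi> <: Q" for \<zeta> \<xi> by (rule bspec[OF bspec[OF IH that(1)] that(2)])
   have i: "\<iota> (\<zeta> \<triangleright> \<xi> \<triangleright> X) *[UP] p = \<iota> (bracket Q \<zeta> \<xi> \<triangleright> X) *[UP] p +[UP] \<iota> (\<xi> \<triangleright> \<zeta> \<triangleright> X) *[UP] p"
   proof -
    have lp: "lin P UP (%Z. \<iota> Z *[UP] p)" by ((assumption | rule p lins cls)+)
    show ?thesis unfolding lact_bracket[OF z x X] using z x X by (intro lin_add[OF lp] c)
   qed
   have ii: "\<iota> X *[UP] der \<zeta> (der \<xi> p) = \<iota> X *[UP] der (bracket Q \<zeta> \<xi>) p +[UP] \<iota> X *[UP] der \<xi> (der \<zeta> p)"
    unfolding IH'[OF z x] using z x X p by (intro alg_distrib[OF P.algU] c)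
   have K: "der (bracket Q \<zeta> \<xi> \<triangleleft> X) p +[UP] der (\<xi> \<triangleleft> (\<zeta> \<triangleright> X)) p =
     (der (bracket Q (\<zeta> \<triangleleft> X) \<xi>) p +[UP] der (bracket Q \<zeta> (\<xi> \<triangleleft> X)) p) +[UP] der (\<zeta> \<triangleleft> (\<xi> \<triangleright> X)) p"
    using arg_cong[OF ract_of_bracket[OF z x X], of "%\<xi>. der \<xi> p"] z x X
    by (simp only: lin_add[OF lin_der(2)[OF p lin_id]] c vs_closed(2)[OF Q.vs_L])
   show "der \<zeta> (der \<xi> (\<iota> X *[UP] p)) = der (bracket Q \<zeta> \<xi>) (\<iota> X *[UP] p) +[UP] der \<xi> (der \<zeta> (\<iota> X *[UP] p))"
    unfolding s[OF z x] s[OF x z] der_step[OF Q.bracket_closed[OF z x] X p] i ii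
     IH'[OF ract_closed[OF z X] x] IH'[OF z ract_closed[OF x X]]
    by (rule vs_sum_shuffle2[OF P.vsU]) ((intro c z x X p | rule K)+)
  qed
 qed
qed

lemma der_incl: "\<xi> <: Q ==> X <: P ==> der \<xi> (\<iota> X) = \<iota> (\<xi> \<triangleright> X)"
 using der_step[of \<xi> X "1[UP]"] lact_closed[of \<xi> X] ract_closed[of \<xi> X] lin_zero[OF P.vsU P.vsU lin_alg_mult(2)[OF P.algU _ lin_id], of "\<iota> X"]
 by (simp add: der_one alg_unit[OF P.algU] alg_closed[OF P.algU] P.incl_closed vs_simps[OF P.vsU])

end

section \<open>Factorisation of the enveloping algebra of the double crossed sum\<close>

context bracket_space
begin

lemma antipode_neg_incl: assumes x: "x <: L" shows "antipode U (-[U] uea_incl L x) = uea_incl L x"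
 unfolding lin_neg[OF vsU vsU lin_antipode[OF lin_id] incl_closed[OF x]] antipode_simps(3)[OF x]
 using incl_closed[OF x] by (simp add: vs_neg_eq[OF vsU] vs_simps[OF vsU])

lemma antipode_involutive: assumes u: "u <: U" shows "antipode U (antipode U u) = u"
proof (rule uea_lin_ext[OF vsU lin_antipode[OF lin_antipode[OF lin_id]] lin_id _ _ u])
 fix x u assume x: "x <: L" and u: "u <: U" and IH: "antipode U (antipode U u) = u"
 note c = incl_closed[OF x] u antipode_closed[OF u] vs_closed(4)[OF vsU incl_closed[OF x]]
 show "antipode U (antipode U (uea_incl L x *[U] u)) = uea_incl L x *[U] u"
  by (simp only: antipode_simps c antipode_simps(3)[OF x] antipode_neg_incl[OF x] IH)
qed (simp only: antipode_simps)

lemma counit_antipode: assumes u: "u <: U" shows "counit U (antipode U u) = counit U u"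
proof (rule uea_lin_ext[OF vs_cpx lin_counit[OF lin_antipode[OF lin_id]] lin_counit[OF lin_id] _ _ u])
 fix x u assume x: "x <: L" and u: "u <: U"
 note c = incl_closed[OF x] u antipode_closed[OF u] vs_closed(4)[OF vsU incl_closed[OF x]]
 have "counit U (-[U] uea_incl L x) = 0"
  using lin_neg[OF vsU vs_cpx lin_counit[OF lin_id] c(1)] counit_simps(3)[OF x] by simp
 then show "counit U (antipode U (uea_incl L x *[U] u)) = counit U (uea_incl L x *[U] u)"
  by (simp only: antipode_simps(2,3) x c counit_simps mult_zero_left mult_zero_right)
qed (simp only: antipode_simps)

lemma Sw_counit_counit: assumes u: "u <: U" shows "Sw cpx (%x y. counit U x * counit U y) (comult U u) = counit U u"
proof -
 have b: "bilin U U U (%x y. counit U x .[U] y)" by (assumption | rule lins cls)+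
 have "counit U (Sw U (%x y. counit U x .[U] y) (comult U u)) = Sw cpx (%x y. counit U (counit U x .[U] y)) (comult U u)"
  by (rule tensor_lift_natural[OF vsU vsU vsU vs_cpx lin_counit[OF lin_id] b comult_closed[OF u]])
 also have "\<dots> = Sw cpx (%x y. counit U x * counit U y) (comult U u)"
  by (rule lift_cong) (simp only: lin_smult[OF lin_counit[OF lin_id]] cpx_simps)
 finally show ?thesis unfolding counit_left_U[OF u] by simp
qed

end

locale bracket_map = L: bracket_space L + M: bracket_space M
 for L :: "'a lie" and M :: "'b lie" +
 fixes f :: "'a \<Rightarrow> 'b"
 assumes lin_f: "lin L M f" and f_bracket: "x <: L ==> y <: L ==> f (bracket L x y) = bracket M (f x) (f y)"
begin

definition emap :: "'a uea \<Rightarrow> 'b uea" where "emap = uea_ext L (uea M) (%x. uea_incl M (f x))"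

lemma f_closed: "x <: L ==> f x <: M" by (rule lin_closed[OF lin_f])

lemma bracket_hom_f: "bracket_hom L (uea M) (%x. uea_incl M (f x))"
 by (rule bracket_homI[OF M.lin_incl[OF lin_f]]) (simp only: f_bracket M.incl_bracket f_closed)

lemma emap_hom: "emap \<in> complex_alg_hom (uea L) (uea M)"
 unfolding emap_def by (rule L.uea_ext_U[OF M.algU bracket_hom_f])

lemma emap_incl: "x <: L ==> emap (uea_incl L x) = uea_incl M (f x)"
 unfolding emap_def by (rule L.uea_ext_incl[OF M.algU bracket_hom_f])

lemmas emap_one = alg_homD(2)[OF emap_hom] and emap_mult = alg_homD(3)[OF emap_hom]

lemma lin_emap [lins]: "lin X (uea L) g ==> lin X (uea M) (%x. emap (g x))"
 by (rule lin_comp[OF alg_homD(1)[OF emap_hom]])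

lemma emap_closed [cls]: "u <: (uea L) ==> emap u <: (uea M)"
 by (rule lin_closed[OF alg_homD(1)[OF emap_hom]])

lemma counit_emap: assumes u: "u <: (uea L)" shows "counit (uea M) (emap u) = counit (uea L) u"
 by (rule L.uea_lin_ext[OF vs_cpx M.lin_counit[OF lin_emap[OF lin_id]] L.lin_counit[OF lin_id] _ _ u])
  (simp_all only: emap_one M.counit_simps L.counit_simps emap_mult L.incl_closed emap_incl f_closed M.incl_closed emap_closed mult_zero_left)

lemma antipode_emap: assumes u: "u <: (uea L)" shows "antipode (uea M) (emap u) = emap (antipode (uea L) u)"
proof (rule L.uea_lin_ext[OF M.vsU M.lin_antipode[OF lin_emap[OF lin_id]] lin_emap[OF L.lin_antipode[OF lin_id]] _ _ u])
 fix x u assume x: "x <: L" and u: "u <: (uea L)" and IH: "antipode (uea M) (emap u) = emap (antipode (uea L) u)"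
 have "emap (-[uea L] uea_incl L x) = -[uea M] uea_incl M (f x)"
  using lin_neg[OF L.vsU M.vsU alg_homD(1)[OF emap_hom] L.incl_closed[OF x]] by (simp only: emap_incl[OF x])
 then show "antipode (uea M) (emap (uea_incl L x *[uea L] u)) = emap (antipode (uea L) (uea_incl L x *[uea L] u))"
  using x u by (simp only: emap_mult L.incl_closed emap_incl f_closed M.incl_closed emap_closed M.antipode_simps L.antipode_simps IH
    L.antipode_closed vs_closed(4)[OF L.vsU])
qed (simp only: emap_one L.antipode_simps M.antipode_simps)

lemma Sw_emap:
 assumes Z: "vs Z" and b: "bilin (uea M) (uea M) Z b" and u: "u <: (uea L)"
 shows "M.Sw Z b (comult (uea M) (emap u)) = L.Sw Z (%x y. b (emap x) (emap y)) (comult (uea L) u)"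
proof -
 let ?P = "%u. \<forall>b. bilin (uea M) (uea M) Z b \<longrightarrow>
  M.Sw Z b (comult (uea M) (emap u)) = L.Sw Z (%x y. b (emap x) (emap y)) (comult (uea L) u)"
 have be: "bilin (uea L) (uea L) Z (%x y. b (emap x) (emap y))" if b: "bilin (uea M) (uea M) Z b" for b
  by ((assumption | rule bilinI bilin_comp[OF b] lin_emap emap_closed lin_id)+)
 have l: "lin (uea L) Z (%u. M.Sw Z b (comult (uea M) (emap u)))" and r: "lin (uea L) Z (%u. L.Sw Z (%x y. b (emap x) (emap y)) (comult (uea L) u))"
  if b: "bilin (uea M) (uea M) Z b" for b
  by (rule M.Sw_lin[OF Z b lin_emap[OF lin_id]], rule L.Sw_lin[OF Z be[OF b] lin_id])
 have "?P u"
 proof (rule L.uea_induct[of u ?P, OF u]; intro allI impI)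
  fix b assume b: "bilin (uea M) (uea M) Z b"
  show "M.Sw Z b (comult (uea M) (emap 1[uea L])) = L.Sw Z (%x y. b (emap x) (emap y)) (comult (uea L) 1[uea L])"
   by (simp only: emap_one M.Sw_one[OF Z b] L.Sw_one[OF Z be[OF b]])
  show "M.Sw Z b (comult (uea M) (emap (u +[uea L] v))) = L.Sw Z (%x y. b (emap x) (emap y)) (comult (uea L) (u +[uea L] v))"
   if "u <: (uea L)" "v <: (uea L)" and h: "?P u" "?P v" for u v
   by (simp only: lin_add[OF l[OF b] that(1,2)] lin_add[OF r[OF b] that(1,2)] mp[OF spec[OF h(1)] b] mp[OF spec[OF h(2)] b])
  show "M.Sw Z b (comult (uea M) (emap (c .[uea L] u))) = L.Sw Z (%x y. b (emap x) (emap y)) (comult (uea L) (c .[uea L] u))"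
   if "u <: (uea L)" and h: "?P u" for c u
   by (simp only: lin_smult[OF l[OF b] that(1)] lin_smult[OF r[OF b] that(1)] mp[OF spec[OF h] b])
  fix x u assume x: "x <: L" and u: "u <: (uea L)" and h: "?P u"
  note i = M.incl_closed[OF f_closed[OF x]]
  have b1: "bilin (uea M) (uea M) Z (%u v. b (uea_incl M (f x) *[uea M] u) v)" and b2: "bilin (uea M) (uea M) Z (%u v. b u (uea_incl M (f x) *[uea M] v))"
   by ((assumption | rule i bilinI bilin_comp[OF b] lin_alg_mult alg_closed M.algU lin_id)+)
  have e: "emap (uea_incl L x *[uea L] y) = uea_incl M (f x) *[uea M] emap y" if "y <: (uea L)" for y
   by (simp only: emap_mult L.incl_closed emap_incl x that)
  show "M.Sw Z b (comult (uea M) (emap (uea_incl L x *[uea L] u))) = L.Sw Z (%x y. b (emap x) (emap y)) (comult (uea L) (uea_incl L x *[uea L] u))"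
   unfolding e[OF u] M.Sw_step[OF Z b f_closed[OF x] emap_closed[OF u]] mp[OF spec[OF h] b1] mp[OF spec[OF h] b2]
    L.Sw_step[OF Z be[OF b] x u]
   by (rule arg_cong2[of _ _ _ _ "add Z"]; rule lift_cong; simp only: e)
 qed
 then show ?thesis using b by blast
qed

end

lemma vs_sum_shuffle3:
 assumes V: "vs V"
  and c: "m <: V" "n <: V" "s1 <: V" "s2 <: V" "t1 <: V" "t2 <: V" "u <: V"
   "v <: V" "w <: V" "x <: V" "y1 <: V" "y2 <: V"
  and eq: "u +[V] s2 = m +[V] s1" "v +[V] t2 = n +[V] t1"
 shows "((m +[V] y1) +[V] x) +[V] ((y2 +[V] (s1 +[V] t1)) +[V] (n +[V] w)) =
  (u +[V] v) +[V] ((y1 +[V] y2) +[V] ((x +[V] (s2 +[V] t2)) +[V] w))"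
proof -
 note ac = vs_add_ac[OF V] vs_closed(2)[OF V] c
 let ?r = "x +[V] y1 +[V] y2 +[V] w"
 have "((m +[V] y1) +[V] x) +[V] ((y2 +[V] (s1 +[V] t1)) +[V] (n +[V] w)) = (m +[V] s1) +[V] (n +[V] t1) +[V] ?r"
  by (simp only: ac)
 also have "\<dots> = (u +[V] s2) +[V] (v +[V] t2) +[V] ?r" unfolding eq by (rule refl)
 also have "\<dots> = (u +[V] v) +[V] ((y1 +[V] y2) +[V] ((x +[V] (s2 +[V] t2)) +[V] w))" by (simp only: ac)
 finally show ?thesis .
qed

context matched_brackets
begin

abbreviation "d \<equiv> double_crossed_sum P Q lact ract"
abbreviation "UD \<equiv> uea d"

lemma d_simps:
 "carrier d = carrier P \<times> carrier Q" "0[d] = (0[P], 0[Q])"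
 "z +[d] w = (fst z +[P] fst w, snd z +[Q] snd w)" "c .[d] z = (c .[P] fst z, c .[Q] snd z)"
 "bracket d z w = (bracket P (fst z) (fst w) +[P] snd z \<triangleright> fst w -[P] snd w \<triangleright> fst z,
   bracket Q (snd z) (snd w) +[Q] snd z \<triangleleft> fst w -[Q] snd w \<triangleleft> fst z)"
 by (simp_all add: double_crossed_sum_def direct_sum_def module.extend_def lie.fields_def case_prod_unfold)

lemma vs_d: "vs d"
 by (rule vsI) (auto simp: d_simps vs_simps[OF P.vs_L] vs_simps[OF Q.vs_L] vs_add_ac[OF P.vs_L] vs_add_ac[OF Q.vs_L])

lemma d_bracket_closed: assumes z: "z <: d" and w: "w <: d" shows "bracket d z w <: d"
proof -
 have c: "fst z <: P" "snd z <: Q" "fst w <: P" "snd w <: Q"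
  using z w by (simp_all add: d_simps mem_Times_iff)
 show ?thesis unfolding d_simps
  by (intro SigmaI vs_closed[OF P.vs_L] vs_closed[OF Q.vs_L] P.bracket_closed Q.bracket_closed lact_closed ract_closed c)
qed

lemma bracket_zero:
 "X <: P ==> bracket P X 0[P] = 0[P]" "X <: P ==> bracket P 0[P] X = 0[P]"
 "\<xi> <: Q ==> bracket Q \<xi> 0[Q] = 0[Q]" "\<xi> <: Q ==> bracket Q 0[Q] \<xi> = 0[Q]"
 "X <: P ==> 0[Q] \<triangleright> X = 0[P]" "\<xi> <: Q ==> \<xi> \<triangleright> 0[P] = 0[P]"
 "X <: P ==> 0[Q] \<triangleleft> X = 0[Q]" "\<xi> <: Q ==> \<xi> \<triangleleft> 0[P] = 0[Q]"
 by (erule lin_zero[OF P.vs_L P.vs_L bilinD(1)[OF bilin_brackets(1)]] lin_zero[OF P.vs_L P.vs_L bilinD(2)[OF bilin_brackets(1)]]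
  lin_zero[OF Q.vs_L Q.vs_L bilinD(1)[OF bilin_brackets(2)]] lin_zero[OF Q.vs_L Q.vs_L bilinD(2)[OF bilin_brackets(2)]]
  lin_zero[OF Q.vs_L P.vs_L bilinD(2)[OF bilin_lact]] lin_zero[OF P.vs_L P.vs_L bilinD(1)[OF bilin_lact]]
  lin_zero[OF Q.vs_L Q.vs_L bilinD(2)[OF bilin_ract]] lin_zero[OF P.vs_L Q.vs_L bilinD(1)[OF bilin_ract]])+

lemma minus_zero_simps:
 "x <: P ==> x -[P] 0[P] = x" "y <: Q ==> y -[Q] 0[Q] = y"
 by (simp_all add: vs_minus_eq[OF P.vs_L] vs_minus_eq[OF Q.vs_L] vs_simps[OF P.vs_L] vs_simps[OF Q.vs_L])

lemma bracket_map_P: "bracket_map P d (%X. (X, 0[Q]))"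
proof (rule bracket_map.intro[OF P.bracket_space_axioms bracket_space.intro[OF vs_d d_bracket_closed] bracket_map_axioms.intro])
 show "lin P d (%X. (X, 0[Q]))" by (rule linI) (simp_all add: d_simps vs_simps[OF Q.vs_L])
 show "(bracket P x y, 0[Q]) = bracket d (x, 0[Q]) (y, 0[Q])" if "x <: P" "y <: P" for x y
  using that by (simp add: d_simps bracket_zero minus_zero_simps vs_simps[OF P.vs_L] vs_simps[OF Q.vs_L] P.bracket_closed)
qed

lemma bracket_map_Q: "bracket_map Q d (%\<xi>. (0[P], \<xi>))"
proof (rule bracket_map.intro[OF Q.bracket_space_axioms bracket_space.intro[OF vs_d d_bracket_closed] bracket_map_axioms.intro])
 show "lin Q d (%\<xi>. (0[P], \<xi>))" by (rule linI) (simp_all add: d_simps vs_simps[OF P.vs_L])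
 show "(0[P], bracket Q x y) = bracket d (0[P], x) (0[P], y)" if "x <: Q" "y <: Q" for x y
  using that by (simp add: d_simps bracket_zero minus_zero_simps vs_simps[OF P.vs_L] vs_simps[OF Q.vs_L] Q.bracket_closed)
qed

end

sublocale matched_brackets \<subseteq> E1: bracket_map P d "%X. (X, 0[Q])" by (rule bracket_map_P)
sublocale matched_brackets \<subseteq> E2: bracket_map Q d "%\<xi>. (0[P], \<xi>)" by (rule bracket_map_Q)

context matched_brackets
begin

abbreviation "e1 \<equiv> E1.emap"
abbreviation "e2 \<equiv> E2.emap"

lemma bracket_hom_d:
 assumes A: "complex_algebra A" and a: "bracket_hom P A a" and b: "bracket_hom Q A b"
  and ab: "!!X \<xi>. X <: P ==> \<xi> <: Q ==> b \<xi> *[A] a X = a X *[A] b \<xi> +[A] (a (\<xi> \<triangleright> X) +[A] b (\<xi> \<triangleleft> X))"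
 shows "bracket_hom d A (%z. a (fst z) +[A] b (snd z))"
proof (rule bracket_homI_add[OF A])
 note vA = alg_vs[OF A] and la = bracket_homD(1)[OF a] and lb = bracket_homD(1)[OF b]
 have "lin d P fst" "lin d Q snd" by (rule linI; auto simp: d_simps)+
 then show "lin d A (%z. a (fst z) +[A] b (snd z))" by (intro lin_pointwise_add[OF vA] lin_comp[OF la] lin_comp[OF lb])
 fix z w assume z: "z <: d" and w: "w <: d"
 show "bracket d z w <: d" by (rule d_bracket_closed[OF z w])
 obtain X \<xi> Y \<zeta> where zw: "z = (X, \<xi>)" "w = (Y, \<zeta>)" by (cases z, cases w)
 then have X: "X <: P" "Y <: P" and xi: "\<xi> <: Q" "\<zeta> <: Q" using z w by (simp_all add: d_simps)
 note c = lact_closed ract_closed P.bracket_closed Q.bracket_closed X xi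
 note cA = alg_closed[OF A] lin_closed[OF la] lin_closed[OF lb] vs_closed(2,5)[OF P.vs_L] vs_closed(2,5)[OF Q.vs_L] vs_closed(2)[OF vA] c
 let ?u = "bracket P X Y +[P] \<xi> \<triangleright> Y -[P] \<zeta> \<triangleright> X" and ?v = "bracket Q \<xi> \<zeta> +[Q] \<xi> \<triangleleft> Y -[Q] \<zeta> \<triangleleft> X"
 have u: "a ?u +[A] a (\<zeta> \<triangleright> X) = a (bracket P X Y) +[A] a (\<xi> \<triangleright> Y)"
  using lin_add[OF la, of ?u "\<zeta> \<triangleright> X"] lin_add[OF la, of "bracket P X Y" "\<xi> \<triangleright> Y"] by (simp only: cA vs_minus_add_cancel[OF P.vs_L])
 have v: "b ?v +[A] b (\<zeta> \<triangleleft> X) = b (bracket Q \<xi> \<zeta>) +[A] b (\<xi> \<triangleleft> Y)"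
  using lin_add[OF lb, of ?v "\<zeta> \<triangleleft> X"] lin_add[OF lb, of "bracket Q \<xi> \<zeta>" "\<xi> \<triangleleft> Y"] by (simp only: cA vs_minus_add_cancel[OF Q.vs_L])
 have ex: "(x1 +[A] x2) *[A] (y1 +[A] y2) = (x1 *[A] y1 +[A] x1 *[A] y2) +[A] (x2 *[A] y1 +[A] x2 *[A] y2)"
  if "x1 <: A" "x2 <: A" "y1 <: A" "y2 <: A" for x1 x2 y1 y2
  unfolding alg_distrib(1)[OF A that(1,2) vs_closed(2)[OF vA that(3,4)]] alg_distrib(2)[OF A that(3,4,1)] alg_distrib(2)[OF A that(3,4,2)] by (rule refl)
 show "(a (fst z) +[A] b (snd z)) *[A] (a (fst w) +[A] b (snd w)) =
   (a (fst (bracket d z w)) +[A] b (snd (bracket d z w))) +[A] (a (fst w) +[A] b (snd w)) *[A] (a (fst z) +[A] b (snd z))"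
  unfolding zw d_simps fst_conv snd_conv ex[OF lin_closed[OF la X(1)] lin_closed[OF lb xi(1)] lin_closed[OF la X(2)] lin_closed[OF lb xi(2)]]
   ex[OF lin_closed[OF la X(2)] lin_closed[OF lb xi(2)] lin_closed[OF la X(1)] lin_closed[OF lb xi(1)]]
   P.bracket_hom_commute[OF A a X] Q.bracket_hom_commute[OF A b xi] ab[OF X(2) xi(1)] ab[OF X(1) xi(2)]
  by (rule vs_sum_shuffle3[OF vA]) ((intro cA | rule u v)+)
qed

text \<open>Left multiplication and \<open>der\<close> define the action of the double crossed sum on \<open>U(P)\<close>.\<close>

lemma bracket_hom_regular:
 "bracket_hom P (end_alg UP) (%X. \<lambda>p\<in>carrier UP. \<iota> X *[UP] p)"
proof (rule bracket_homI_add[OF complex_algebra_end_alg[OF P.vsU]])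
 have cl: "(\<lambda>p\<in>carrier UP. \<iota> X *[UP] p) <: (end_alg UP)" if "X <: P" for X
  by (rule end_algI[OF P.vsU]) ((assumption | rule that P.vsU lins cls)+)
 have lp: "lin P UP (%X. \<iota> X *[UP] p)" if "p <: UP" for p by ((assumption | rule that lins cls)+)
 show "lin P (end_alg UP) (%X. \<lambda>p\<in>carrier UP. \<iota> X *[UP] p)"
  by ((rule linI, erule cl); unfold end_alg_simps; rule restrict_ext; simp only: restrict_apply' lin_add[OF lp] lin_smult[OF lp])
 fix X Y assume X: "X <: P" and Y: "Y <: P"
 show "bracket P X Y <: P" by (rule P.bracket_closed[OF X Y])
 show "(\<lambda>p\<in>carrier UP. \<iota> X *[UP] p) *[end_alg UP] (\<lambda>p\<in>carrier UP. \<iota> Y *[UP] p) =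
   (\<lambda>p\<in>carrier UP. \<iota> (bracket P X Y) *[UP] p) +[end_alg UP] (\<lambda>p\<in>carrier UP. \<iota> Y *[UP] p) *[end_alg UP] (\<lambda>p\<in>carrier UP. \<iota> X *[UP] p)"
  unfolding end_alg_simps
  by (rule restrict_ext) (simp only: restrict_apply' alg_closed[OF P.algU] P.incl_closed X Y, rule incl_commute[OF X Y])
qed

lemma bracket_hom_der: "bracket_hom Q (end_alg UP) (%\<xi>. \<lambda>p\<in>carrier UP. der \<xi> p)"
proof (rule bracket_homI_add[OF complex_algebra_end_alg[OF P.vsU]])
 have cl: "(\<lambda>p\<in>carrier UP. der \<xi> p) <: (end_alg UP)" if "\<xi> <: Q" for \<xi>
  by (rule end_algI[OF P.vsU lin_der(1)[OF that lin_id]])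
 show "lin Q (end_alg UP) (%\<xi>. \<lambda>p\<in>carrier UP. der \<xi> p)"
  by ((rule linI, erule cl); unfold end_alg_simps; rule restrict_ext;
   simp only: restrict_apply' lin_add[OF lin_der(2)[OF _ lin_id]] lin_smult[OF lin_der(2)[OF _ lin_id]])
 fix \<zeta> \<xi> assume z: "\<zeta> <: Q" and x: "\<xi> <: Q"
 show "bracket Q \<zeta> \<xi> <: Q" by (rule Q.bracket_closed[OF z x])
 show "(\<lambda>p\<in>carrier UP. der \<zeta> p) *[end_alg UP] (\<lambda>p\<in>carrier UP. der \<xi> p) =
   (\<lambda>p\<in>carrier UP. der (bracket Q \<zeta> \<xi>) p) +[end_alg UP] (\<lambda>p\<in>carrier UP. der \<xi> p) *[end_alg UP] (\<lambda>p\<in>carrier UP. der \<zeta> p)"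
  unfolding end_alg_simps
  by (rule restrict_ext) (simp only: restrict_apply' der_closed z x, rule bspec[OF bspec[OF der_commute z] x])
qed

lemma der_regular:
 assumes X: "X <: P" and xi: "\<xi> <: Q"
 shows "(\<lambda>p\<in>carrier UP. der \<xi> p) *[end_alg UP] (\<lambda>p\<in>carrier UP. \<iota> X *[UP] p) =
  (\<lambda>p\<in>carrier UP. \<iota> X *[UP] p) *[end_alg UP] (\<lambda>p\<in>carrier UP. der \<xi> p) +[end_alg UP]
  ((\<lambda>p\<in>carrier UP. \<iota> (\<xi> \<triangleright> X) *[UP] p) +[end_alg UP] (\<lambda>p\<in>carrier UP. der (\<xi> \<triangleleft> X) p))"
 unfolding end_alg_simps
proof (rule restrict_ext)
 fix p assume p: "p <: UP"
 note c = alg_closed[OF P.algU] P.incl_closed der_closed lact_closed ract_closed X xi p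
 show "(\<lambda>p\<in>carrier UP. der \<xi> p) ((\<lambda>p\<in>carrier UP. \<iota> X *[UP] p) p) =
   (\<lambda>x\<in>carrier UP. (\<lambda>p\<in>carrier UP. \<iota> X *[UP] p) ((\<lambda>p\<in>carrier UP. der \<xi> p) x)) p +[UP]
   (\<lambda>x\<in>carrier UP. (\<lambda>p\<in>carrier UP. \<iota> (\<xi> \<triangleright> X) *[UP] p) x +[UP] (\<lambda>p\<in>carrier UP. der (\<xi> \<triangleleft> X) p) x) p"
  by (simp only: restrict_apply' c der_step vs_add_ac[OF P.vsU])
qed

definition rep1 :: "('a \<times> 'b) uea \<Rightarrow> 'a uea \<Rightarrow> 'a uea" where
 "rep1 = uea_ext d (end_alg UP) (%z. (\<lambda>p\<in>carrier UP. \<iota> (fst z) *[UP] p) +[end_alg UP] (\<lambda>p\<in>carrier UP. der (snd z) p))"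

lemmas bracket_hom_rep1 = bracket_hom_d[OF complex_algebra_end_alg[OF P.vsU] bracket_hom_regular bracket_hom_der der_regular]

lemma rep1_hom: "rep1 \<in> complex_alg_hom UD (end_alg UP)"
 unfolding rep1_def by (rule E1.M.uea_ext_U[OF complex_algebra_end_alg[OF P.vsU] bracket_hom_rep1])

lemma rep1_incl: "z <: d ==> p <: UP ==> rep1 (uea_incl d z) p = \<iota> (fst z) *[UP] p +[UP] der (snd z) p"
 using E1.M.uea_ext_incl[OF complex_algebra_end_alg[OF P.vsU] bracket_hom_rep1, of z]
 unfolding rep1_def[symmetric] by (simp only: end_alg_simps restrict_apply')

end

lemma vs_neg_neg: "vs V ==> x <: V ==> -[V] (-[V] x) = x"
 by (simp add: vs_neg_eq vs_closed vs_smult_smult vs_smult_zero)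

lemma vs_neg_cancel:
 assumes V: "vs V" and x: "x <: V" and y: "y <: V"
 shows "-[V] x +[V] (x +[V] y) = y" "x +[V] (-[V] x +[V] y) = y"
proof -
 interpret vectorspace cpx V by (rule V)
 show "-[V] x +[V] (x +[V] y) = y" "x +[V] (-[V] x +[V] y) = y" using x y by (rule M.r_neg1 M.r_neg2)+
qed

lemma vs_move2:
 assumes V: "vs V" and c: "s <: V" "p <: V" "q <: V" "r <: V" "w <: V"
  and eq: "s +[V] p = (q +[V] r) +[V] w"
 shows "-[V] s +[V] w = (-[V] q +[V] -[V] r) +[V] p"
proof -
 note cl = c vs_closed[OF V] and ac = vs_add_ac[OF V]
 have "-[V] s +[V] w = -[V] s +[V] (-[V] q +[V] (-[V] r +[V] (q +[V] (r +[V] w))))"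
  using cl by (simp only: ac(3)[of "-[V] r" q] vs_neg_cancel[OF V])
 also have "\<dots> = -[V] s +[V] (-[V] q +[V] (-[V] r +[V] (s +[V] p)))"
  unfolding eq using cl by (simp only: ac(1))
 also have "\<dots> = -[V] q +[V] (-[V] r +[V] (-[V] s +[V] (s +[V] p)))" using cl by (simp only: ac)
 finally show ?thesis using cl by (simp only: vs_neg_cancel[OF V] ac(1))
qed

context matched_brackets
begin

lemmas neg_rules =
 lin_neg[OF P.vs_L P.vs_L bilinD(1)[OF bilin_brackets(1)]] lin_neg[OF P.vs_L P.vs_L bilinD(2)[OF bilin_brackets(1)]]
 lin_neg[OF Q.vs_L Q.vs_L bilinD(1)[OF bilin_brackets(2)]] lin_neg[OF Q.vs_L Q.vs_L bilinD(2)[OF bilin_brackets(2)]]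
 lin_neg[OF Q.vs_L P.vs_L bilinD(2)[OF bilin_lact]] lin_neg[OF P.vs_L P.vs_L bilinD(1)[OF bilin_lact]]
 lin_neg[OF Q.vs_L Q.vs_L bilinD(2)[OF bilin_ract]] lin_neg[OF P.vs_L Q.vs_L bilinD(1)[OF bilin_ract]]

text \<open>Exchanging the roles of the two spaces turns a matched pair into a matched pair, up to signs:
 \<open>[X, \<xi>] = - \<xi> \<triangleleft> X - \<xi> \<triangleright> X\<close>.\<close>

lemma swapped: "matched_brackets Q P (%X \<xi>. -[Q] (\<xi> \<triangleleft> X)) (%X \<xi>. -[P] (\<xi> \<triangleright> X))"
proof (rule matched_brackets.intro[OF Q.bracket_space_axioms P.bracket_space_axioms], rule matched_brackets_axioms.intro)
 note vP = P.vs_L and vQ = Q.vs_L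
 note cl = lact_closed ract_closed P.bracket_closed Q.bracket_closed vs_closed(4)[OF vP] vs_closed(4)[OF vQ]
 show "bilin Q Q Q (bracket Q)" "bilin P P P (bracket P)" by (rule bilin_brackets)+
 show "bilin P Q Q (%X \<xi>. -[Q] (\<xi> \<triangleleft> X))" "bilin P Q P (%X \<xi>. -[P] (\<xi> \<triangleright> X))"
  by ((assumption | rule bilinI lin_pointwise_neg vP vQ lin_lact lin_ract lin_id)+)
 fix X Y \<xi> assume X: "X <: P" and Y: "Y <: P" and xi: "\<xi> <: Q"
 note c = X Y xi
 show "-[Q] (-[Q] (\<xi> \<triangleleft> Y) \<triangleleft> X) = -[Q] (\<xi> \<triangleleft> bracket P X Y) +[Q] -[Q] (-[Q] (\<xi> \<triangleleft> X) \<triangleleft> Y)"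
 proof -
  have n: "-[Q] (-[Q] (\<xi> \<triangleleft> A) \<triangleleft> B) = \<xi> \<triangleleft> A \<triangleleft> B" if "A <: P" "B <: P" for A B
   unfolding lin_neg[OF vQ vQ bilinD(2)[OF bilin_ract that(2)] ract_closed[OF xi that(1)]]
   by (rule vs_neg_neg[OF vQ]) (intro ract_closed that xi)
  show ?thesis unfolding n[OF Y X] n[OF X Y] ract_bracket[OF xi X Y]
   by (rule vs_neg_cancel(1)[OF vQ, symmetric]) (intro ract_closed P.bracket_closed X xi Y)+
 qed
 show "-[P] (\<xi> \<triangleright> bracket P X Y) +[P] -[P] (-[Q] (\<xi> \<triangleleft> X) \<triangleright> Y) =
   (bracket P (-[P] (\<xi> \<triangleright> X)) Y +[P] bracket P X (-[P] (\<xi> \<triangleright> Y))) +[P] -[P] (-[Q] (\<xi> \<triangleleft> Y) \<triangleright> X)"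
  using c vs_move2[OF vP _ _ _ _ _ lact_of_bracket[OF xi X Y]] by (simp only: neg_rules cl vs_neg_neg[OF vP])
next
 note vP = P.vs_L and vQ = Q.vs_L
 note cl = lact_closed ract_closed P.bracket_closed Q.bracket_closed vs_closed(4)[OF vP] vs_closed(4)[OF vQ]
 fix X \<xi> \<zeta> assume X: "X <: P" and xi: "\<xi> <: Q" and z: "\<zeta> <: Q"
 note c = X xi z
 show "-[P] (\<zeta> \<triangleright> -[P] (\<xi> \<triangleright> X)) = -[P] (bracket Q \<xi> \<zeta> \<triangleright> X) +[P] -[P] (\<xi> \<triangleright> -[P] (\<zeta> \<triangleright> X))"
 proof -
  have n: "-[P] (\<alpha> \<triangleright> -[P] (\<beta> \<triangleright> X)) = \<alpha> \<triangleright> \<beta> \<triangleright> X" if "\<alpha> <: Q" "\<beta> <: Q" for \<alpha> \<beta>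
   unfolding lin_neg[OF vP vP bilinD(1)[OF bilin_lact that(1)] lact_closed[OF that(2) X]]
   by (rule vs_neg_neg[OF vP]) (intro lact_closed that X)
  show ?thesis unfolding n[OF z xi] n[OF xi z] lact_bracket[OF xi z X]
   by (rule vs_neg_cancel(1)[OF vP, symmetric]) (intro lact_closed Q.bracket_closed X xi z)+
 qed
 show "-[Q] (bracket Q \<xi> \<zeta> \<triangleleft> X) +[Q] -[Q] (\<xi> \<triangleleft> -[P] (\<zeta> \<triangleright> X)) =
   (bracket Q (-[Q] (\<xi> \<triangleleft> X)) \<zeta> +[Q] bracket Q \<xi> (-[Q] (\<zeta> \<triangleleft> X))) +[Q] -[Q] (\<zeta> \<triangleleft> -[P] (\<xi> \<triangleright> X))"
  using c vs_move2[OF vQ _ _ _ _ _ ract_of_bracket[OF xi z X]] by (simp only: neg_rules cl vs_neg_neg[OF vQ])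
qed

definition codir :: "'a \<Rightarrow> 'b uea \<Rightarrow> 'b uea" where
 "codir = matched_brackets.der Q P (%X \<xi>. -[Q] (\<xi> \<triangleleft> X)) (%X \<xi>. -[P] (\<xi> \<triangleright> X))"

lemmas codir_one = matched_brackets.der_one[OF swapped, folded codir_def]
 and bracket_hom_codir = matched_brackets.bracket_hom_der[OF swapped, folded codir_def]
 and bracket_hom_regular_Q = matched_brackets.bracket_hom_regular[OF swapped]
 and codir_regular = matched_brackets.der_regular[OF swapped, folded codir_def]
 and lin_codir = matched_brackets.lin_der[OF swapped, folded codir_def]

lemma regular_codir:
 assumes X: "X <: P" and xi: "\<xi> <: Q"
 shows "(\<lambda>q\<in>carrier UQ. \<kappa> \<xi> *[UQ] q) *[end_alg UQ] (\<lambda>q\<in>carrier UQ. codir X q) =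
  (\<lambda>q\<in>carrier UQ. codir X q) *[end_alg UQ] (\<lambda>q\<in>carrier UQ. \<kappa> \<xi> *[UQ] q) +[end_alg UQ]
  ((\<lambda>q\<in>carrier UQ. codir (\<xi> \<triangleright> X) q) +[end_alg UQ] (\<lambda>q\<in>carrier UQ. \<kappa> (\<xi> \<triangleleft> X) *[UQ] q))" (is "?b \<xi> *[?E] ?a X = _")
proof -
 note E = complex_algebra_end_alg[OF Q.vsU] and vE = alg_vs[OF complex_algebra_end_alg[OF Q.vsU]]
 note la = bracket_homD(1)[OF bracket_hom_codir] and lb = bracket_homD(1)[OF bracket_hom_regular_Q]
 note cl = lin_closed[OF la] lin_closed[OF lb] alg_closed[OF E] lact_closed ract_closed X xi
 have "?a X *[?E] ?b \<xi> +[?E] (?a (\<xi> \<triangleright> X) +[?E] ?b (\<xi> \<triangleleft> X)) =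
  (?b \<xi> *[?E] ?a X +[?E] (-[?E] ?b (\<xi> \<triangleleft> X) +[?E] -[?E] ?a (\<xi> \<triangleright> X))) +[?E] (?a (\<xi> \<triangleright> X) +[?E] ?b (\<xi> \<triangleleft> X))"
  unfolding codir_regular[OF xi X] lin_neg[OF Q.vs_L vE lb ract_closed[OF xi X]] lin_neg[OF P.vs_L vE la lact_closed[OF xi X]]
  by (rule refl)
 also have "\<dots> = -[?E] ?b (\<xi> \<triangleleft> X) +[?E] (?b (\<xi> \<triangleleft> X) +[?E]
   (-[?E] ?a (\<xi> \<triangleright> X) +[?E] (?a (\<xi> \<triangleright> X) +[?E] ?b \<xi> *[?E] ?a X)))"
  by (simp only: vs_add_ac[OF vE] vs_closed(2,4)[OF vE] cl)
 also have "\<dots> = ?b \<xi> *[?E] ?a X" by (simp only: vs_neg_cancel[OF vE] vs_closed(2,4)[OF vE] cl)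
 finally show ?thesis by (rule HOL.sym)
qed

definition rep2 :: "('a \<times> 'b) uea \<Rightarrow> 'b uea \<Rightarrow> 'b uea" where
 "rep2 = uea_ext d (end_alg UQ) (%z. (\<lambda>q\<in>carrier UQ. codir (fst z) q) +[end_alg UQ] (\<lambda>q\<in>carrier UQ. \<kappa> (snd z) *[UQ] q))"

lemmas bracket_hom_rep2 = bracket_hom_d[OF complex_algebra_end_alg[OF Q.vsU] bracket_hom_codir bracket_hom_regular_Q regular_codir]

lemma rep2_hom: "rep2 \<in> complex_alg_hom UD (end_alg UQ)"
 unfolding rep2_def by (rule E1.M.uea_ext_U[OF complex_algebra_end_alg[OF Q.vsU] bracket_hom_rep2])

lemma rep2_incl: "z <: d ==> q <: UQ ==> rep2 (uea_incl d z) q = codir (fst z) q +[UQ] \<kappa> (snd z) *[UQ] q"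
 using E1.M.uea_ext_incl[OF complex_algebra_end_alg[OF Q.vsU] bracket_hom_rep2, of z]
 unfolding rep2_def[symmetric] by (simp only: end_alg_simps restrict_apply')

lemma d_closed: "X <: P ==> (X, 0[Q]) <: d" "\<xi> <: Q ==> (0[P], \<xi>) <: d"
 by (simp_all add: d_simps vs_closed[OF P.vs_L] vs_closed[OF Q.vs_L])

lemma rep_incl_zero:
 assumes X: "X <: P" and xi: "\<xi> <: Q" and p: "p <: UP" and q: "q <: UQ"
 shows "rep1 (uea_incl d (X, 0[Q])) p = \<iota> X *[UP] p" "rep1 (uea_incl d (0[P], \<xi>)) p = der \<xi> p"
  "rep2 (uea_incl d (X, 0[Q])) q = codir X q" "rep2 (uea_incl d (0[P], \<xi>)) q = \<kappa> \<xi> *[UQ] q"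
proof -
 have l: "lin P UP (%X. \<iota> X *[UP] p)" "lin Q UQ (%\<xi>. \<kappa> \<xi> *[UQ] q)" by ((assumption | rule p q lins cls)+)
 note l' = lin_codir(2)[OF q lin_id] lin_der(2)[OF p lin_id]
 note z = lin_zero[OF P.vs_L P.vsU l(1)] lin_zero[OF Q.vs_L Q.vsU l(2)] lin_zero[OF P.vs_L Q.vsU l'(1)] lin_zero[OF Q.vs_L P.vsU l'(2)]
 show "rep1 (uea_incl d (X, 0[Q])) p = \<iota> X *[UP] p" "rep1 (uea_incl d (0[P], \<xi>)) p = der \<xi> p"
  "rep2 (uea_incl d (X, 0[Q])) q = codir X q" "rep2 (uea_incl d (0[P], \<xi>)) q = \<kappa> \<xi> *[UQ] q"
  unfolding rep1_incl[OF d_closed(1)[OF X] p] rep1_incl[OF d_closed(2)[OF xi] p] rep2_incl[OF d_closed(1)[OF X] q]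
   rep2_incl[OF d_closed(2)[OF xi] q] fst_conv snd_conv z
  by (rule vs_add_zero[OF P.vsU] vs_add_zero[OF Q.vsU]; rule lin_closed[OF l(1) X] lin_closed[OF l(2) xi] lin_closed[OF l'(1) X] lin_closed[OF l'(2) xi])+
qed

lemmas rep1_eval = eval_end_alg[OF rep1_hom] and rep2_eval = eval_end_alg[OF rep2_hom]

lemma rep1_e1: assumes p: "p <: UP" and r: "r <: UP" shows "rep1 (e1 p) r = p *[UP] r"
proof (rule P.uea_lin_ext[OF P.vsU lin_comp[OF rep1_eval(1)[OF r] E1.lin_emap[OF lin_id]] lin_alg_mult(1)[OF P.algU r lin_id] _ _ p])
 show "rep1 (e1 1[UP]) r = 1[UP] *[UP] r" by (simp only: E1.emap_one rep1_eval(2)[OF r] alg_unit[OF P.algU] r)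
 fix X u assume X: "X <: P" and u: "u <: UP" and IH: "rep1 (e1 u) r = u *[UP] r"
 note i = E1.M.incl_closed[OF d_closed(1)[OF X]] P.incl_closed[OF X]
 show "rep1 (e1 (\<iota> X *[UP] u)) r = \<iota> X *[UP] u *[UP] r"
  unfolding E1.emap_mult[OF i(2) u] E1.emap_incl[OF X] rep1_eval(3)[OF r i(1) E1.emap_closed[OF u]] IH
   rep_incl_zero(1)[OF X vs_closed(1)[OF Q.vs_L] alg_closed(2)[OF P.algU u r] alg_closed(1)[OF Q.algU]]
  by (rule alg_assoc[OF P.algU i(2) u r, symmetric])
qed

lemma rep2_e2: assumes p: "p <: UQ" and r: "r <: UQ" shows "rep2 (e2 p) r = p *[UQ] r"
proof (rule Q.uea_lin_ext[OF Q.vsU lin_comp[OF rep2_eval(1)[OF r] E2.lin_emap[OF lin_id]] lin_alg_mult(1)[OF Q.algU r lin_id] _ _ p])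
 show "rep2 (e2 1[UQ]) r = 1[UQ] *[UQ] r" by (simp only: E2.emap_one rep2_eval(2)[OF r] alg_unit[OF Q.algU] r)
 fix X u assume X: "X <: Q" and u: "u <: UQ" and IH: "rep2 (e2 u) r = u *[UQ] r"
 note i = E1.M.incl_closed[OF d_closed(2)[OF X]] Q.incl_closed[OF X]
 show "rep2 (e2 (\<kappa> X *[UQ] u)) r = \<kappa> X *[UQ] u *[UQ] r"
  unfolding E2.emap_mult[OF i(2) u] E2.emap_incl[OF X] rep2_eval(3)[OF r i(1) E2.emap_closed[OF u]] IH
   rep_incl_zero(4)[OF vs_closed(1)[OF P.vs_L] X alg_closed(1)[OF P.algU] alg_closed(2)[OF Q.algU u r]]
  by (rule alg_assoc[OF Q.algU i(2) u r, symmetric])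
qed

lemma rep1_e2: assumes q: "q <: UQ" shows "rep1 (e2 q) 1[UP] = counit UQ q .[UP] 1[UP]"
proof -
 note one = alg_closed(1)[OF P.algU]
 show ?thesis
 proof (rule Q.uea_lin_ext[OF P.vsU lin_comp[OF rep1_eval(1)[OF one] E2.lin_emap[OF lin_id]] lin_smult_left[OF P.vsU one Q.lin_counit[OF lin_id]] _ _ q])
  show "rep1 (e2 1[UQ]) 1[UP] = counit UQ 1[UQ] .[UP] 1[UP]"
   by (simp only: E2.emap_one rep1_eval(2)[OF one] Q.counit_simps vs_smult_zero[OF P.vsU] one)
  fix \<xi> u assume x: "\<xi> <: Q" and u: "u <: UQ" and IH: "rep1 (e2 u) 1[UP] = counit UQ u .[UP] 1[UP]"
  note i = E1.M.incl_closed[OF d_closed(2)[OF x]] Q.incl_closed[OF x]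
  show "rep1 (e2 (\<kappa> \<xi> *[UQ] u)) 1[UP] = counit UQ (\<kappa> \<xi> *[UQ] u) .[UP] 1[UP]"
   unfolding E2.emap_mult[OF i(2) u] E2.emap_incl[OF x] rep1_eval(3)[OF one i(1) E2.emap_closed[OF u]] IH
    rep_incl_zero(2)[OF vs_closed(1)[OF P.vs_L] x vs_closed(3)[OF P.vsU one] alg_closed(1)[OF Q.algU]]
    lin_smult[OF lin_der(1)[OF x lin_id] one] der_one[OF x] Q.counit_simps(2)[OF i(2) u] Q.counit_simps(3)[OF x]
   by (simp only: vs_smult_zero[OF P.vsU] mult_zero_left one)
 qed
qed

lemma rep2_e1: assumes p: "p <: UP" shows "rep2 (e1 p) 1[UQ] = counit UP p .[UQ] 1[UQ]"
proof -
 note one = alg_closed(1)[OF Q.algU]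
 show ?thesis
 proof (rule P.uea_lin_ext[OF Q.vsU lin_comp[OF rep2_eval(1)[OF one] E1.lin_emap[OF lin_id]] lin_smult_left[OF Q.vsU one P.lin_counit[OF lin_id]] _ _ p])
  show "rep2 (e1 1[UP]) 1[UQ] = counit UP 1[UP] .[UQ] 1[UQ]"
   by (simp only: E1.emap_one rep2_eval(2)[OF one] P.counit_simps vs_smult_zero[OF Q.vsU] one)
  fix X u assume x: "X <: P" and u: "u <: UP" and IH: "rep2 (e1 u) 1[UQ] = counit UP u .[UQ] 1[UQ]"
  note i = E1.M.incl_closed[OF d_closed(1)[OF x]] P.incl_closed[OF x]
  show "rep2 (e1 (\<iota> X *[UP] u)) 1[UQ] = counit UP (\<iota> X *[UP] u) .[UQ] 1[UQ]"
   unfolding E1.emap_mult[OF i(2) u] E1.emap_incl[OF x] rep2_eval(3)[OF one i(1) E1.emap_closed[OF u]] IH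
    rep_incl_zero(3)[OF x vs_closed(1)[OF Q.vs_L] alg_closed(1)[OF P.algU] vs_closed(3)[OF Q.vsU one]]
    lin_smult[OF lin_codir(1)[OF x lin_id] one] codir_one[OF x] P.counit_simps(2)[OF i(2) u] P.counit_simps(3)[OF x]
   by (simp only: vs_smult_zero[OF Q.vsU] mult_zero_left one)
 qed
qed

text \<open>The two projections \<open>p q \<mapsto> p \<epsilon>(q)\<close> and \<open>p q \<mapsto> \<epsilon>(p) q\<close>. The second one is obtained from the
 left module \<open>U(Q)\<close> by conjugation with the antipode.\<close>

definition pr1 :: "('a \<times> 'b) uea \<Rightarrow> 'a uea" where "pr1 x = rep1 x 1[UP]"
definition pr2 :: "('a \<times> 'b) uea \<Rightarrow> 'b uea" where "pr2 x = antipode UQ (rep2 (antipode UD x) 1[UQ])"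

lemma lin_pr [lins]: "lin X UD f ==> lin X UP (%x. pr1 (f x))" "lin X UD f ==> lin X UQ (%x. pr2 (f x))"
 unfolding pr1_def pr2_def
 by (rule lin_comp[OF rep1_eval(1)[OF alg_closed(1)[OF P.algU]]]; assumption)
  (intro Q.lin_antipode lin_comp[OF rep2_eval(1)[OF alg_closed(1)[OF Q.algU]]] E1.M.lin_antipode; assumption)

lemma pr_closed [cls]: "x <: UD ==> pr1 x <: UP" "x <: UD ==> pr2 x <: UQ"
 by (erule lin_closed[OF lin_pr(1)[OF lin_id]] lin_closed[OF lin_pr(2)[OF lin_id]])+

lemma pr1_product:
 assumes p: "p <: UP" and q: "q <: UQ" shows "pr1 (e1 p *[UD] e2 q) = counit UQ q .[UP] p"
proof -
 note one = alg_closed(1)[OF P.algU]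
 show ?thesis
  unfolding pr1_def rep1_eval(3)[OF one E1.emap_closed[OF p] E2.emap_closed[OF q]] rep1_e2[OF q]
   rep1_e1[OF p vs_closed(3)[OF P.vsU one]] alg_smult_mult(2)[OF P.algU p one] alg_unit(2)[OF P.algU p] by (rule refl)
qed

lemma pr2_product:
 assumes p: "p <: UP" and q: "q <: UQ" shows "pr2 (e1 p *[UD] e2 q) = counit UP p .[UQ] q"
proof -
 note one = alg_closed(1)[OF Q.algU] and Sq = Q.antipode_closed[OF q] and Sp = P.antipode_closed[OF p]
 show ?thesis
  unfolding pr2_def E1.M.antipode_simps(2)[OF E1.emap_closed[OF p] E2.emap_closed[OF q]] E1.antipode_emap[OF p] E2.antipode_emap[OF q]
   rep2_eval(3)[OF one E2.emap_closed[OF Sq] E1.emap_closed[OF Sp]] rep2_e1[OF Sp] P.counit_antipode[OF p]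
   rep2_e2[OF Sq vs_closed(3)[OF Q.vsU one]] alg_smult_mult(2)[OF Q.algU Sq one] alg_unit(2)[OF Q.algU Sq]
   lin_smult[OF Q.lin_antipode[OF lin_id] Sq] Q.antipode_involutive[OF q] by (rule refl)
qed

lemma pr1_mult:
 assumes x: "x <: UD" and y: "y <: UD" shows "pr1 (x *[UD] y) = pr1 (x *[UD] e1 (pr1 y))"
proof -
 note one = alg_closed(1)[OF P.algU]
 note w = pr_closed(1)[OF y]
 show ?thesis
  unfolding pr1_def[of "x *[UD] y"] pr1_def[of "x *[UD] e1 (pr1 y)"] rep1_eval(3)[OF one x y] rep1_eval(3)[OF one x E1.emap_closed[OF w]]
   rep1_e1[OF w one] alg_unit(2)[OF P.algU w] unfolding pr1_def by (rule refl)
qed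

lemma pr2_mult:
 assumes x: "x <: UD" and y: "y <: UD" shows "pr2 (x *[UD] y) = pr2 (e2 (pr2 x) *[UD] y)"
proof -
 note one = alg_closed(1)[OF Q.algU]
 note w = pr_closed(2)[OF x] and Sx = E1.M.antipode_closed[OF x] and Sy = E1.M.antipode_closed[OF y]
 note Sw = Q.antipode_closed[OF w]
 have "rep2 (antipode UD x) 1[UQ] <: UQ" by (rule lin_closed[OF rep2_eval(1)[OF one] Sx])
 then have e: "antipode UQ (pr2 x) = rep2 (antipode UD x) 1[UQ]" unfolding pr2_def by (rule Q.antipode_involutive)
 show ?thesis
  unfolding pr2_def[of "x *[UD] y"] pr2_def[of "e2 (pr2 x) *[UD] y"] E1.M.antipode_simps(2)[OF x y]
   E1.M.antipode_simps(2)[OF E2.emap_closed[OF w] y] rep2_eval(3)[OF one Sy Sx] E2.antipode_emap[OF w]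
   rep2_eval(3)[OF one Sy E2.emap_closed[OF Sw]] rep2_e2[OF Sw one] alg_unit(2)[OF Q.algU Sw] unfolding e by (rule refl)
qed

end

context matched_brackets
begin

abbreviation "SP Z b u \<equiv> tensor_lift UP UP Z b (comult UP u)"
abbreviation "SQ Z b u \<equiv> tensor_lift UQ UQ Z b (comult UQ u)"
abbreviation "SD Z b u \<equiv> tensor_lift UD UD Z b (comult UD u)"

definition mult_map :: "('a uea \<times> 'b uea \<Rightarrow>\<^sub>0 complex) set \<Rightarrow> ('a \<times> 'b) uea" where
 "mult_map = tensor_lift UP UQ UD (%p q. e1 p *[UD] e2 q)"

lemma bilin_product: "bilin UP UQ UD (%p q. e1 p *[UD] e2 q)"
 by ((assumption | rule lins cls E1.M.algU)+)

lemmas lin_mult_map = tensor_lift_lin[OF P.vsU Q.vsU E1.M.vsU bilin_product, folded mult_map_def]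
 and mult_map_pure = tensor_lift_pure[OF P.vsU Q.vsU E1.M.vsU bilin_product, folded mult_map_def]

abbreviation "i1 X \<equiv> uea_incl d (X, 0[Q])"
abbreviation "i2 \<xi> \<equiv> uea_incl d (0[P], \<xi>)"

lemma i_closed: "X <: P ==> i1 X <: UD" "\<xi> <: Q ==> i2 \<xi> <: UD"
 by (intro E1.M.incl_closed d_closed; assumption)+

lemma i_split: assumes X: "X <: P" and xi: "\<xi> <: Q" shows "uea_incl d (X, \<xi>) = i1 X +[UD] i2 \<xi>"
proof -
 have "(X, \<xi>) = (X, 0[Q]) +[d] (0[P], \<xi>)"
  using X xi by (simp add: d_simps vs_add_zero[OF P.vs_L] vs_add_zero[OF Q.vs_L])
 then show ?thesis using lin_add[OF E1.M.lin_incl[OF lin_id] d_closed(1)[OF X] d_closed(2)[OF xi]] by (simp only:)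
qed

lemma i_commute:
 assumes X: "X <: P" and xi: "\<xi> <: Q"
 shows "i2 \<xi> *[UD] i1 X = (i1 (\<xi> \<triangleright> X) +[UD] i2 (\<xi> \<triangleleft> X)) +[UD] i1 X *[UD] i2 \<xi>"
proof -
 have "bracket d (0[P], \<xi>) (X, 0[Q]) = (\<xi> \<triangleright> X, \<xi> \<triangleleft> X)"
  using X xi lact_closed[OF xi X] ract_closed[OF xi X]
  by (simp add: d_simps bracket_zero minus_zero_simps vs_simps[OF P.vs_L] vs_simps[OF Q.vs_L])
 then show ?thesis
  using E1.M.bracket_hom_commute[OF E1.M.algU E1.M.bracket_hom_U d_closed(2)[OF xi] d_closed(1)[OF X]]
   i_split[OF lact_closed[OF xi X] ract_closed[OF xi X]] by (simp only:)
qed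

lemma mult_map_image:
 "a \<in> mult_map ` carrier (tensor UP UQ) ==> b \<in> mult_map ` carrier (tensor UP UQ) ==> a +[UD] b \<in> mult_map ` carrier (tensor UP UQ)"
 "a \<in> mult_map ` carrier (tensor UP UQ) ==> c .[UD] a \<in> mult_map ` carrier (tensor UP UQ)"
 "p <: UP ==> q <: UQ ==> e1 p *[UD] e2 q \<in> mult_map ` carrier (tensor UP UQ)"
proof -
 note T = vs_tensor[OF P.vsU Q.vsU]
 show "a +[UD] b \<in> mult_map ` carrier (tensor UP UQ)" if "a \<in> mult_map ` carrier (tensor UP UQ)" "b \<in> mult_map ` carrier (tensor UP UQ)"
 proof -
  from that obtain s t where st: "a = mult_map s" "b = mult_map t" "s <: (tensor UP UQ)" "t <: (tensor UP UQ)"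
   by (elim imageE)
  show ?thesis unfolding st(1,2) lin_add[OF lin_mult_map st(3,4), symmetric] by (rule imageI[OF vs_closed(2)[OF T st(3,4)]])
 qed
 show "c .[UD] a \<in> mult_map ` carrier (tensor UP UQ)" if "a \<in> mult_map ` carrier (tensor UP UQ)"
 proof -
  from that obtain s where s: "a = mult_map s" "s <: (tensor UP UQ)" by (elim imageE)
  show ?thesis unfolding s(1) lin_smult[OF lin_mult_map s(2), symmetric] by (rule imageI[OF vs_closed(3)[OF T s(2)]])
 qed
 show "e1 p *[UD] e2 q \<in> mult_map ` carrier (tensor UP UQ)" if "p <: UP" "q <: UQ"
  unfolding mult_map_pure[OF that, symmetric] by (rule imageI[OF pure_tensor_closed[OF P.vsU Q.vsU that]])
qed

lemma mult_map_image_left1: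
 assumes X: "X <: P" and y: "y \<in> mult_map ` carrier (tensor UP UQ)"
 shows "i1 X *[UD] y \<in> mult_map ` carrier (tensor UP UQ)"
proof -
 obtain t where t: "t <: (tensor UP UQ)" and y: "y = mult_map t" using y by blast
 note i = P.incl_closed[OF X]
 have b: "bilin UP UQ (tensor UP UQ) (%p q. (\<iota> X *[UP] p) \<boxtimes>[UP,UQ] q)" by ((assumption | rule i lins cls)+)
 note T = vs_tensor[OF P.vsU Q.vsU]
 have "i1 X *[UD] mult_map t = mult_map (tensor_lift UP UQ (tensor UP UQ) (%p q. (\<iota> X *[UP] p) \<boxtimes>[UP,UQ] q) t)"
 proof (rule tensor_ext[OF P.vsU Q.vsU E1.M.vsU lin_alg_mult(2)[OF E1.M.algU i_closed(1)[OF X] lin_mult_map]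
    lin_comp[OF lin_mult_map tensor_lift_lin[OF P.vsU Q.vsU T b]] _ t])
  fix p q assume p: "p <: UP" and q: "q <: UQ"
  show "i1 X *[UD] mult_map (p \<boxtimes>[UP,UQ] q) = mult_map (tensor_lift UP UQ (tensor UP UQ) (%p q. (\<iota> X *[UP] p) \<boxtimes>[UP,UQ] q) (p \<boxtimes>[UP,UQ] q))"
   unfolding mult_map_pure[OF p q] tensor_lift_pure[OF P.vsU Q.vsU T b p q] mult_map_pure[OF alg_closed(2)[OF P.algU i p] q]
    E1.emap_mult[OF i p] E1.emap_incl[OF X]
   by (rule alg_assoc[OF E1.M.algU i_closed(1)[OF X] E1.emap_closed[OF p] E2.emap_closed[OF q], symmetric])
 qed
 then show ?thesis unfolding y by (rule image_eqI) (rule tensor_lift_closed[OF P.vsU Q.vsU T b t])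
qed

lemma mult_map_image_cross:
 assumes p: "p <: UP" and q: "q <: UQ"
 shows "\<forall>\<xi>\<in>carrier Q. i2 \<xi> *[UD] (e1 p *[UD] e2 q) \<in> mult_map ` carrier (tensor UP UQ)"
proof -
 note A = E1.M.algU
 let ?R = "%p. \<forall>\<xi>\<in>carrier Q. i2 \<xi> *[UD] (e1 p *[UD] e2 q) \<in> mult_map ` carrier (tensor UP UQ)"
 have l: "lin UP UD (%p. i2 \<xi> *[UD] (e1 p *[UD] e2 q))" if "\<xi> <: Q" for \<xi>
  by ((assumption | rule i_closed(2)[OF that] q lin_alg_mult A lin_id E1.lin_emap E2.emap_closed)+)
 show ?thesis
 proof (rule P.uea_induct[of p ?R, OF p])
  show "?R 1[UP]"
  proof
   fix \<xi> assume x: "\<xi> <: Q"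
   note k = Q.incl_closed[OF x]
   have "i2 \<xi> *[UD] (e1 1[UP] *[UD] e2 q) = e1 1[UP] *[UD] e2 (\<kappa> \<xi> *[UQ] q)"
    by (simp only: E1.emap_one alg_unit[OF A] E2.emap_closed alg_closed[OF Q.algU] k q E2.emap_mult E2.emap_incl x alg_closed[OF A] i_closed)
   then show "i2 \<xi> *[UD] (e1 1[UP] *[UD] e2 q) \<in> mult_map ` carrier (tensor UP UQ)"
    using mult_map_image(3)[OF alg_closed(1)[OF P.algU] alg_closed(2)[OF Q.algU k q]] by (simp only:)
  qed
  show "?R (u +[UP] v)" if "u <: UP" "v <: UP" "?R u" "?R v" for u v
  proof
   fix \<xi> assume x: "\<xi> <: Q"
   show "i2 \<xi> *[UD] (e1 (u +[UP] v) *[UD] e2 q) \<in> mult_map ` carrier (tensor UP UQ)"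
    unfolding lin_add[OF l[OF x] that(1,2)] by (rule mult_map_image(1)[OF bspec[OF that(3) x] bspec[OF that(4) x]])
  qed
  show "?R (c .[UP] u)" if "u <: UP" "?R u" for c u
  proof
   fix \<xi> assume x: "\<xi> <: Q"
   show "i2 \<xi> *[UD] (e1 (c .[UP] u) *[UD] e2 q) \<in> mult_map ` carrier (tensor UP UQ)"
    unfolding lin_smult[OF l[OF x] that(1)] by (rule mult_map_image(2)[OF bspec[OF that(2) x]])
  qed
  fix X p assume X: "X <: P" and p: "p <: UP" and IH: "?R p"
  show "?R (\<iota> X *[UP] p)"
  proof
   fix \<xi> assume x: "\<xi> <: Q"
   let ?y = "e1 p *[UD] e2 q"
   note y = alg_closed(2)[OF A E1.emap_closed[OF p] E2.emap_closed[OF q]]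
   note i = i_closed(1)[OF X] i_closed(2)[OF x] i_closed(1)[OF lact_closed[OF x X]] i_closed(2)[OF ract_closed[OF x X]]
   have "i2 \<xi> *[UD] (e1 (\<iota> X *[UP] p) *[UD] e2 q) = (i2 \<xi> *[UD] i1 X) *[UD] ?y"
    by (simp only: E1.emap_mult P.incl_closed X p E1.emap_incl alg_assoc[OF A] i y E1.emap_closed E2.emap_closed q alg_closed[OF A])
   also have "\<dots> = (i1 (\<xi> \<triangleright> X) *[UD] ?y +[UD] i2 (\<xi> \<triangleleft> X) *[UD] ?y) +[UD] i1 X *[UD] (i2 \<xi> *[UD] ?y)"
    unfolding i_commute[OF X x]
    by (simp only: alg_distrib[OF A] alg_assoc[OF A] i y alg_closed[OF A] vs_closed(2)[OF E1.M.vsU])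
   finally show "i2 \<xi> *[UD] (e1 (\<iota> X *[UP] p) *[UD] e2 q) \<in> mult_map ` carrier (tensor UP UQ)"
    using mult_map_image(1)[OF mult_map_image(1)[OF mult_map_image_left1[OF lact_closed[OF x X] mult_map_image(3)[OF p q]]
     bspec[OF IH ract_closed[OF x X]]] mult_map_image_left1[OF X bspec[OF IH x]]] by (simp only:)
  qed
 qed
qed

lemma mult_map_surj:
 assumes x: "x <: UD" shows "x \<in> mult_map ` carrier (tensor UP UQ)"
proof -
 note A = E1.M.algU
 have left2: "i2 \<xi> *[UD] y \<in> mult_map ` carrier (tensor UP UQ)" if xi: "\<xi> <: Q" and y: "y \<in> mult_map ` carrier (tensor UP UQ)" for \<xi> y
 proof -
  obtain t where t: "t <: (tensor UP UQ)" and y: "y = mult_map t" using y by blast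
  have l: "lin (tensor UP UQ) UD (%t. i2 \<xi> *[UD] mult_map t)" by (rule lin_alg_mult(2)[OF A i_closed(2)[OF xi] lin_mult_map])
  have "i2 \<xi> *[UD] mult_map t \<in> mult_map ` carrier (tensor UP UQ)"
  proof (rule tensor_induct[OF P.vsU Q.vsU t])
   note T = vs_tensor[OF P.vsU Q.vsU]
   show "i2 \<xi> *[UD] mult_map 0[tensor UP UQ] \<in> mult_map ` carrier (tensor UP UQ)"
    unfolding lin_zero[OF T E1.M.vsU l] lin_zero[OF T E1.M.vsU lin_mult_map, symmetric] by (rule imageI[OF vs_closed(1)[OF T]])
   show "i2 \<xi> *[UD] mult_map (s +[tensor UP UQ] t) \<in> mult_map ` carrier (tensor UP UQ)"
    if "s <: (tensor UP UQ)" "t <: (tensor UP UQ)" "i2 \<xi> *[UD] mult_map s \<in> mult_map ` carrier (tensor UP UQ)"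
     "i2 \<xi> *[UD] mult_map t \<in> mult_map ` carrier (tensor UP UQ)" for s t
    unfolding lin_add[OF l that(1,2)] by (rule mult_map_image(1)[OF that(3,4)])
   show "i2 \<xi> *[UD] mult_map (p \<boxtimes>[UP,UQ] q) \<in> mult_map ` carrier (tensor UP UQ)" if "p <: UP" "q <: UQ" for p q
    unfolding mult_map_pure[OF that] by (rule bspec[OF mult_map_image_cross[OF that] xi])
  qed
  then show ?thesis unfolding y .
 qed
 have sub: "y <: UD" if "y \<in> mult_map ` carrier (tensor UP UQ)" for y using that lin_closed[OF lin_mult_map] by blast
 show ?thesis
 proof (rule E1.M.uea_induct[OF x])
  have "1[UD] = e1 1[UP] *[UD] e2 1[UQ]" by (simp only: E1.emap_one E2.emap_one alg_unit[OF A] alg_closed[OF A])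
  then show "1[UD] \<in> mult_map ` carrier (tensor UP UQ)"
   using mult_map_image(3)[OF alg_closed(1)[OF P.algU] alg_closed(1)[OF Q.algU]] by (simp only:)
  show "u +[UD] v \<in> mult_map ` carrier (tensor UP UQ)"
   if "u \<in> mult_map ` carrier (tensor UP UQ)" "v \<in> mult_map ` carrier (tensor UP UQ)" for u v by (rule mult_map_image(1)[OF that])
  show "c .[UD] u \<in> mult_map ` carrier (tensor UP UQ)" if "u \<in> mult_map ` carrier (tensor UP UQ)" for c u by (rule mult_map_image(2)[OF that])
  fix z u assume z: "z <: d" and u: "u \<in> mult_map ` carrier (tensor UP UQ)"
  obtain X \<xi> where zz: "z = (X, \<xi>)" and X: "X <: P" and xi: "\<xi> <: Q" using z by (auto simp: d_simps)
  show "uea_incl d z *[UD] u \<in> mult_map ` carrier (tensor UP UQ)"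
   unfolding zz i_split[OF X xi] alg_distrib(1)[OF A i_closed(1)[OF X] i_closed(2)[OF xi] sub[OF u]]
   by (rule mult_map_image(1)[OF mult_map_image_left1[OF X u] left2[OF xi u]])
 qed
qed

lemma D_ext:
 assumes Z: "vs Z" and f: "lin UD Z f" and g: "lin UD Z g"
  and eq: "!!p q. p <: UP ==> q <: UQ ==> f (e1 p *[UD] e2 q) = g (e1 p *[UD] e2 q)"
  and x: "x <: UD"
 shows "f x = g x"
proof -
 obtain t where t: "t <: (tensor UP UQ)" and y: "x = mult_map t" using mult_map_surj[OF x] by blast
 show ?thesis unfolding y
  by (rule tensor_ext[OF P.vsU Q.vsU Z lin_comp[OF f lin_mult_map] lin_comp[OF g lin_mult_map] _ t]) (simp only: mult_map_pure eq)
qed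

lemma SD_mult_emap:
 assumes Z: "vs Z" and b: "bilin UD UD Z b" and p: "p <: UP" and q: "q <: UQ"
 shows "SD Z b (e1 p *[UD] e2 q) = SP Z (%p1 p2. SQ Z (%q1 q2. b (e1 p1 *[UD] e2 q1) (e1 p2 *[UD] e2 q2)) q) p" (is ?A)
  and "SD Z b (e2 q *[UD] e1 p) = SQ Z (%q1 q2. SP Z (%p1 p2. b (e2 q1 *[UD] e1 p1) (e2 q2 *[UD] e1 p2)) p) q" (is ?B)
proof -
 note ce = E1.emap_closed[OF p] E2.emap_closed[OF q]
 have inner: "bilin UD UD Z (%v1 v2. b (u1 *[UD] v1) (u2 *[UD] v2))" if "u1 <: UD" "u2 <: UD" for u1 u2
  by ((assumption | rule that bilinI bilin_comp[OF b] lin_alg_mult alg_closed E1.M.algU lin_id)+)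
 have outer: "bilin UD UD Z (%u1 u2. SD Z (%v1 v2. b (u1 *[UD] v1) (u2 *[UD] v2)) w)" if "w <: UD" for w
  by ((assumption | rule that Z inner bilinI lin_tensor_lift_fun E1.M.vsU E1.M.comult_closed bilin_comp[OF b] lin_alg_mult alg_closed E1.M.algU lin_id)+)
 show ?A unfolding E1.M.Sw_mult[OF Z b ce] E1.Sw_emap[OF Z outer[OF ce(2)] p]
  by (rule lift_cong) (rule E2.Sw_emap[OF Z inner q]; rule E1.emap_closed; assumption)
 show ?B unfolding E1.M.Sw_mult[OF Z b ce(2,1)] E2.Sw_emap[OF Z outer[OF ce(1)] q]
  by (rule lift_cong) (rule E1.Sw_emap[OF Z inner p]; rule E2.emap_closed; assumption)
qed

lemma bilin_split: "bilin UD UD (tensor UP UQ) (%x y. pr1 x \<boxtimes>[UP,UQ] pr2 y)"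
 by ((assumption | rule lins cls)+)

lemma split_product:
 assumes p: "p <: UP" and q: "q <: UQ"
 shows "SD (tensor UP UQ) (%x y. pr1 x \<boxtimes>[UP,UQ] pr2 y) (e1 p *[UD] e2 q) = p \<boxtimes>[UP,UQ] q"
proof -
 let ?T = "tensor UP UQ"
 note T = vs_tensor[OF P.vsU Q.vsU]
 have bQ: "bilin UQ UQ UQ (%x y. counit UQ x .[UQ] y)" and bP: "bilin UP UP UP (%x y. counit UP y .[UP] x)"
  by (assumption | rule lins cls)+
 have "SD ?T (%x y. pr1 x \<boxtimes>[UP,UQ] pr2 y) (e1 p *[UD] e2 q) =
   SP ?T (%p1 p2. SQ ?T (%q1 q2. pr1 (e1 p1 *[UD] e2 q1) \<boxtimes>[UP,UQ] pr2 (e1 p2 *[UD] e2 q2)) q) p"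
  by (rule SD_mult_emap(1)[OF T bilin_split p q])
 also have "\<dots> = SP ?T (%p1 p2. (counit UP p2 .[UP] p1) \<boxtimes>[UP,UQ] q) p"
 proof (rule lift_cong)
  fix p1 p2 assume p1: "p1 <: UP" and p2: "p2 <: UP"
  note c = vs_closed(3)[OF P.vsU p1]
  have "SQ ?T (%q1 q2. pr1 (e1 p1 *[UD] e2 q1) \<boxtimes>[UP,UQ] pr2 (e1 p2 *[UD] e2 q2)) q =
    SQ ?T (%q1 q2. (counit UP p2 .[UP] p1) \<boxtimes>[UP,UQ] (counit UQ q1 .[UQ] q2)) q"
   by (rule lift_cong)
    (simp only: pr1_product pr2_product p1 p2 pure_tensor_smult[OF P.vsU Q.vsU] vs_closed(3)[OF P.vsU] vs_closed(3)[OF Q.vsU]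
     vs_smult_smult[OF T] pure_tensor_closed[OF P.vsU Q.vsU] mult.commute)
  also have "\<dots> = (counit UP p2 .[UP] p1) \<boxtimes>[UP,UQ] SQ UQ (%q1 q2. counit UQ q1 .[UQ] q2) q"
   by (rule tensor_lift_natural[OF Q.vsU Q.vsU Q.vsU T lin_pure_tensor(2)[OF P.vsU Q.vsU c lin_id] bQ Q.comult_closed[OF q], symmetric])
  finally show "SQ ?T (%q1 q2. pr1 (e1 p1 *[UD] e2 q1) \<boxtimes>[UP,UQ] pr2 (e1 p2 *[UD] e2 q2)) q = (counit UP p2 .[UP] p1) \<boxtimes>[UP,UQ] q"
   unfolding Q.counit_left_U[OF q] .
 qed
 also have "\<dots> = SP UP (%p1 p2. counit UP p2 .[UP] p1) p \<boxtimes>[UP,UQ] q"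
  by (rule tensor_lift_natural[OF P.vsU P.vsU P.vsU T lin_pure_tensor(1)[OF P.vsU Q.vsU q lin_id] bP P.comult_closed[OF p], symmetric])
 finally show ?thesis unfolding P.counit_right_U[OF p] .
qed

lemma split_mult_map:
 assumes t: "t <: (tensor UP UQ)"
 shows "SD (tensor UP UQ) (%x y. pr1 x \<boxtimes>[UP,UQ] pr2 y) (mult_map t) = t"
 by (rule tensor_ext[OF P.vsU Q.vsU vs_tensor[OF P.vsU Q.vsU]
   E1.M.Sw_lin[OF vs_tensor[OF P.vsU Q.vsU] bilin_split lin_mult_map] lin_id _ t]) (simp only: mult_map_pure split_product)

lemma inj_mult_map: "inj_on mult_map (carrier (tensor UP UQ))"
 by (rule inj_on_inverseI) (rule split_mult_map)

lemma recompose: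
 assumes x: "x <: UD" shows "SD UD (%x y. e1 (pr1 x) *[UD] e2 (pr2 y)) x = x"
proof -
 note T = vs_tensor[OF P.vsU Q.vsU] and cx = E1.M.comult_closed
 have "SD UD (%x y. e1 (pr1 x) *[UD] e2 (pr2 y)) x = SD UD (%x y. mult_map (pr1 x \<boxtimes>[UP,UQ] pr2 y)) x"
  by (rule lift_cong) (simp only: mult_map_pure pr_closed)
 also have "\<dots> = mult_map (SD (tensor UP UQ) (%x y. pr1 x \<boxtimes>[UP,UQ] pr2 y) x)"
  by (rule tensor_lift_natural[OF E1.M.vsU E1.M.vsU T E1.M.vsU lin_mult_map bilin_split cx[OF x], symmetric])
 also have "\<dots> = x"
  by (rule D_ext[OF E1.M.vsU lin_comp[OF lin_mult_map E1.M.Sw_lin[OF T bilin_split lin_id]] lin_id _ x])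
   (simp only: split_product mult_map_pure)
 finally show ?thesis .
qed

lemma uea_mult_map_eq: "uea_mult_map P Q lact ract = mult_map"
 and emb_eq: "uea_emb1 P Q lact ract = e1" "uea_emb2 P Q lact ract = e2"
 by (simp_all only: uea_mult_map_def uea_emb1_def uea_emb2_def mult_map_def E1.emap_def E2.emap_def)

lemma swap_eq:
 assumes u': "u' <: UQ" and u: "u <: UP"
 shows "uea_lact P Q lact ract u' u = pr1 (e2 u' *[UD] e1 u)" "uea_ract P Q lact ract u' u = pr2 (e2 u' *[UD] e1 u)"
proof -
 note x = alg_closed(2)[OF E1.M.algU E2.emap_closed[OF u'] E1.emap_closed[OF u]] and T = vs_tensor[OF P.vsU Q.vsU]
 let ?x = "e2 u' *[UD] e1 u"
 obtain t where t: "t <: (tensor UP UQ)" and xt: "?x = mult_map t" using mult_map_surj[OF x] by blast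
 have s: "uea_swap P Q lact ract u' u = t"
  unfolding uea_swap_def uea_mult_map_eq emb_eq xt by (rule inv_into_f_f[OF inj_mult_map t])
 have b: "bilin UP UQ UP (%p q. counit UQ q .[UP] p)" "bilin UP UQ UQ (%p q. counit UP p .[UQ] q)"
  by (assumption | rule lins cls)+
 show "uea_lact P Q lact ract u' u = pr1 ?x" unfolding uea_lact_def s xt
  by (rule tensor_lift_unique[OF P.vsU Q.vsU P.vsU b(1) lin_pr(1)[OF lin_mult_map] _ t]) (simp only: mult_map_pure pr1_product)
 show "uea_ract P Q lact ract u' u = pr2 ?x" unfolding uea_ract_def s xt
  by (rule tensor_lift_unique[OF P.vsU Q.vsU Q.vsU b(2) lin_pr(2)[OF lin_mult_map] _ t]) (simp only: mult_map_pure pr2_product)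
qed

end

section \<open>The mutual actions of the enveloping algebras\<close>

context matched_brackets
begin

definition la :: "'b uea \<Rightarrow> 'a uea \<Rightarrow> 'a uea" where "la v u = pr1 (e2 v *[UD] e1 u)"
definition ra :: "'b uea \<Rightarrow> 'a uea \<Rightarrow> 'b uea" where "ra v u = pr2 (e2 v *[UD] e1 u)"

lemma bilin_la: "bilin UQ UP UP la" and bilin_ra: "bilin UQ UP UQ ra"
 unfolding la_def[abs_def] ra_def[abs_def] by ((assumption | rule lins cls E1.M.algU)+)

lemmas lin_la [lins] = bilin_comp[OF bilin_la] and lin_ra [lins] = bilin_comp[OF bilin_ra]
lemmas la_closed [cls] = bilin_closed[OF bilin_la] and ra_closed [cls] = bilin_closed[OF bilin_ra]

lemma pr_e:
 "p <: UP ==> pr1 (e1 p) = p" "p <: UP ==> pr2 (e1 p) = counit UP p .[UQ] 1[UQ]"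
 "q <: UQ ==> pr1 (e2 q) = counit UQ q .[UP] 1[UP]" "q <: UQ ==> pr2 (e2 q) = q"
 using pr1_product[of p "1[UQ]"] pr2_product[of p "1[UQ]"] pr1_product[of "1[UP]" q] pr2_product[of "1[UP]" q]
 by (simp_all only: E1.emap_one E2.emap_one alg_unit[OF E1.M.algU] E1.emap_closed E2.emap_closed alg_closed(1)[OF P.algU] alg_closed(1)[OF Q.algU]
  P.counit_simps(1) Q.counit_simps(1) vs_smult_zero[OF P.vsU] vs_smult_zero[OF Q.vsU])

lemma la_one: "u <: UP ==> la 1[UQ] u = u" "v <: UQ ==> la v 1[UP] = counit UQ v .[UP] 1[UP]"
 and ra_one: "v <: UQ ==> ra v 1[UP] = v" "u <: UP ==> ra 1[UQ] u = counit UP u .[UQ] 1[UQ]"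
 unfolding la_def ra_def by (simp_all only: E1.emap_one E2.emap_one alg_unit[OF E1.M.algU] E1.emap_closed E2.emap_closed pr_e)

lemma la_mult:
 assumes v: "v <: UQ" and w: "w <: UQ" and u: "u <: UP"
 shows "la (v *[UQ] w) u = la v (la w u)"
proof -
 note e = E2.emap_closed[OF v] E2.emap_closed[OF w] E1.emap_closed[OF u]
 show ?thesis unfolding la_def E2.emap_mult[OF v w] alg_assoc[OF E1.M.algU e] by (rule pr1_mult[OF e(1) alg_closed(2)[OF E1.M.algU e(2,3)]])
qed

lemma ra_mult:
 assumes v: "v <: UQ" and u: "u <: UP" and w: "w <: UP"
 shows "ra v (u *[UP] w) = ra (ra v u) w"
proof -
 note e = E2.emap_closed[OF v] E1.emap_closed[OF u] E1.emap_closed[OF w]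
 show ?thesis unfolding ra_def E1.emap_mult[OF u w] alg_assoc[OF E1.M.algU e, symmetric]
  by (rule pr2_mult[OF alg_closed(2)[OF E1.M.algU e(1,2)] e(3)])
qed

lemma counit_pr:
 assumes x: "x <: UD" shows "counit UP (pr1 x) = counit UD x" "counit UQ (pr2 x) = counit UD x"
 by (rule D_ext[OF vs_cpx P.lin_counit[OF lin_pr(1)[OF lin_id]] E1.M.lin_counit[OF lin_id] _ x],
   simp only: pr1_product lin_smult[OF P.lin_counit[OF lin_id]] E1.M.counit_simps(2) E1.emap_closed E2.emap_closed E1.counit_emap E2.counit_emap cpx_simps mult.commute)
  (rule D_ext[OF vs_cpx Q.lin_counit[OF lin_pr(2)[OF lin_id]] E1.M.lin_counit[OF lin_id] _ x],
   simp only: pr2_product lin_smult[OF Q.lin_counit[OF lin_id]] E1.M.counit_simps(2) E1.emap_closed E2.emap_closed E1.counit_emap E2.counit_emap cpx_simps)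

lemma counit_la: "v <: UQ ==> u <: UP ==> counit UP (la v u) = counit UQ v * counit UP u"
 and counit_ra: "v <: UQ ==> u <: UP ==> counit UQ (ra v u) = counit UQ v * counit UP u"
 unfolding la_def ra_def
 by (simp_all only: counit_pr alg_closed(2)[OF E1.M.algU] E1.emap_closed E2.emap_closed E1.M.counit_simps(2) E1.counit_emap E2.counit_emap)

lemma bilin_smult_smult:
 assumes Z: "vs Z" and b: "bilin V W Z b" and v: "v <: V" and w: "w <: W" and V: "vs V" and W: "vs W"
 shows "b (c .[V] v) (k .[W] w) = (c * k) .[Z] b v w"
 unfolding lin_smult[OF bilinD(2)[OF b vs_closed(3)[OF W w]] v] lin_smult[OF bilinD(1)[OF b v] w]
 by (rule vs_smult_smult[OF Z bilin_closed[OF b v w]])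

lemma pr1_comult:
 assumes Z: "vs Z" and b: "bilin UP UP Z b" and x: "x <: UD"
 shows "SP Z b (pr1 x) = SD Z (%x y. b (pr1 x) (pr1 y)) x"
proof -
 have bb: "bilin UD UD Z (%x y. b (pr1 x) (pr1 y))" by ((assumption | rule bilinI bilin_comp[OF b] lin_pr pr_closed lin_id)+)
 show ?thesis
 proof (rule D_ext[OF Z P.Sw_lin[OF Z b lin_pr(1)[OF lin_id]] E1.M.Sw_lin[OF Z bb lin_id] _ x])
  fix p q assume p: "p <: UP" and q: "q <: UQ"
  have bc: "bilin UQ UQ cpx (%x y. counit UQ x * counit UQ y)" by ((assumption | rule lins cls)+)
  have "SD Z (%x y. b (pr1 x) (pr1 y)) (e1 p *[UD] e2 q) =
    SP Z (%p1 p2. SQ Z (%q1 q2. b (pr1 (e1 p1 *[UD] e2 q1)) (pr1 (e1 p2 *[UD] e2 q2))) q) p"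
   by (rule SD_mult_emap(1)[OF Z bb p q])
  also have "\<dots> = SP Z (%p1 p2. counit UQ q .[Z] b p1 p2) p"
  proof (rule lift_cong)
   fix p1 p2 assume p1: "p1 <: UP" and p2: "p2 <: UP"
   have "SQ Z (%q1 q2. b (pr1 (e1 p1 *[UD] e2 q1)) (pr1 (e1 p2 *[UD] e2 q2))) q = SQ Z (%q1 q2. (counit UQ q1 * counit UQ q2) .[Z] b p1 p2) q"
    by (rule lift_cong) (simp only: pr1_product p1 p2 bilin_smult_smult[OF Z b p1 p2 P.vsU P.vsU])
   also have "\<dots> = SQ cpx (%x y. counit UQ x * counit UQ y) q .[Z] b p1 p2"
    by (rule tensor_lift_natural[OF Q.vsU Q.vsU vs_cpx Z lin_smult_left[OF Z bilin_closed[OF b p1 p2] lin_id] bc Q.comult_closed[OF q], symmetric])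
   finally show "SQ Z (%q1 q2. b (pr1 (e1 p1 *[UD] e2 q1)) (pr1 (e1 p2 *[UD] e2 q2))) q = counit UQ q .[Z] b p1 p2"
    unfolding Q.Sw_counit_counit[OF q] .
  qed
  also have "\<dots> = counit UQ q .[Z] SP Z b p"
   by (rule tensor_lift_natural[OF P.vsU P.vsU Z Z lin_pointwise_smult[OF Z lin_id] b P.comult_closed[OF p], symmetric])
  finally show "SP Z b (pr1 (e1 p *[UD] e2 q)) = SD Z (%x y. b (pr1 x) (pr1 y)) (e1 p *[UD] e2 q)"
   unfolding pr1_product[OF p q] lin_smult[OF P.Sw_lin[OF Z b lin_id] p] by (rule HOL.sym)
 qed
qed

lemma pr2_comult:
 assumes Z: "vs Z" and b: "bilin UQ UQ Z b" and x: "x <: UD"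
 shows "SQ Z b (pr2 x) = SD Z (%x y. b (pr2 x) (pr2 y)) x"
proof -
 have bb: "bilin UD UD Z (%x y. b (pr2 x) (pr2 y))" by ((assumption | rule bilinI bilin_comp[OF b] lin_pr pr_closed lin_id)+)
 show ?thesis
 proof (rule D_ext[OF Z Q.Sw_lin[OF Z b lin_pr(2)[OF lin_id]] E1.M.Sw_lin[OF Z bb lin_id] _ x])
  fix p q assume p: "p <: UP" and q: "q <: UQ"
  have bc: "bilin UP UP cpx (%x y. counit UP x * counit UP y)" by ((assumption | rule lins cls)+)
  note zq = tensor_lift_closed[OF Q.vsU Q.vsU Z b Q.comult_closed[OF q]]
  have "SD Z (%x y. b (pr2 x) (pr2 y)) (e1 p *[UD] e2 q) =
    SP Z (%p1 p2. SQ Z (%q1 q2. b (pr2 (e1 p1 *[UD] e2 q1)) (pr2 (e1 p2 *[UD] e2 q2))) q) p"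
   by (rule SD_mult_emap(1)[OF Z bb p q])
  also have "\<dots> = SP Z (%p1 p2. (counit UP p1 * counit UP p2) .[Z] SQ Z b q) p"
  proof (rule lift_cong)
   fix p1 p2 assume p1: "p1 <: UP" and p2: "p2 <: UP"
   have "SQ Z (%q1 q2. b (pr2 (e1 p1 *[UD] e2 q1)) (pr2 (e1 p2 *[UD] e2 q2))) q = SQ Z (%q1 q2. (counit UP p1 * counit UP p2) .[Z] b q1 q2) q"
    by (rule lift_cong) (simp only: pr2_product p1 p2 bilin_smult_smult[OF Z b _ _ Q.vsU Q.vsU])
   also have "\<dots> = (counit UP p1 * counit UP p2) .[Z] SQ Z b q"
    by (rule tensor_lift_natural[OF Q.vsU Q.vsU Z Z lin_pointwise_smult[OF Z lin_id] b Q.comult_closed[OF q], symmetric])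
   finally show "SQ Z (%q1 q2. b (pr2 (e1 p1 *[UD] e2 q1)) (pr2 (e1 p2 *[UD] e2 q2))) q = (counit UP p1 * counit UP p2) .[Z] SQ Z b q" .
  qed
  also have "\<dots> = SP cpx (%x y. counit UP x * counit UP y) p .[Z] SQ Z b q"
   by (rule tensor_lift_natural[OF P.vsU P.vsU vs_cpx Z lin_smult_left[OF Z zq lin_id] bc P.comult_closed[OF p], symmetric])
  finally show "SQ Z b (pr2 (e1 p *[UD] e2 q)) = SD Z (%x y. b (pr2 x) (pr2 y)) (e1 p *[UD] e2 q)"
   unfolding pr2_product[OF p q] lin_smult[OF Q.Sw_lin[OF Z b lin_id] q] P.Sw_counit_counit[OF p] by (rule HOL.sym)
 qed
qed

lemma cross_closed: "v <: UQ ==> u <: UP ==> e2 v *[UD] e1 u <: UD"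
 by (intro alg_closed(2)[OF E1.M.algU] E1.emap_closed E2.emap_closed)

lemma la_comult:
 assumes Z: "vs Z" and b: "bilin UP UP Z b" and v: "v <: UQ" and u: "u <: UP"
 shows "SP Z b (la v u) = SQ Z (%v1 v2. SP Z (%u1 u2. b (la v1 u1) (la v2 u2)) u) v"
proof -
 have bb: "bilin UD UD Z (%x y. b (pr1 x) (pr1 y))" by ((assumption | rule bilinI bilin_comp[OF b] lin_pr pr_closed lin_id)+)
 show ?thesis unfolding la_def pr1_comult[OF Z b cross_closed[OF v u]] by (rule SD_mult_emap(2)[OF Z bb u v])
qed

lemma ra_comult:
 assumes Z: "vs Z" and b: "bilin UQ UQ Z b" and v: "v <: UQ" and u: "u <: UP"
 shows "SQ Z b (ra v u) = SQ Z (%v1 v2. SP Z (%u1 u2. b (ra v1 u1) (ra v2 u2)) u) v"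
proof -
 have bb: "bilin UD UD Z (%x y. b (pr2 x) (pr2 y))" by ((assumption | rule bilinI bilin_comp[OF b] lin_pr pr_closed lin_id)+)
 show ?thesis unfolding ra_def pr2_comult[OF Z b cross_closed[OF v u]] by (rule SD_mult_emap(2)[OF Z bb u v])
qed

lemma pr1_e1_left: assumes p: "p <: UP" and y: "y <: UD" shows "pr1 (e1 p *[UD] y) = p *[UP] pr1 y"
 unfolding pr1_mult[OF E1.emap_closed[OF p] y] E1.emap_mult[OF p pr_closed(1)[OF y], symmetric]
 by (rule pr_e(1)[OF alg_closed(2)[OF P.algU p pr_closed(1)[OF y]]])

lemma pr2_e2_right: assumes q: "q <: UQ" and x: "x <: UD" shows "pr2 (x *[UD] e2 q) = pr2 x *[UQ] q"
 unfolding pr2_mult[OF x E2.emap_closed[OF q]] E2.emap_mult[OF pr_closed(2)[OF x] q, symmetric]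
 by (rule pr_e(4)[OF alg_closed(2)[OF Q.algU pr_closed(2)[OF x] q]])

lemma bilin_recompose: "bilin UD UD UD (%x y. e1 (pr1 x) *[UD] e2 (pr2 y))"
 by ((assumption | rule bilinI lin_alg_mult E1.M.algU E1.lin_emap E2.lin_emap E1.emap_closed E2.emap_closed lin_pr pr_closed lin_id)+)

lemma la_of_mult:
 assumes v: "v <: UQ" and u: "u <: UP" and w: "w <: UP"
 shows "la v (u *[UP] w) = SQ UP (%v1 v2. SP UP (%u1 u2. la v1 u1 *[UP] la (ra v2 u2) w) u) v"
proof -
 note A = E1.M.algU and ew = E1.emap_closed[OF w] and x = cross_closed[OF v u]
 let ?x = "e2 v *[UD] e1 u"
 have l: "lin UD UP (%y. pr1 (y *[UD] e1 w))" by (intro lin_pr lin_alg_mult(1)[OF A ew] lin_id)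
 have b: "bilin UD UD UP (%x y. pr1 x *[UP] la (pr2 y) w)" by ((assumption | rule w lins cls)+)
 have "la v (u *[UP] w) = pr1 (?x *[UD] e1 w)"
  unfolding la_def E1.emap_mult[OF u w] alg_assoc[OF A E2.emap_closed[OF v] E1.emap_closed[OF u] ew] by (rule refl)
 also have "\<dots> = pr1 (SD UD (%x y. e1 (pr1 x) *[UD] e2 (pr2 y)) ?x *[UD] e1 w)" unfolding recompose[OF x] by (rule refl)
 also have "\<dots> = SD UP (%x y. pr1 ((e1 (pr1 x) *[UD] e2 (pr2 y)) *[UD] e1 w)) ?x"
  by (rule tensor_lift_natural[OF E1.M.vsU E1.M.vsU E1.M.vsU P.vsU l bilin_recompose E1.M.comult_closed[OF x]])
 also have "\<dots> = SD UP (%x y. pr1 x *[UP] la (pr2 y) w) ?x"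
  by (rule lift_cong)
   (simp only: alg_assoc[OF A] E1.emap_closed E2.emap_closed pr_closed w pr1_e1_left alg_closed(2)[OF A] la_def)
 also have "\<dots> = SQ UP (%v1 v2. SP UP (%u1 u2. la v1 u1 *[UP] la (ra v2 u2) w) u) v"
  unfolding SD_mult_emap(2)[OF P.vsU b u v] unfolding la_def[symmetric] ra_def[symmetric] by (rule refl)
 finally show ?thesis .
qed

lemma ra_of_mult:
 assumes v: "v <: UQ" and w: "w <: UQ" and u: "u <: UP"
 shows "ra (v *[UQ] w) u = SQ UQ (%w1 w2. SP UQ (%u1 u2. ra v (la w1 u1) *[UQ] ra w2 u2) u) w"
proof -
 note A = E1.M.algU and ev = E2.emap_closed[OF v] and x = cross_closed[OF w u]
 let ?x = "e2 w *[UD] e1 u"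
 have l: "lin UD UQ (%y. pr2 (e2 v *[UD] y))" by (intro lin_pr lin_alg_mult(2)[OF A ev] lin_id)
 have b: "bilin UD UD UQ (%x y. ra v (pr1 x) *[UQ] pr2 y)" by ((assumption | rule v lins cls)+)
 have "ra (v *[UQ] w) u = pr2 (e2 v *[UD] ?x)"
  unfolding ra_def E2.emap_mult[OF v w] alg_assoc[OF A ev E2.emap_closed[OF w] E1.emap_closed[OF u]] by (rule refl)
 also have "\<dots> = pr2 (e2 v *[UD] SD UD (%x y. e1 (pr1 x) *[UD] e2 (pr2 y)) ?x)" unfolding recompose[OF x] by (rule refl)
 also have "\<dots> = SD UQ (%x y. pr2 (e2 v *[UD] (e1 (pr1 x) *[UD] e2 (pr2 y)))) ?x"
  by (rule tensor_lift_natural[OF E1.M.vsU E1.M.vsU E1.M.vsU Q.vsU l bilin_recompose E1.M.comult_closed[OF x]])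
 also have "\<dots> = SD UQ (%x y. ra v (pr1 x) *[UQ] pr2 y) ?x"
  by (rule lift_cong)
   (simp only: alg_assoc[OF A, symmetric] E1.emap_closed E2.emap_closed pr_closed v pr2_e2_right alg_closed(2)[OF A] ra_def)
 also have "\<dots> = SQ UQ (%w1 w2. SP UQ (%u1 u2. ra v (la w1 u1) *[UQ] ra w2 u2) u) w"
  unfolding SD_mult_emap(2)[OF Q.vsU b u w] unfolding la_def[symmetric] ra_def[symmetric] by (rule refl)
 finally show ?thesis .
qed

lemma la_incl_incl: assumes xi: "\<xi> <: Q" and X: "X <: P" shows "la (\<kappa> \<xi>) (\<iota> X) = \<iota> (\<xi> \<triangleright> X)"
proof -
 note one = alg_closed(1)[OF P.algU] and iX = P.incl_closed[OF X]
 show ?thesis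
  unfolding la_def pr1_def E2.emap_incl[OF xi] rep1_eval(3)[OF one i_closed(2)[OF xi] E1.emap_closed[OF iX]] rep1_e1[OF iX one]
   alg_unit(2)[OF P.algU iX] rep_incl_zero(2)[OF vs_closed(1)[OF P.vs_L] xi iX alg_closed(1)[OF Q.algU]]
  by (rule der_incl[OF xi X])
qed

lemma la_incl_image:
 assumes v: "v <: UQ" and X: "X <: P" shows "la v (\<iota> X) \<in> \<iota> ` carrier P"
proof (rule Q.uea_induct[OF v])
 note iX = P.incl_closed[OF X] and i = P.lin_incl[OF lin_id] and l = lin_la(1)[OF P.incl_closed[OF X] lin_id]
 show "la 1[UQ] (\<iota> X) \<in> \<iota> ` carrier P" unfolding la_one(1)[OF iX] by (rule imageI[OF X])
 fix u w c assume u: "u <: UQ" and hu: "la u (\<iota> X) \<in> \<iota> ` carrier P"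
 obtain Y where Y: "Y <: P" "la u (\<iota> X) = \<iota> Y" using hu by blast
 show "la (c .[UQ] u) (\<iota> X) \<in> \<iota> ` carrier P"
  unfolding lin_smult[OF l u] Y(2) lin_smult[OF i Y(1), symmetric] by (rule imageI[OF vs_closed(3)[OF P.vs_L Y(1)]])
 show "la (\<kappa> \<xi> *[UQ] u) (\<iota> X) \<in> \<iota> ` carrier P" if xi: "\<xi> <: Q" for \<xi>
  unfolding la_mult[OF Q.incl_closed[OF xi] u iX] Y(2) la_incl_incl[OF xi Y(1)] by (rule imageI[OF lact_closed[OF xi Y(1)]])
 assume w: "w <: UQ" and hw: "la w (\<iota> X) \<in> \<iota> ` carrier P"
 obtain Y' where Y': "Y' <: P" "la w (\<iota> X) = \<iota> Y'" using hw by blast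
 show "la (u +[UQ] w) (\<iota> X) \<in> \<iota> ` carrier P"
  unfolding lin_add[OF l u w] Y(2) Y'(2) lin_add[OF i Y(1) Y'(1), symmetric] by (rule imageI[OF vs_closed(2)[OF P.vs_L Y(1) Y'(1)]])
qed

end

section \<open>The canonical action and coaction\<close>

locale based_matched_brackets = matched_brackets P Q lact ract
 for P :: "'a lie" and Q :: "'b lie" and lact (infixr \<open>\<triangleright>\<close> 75) and ract (infixl \<open>\<triangleleft>\<close> 75) +
 fixes B :: "'a set" and \<delta> :: "'a \<Rightarrow> 'a uea \<Rightarrow> complex"
 assumes finite_B: "finite B" and B_sub: "B \<subseteq> carrier P"
  and lin_\<delta>: "b \<in> B ==> lin (uea P) cpx (\<delta> b)"
  and \<delta>_incl: "b \<in> B ==> c \<in> B ==> \<delta> b (uea_incl P c) = (if b = c then 1 else 0)"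
  and B_span: "X <: P ==> \<exists>k. X = (\<Oplus>\<^bsub>P\<^esub>b\<in>B. k b .[P] b)"
begin

abbreviation "F \<equiv> rep_hopf Q"
abbreviation "UF \<equiv> tensor UP F"
abbreviation "act \<equiv> canonical_action P Q lact ract"

lemma vsUF [cls]: "vs UF" by (rule vs_tensor[OF P.vsU Q.vsH])

lemma B_closed: "b \<in> B ==> b <: P" "b \<in> B ==> \<iota> b <: UP"
 using B_sub by (auto intro: P.incl_closed)

lemma incl_finsum: "vs Z ==> lin P Z h ==>
  h (\<Oplus>\<^bsub>P\<^esub>b\<in>B. k b .[P] b) = (\<Oplus>\<^bsub>Z\<^esub>b\<in>B. k b .[Z] h b)"
proof -
 assume Z: "vs Z" and h: "lin P Z h"
 interpret Z: vectorspace cpx Z by (rule Z)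
 have "h (\<Oplus>\<^bsub>P\<^esub>b\<in>B. k b .[P] b) = (\<Oplus>\<^bsub>Z\<^esub>b\<in>B. h (k b .[P] b))"
  using vs_closed(3)[OF P.vs_L B_closed(1)] by (intro lin_finsum[OF P.vs_L Z h]) blast
 also have "\<dots> = (\<Oplus>\<^bsub>Z\<^esub>b\<in>B. k b .[Z] h b)"
  by (rule Z.M.finsum_cong') (auto simp: lin_smult[OF h] B_closed vs_closed(3)[OF Z] lin_closed[OF h])
 finally show ?thesis .
qed

lemma lin_eq_on_basis:
 assumes Z: "vs Z" and h: "lin P Z h" and h': "lin P Z h'" and eq: "!!b. b \<in> B ==> h b = h' b" and X: "X <: P"
 shows "h X = h' X"
proof -
 interpret Z: vectorspace cpx Z by (rule Z)
 obtain k where k: "X = (\<Oplus>\<^bsub>P\<^esub>b\<in>B. k b .[P] b)" using B_span[OF X] by (rule exE)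
 show ?thesis unfolding k incl_finsum[OF Z h] incl_finsum[OF Z h']
  by (rule Z.M.finsum_cong') (auto simp: eq B_closed vs_closed(3)[OF Z] lin_closed[OF h'])
qed

lemma incl_expand:
 assumes Y: "Y \<in> \<iota> ` carrier P" and Z: "vs Z" and h: "lin UP Z h"
 shows "h Y = (\<Oplus>\<^bsub>Z\<^esub>b\<in>B. \<delta> b Y .[Z] h (\<iota> b))"
proof -
 interpret Z: vectorspace cpx Z by (rule Z)
 obtain X where X: "X <: P" and YX: "Y = \<iota> X" using Y by blast
 obtain k where k: "X = (\<Oplus>\<^bsub>P\<^esub>b\<in>B. k b .[P] b)" using B_span[OF X] by (rule exE)
 have d: "\<delta> c Y = k c" if c: "c \<in> B" for c
 proof -
  have "\<delta> c Y = (\<Sum>b\<in>B. k b * \<delta> c (\<iota> b))"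
   unfolding incl_finsum[OF vs_cpx lin_comp[OF lin_\<delta>[OF c] P.lin_incl[OF lin_id]]] YX k
   by (simp add: finsum_cpx[OF finite_B])
  also have "\<dots> = (\<Sum>b\<in>B. if c = b then k b else 0)" by (rule sum.cong) (simp_all add: \<delta>_incl c)
  also have "\<dots> = k c" using c finite_B by simp
  finally show ?thesis .
 qed
 have "h Y = (\<Oplus>\<^bsub>Z\<^esub>b\<in>B. k b .[Z] h (\<iota> b))"
  unfolding YX k by (rule incl_finsum[OF Z lin_comp[OF h P.lin_incl[OF lin_id]]])
 also have "\<dots> = (\<Oplus>\<^bsub>Z\<^esub>b\<in>B. \<delta> b Y .[Z] h (\<iota> b))"
  by (rule Z.M.finsum_cong') (auto simp: d B_closed vs_closed(3)[OF Z] lin_closed[OF h])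
 finally show ?thesis .
qed

lemma incl_expand_cpx: "Y \<in> \<iota> ` carrier P ==> lin UP cpx h ==> h Y = (\<Sum>b\<in>B. \<delta> b Y * h (\<iota> b))"
 using incl_expand[OF _ vs_cpx, of Y h] by (simp add: finsum_cpx[OF finite_B])

definition Bs :: "'a list" where "Bs = (SOME xs. set xs = B \<and> distinct xs)"

lemma Bs: "set Bs = B" "distinct Bs"
 using someI_ex[OF finite_distinct_list[OF finite_B]] unfolding Bs_def by blast+

lemma sum_Bs: "(\<Sum>b\<in>B. g b) = (\<Sum>b\<leftarrow>Bs. g b)" for g :: "'a \<Rightarrow> complex"
 using sum.distinct_set_conv_list[OF Bs(2), of g] unfolding Bs(1) .

lemma act_eq: "u <: UP ==> act u f = (\<lambda>v\<in>carrier UQ. f (ra v u))"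
 unfolding canonical_action_def ra_def by (rule restrict_ext) (simp only: swap_eq)

lemma act_eval: "u <: UP ==> v <: UQ ==> act u f v = f (ra v u)"
 by (simp add: act_eq)

lemma act_incl_closed:
 assumes X: "X <: P" and f: "f <: F" shows "act (\<iota> X) f <: F"
proof -
 note iX = P.incl_closed[OF X] and one = alg_closed(1)[OF P.algU]
 obtain qs where qs0: "set qs \<subseteq> carrier F \<times> carrier F \<and> (\<forall>u\<in>carrier UQ. \<forall>v\<in>carrier UQ. f (u *[UQ] v) = rank_sum qs u v)"
  using Q.H_decompose[OF f] by (rule exE)
 have fst_qs: "fst z <: F" "snd z <: F" if "z \<in> set qs" for z
  using subsetD[OF conjunct1[OF qs0] that] by (simp_all add: mem_Times_iff)
 have qs: "f (u *[UQ] v) = (\<Sum>z\<leftarrow>qs. fst z u * snd z v)" if "u <: UQ" "v <: UQ" for u v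
  using conjunct2[OF qs0] that by (simp add: rank_sum_def case_prod_unfold)
 let ?g = "%y w. SQ cpx (%w1 w2. \<delta> (fst y) (la w1 (\<iota> X)) * snd (snd y) w2) w"
 let ?ps = "map (%y. (%v. fst (snd y) (ra v (\<iota> (fst y))), ?g y)) (List.product Bs qs) @
  map (%z. (fst z, %w. snd z (ra w (\<iota> X)))) qs"
 note lf = Q.H_lin[OF f lin_id]
 have "f (ra (v *[UQ] w) (\<iota> X)) = rank_sum ?ps v w" if v: "v <: UQ" and w: "w <: UQ" for v w
 proof -
  note cw = Q.comult_closed[OF w]
  let ?t1 = "%w1 w2. ra v (la w1 (\<iota> X)) *[UQ] w2" and ?t2 = "%w1 w2. v *[UQ] ra (counit UQ w1 .[UQ] w2) (\<iota> X)"
  have b1: "bilin UQ UQ UQ ?t1" by ((assumption | rule v iX lins cls)+)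
  have bc: "bilin UQ UQ UQ (%w1 w2. counit UQ w1 .[UQ] w2)" by ((assumption | rule lins cls)+)
  have b2: "bilin UQ UQ UQ ?t2"
  proof (rule bilinI)
   note l = lin_alg_mult(2)[OF Q.algU v lin_ra(1)[OF iX lin_id]]
   show "lin UQ UQ (?t2 w1)" if "w1 <: UQ" for w1 by (rule lin_comp[OF l bilinD(1)[OF bc that]])
   show "lin UQ UQ (%w1. ?t2 w1 w2)" if "w2 <: UQ" for w2 by (rule lin_comp[OF l bilinD(2)[OF bc that]])
  qed
  have "ra (v *[UQ] w) (\<iota> X) = SQ UQ (%w1 w2. ?t1 w1 w2 +[UQ] ?t2 w1 w2) w"
   unfolding ra_of_mult[OF v w iX]
  proof (rule lift_cong)
   fix w1 w2 assume w1: "w1 <: UQ" and w2: "w2 <: UQ"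
   have b: "bilin UP UP UQ (%u1 u2. ra v (la w1 u1) *[UQ] ra w2 u2)" by ((assumption | rule v w1 w2 lins cls)+)
   note ck = vs_closed(3)[OF Q.vsU w2] ra_closed[OF w2 iX]
   show "SP UQ (%u1 u2. ra v (la w1 u1) *[UQ] ra w2 u2) (\<iota> X) = ?t1 w1 w2 +[UQ] ?t2 w1 w2"
    unfolding P.Sw_incl[OF Q.vsU b X] ra_one(1)[OF w2] la_one(2)[OF w1] lin_smult[OF lin_ra(2)[OF v lin_id] one] ra_one(1)[OF v]
     lin_smult[OF lin_ra(1)[OF iX lin_id] w2] alg_smult_mult[OF Q.algU v ck(2)] by (rule refl)
  qed
  also have "\<dots> = SQ UQ ?t1 w +[UQ] SQ UQ ?t2 w" by (rule tensor_lift_add[OF Q.vsU Q.vsU Q.vsU b1 b2 cw])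
  also have "SQ UQ ?t2 w = v *[UQ] ra (SQ UQ (%w1 w2. counit UQ w1 .[UQ] w2) w) (\<iota> X)"
   by (rule tensor_lift_natural[OF Q.vsU Q.vsU Q.vsU Q.vsU lin_alg_mult(2)[OF Q.algU v lin_ra(1)[OF iX lin_id]] bc cw, symmetric])
  also have "\<dots> = v *[UQ] ra w (\<iota> X)" unfolding Q.counit_left_U[OF w] by (rule refl)
  finally have ra_eq: "ra (v *[UQ] w) (\<iota> X) = SQ UQ ?t1 w +[UQ] v *[UQ] ra w (\<iota> X)" .
  let ?h = "%y w1 w2. fst (snd y) (ra v (\<iota> (fst y))) * (\<delta> (fst y) (la w1 (\<iota> X)) * snd (snd y) w2)"
  have bg: "bilin UQ UQ cpx (%w1 w2. \<delta> (fst y) (la w1 (\<iota> X)) * snd (snd y) w2)" if y: "y \<in> set (List.product Bs qs)" for y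
  proof -
   have b: "fst y \<in> B" and z: "snd y \<in> set qs" using y Bs(1) by (auto simp only: set_product mem_Times_iff)
   note l1 = lin_comp[OF lin_\<delta>[OF b] lin_la(1)[OF iX lin_id]] and l2 = Q.H_lin[OF fst_qs(2)[OF z] lin_id]
   show ?thesis by (rule bilinI) (rule lin_cpx_mult(2)[OF l2] lin_cpx_mult(1)[OF l1])+
  qed
  have "f (SQ UQ ?t1 w) = SQ cpx (%w1 w2. f (?t1 w1 w2)) w"
   by (rule tensor_lift_natural[OF Q.vsU Q.vsU Q.vsU vs_cpx lf b1 cw])
  also have "\<dots> = SQ cpx (%w1 w2. \<Sum>y\<leftarrow>List.product Bs qs. ?h y w1 w2) w"
  proof (rule lift_cong)
   fix w1 w2 assume w1: "w1 <: UQ" and w2: "w2 <: UQ"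
   have "lin UP cpx (%Y. f (ra v Y *[UQ] w2))"
    by (rule Q.H_lin[OF f]) (intro lin_alg_mult(1)[OF Q.algU w2] lin_ra(2)[OF v lin_id])
   from incl_expand_cpx[OF la_incl_image[OF w1 X] this]
   have "f (?t1 w1 w2) = (\<Sum>b\<leftarrow>Bs. \<delta> b (la w1 (\<iota> X)) * f (ra v (\<iota> b) *[UQ] w2))" unfolding sum_Bs .
   also have "\<dots> = (\<Sum>b\<leftarrow>Bs. \<Sum>z\<leftarrow>qs. ?h (b, z) w1 w2)"
   proof (rule arg_cong[of _ _ sum_list], rule map_cong[OF refl])
    fix b assume "b \<in> set Bs"
    then have b: "b \<in> B" using Bs(1) by simp
    show "\<delta> b (la w1 (\<iota> X)) * f (ra v (\<iota> b) *[UQ] w2) = (\<Sum>z\<leftarrow>qs. ?h (b, z) w1 w2)"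
     unfolding qs[OF ra_closed[OF v B_closed(2)[OF b]] w2] by (subst sum_list_const_mult[symmetric], rule arg_cong[of _ _ sum_list], rule map_cong[OF refl])
       (simp only: fst_conv snd_conv mult_ac)
   qed
   also have "\<dots> = (\<Sum>y\<leftarrow>List.product Bs qs. ?h y w1 w2)"
    using sum_list_product[of "%b z. ?h (b, z) w1 w2" Bs qs] by (simp add: case_prod_unfold)
   finally show "f (?t1 w1 w2) = (\<Sum>y\<leftarrow>List.product Bs qs. ?h y w1 w2)" .
  qed
  also have "\<dots> = (\<Sum>y\<leftarrow>List.product Bs qs. SQ cpx (?h y) w)"
  proof (rule conjunct1[OF tensor_lift_sum_list[OF Q.vsU Q.vsU cw]])
   fix y assume y: "y \<in> set (List.product Bs qs)"
   show "bilin UQ UQ cpx (?h y)" by (rule bilinI; rule lin_cpx_mult(2)) (rule bilinD(1)[OF bg[OF y]] bilinD(2)[OF bg[OF y]], assumption)+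
  qed
  also have "\<dots> = (\<Sum>y\<leftarrow>List.product Bs qs. fst (snd y) (ra v (\<iota> (fst y))) * ?g y w)"
  proof (rule arg_cong[of _ _ sum_list], rule map_cong[OF refl])
   fix y assume y: "y \<in> set (List.product Bs qs)"
   show "SQ cpx (?h y) w = fst (snd y) (ra v (\<iota> (fst y))) * ?g y w"
    by (rule tensor_lift_natural[OF Q.vsU Q.vsU vs_cpx vs_cpx lin_cpx_mult(2)[OF lin_id] bg[OF y] cw, symmetric])
  qed
  finally have t1: "f (SQ UQ ?t1 w) = (\<Sum>y\<leftarrow>List.product Bs qs. fst (snd y) (ra v (\<iota> (fst y))) * ?g y w)" .
  have "f (ra (v *[UQ] w) (\<iota> X)) = f (SQ UQ ?t1 w) + f (v *[UQ] ra w (\<iota> X))"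
   unfolding ra_eq using lin_add[OF lf tensor_lift_closed[OF Q.vsU Q.vsU Q.vsU b1 cw] alg_closed(2)[OF Q.algU v ra_closed[OF w iX]]] by simp
  also have "\<dots> = rank_sum ?ps v w" unfolding t1 qs[OF v ra_closed[OF w iX]] by (simp add: rank_sum_def o_def)
  finally show ?thesis .
 qed
 then show ?thesis unfolding act_eq[OF iX] by (rule Q.H_I[OF Q.H_lin[OF f lin_ra(1)[OF iX lin_id]]])
qed

lemma act_mult_eq:
 assumes u: "u <: UP" and w: "w <: UP" shows "act (u *[UP] w) f = act u (act w f)"
 unfolding act_eq[OF alg_closed(2)[OF P.algU u w]] act_eq[OF u]
 by (rule restrict_ext) (simp only: act_eval ra_mult ra_closed u w)

lemma act_closed [cls]: assumes u: "u <: UP" and f: "f <: F" shows "act u f <: F"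
proof -
 have lf: "lin UP cpx (%u. f (ra v u))" if "f <: F" "v <: UQ" for f v
  by (rule Q.H_lin[OF that(1) lin_ra(2)[OF that(2) lin_id]])
 have "\<forall>f\<in>carrier F. act u f <: F"
 proof (rule P.uea_induct[OF u]; rule ballI)
  fix f assume f: "f <: F"
  have "act 1[UP] f = f" if c: "act 1[UP] f \<in> extensional (carrier UQ)"
   by (rule extensionalityI[OF c, of f]) (use f in \<open>simp_all add: Q.H_carrier Q.RF_D(2) act_eval ra_one P.algU\<close>)
  then show "act 1[UP] f <: F" using f by (simp add: act_eq P.algU)
  show "act (u +[UP] w) f <: F" if "u <: UP" "w <: UP" and h: "\<forall>f\<in>carrier F. act u f <: F" "\<forall>f\<in>carrier F. act w f <: F" for u w
  proof -
   have "act (u +[UP] w) f = act u f +[F] act w f"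
    unfolding Q.H_ops act_eq[OF vs_closed(2)[OF P.vsU that(1,2)]]
    by (rule restrict_ext) (simp only: act_eval that(1,2) lin_add[OF lf[OF f] that(1,2)] cpx_simps)
   then show ?thesis using vs_closed(2)[OF Q.vsH bspec[OF h(1) f] bspec[OF h(2) f]] by (simp only:)
  qed
  show "act (c .[UP] u) f <: F" if "u <: UP" and h: "\<forall>f\<in>carrier F. act u f <: F" for c u
  proof -
   have "act (c .[UP] u) f = c .[F] act u f"
    unfolding Q.H_ops act_eq[OF vs_closed(3)[OF P.vsU that(1)]]
    by (rule restrict_ext) (simp only: act_eval that(1) lin_smult[OF lf[OF f] that(1)] cpx_simps)
   then show ?thesis using vs_closed(3)[OF Q.vsH bspec[OF h f]] by (simp only:)
  qed
  show "act (\<iota> X *[UP] u) f <: F" if "X <: P" "u <: UP" and h: "\<forall>f\<in>carrier F. act u f <: F" for X u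
   unfolding act_mult_eq[OF P.incl_closed[OF that(1)] that(2)] by (rule act_incl_closed[OF that(1) bspec[OF h f]])
 qed
 then show ?thesis using f by (rule bspec)
qed

lemma lin_act [lins]:
 "u <: UP ==> lin X F g ==> lin X F (%x. act u (g x))" "f <: F ==> lin X UP h ==> lin X F (%x. act (h x) f)"
proof -
 have 1: "lin F F (act u)" if u: "u <: UP" for u
  by (rule Q.lin_HI[OF act_closed[OF u] _ Q.vsH], assumption) (simp only: act_eval u, rule Q.lin_eval[OF ra_closed[OF _ u] lin_id])
 have 2: "lin UP F (%u. act u f)" if f: "f <: F" for f
 proof (rule Q.lin_HI[OF act_closed[OF _ f] _ P.vsU], assumption)
  fix v assume v: "v <: UQ"
  have "lin UP cpx (%u. f (ra v u))" by (rule Q.H_lin[OF f lin_ra(2)[OF v lin_id]])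
  then show "lin UP cpx (%u. act u f v)" using lin_cong[of UP "%u. act u f v" "%u. f (ra v u)" cpx] by (simp add: act_eval v)
 qed
 show "u <: UP ==> lin X F g ==> lin X F (%x. act u (g x))" by (rule lin_comp[OF 1])
 show "f <: F ==> lin X UP h ==> lin X F (%x. act (h x) f)" by (rule lin_comp[OF 2])
qed

definition ev :: "'b uea \<Rightarrow> ('a uea \<times> ('b uea \<Rightarrow> complex) \<Rightarrow>\<^sub>0 complex) set \<Rightarrow> 'a uea" where
 "ev v = tensor_lift UP F UP (%x f. f v .[UP] x)"

lemma bilin_ev: "v <: UQ ==> bilin UP F UP (%x f. f v .[UP] x)"
 by (intro bilinI lin_smult_left[OF P.vsU] lin_pointwise_smult[OF P.vsU] Q.lin_eval lin_id)

lemma lin_ev [lins]: "v <: UQ ==> lin X UF t ==> lin X UP (%x. ev v (t x))"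
 unfolding ev_def by (rule lin_tensor_lift_arg[OF P.vsU Q.vsH P.vsU bilin_ev])

lemma lin_ev_left [lins]: assumes t: "t <: UF" and g: "lin X UQ g" shows "lin X UP (%x. ev (g x) t)"
proof -
 have "lin UQ UP (%v. ev v t)" unfolding ev_def
  by (rule lin_tensor_lift_fun[OF P.vsU Q.vsH Q.vsU P.vsU t bilin_ev]) (assumption | rule lin_smult_left[OF P.vsU] Q.H_lin lin_id)+
 then show ?thesis using g by (rule lin_comp)
qed

lemma ev_closed [cls]: "v <: UQ ==> t <: UF ==> ev v t <: UP"
 by (rule lin_closed[OF lin_ev[OF _ lin_id]])

lemma ev_pure: "v <: UQ ==> x <: UP ==> f <: F ==> ev v (x \<boxtimes>[UP,F] f) = f v .[UP] x"
 unfolding ev_def by (rule tensor_lift_pure[OF P.vsU Q.vsH P.vsU bilin_ev])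

lemma UF_eqI:
 "s <: UF ==> t <: UF ==> (!!v. v <: UQ ==> ev v s = ev v t) ==> s = t"
 unfolding ev_def by (rule Q.tensor_H_eqI[OF P.vsU])

definition coeff :: "'a \<Rightarrow> 'a \<Rightarrow> 'b uea \<Rightarrow> complex" where "coeff X b = (\<lambda>v\<in>carrier UQ. \<delta> b (la v (\<iota> X)))"

lemma coeff_closed: assumes X: "X <: P" and b: "b \<in> B" shows "coeff X b <: F"
 unfolding coeff_def
proof (rule Q.H_I[OF lin_comp[OF lin_\<delta>[OF b] lin_la(1)[OF P.incl_closed[OF X] lin_id]]])
 fix v w assume v: "v <: UQ" and w: "w <: UQ"
 have "\<delta> b (la v (la w (\<iota> X))) = (\<Sum>c\<in>B. \<delta> c (la w (\<iota> X)) * \<delta> b (la v (\<iota> c)))"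
  by (rule incl_expand_cpx[OF la_incl_image[OF w X] lin_comp[OF lin_\<delta>[OF b] lin_la(2)[OF v lin_id]]])
 then show "\<delta> b (la (v *[UQ] w) (\<iota> X)) = rank_sum (map (%c. (%v. \<delta> b (la v (\<iota> c)), %w. \<delta> c (la w (\<iota> X)))) Bs) v w"
  unfolding la_mult[OF v w P.incl_closed[OF X]] rank_sum_map sum_Bs by (simp only: mult.commute)
qed

definition gen :: "'a \<Rightarrow> ('a uea \<times> ('b uea \<Rightarrow> complex) \<Rightarrow>\<^sub>0 complex) set" where
 "gen X = (\<Oplus>\<^bsub>UF\<^esub>b\<in>B. \<iota> b \<boxtimes>[UP,F] coeff X b)"

lemma gen:
 assumes X: "X <: P"
 shows "gen X <: UF" "v <: UQ ==> ev v (gen X) = la v (\<iota> X)"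
proof -
 interpret T: vectorspace cpx UF by (rule vsUF)
 interpret A: vectorspace cpx UP by (rule P.vsU)
 have c: "(%b. \<iota> b \<boxtimes>[UP,F] coeff X b) \<in> B \<rightarrow> carrier UF"
  using pure_tensor_closed[OF P.vsU Q.vsH B_closed(2) coeff_closed[OF X]] by blast
 show "gen X <: UF" unfolding gen_def by (rule T.M.finsum_closed[OF c])
 assume v: "v <: UQ"
 have "ev v (gen X) = (\<Oplus>\<^bsub>UP\<^esub>b\<in>B. ev v (\<iota> b \<boxtimes>[UP,F] coeff X b))"
  unfolding gen_def by (rule lin_finsum[OF vsUF P.vsU lin_ev[OF v lin_id] c])
 also have "\<dots> = (\<Oplus>\<^bsub>UP\<^esub>b\<in>B. \<delta> b (la v (\<iota> X)) .[UP] \<iota> b)"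
 proof (rule A.M.finsum_cong'[OF refl])
  show "(%b. \<delta> b (la v (\<iota> X)) .[UP] \<iota> b) \<in> B \<rightarrow> carrier UP" by (rule Pi_I) (intro vs_closed(3)[OF P.vsU] B_closed(2))
  show "ev v (\<iota> b \<boxtimes>[UP,F] coeff X b) = \<delta> b (la v (\<iota> X)) .[UP] \<iota> b" if b: "b \<in> B" for b
   unfolding ev_pure[OF v B_closed(2)[OF b] coeff_closed[OF X b]] using v by (simp only: coeff_def restrict_apply')
 qed
 also have "\<dots> = la v (\<iota> X)" by (rule incl_expand[OF la_incl_image[OF v X] P.vsU lin_id, symmetric])
 finally show "ev v (gen X) = la v (\<iota> X)" .
qed

lemma coaction_coeff_eq:
 assumes X: "X \<in> B" and b: "b \<in> B" shows "coaction_coeff P Q lact ract B X b = coeff X b"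
 unfolding coaction_coeff_def coeff_def
proof (rule restrict_ext)
 fix v assume v: "v <: UQ"
 interpret A: vectorspace cpx UP by (rule P.vsU)
 note XP = B_closed[OF X]
 have lact_eq: "uea_lact P Q lact ract v (\<iota> X) = la v (\<iota> X)" unfolding la_def by (rule swap_eq(1)[OF v XP(2)])
 have "(THE a. a \<in> extensional B \<and> la v (\<iota> X) = (\<Oplus>\<^bsub>UP\<^esub>Z\<in>B. a Z .[UP] \<iota> Z)) = (\<lambda>b\<in>B. \<delta> b (la v (\<iota> X)))"
 proof (rule the_equality)
  have "la v (\<iota> X) = (\<Oplus>\<^bsub>UP\<^esub>Z\<in>B. \<delta> Z (la v (\<iota> X)) .[UP] \<iota> Z)" by (rule incl_expand[OF la_incl_image[OF v XP(1)] P.vsU lin_id])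
  also have "\<dots> = (\<Oplus>\<^bsub>UP\<^esub>Z\<in>B. (\<lambda>b\<in>B. \<delta> b (la v (\<iota> X))) Z .[UP] \<iota> Z)"
   by (rule A.M.finsum_cong') (auto simp: vs_closed(3)[OF P.vsU] B_closed)
  finally show "(\<lambda>b\<in>B. \<delta> b (la v (\<iota> X))) \<in> extensional B \<and> la v (\<iota> X) = (\<Oplus>\<^bsub>UP\<^esub>Z\<in>B. (\<lambda>b\<in>B. \<delta> b (la v (\<iota> X))) Z .[UP] \<iota> Z)"
   by (intro conjI restrict_extensional)
  fix a assume a: "a \<in> extensional B \<and> la v (\<iota> X) = (\<Oplus>\<^bsub>UP\<^esub>Z\<in>B. a Z .[UP] \<iota> Z)"
  have "\<delta> b (la v (\<iota> X)) = a b" if b: "b \<in> B" for b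
  proof -
   have "(%Z. a Z .[UP] \<iota> Z) \<in> B \<rightarrow> carrier UP" using vs_closed(3)[OF P.vsU B_closed(2)] by blast
   from lin_finsum[OF P.vsU vs_cpx lin_\<delta>[OF b] this]
   have "\<delta> b (la v (\<iota> X)) = (\<Sum>Z\<in>B. \<delta> b (a Z .[UP] \<iota> Z))" unfolding conjunct2[OF a, symmetric] finsum_cpx[OF finite_B] .
   also have "\<dots> = (\<Sum>Z\<in>B. if b = Z then a Z else 0)"
    by (rule sum.cong) (simp_all add: lin_smult[OF lin_\<delta>[OF b]] B_closed \<delta>_incl b)
   also have "\<dots> = a b" using b finite_B by simp
   finally show ?thesis .
  qed
  then show "a = (\<lambda>b\<in>B. \<delta> b (la v (\<iota> X)))" using conjunct1[OF a] by (intro extensionalityI[of _ B]) simp_all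
 qed
 then show "(THE a. a \<in> extensional B \<and> uea_lact P Q lact ract v (\<iota> X) = (\<Oplus>\<^bsub>UP\<^esub>Z\<in>B. a Z .[UP] \<iota> Z)) b = \<delta> b (la v (\<iota> X))"
  unfolding lact_eq using b by simp
qed

lemma coaction_alg_eq: assumes X: "X \<in> B" shows "coaction_alg P Q lact ract B X = gen X"
proof -
 interpret T: vectorspace cpx UF by (rule vsUF)
 show ?thesis unfolding coaction_alg_def gen_def
 proof (rule T.M.finsum_cong'[OF refl])
  show "(%b. \<iota> b \<boxtimes>[UP,F] coeff X b) \<in> B \<rightarrow> carrier UF"
   by (rule Pi_I) (intro pure_tensor_closed[OF P.vsU Q.vsH] B_closed(2) coeff_closed[OF B_closed(1)[OF X]])
  show "\<iota> b \<boxtimes>[UP,F] coaction_coeff P Q lact ract B X b = \<iota> b \<boxtimes>[UP,F] coeff X b" if "b \<in> B" for b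
   unfolding coaction_coeff_eq[OF X that] by (rule refl)
 qed
qed

definition prodt :: "'a uea \<Rightarrow> ('a uea \<times> ('b uea \<Rightarrow> complex) \<Rightarrow>\<^sub>0 complex) set \<Rightarrow> ('a uea \<times> ('b uea \<Rightarrow> complex) \<Rightarrow>\<^sub>0 complex) set
  \<Rightarrow> ('a uea \<times> ('b uea \<Rightarrow> complex) \<Rightarrow>\<^sub>0 complex) set" where
 "prodt u s t = tensor_lift UP F UF (%x f. tensor_lift UP F UF (%y g. (x *[UP] y) \<boxtimes>[UP,F] (f *[F] act u g)) t) s"

lemma bilin_prodt_inner:
 "u <: UP ==> x <: UP ==> f <: F ==> bilin UP F UF (%y g. (x *[UP] y) \<boxtimes>[UP,F] (f *[F] act u g))"
 by ((assumption | rule lins cls)+)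

lemma bilin_prodt_outer:
 "u <: UP ==> t <: UF ==>
  bilin UP F UF (%x f. tensor_lift UP F UF (%y g. (x *[UP] y) \<boxtimes>[UP,F] (f *[F] act u g)) t)"
 by ((assumption | rule lins cls)+)

lemma prodt_closed [cls]: "u <: UP ==> s <: UF ==> t <: UF ==> prodt u s t <: UF"
 unfolding prodt_def by (rule tensor_lift_closed[OF P.vsU Q.vsH vsUF bilin_prodt_outer])

lemma lin_prodt [lins]:
 "u <: UP ==> t <: UF ==> lin X UF h ==> lin X UF (%x. prodt u (h x) t)"
 "u <: UP ==> s <: UF ==> lin X UF h ==> lin X UF (%x. prodt u s (h x))"
 "s <: UF ==> t <: UF ==> lin X UP k ==> lin X UF (%x. prodt (k x) s t)"
proof -
 show "lin X UF (%x. prodt u (h x) t)" if "u <: UP" "t <: UF" "lin X UF h"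
  unfolding prodt_def by (rule lin_tensor_lift_arg[OF P.vsU Q.vsH vsUF bilin_prodt_outer[OF that(1,2)] that(3)])
 have 2: "lin UF UF (prodt u s)" if "u <: UP" "s <: UF"
  unfolding prodt_def by ((assumption | rule that lins cls)+)
 show "lin X UF (%x. prodt u s (h x))" if "u <: UP" "s <: UF" "lin X UF h" by (rule lin_comp[OF 2[OF that(1,2)] that(3)])
 have 3: "lin UP UF (%u. prodt u s t)" if "s <: UF" "t <: UF"
  unfolding prodt_def by ((assumption | rule that lins cls)+)
 show "lin X UF (%x. prodt (k x) s t)" if "s <: UF" "t <: UF" "lin X UP k" by (rule lin_comp[OF 3[OF that(1,2)] that(3)])
qed

lemma ev_prodt:
 assumes v: "v <: UQ" and u: "u <: UP" and s: "s <: UF" and t: "t <: UF"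
 shows "ev v (prodt u s t) = SQ UP (%v1 v2. ev v1 s *[UP] ev (ra v2 u) t) v"
proof -
 note cv = Q.comult_closed[OF v]
 have bl: "bilin UQ UQ UP (%v1 v2. ev v1 s *[UP] ev (ra v2 u) t)" if "s <: UF" "t <: UF" for s t
  by ((assumption | rule that u lins cls)+)
 have r1: "lin UF UP (%s. SQ UP (%v1 v2. ev v1 s *[UP] ev (ra v2 u) t) v)" if "t <: UF" for t
  by ((assumption | rule lin_tensor_lift_fun[OF Q.vsU Q.vsU vsUF P.vsU cv bl] that u lins cls)+)
 have r2: "lin UF UP (%t. SQ UP (%v1 v2. ev v1 s *[UP] ev (ra v2 u) t) v)" if "s <: UF" for s
  by ((assumption | rule lin_tensor_lift_fun[OF Q.vsU Q.vsU vsUF P.vsU cv bl] that u lins cls)+)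
 show ?thesis
 proof (rule tensor_ext[OF P.vsU Q.vsH P.vsU lin_ev[OF v lin_prodt(1)[OF u t lin_id]] r1[OF t] _ s])
  fix x f assume x: "x <: UP" and f: "f <: F"
  note xf = pure_tensor_closed[OF P.vsU Q.vsH x f]
  show "ev v (prodt u (x \<boxtimes>[UP,F] f) t) = SQ UP (%v1 v2. ev v1 (x \<boxtimes>[UP,F] f) *[UP] ev (ra v2 u) t) v"
  proof (rule tensor_ext[OF P.vsU Q.vsH P.vsU lin_ev[OF v lin_prodt(2)[OF u xf lin_id]] r2[OF xf] _ t])
   fix y g assume y: "y <: UP" and g: "g <: F"
   note yg = pure_tensor_closed[OF P.vsU Q.vsH y g] and ag = act_closed[OF u g] and xy = alg_closed(2)[OF P.algU x y]
   have bm: "bilin UQ UQ cpx (%v1 v2. f v1 * act u g v2)"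
    by (intro bilinI lin_cpx_mult Q.H_lin[OF f lin_id] Q.H_lin[OF ag lin_id])
   have "ev v (prodt u (x \<boxtimes>[UP,F] f) (y \<boxtimes>[UP,F] g)) = SQ cpx (%v1 v2. f v1 * act u g v2) v .[UP] (x *[UP] y)"
    unfolding prodt_def tensor_lift_pure[OF P.vsU Q.vsH vsUF bilin_prodt_outer[OF u yg] x f]
     tensor_lift_pure[OF P.vsU Q.vsH vsUF bilin_prodt_inner[OF u x f] y g] ev_pure[OF v xy Q.H_mult_closed[OF f ag]] Q.H_eval(1)[OF v]
    by (rule refl)
   also have "\<dots> = SQ UP (%v1 v2. (f v1 * act u g v2) .[UP] (x *[UP] y)) v"
    by (rule tensor_lift_natural[OF Q.vsU Q.vsU vs_cpx P.vsU lin_smult_left[OF P.vsU xy lin_id] bm cv])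
   also have "\<dots> = SQ UP (%v1 v2. ev v1 (x \<boxtimes>[UP,F] f) *[UP] ev (ra v2 u) (y \<boxtimes>[UP,F] g)) v"
    by (rule lift_cong)
     (simp only: ev_pure x f y g ra_closed u act_eval bilin_smult_smult[OF P.vsU alg_mult_bilin[OF P.algU] x y P.vsU P.vsU])
   finally show "ev v (prodt u (x \<boxtimes>[UP,F] f) (y \<boxtimes>[UP,F] g)) = SQ UP (%v1 v2. ev v1 (x \<boxtimes>[UP,F] f) *[UP] ev (ra v2 u) (y \<boxtimes>[UP,F] g)) v" .
  qed
 qed
qed

lemma unit_UF:
 "1[UP] \<boxtimes>[UP,F] 1[F] <: UF" "v <: UQ ==> ev v (1[UP] \<boxtimes>[UP,F] 1[F]) = la v 1[UP]"
 by (rule pure_tensor_closed[OF P.vsU Q.vsH alg_closed(1)[OF P.algU] alg_closed(1)[OF Q.algH]])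
  (simp only: ev_pure alg_closed(1)[OF P.algU] alg_closed(1)[OF Q.algH] Q.H_eval la_one)

lemma coaction_exists:
 assumes u: "u <: UP" shows "\<exists>t. t <: UF \<and> (\<forall>v\<in>carrier UQ. ev v t = la v u)"
proof (rule P.uea_induct[OF u])
 note one = alg_closed(1)[OF P.algU]
 show "\<exists>t. t <: UF \<and> (\<forall>v\<in>carrier UQ. ev v t = la v 1[UP])"
  using unit_UF by (intro exI[of _ "1[UP] \<boxtimes>[UP,F] 1[F]"] conjI ballI)
 fix u w c assume u: "u <: UP" and hu: "\<exists>t. t <: UF \<and> (\<forall>v\<in>carrier UQ. ev v t = la v u)"
 obtain s where s0: "s <: UF \<and> (\<forall>v\<in>carrier UQ. ev v s = la v u)" using hu by (rule exE)
 note s = conjunct1[OF s0] bspec[OF conjunct2[OF s0]]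
 show "\<exists>t. t <: UF \<and> (\<forall>v\<in>carrier UQ. ev v t = la v (c .[UP] u))"
  by (intro exI[of _ "c .[UF] s"] conjI ballI vs_closed(3)[OF vsUF s(1)])
   (simp only: lin_smult[OF lin_ev[OF _ lin_id] s(1)] lin_smult[OF lin_la(2)[OF _ lin_id] u] s(2))
 show "\<exists>t. t <: UF \<and> (\<forall>v\<in>carrier UQ. ev v t = la v (\<iota> X *[UP] u))" if X: "X <: P" for X
 proof (intro exI conjI ballI)
  note iX = P.incl_closed[OF X]
  let ?a = "prodt 1[UP] (gen X) s" and ?b = "prodt (\<iota> X) (1[UP] \<boxtimes>[UP,F] 1[F]) s"
  note ab = prodt_closed[OF one gen(1)[OF X] s(1)] prodt_closed[OF iX unit_UF(1) s(1)]
  show "?a +[UF] ?b <: UF" by (rule vs_closed(2)[OF vsUF ab])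
  fix v assume v: "v <: UQ"
  have b: "bilin UP UP UP (%u1 u2. la v1 u1 *[UP] la (ra v2 u2) u)" if "v1 <: UQ" "v2 <: UQ" for v1 v2
   by ((assumption | rule that u lins cls)+)
  have b1: "bilin UQ UQ UP (%v1 v2. la v1 w *[UP] la (ra v2 z) u)" if "w <: UP" "z <: UP" for w z
   by ((assumption | rule that u lins cls)+)
  have e: "SQ UP (%v1 v2. ev v1 r *[UP] ev (ra v2 z) s) v = SQ UP (%v1 v2. la v1 w *[UP] la (ra v2 z) u) v"
   if r: "!!v. v <: UQ ==> ev v r = la v w" and z: "z <: UP" for r w z
   by (rule lift_cong) (simp only: r s(2) ra_closed z)
  have x1: "SQ UP (%v1 v2. ev v1 (gen X) *[UP] ev (ra v2 1[UP]) s) v = SQ UP (%v1 v2. la v1 (\<iota> X) *[UP] la (ra v2 1[UP]) u) v"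
   by (rule e[OF gen(2)[OF X] one])
  have x2: "SQ UP (%v1 v2. ev v1 (1[UP] \<boxtimes>[UP,F] 1[F]) *[UP] ev (ra v2 (\<iota> X)) s) v =
    SQ UP (%v1 v2. la v1 1[UP] *[UP] la (ra v2 (\<iota> X)) u) v"
   by (rule e[OF unit_UF(2) iX])
  have "ev v (?a +[UF] ?b) = SQ UP (%v1 v2. la v1 (\<iota> X) *[UP] la (ra v2 1[UP]) u) v +[UP]
    SQ UP (%v1 v2. la v1 1[UP] *[UP] la (ra v2 (\<iota> X)) u) v"
   unfolding lin_add[OF lin_ev[OF v lin_id] ab] ev_prodt[OF v one gen(1)[OF X] s(1)] ev_prodt[OF v iX unit_UF(1) s(1)]
    x1 x2 by (rule refl)
  also have "\<dots> = SQ UP (%v1 v2. la v1 (\<iota> X) *[UP] la (ra v2 1[UP]) u +[UP] la v1 1[UP] *[UP] la (ra v2 (\<iota> X)) u) v"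
   by (rule tensor_lift_add[OF Q.vsU Q.vsU P.vsU b1[OF iX one] b1[OF one iX] Q.comult_closed[OF v], symmetric])
  also have "\<dots> = SQ UP (%v1 v2. SP UP (%u1 u2. la v1 u1 *[UP] la (ra v2 u2) u) (\<iota> X)) v"
   by (rule lift_cong) (rule P.Sw_incl[OF P.vsU b X, symmetric])
  finally show "ev v (?a +[UF] ?b) = la v (\<iota> X *[UP] u)" unfolding la_of_mult[OF v iX u] .
 qed
 assume w: "w <: UP" and hw: "\<exists>t. t <: UF \<and> (\<forall>v\<in>carrier UQ. ev v t = la v w)"
 obtain t where t0: "t <: UF \<and> (\<forall>v\<in>carrier UQ. ev v t = la v w)" using hw by (rule exE)
 note t = conjunct1[OF t0] bspec[OF conjunct2[OF t0]]
 show "\<exists>t. t <: UF \<and> (\<forall>v\<in>carrier UQ. ev v t = la v (u +[UP] w))"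
  by (intro exI[of _ "s +[UF] t"] conjI ballI vs_closed(2)[OF vsUF s(1) t(1)])
   (simp only: lin_add[OF lin_ev[OF _ lin_id] s(1) t(1)] lin_add[OF lin_la(2)[OF _ lin_id] u w] s(2) t(2))
qed

definition co :: "'a uea \<Rightarrow> ('a uea \<times> ('b uea \<Rightarrow> complex) \<Rightarrow>\<^sub>0 complex) set" where
 "co = (\<lambda>u\<in>carrier UP. SOME t. t <: UF \<and> (\<forall>v\<in>carrier UQ. ev v t = la v u))"

lemma co:
 assumes u: "u <: UP" shows "co u <: UF" "v <: UQ ==> ev v (co u) = la v u"
proof -
 note c = someI_ex[OF coaction_exists[OF u]]
 have e: "co u = (SOME t. t <: UF \<and> (\<forall>v\<in>carrier UQ. ev v t = la v u))" using u by (simp add: co_def)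
 show "co u <: UF" unfolding e by (rule conjunct1[OF c])
 show "v <: UQ ==> ev v (co u) = la v u" unfolding e by (rule bspec[OF conjunct2[OF c]])
qed

lemmas co_closed [cls] = co(1)

lemma co_eqI: "u <: UP ==> t <: UF ==> (!!v. v <: UQ ==> ev v t = la v u) ==> co u = t"
 by (rule UF_eqI[OF co(1)]) (simp_all only: co)

lemma lin_co [lins]: "lin X UP f ==> lin X UF (%x. co (f x))"
proof (rule lin_comp[where W = UP], rule linI, erule co(1))
 fix u w c assume u: "u <: UP"
 show "co (c .[UP] u) = c .[UF] co u"
  by (rule co_eqI[OF vs_closed(3)[OF P.vsU u] vs_closed(3)[OF vsUF co(1)[OF u]]])
   (simp only: lin_smult[OF lin_ev[OF _ lin_id] co(1)[OF u]] lin_smult[OF lin_la(2)[OF _ lin_id] u] co(2)[OF u])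
 assume w: "w <: UP"
 show "co (u +[UP] w) = co u +[UF] co w"
  by (rule co_eqI[OF vs_closed(2)[OF P.vsU u w] vs_closed(2)[OF vsUF co(1)[OF u] co(1)[OF w]]])
   (simp only: lin_add[OF lin_ev[OF _ lin_id] co(1)[OF u] co(1)[OF w]] lin_add[OF lin_la(2)[OF _ lin_id] u w] co(2)[OF u] co(2)[OF w])
qed

lemma co_one_eq: "co 1[UP] = 1[UP] \<boxtimes>[UP,F] 1[F]"
 by (rule co_eqI[OF alg_closed(1)[OF P.algU] unit_UF])

lemma co_incl: "X <: P ==> co (\<iota> X) = gen X"
 by (rule co_eqI[OF P.incl_closed gen])

lemma coaction_product_eq: "coaction_product F UP act k u w = SP UF (%u1 u2. prodt u2 (k u1) (k w)) u"
 unfolding coaction_product_def sweedler_def prodt_def by (rule refl)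

lemma SQ_SP_swap:
 assumes Z: "vs Z" and v: "v <: UQ" and u: "u <: UP"
  and b: "!!v1 v2. v1 <: UQ ==> v2 <: UQ ==> bilin UP UP Z (b v1 v2)"
  and b': "!!u1 u2. u1 <: UP ==> u2 <: UP ==> bilin UQ UQ Z (%v1 v2. b v1 v2 u1 u2)"
 shows "SP Z (%u1 u2. SQ Z (%v1 v2. b v1 v2 u1 u2) v) u = SQ Z (%v1 v2. SP Z (b v1 v2) u) v"
 by (rule tensor_lift_swap[OF Q.vsU Q.vsU P.vsU P.vsU Z Q.comult_closed[OF v] P.comult_closed[OF u] b b', symmetric])

lemma co_mult_eq:
 assumes u: "u <: UP" and w: "w <: UP"
 shows "co (u *[UP] w) = coaction_product F UP act co u w"
proof (rule co_eqI[OF alg_closed(2)[OF P.algU u w]])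
 have b: "bilin UP UP UF (%u1 u2. prodt u2 (co u1) (co w))" by ((assumption | rule w lins cls)+)
 show "coaction_product F UP act co u w <: UF"
  unfolding coaction_product_eq by (rule tensor_lift_closed[OF P.vsU P.vsU vsUF b P.comult_closed[OF u]])
 fix v assume v: "v <: UQ"
 have "ev v (coaction_product F UP act co u w) = SP UP (%u1 u2. ev v (prodt u2 (co u1) (co w))) u"
  unfolding coaction_product_eq by (rule tensor_lift_natural[OF P.vsU P.vsU vsUF P.vsU lin_ev[OF v lin_id] b P.comult_closed[OF u]])
 also have "\<dots> = SP UP (%u1 u2. SQ UP (%v1 v2. la v1 u1 *[UP] la (ra v2 u2) w) v) u"
 proof (rule lift_cong)
  fix u1 u2 assume u1: "u1 <: UP" and u2: "u2 <: UP"
  show "ev v (prodt u2 (co u1) (co w)) = SQ UP (%v1 v2. la v1 u1 *[UP] la (ra v2 u2) w) v"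
   unfolding ev_prodt[OF v u2 co(1)[OF u1] co(1)[OF w]]
   by (rule lift_cong) (simp only: co(2) u1 w ra_closed u2)
 qed
 also have "\<dots> = SQ UP (%v1 v2. SP UP (%u1 u2. la v1 u1 *[UP] la (ra v2 u2) w) u) v"
  by (rule SQ_SP_swap[OF P.vsU v u]) ((assumption | rule w lins cls)+)
 finally show "ev v (coaction_product F UP act co u w) = la v (u *[UP] w)" unfolding la_of_mult[OF v u w] .
qed

lemma canonical_co: "is_canonical_coaction P Q lact ract B co"
proof -
 have "co \<in> extensional (carrier UP)" by (simp add: co_def)
 moreover have "co (\<iota> X) = coaction_alg P Q lact ract B X" if "X \<in> B" for X
  unfolding coaction_alg_eq[OF that] by (rule co_incl[OF B_closed(1)[OF that]])
 ultimately show ?thesis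
  unfolding is_canonical_coaction_def by (intro conjI ballI lin_co lin_id co_one_eq co_mult_eq)
qed

lemma canonical_co_unique:
 assumes k: "is_canonical_coaction P Q lact ract B k" shows "k = co"
proof -
 have lk: "lin UP UF k" and ext: "k \<in> extensional (carrier UP)" and kB: "X \<in> B ==> k (\<iota> X) = gen X"
  and k1: "k 1[UP] = 1[UP] \<boxtimes>[UP,F] 1[F]"
  and km: "u <: UP ==> w <: UP ==> k (u *[UP] w) = coaction_product F UP act k u w" for X u w
  using k coaction_alg_eq unfolding is_canonical_coaction_def by simp_all
 have kX: "k (\<iota> X) = co (\<iota> X)" if X: "X <: P" for X
  by (rule lin_eq_on_basis[OF vsUF lin_comp[OF lk P.lin_incl[OF lin_id]] lin_co[OF P.lin_incl[OF lin_id]] _ X])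
   (simp only: kB co_incl B_closed)
 have step: "h (\<iota> X *[UP] u) = prodt 1[UP] (h (\<iota> X)) (h u) +[UF] prodt (\<iota> X) (h 1[UP]) (h u)"
  if h: "lin UP UF h" and hm: "!!u w. u <: UP ==> w <: UP ==> h (u *[UP] w) = coaction_product F UP act h u w"
   and X: "X <: P" and u: "u <: UP" for h X u
 proof -
  have b: "bilin UP UP UF (%u1 u2. prodt u2 (h u1) (h u))"
   by (intro bilinI lin_prodt(1,3) h lin_id lin_closed[OF h] u)
  show ?thesis unfolding hm[OF P.incl_closed[OF X] u] coaction_product_eq by (rule P.Sw_incl[OF vsUF b X])
 qed
 have "k u = co u" if u: "u <: UP" for u
 proof (rule P.uea_lin_ext[OF vsUF lk lin_co[OF lin_id] _ _ u])
  show "k 1[UP] = co 1[UP]" unfolding k1 co_one_eq by (rule refl)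
  fix X u assume X: "X <: P" and u: "u <: UP" and IH: "k u = co u"
  have s1: "k (\<iota> X *[UP] u) = prodt 1[UP] (k (\<iota> X)) (k u) +[UF] prodt (\<iota> X) (k 1[UP]) (k u)"
   by (rule step[OF lk km X u])
  have s2: "co (\<iota> X *[UP] u) = prodt 1[UP] (co (\<iota> X)) (co u) +[UF] prodt (\<iota> X) (co 1[UP]) (co u)"
   by (rule step[OF lin_co[OF lin_id] co_mult_eq X u])
  show "k (\<iota> X *[UP] u) = co (\<iota> X *[UP] u)"
   unfolding s1 s2 kX[OF X] IH k1 co_one_eq by (rule refl)
 qed
 then show ?thesis by (intro extensionalityI[OF ext]) (simp_all add: co_def)
qed

lemma canonical_coaction_eq: "canonical_coaction P Q lact ract B = co"
 unfolding canonical_coaction_def by (rule the_equality[where P = "is_canonical_coaction P Q lact ract B", OF canonical_co canonical_co_unique])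

end

section \<open>The matched pair of Hopf algebras\<close>

context based_matched_brackets
begin

lemma tensor_UUF_eqI:
 assumes s: "s <: (tensor UP UF)" and t: "t <: (tensor UP UF)"
  and eq: "!!v. v <: UQ ==>
   tensor_lift UP UF (tensor UP UP) (%x r. x \<boxtimes>[UP,UP] ev v r) s = tensor_lift UP UF (tensor UP UP) (%x r. x \<boxtimes>[UP,UP] ev v r) t"
 shows "s = t"
proof -
 let ?UU = "tensor UP UP"
 let ?A = "tensor ?UU F" and ?B = "tensor UP UF"
 have vA: "vs ?A" and vB: "vs ?B" by (intro vs_tensor P.vsU Q.vsH vsUF)+
 have ai: "bilin UP F ?A (%y f. (x \<boxtimes>[UP,UP] y) \<boxtimes>[?UU,F] f)" if "x <: UP" for x by ((assumption | rule that lins cls)+)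
 have ao: "bilin UP UF ?A (%x r. tensor_lift UP F ?A (%y f. (x \<boxtimes>[UP,UP] y) \<boxtimes>[?UU,F] f) r)" by ((assumption | rule vA lins cls)+)
 have bi: "bilin UP UP ?B (%x y. x \<boxtimes>[UP,UF] (y \<boxtimes>[UP,F] f))" if "f <: F" for f by ((assumption | rule that lins cls)+)
 have bo: "bilin ?UU F ?B (%z f. tensor_lift UP UP ?B (%x y. x \<boxtimes>[UP,UF] (y \<boxtimes>[UP,F] f)) z)" by ((assumption | rule vB lins cls)+)
 define a where "a = tensor_lift UP UF ?A (%x r. tensor_lift UP F ?A (%y f. (x \<boxtimes>[UP,UP] y) \<boxtimes>[?UU,F] f) r)"
 define b where "b = tensor_lift ?UU F ?B (%z f. tensor_lift UP UP ?B (%x y. x \<boxtimes>[UP,UF] (y \<boxtimes>[UP,F] f)) z)"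
 note la = tensor_lift_lin[OF P.vsU vsUF vA ao, folded a_def] and lb = tensor_lift_lin[OF P.vsUU Q.vsH vB bo, folded b_def]
 have a_pure: "a (x \<boxtimes>[UP,UF] (y \<boxtimes>[UP,F] f)) = (x \<boxtimes>[UP,UP] y) \<boxtimes>[?UU,F] f"
  if "x <: UP" "y <: UP" "f <: F" for x y f
  unfolding a_def tensor_lift_pure[OF P.vsU vsUF vA ao that(1) pure_tensor_closed[OF P.vsU Q.vsH that(2,3)]]
  by (rule tensor_lift_pure[OF P.vsU Q.vsH vA ai[OF that(1)] that(2,3)])
 have ext: "h r = h' r" if Z: "vs Z" and h: "lin ?B Z h" and h': "lin ?B Z h'" and r: "r <: ?B"
  and e: "!!x y f. x <: UP ==> y <: UP ==> f <: F ==> h (x \<boxtimes>[UP,UF] (y \<boxtimes>[UP,F] f)) = h' (x \<boxtimes>[UP,UF] (y \<boxtimes>[UP,F] f))"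
  for Z :: "(complex, 'z, 'zz) module_scheme" and h h' r
 proof (rule tensor_ext[OF P.vsU vsUF Z h h' _ r])
  fix x q assume x: "x <: UP" and q: "q <: UF"
  note lx = lin_pure_tensor(2)[OF P.vsU vsUF x lin_id]
  show "h (x \<boxtimes>[UP,UF] q) = h' (x \<boxtimes>[UP,UF] q)"
   by (rule tensor_ext[OF P.vsU Q.vsH Z lin_comp[OF h lx] lin_comp[OF h' lx] e[OF x] q])
 qed
 have ba: "b (a r) = r" if r: "r <: ?B" for r
 proof (rule ext[OF vB lin_comp[OF lb la] lin_id r])
  fix x y f assume x: "x <: UP" and y: "y <: UP" and f: "f <: F"
  show "b (a (x \<boxtimes>[UP,UF] (y \<boxtimes>[UP,F] f))) = x \<boxtimes>[UP,UF] (y \<boxtimes>[UP,F] f)"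
   unfolding a_pure[OF x y f] b_def tensor_lift_pure[OF P.vsUU Q.vsH vB bo pure_tensor_closed[OF P.vsU P.vsU x y] f]
   by (rule tensor_lift_pure[OF P.vsU P.vsU vB bi[OF f] x y])
 qed
 have eq': "a s = a t"
 proof (rule Q.tensor_H_eqI[OF P.vsUU lin_closed[OF la s] lin_closed[OF la t]])
  fix v assume v: "v <: UQ"
  have be: "bilin ?UU F ?UU (%z f. f v .[?UU] z)"
   by (intro bilinI lin_smult_left[OF P.vsUU] lin_pointwise_smult[OF P.vsUU] Q.lin_eval v lin_id)
  have br: "bilin UP UF ?UU (%x r. x \<boxtimes>[UP,UP] ev v r)" by ((assumption | rule v lins cls)+)
  have "tensor_lift ?UU F ?UU (%z f. f v .[?UU] z) (a r) = tensor_lift UP UF ?UU (%x r. x \<boxtimes>[UP,UP] ev v r) r"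
   if r: "r <: ?B" for r
  proof (rule ext[OF P.vsUU lin_comp[OF tensor_lift_lin[OF P.vsUU Q.vsH P.vsUU be] la] tensor_lift_lin[OF P.vsU vsUF P.vsUU br] r])
   fix x y f assume x: "x <: UP" and y: "y <: UP" and f: "f <: F"
   show "tensor_lift ?UU F ?UU (%z f. f v .[?UU] z) (a (x \<boxtimes>[UP,UF] (y \<boxtimes>[UP,F] f))) =
     tensor_lift UP UF ?UU (%x r. x \<boxtimes>[UP,UP] ev v r) (x \<boxtimes>[UP,UF] (y \<boxtimes>[UP,F] f))"
    unfolding a_pure[OF x y f] tensor_lift_pure[OF P.vsUU Q.vsH P.vsUU be pure_tensor_closed[OF P.vsU P.vsU x y] f]
     tensor_lift_pure[OF P.vsU vsUF P.vsUU br x pure_tensor_closed[OF P.vsU Q.vsH y f]] ev_pure[OF v y f]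
    by (rule pure_tensor_smult(2)[OF P.vsU P.vsU x y, symmetric])
  qed
  then show "tensor_lift ?UU F ?UU (%z f. f v .[?UU] z) (a s) = tensor_lift ?UU F ?UU (%z f. f v .[?UU] z) (a t)"
   using s t eq[OF v] by (simp only:)
 qed
 show ?thesis using arg_cong[OF eq', of b] unfolding ba[OF s] ba[OF t] .
qed

lemma act_on_mult_eq:
 assumes u: "u <: UP" and f: "f <: F" and g: "g <: F"
 shows "act u (f *[F] g) = sweedler UP F (%u1 u2. act u1 f *[F] act u2 g) u"
proof -
 have b: "bilin UP UP F (%u1 u2. act u1 f *[F] act u2 g)"
 proof (rule bilinI)
  show "lin UP F (%u2. act u1 f *[F] act u2 g)" if "u1 <: UP" for u1
   by (rule lin_alg_mult(2)[OF Q.algH act_closed[OF that f] lin_act(2)[OF g lin_id]])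
  show "lin UP F (%u1. act u1 f *[F] act u2 g)" if "u2 <: UP" for u2
   by (rule lin_alg_mult(1)[OF Q.algH act_closed[OF that g] lin_act(2)[OF f lin_id]])
 qed
 note cu = P.comult_closed[OF u]
 show ?thesis unfolding sweedler_def
 proof (rule Q.H_eqI[OF act_closed[OF u Q.H_mult_closed[OF f g]] tensor_lift_closed[OF P.vsU P.vsU Q.vsH b cu]])
  fix v assume v: "v <: UQ"
  have "act u (f *[F] g) v = SQ cpx (%v1 v2. SP cpx (%u1 u2. f (ra v1 u1) * g (ra v2 u2)) u) v"
   unfolding act_eval[OF u v] Q.H_eval(1)[OF ra_closed[OF v u]] by (rule ra_comult[OF vs_cpx Q.bilin_H_product[OF f g] v u])
  also have "\<dots> = SP cpx (%u1 u2. SQ cpx (%v1 v2. f (ra v1 u1) * g (ra v2 u2)) v) u"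
  proof (rule SQ_SP_swap[OF vs_cpx v u, symmetric])
   fix v1 v2 assume v12: "v1 <: UQ" "v2 <: UQ"
   show "bilin UP UP cpx (%u1 u2. f (ra v1 u1) * g (ra v2 u2))"
   proof (rule bilinI)
    show "lin UP cpx (%u2. f (ra v1 u1) * g (ra v2 u2))" for u1
     by (rule lin_cpx_mult(2)[OF Q.H_lin[OF g lin_ra(2)[OF v12(2) lin_id]]])
    show "lin UP cpx (%u1. f (ra v1 u1) * g (ra v2 u2))" for u2
     by (rule lin_cpx_mult(1)[OF Q.H_lin[OF f lin_ra(2)[OF v12(1) lin_id]]])
   qed
  next
   fix u1 u2 assume u12: "u1 <: UP" "u2 <: UP"
   show "bilin UQ UQ cpx (%v1 v2. f (ra v1 u1) * g (ra v2 u2))"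
   proof (rule bilinI)
    show "lin UQ cpx (%v2. f (ra v1 u1) * g (ra v2 u2))" for v1
     by (rule lin_cpx_mult(2)[OF Q.H_lin[OF g lin_ra(1)[OF u12(2) lin_id]]])
    show "lin UQ cpx (%v1. f (ra v1 u1) * g (ra v2 u2))" for v2
     by (rule lin_cpx_mult(1)[OF Q.H_lin[OF f lin_ra(1)[OF u12(1) lin_id]]])
   qed
  qed
  also have "\<dots> = SP cpx (%u1 u2. (act u1 f *[F] act u2 g) v) u"
  proof (rule lift_cong)
   fix u1 u2 assume u12: "u1 <: UP" "u2 <: UP"
   show "SQ cpx (%v1 v2. f (ra v1 u1) * g (ra v2 u2)) v = (act u1 f *[F] act u2 g) v"
    unfolding Q.H_eval(1)[OF v] by (rule lift_cong) (simp only: act_eval u12)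
  qed
  finally show "act u (f *[F] g) v = SP F (%u1 u2. act u1 f *[F] act u2 g) u v"
   unfolding Q.H_lift_eval[OF P.vsU P.vsU b cu v] .
 qed
qed

lemma co_coassociative_eq:
 assumes u: "u <: UP"
 shows "tensor_lift UP F (tensor UP (tensor F F)) (%x g. tensor_lift UP F (tensor UP (tensor F F)) (%y f.
   y \<boxtimes>[UP,tensor F F] (f \<boxtimes>[F,F] g)) (co x)) (co u) =
  tensor_lift UP F (tensor UP (tensor F F)) (%x f. x \<boxtimes>[UP,tensor F F] comult F f) (co u)"
proof -
 let ?FF = "tensor F F"
 let ?Z = "tensor UP ?FF"
 note cu = co(1)[OF u]
 have Z: "vs ?Z" by (rule vs_tensor[OF P.vsU Q.vsHH])
 have bi: "bilin UP F ?Z (%y f. y \<boxtimes>[UP,?FF] (f \<boxtimes>[F,F] g))" if "g <: F" for g by ((assumption | rule that lins cls)+)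
 have bl: "bilin UP F ?Z (%x g. tensor_lift UP F ?Z (%y f. y \<boxtimes>[UP,?FF] (f \<boxtimes>[F,F] g)) (co x))" by ((assumption | rule Z lins cls)+)
 have br: "bilin UP F ?Z (%x f. x \<boxtimes>[UP,?FF] comult F f)" by ((assumption | rule lins cls)+)
 show ?thesis
 proof (rule Q.tensor_HH_eqI[OF P.vsU tensor_lift_closed[OF P.vsU Q.vsH Z bl cu] tensor_lift_closed[OF P.vsU Q.vsH Z br cu]])
  fix v w assume v: "v <: UQ" and w: "w <: UQ"
  let ?E = "tensor_lift UP ?FF UP (%x r. Q.ev2 v w r .[UP] x)"
  have be: "bilin UP ?FF UP (%x r. Q.ev2 v w r .[UP] x)" by ((assumption | rule v w lins cls)+)
  note lE = tensor_lift_lin[OF P.vsU Q.vsHH P.vsU be]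
  have "?E (tensor_lift UP F ?Z (%y f. y \<boxtimes>[UP,?FF] (f \<boxtimes>[F,F] g)) s) = g w .[UP] ev v s" if s: "s <: UF" and g: "g <: F" for s g
  proof (rule tensor_ext[OF P.vsU Q.vsH P.vsU lin_comp[OF lE tensor_lift_lin[OF P.vsU Q.vsH Z bi[OF g]]] lin_pointwise_smult[OF P.vsU lin_ev[OF v lin_id]] _ s])
   fix y f assume y: "y <: UP" and f: "f <: F"
   show "?E (tensor_lift UP F ?Z (%y f. y \<boxtimes>[UP,?FF] (f \<boxtimes>[F,F] g)) (y \<boxtimes>[UP,F] f)) = g w .[UP] ev v (y \<boxtimes>[UP,F] f)"
    unfolding tensor_lift_pure[OF P.vsU Q.vsH Z bi[OF g] y f] tensor_lift_pure[OF P.vsU Q.vsHH P.vsU be y pure_tensor_closed[OF Q.vsH Q.vsH f g]]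
     ev_pure[OF v y f] Q.ev2_pure[OF v w f g] by (simp only: vs_smult_smult[OF P.vsU y] mult.commute)
  qed
  note inner = this
  have "?E (tensor_lift UP F ?Z (%x g. tensor_lift UP F ?Z (%y f. y \<boxtimes>[UP,?FF] (f \<boxtimes>[F,F] g)) (co x)) (co u)) =
    tensor_lift UP F UP (%x g. la v (g w .[UP] x)) (co u)"
   unfolding tensor_lift_natural[OF P.vsU Q.vsH Z P.vsU lE bl cu]
   by (rule lift_cong) (simp only: inner co v lin_smult[OF lin_la(2)[OF v lin_id]])
  also have "\<dots> = la v (ev w (co u))"
   unfolding ev_def by (rule tensor_lift_natural[OF P.vsU Q.vsH P.vsU P.vsU lin_la(2)[OF v lin_id] bilin_ev[OF w] cu, symmetric])
  also have "\<dots> = ev (v *[UQ] w) (co u)"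
   unfolding co(2)[OF u w] co(2)[OF u alg_closed(2)[OF Q.algU v w]] la_mult[OF v w u] by (rule refl)
  also have "\<dots> = ?E (tensor_lift UP F ?Z (%x f. x \<boxtimes>[UP,?FF] comult F f) (co u))"
   unfolding ev_def tensor_lift_natural[OF P.vsU Q.vsH Z P.vsU lE br cu]
   by (rule lift_cong) (simp only: tensor_lift_pure[OF P.vsU Q.vsHH P.vsU be] Q.comult_H v w)
  finally show "?E (tensor_lift UP F ?Z (%x g. tensor_lift UP F ?Z (%y f. y \<boxtimes>[UP,?FF] (f \<boxtimes>[F,F] g)) (co x)) (co u)) =
   ?E (tensor_lift UP F ?Z (%x f. x \<boxtimes>[UP,?FF] comult F f) (co u))" .
 qed
qed

lemma co_comult_eq:
 assumes u: "u <: UP"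
 shows "tensor_lift UP F (tensor UP UF) (%x f. sweedler UP (tensor UP UF) (%x1 x2. x1 \<boxtimes>[UP,UF] (x2 \<boxtimes>[UP,F] f)) x) (co u) =
  sweedler UP (tensor UP UF) (%u1 u2. tensor_lift UP F (tensor UP UF) (%x f. tensor_lift UP F (tensor UP UF) (%y g.
   x \<boxtimes>[UP,UF] (y \<boxtimes>[UP,F] (f *[F] g))) (co u2)) (co u1)) u"
proof -
 let ?Z = "tensor UP UF" and ?UU = "tensor UP UP"
 note cu = co(1)[OF u] and cmu = P.comult_closed[OF u]
 have Z: "vs ?Z" by (rule vs_tensor[OF P.vsU vsUF])
 have bi: "bilin UP UP ?Z (%x1 x2. x1 \<boxtimes>[UP,UF] (x2 \<boxtimes>[UP,F] f))" if "f <: F" for f by ((assumption | rule that lins cls)+)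
 have bl: "bilin UP F ?Z (%x f. SP ?Z (%x1 x2. x1 \<boxtimes>[UP,UF] (x2 \<boxtimes>[UP,F] f)) x)" by ((assumption | rule Z lins cls)+)
 let ?r = "%s t. tensor_lift UP F ?Z (%x f. tensor_lift UP F ?Z (%y g. x \<boxtimes>[UP,UF] (y \<boxtimes>[UP,F] (f *[F] g))) t) s"
 have bri: "bilin UP F ?Z (%y g. x \<boxtimes>[UP,UF] (y \<boxtimes>[UP,F] (f *[F] g)))" if "x <: UP" "f <: F" for x f
  by ((assumption | rule that lins cls)+)
 have bro: "bilin UP F ?Z (%x f. tensor_lift UP F ?Z (%y g. x \<boxtimes>[UP,UF] (y \<boxtimes>[UP,F] (f *[F] g))) t)" if "t <: UF" for t
  by ((assumption | rule that Z lins cls)+)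
 have br: "bilin UP UP ?Z (%u1 u2. ?r (co u1) (co u2))" by ((assumption | rule Z lins cls)+)
 show ?thesis unfolding sweedler_def
 proof (rule tensor_UUF_eqI[OF tensor_lift_closed[OF P.vsU Q.vsH Z bl cu] tensor_lift_closed[OF P.vsU P.vsU Z br cmu]])
  fix v assume v: "v <: UQ"
  let ?G = "tensor_lift UP UF ?UU (%x r. x \<boxtimes>[UP,UP] ev v r)"
  have bG: "bilin UP UF ?UU (%x r. x \<boxtimes>[UP,UP] ev v r)" by ((assumption | rule v lins cls)+)
  note lG = tensor_lift_lin[OF P.vsU vsUF P.vsUU bG]
  have G_pure: "?G (x \<boxtimes>[UP,UF] (y \<boxtimes>[UP,F] f)) = f v .[?UU] (x \<boxtimes>[UP,UP] y)"
   if "x <: UP" "y <: UP" "f <: F" for x y f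
   unfolding tensor_lift_pure[OF P.vsU vsUF P.vsUU bG that(1) pure_tensor_closed[OF P.vsU Q.vsH that(2,3)]] ev_pure[OF v that(2,3)]
   by (rule pure_tensor_smult(2)[OF P.vsU P.vsU that(1,2)])
  have L: "?G (tensor_lift UP F ?Z (%x f. SP ?Z (%x1 x2. x1 \<boxtimes>[UP,UF] (x2 \<boxtimes>[UP,F] f)) x) t) = comult UP (ev v t)" if t: "t <: UF" for t
  proof (rule tensor_ext[OF P.vsU Q.vsH P.vsUU lin_comp[OF lG tensor_lift_lin[OF P.vsU Q.vsH Z bl]] P.lin_comult[OF lin_ev[OF v lin_id]] _ t])
   fix x f assume x: "x <: UP" and f: "f <: F"
   note cx = P.comult_closed[OF x]
   have "?G (SP ?Z (%x1 x2. x1 \<boxtimes>[UP,UF] (x2 \<boxtimes>[UP,F] f)) x) = SP ?UU (%x1 x2. f v .[?UU] (x1 \<boxtimes>[UP,UP] x2)) x"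
    unfolding tensor_lift_natural[OF P.vsU P.vsU Z P.vsUU lG bi[OF f] cx]
    by (rule lift_cong) (rule G_pure[OF _ _ f])
   also have "\<dots> = f v .[?UU] SP ?UU (%x1 x2. x1 \<boxtimes>[UP,UP] x2) x"
    by (rule tensor_lift_natural[OF P.vsU P.vsU P.vsUU P.vsUU lin_pointwise_smult[OF P.vsUU lin_id] bilin_pure_tensor[OF P.vsU P.vsU] cx, symmetric])
   finally show "?G (tensor_lift UP F ?Z (%x f. SP ?Z (%x1 x2. x1 \<boxtimes>[UP,UF] (x2 \<boxtimes>[UP,F] f)) x) (x \<boxtimes>[UP,F] f)) = comult UP (ev v (x \<boxtimes>[UP,F] f))"
    unfolding tensor_lift_pure[OF P.vsU Q.vsH Z bl x f] ev_pure[OF v x f] lin_smult[OF P.lin_comult[OF lin_id] x]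
     tensor_lift_pure_self[OF P.vsU P.vsU cx] .
  qed
  have bR: "bilin UQ UQ ?UU (%v1 v2. ev v1 s \<boxtimes>[UP,UP] ev v2 t)" if "s <: UF" "t <: UF" for s t
   by ((assumption | rule that lins cls)+)
  have R: "?G (?r s t) = SQ ?UU (%v1 v2. ev v1 s \<boxtimes>[UP,UP] ev v2 t) v" if s: "s <: UF" and t: "t <: UF" for s t
  proof -
   have r1: "lin UF ?UU (%s. SQ ?UU (%v1 v2. ev v1 s \<boxtimes>[UP,UP] ev v2 t) v)" if "t <: UF" for t
    by ((assumption | rule lin_tensor_lift_fun[OF Q.vsU Q.vsU vsUF P.vsUU Q.comult_closed[OF v] bR] that lins cls)+)
   have r2: "lin UF ?UU (%t. SQ ?UU (%v1 v2. ev v1 s \<boxtimes>[UP,UP] ev v2 t) v)" if "s <: UF" for s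
    by ((assumption | rule lin_tensor_lift_fun[OF Q.vsU Q.vsU vsUF P.vsUU Q.comult_closed[OF v] bR] that lins cls)+)
   have l2: "lin UF ?Z (%t. ?r s t)" if "s <: UF" for s by ((assumption | rule that Z lins cls)+)
   show ?thesis
   proof (rule tensor_ext[OF P.vsU Q.vsH P.vsUU lin_comp[OF lG tensor_lift_lin[OF P.vsU Q.vsH Z bro[OF t]]] r1[OF t] _ s])
    fix x f assume x: "x <: UP" and f: "f <: F"
    note xf = pure_tensor_closed[OF P.vsU Q.vsH x f]
    show "?G (?r (x \<boxtimes>[UP,F] f) t) = SQ ?UU (%v1 v2. ev v1 (x \<boxtimes>[UP,F] f) \<boxtimes>[UP,UP] ev v2 t) v"
    proof (rule tensor_ext[OF P.vsU Q.vsH P.vsUU lin_comp[OF lG l2[OF xf]] r2[OF xf] _ t])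
     fix y g assume y: "y <: UP" and g: "g <: F"
     note yg = pure_tensor_closed[OF P.vsU Q.vsH y g] and xy = pure_tensor_closed[OF P.vsU P.vsU x y]
     have "?G (?r (x \<boxtimes>[UP,F] f) (y \<boxtimes>[UP,F] g)) = SQ cpx (%v1 v2. f v1 * g v2) v .[?UU] (x \<boxtimes>[UP,UP] y)"
      unfolding tensor_lift_pure[OF P.vsU Q.vsH Z bro[OF yg] x f] tensor_lift_pure[OF P.vsU Q.vsH Z bri[OF x f] y g]
       G_pure[OF x y Q.H_mult_closed[OF f g]] Q.H_eval(1)[OF v] by (rule refl)
     also have "\<dots> = SQ ?UU (%v1 v2. (f v1 * g v2) .[?UU] (x \<boxtimes>[UP,UP] y)) v"
      by (rule tensor_lift_natural[OF Q.vsU Q.vsU vs_cpx P.vsUU lin_smult_left[OF P.vsUU xy lin_id] Q.bilin_H_product[OF f g] Q.comult_closed[OF v]])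
     also have "\<dots> = SQ ?UU (%v1 v2. ev v1 (x \<boxtimes>[UP,F] f) \<boxtimes>[UP,UP] ev v2 (y \<boxtimes>[UP,F] g)) v"
      by (rule lift_cong)
       (simp only: ev_pure x f y g bilin_smult_smult[OF P.vsUU bilin_pure_tensor[OF P.vsU P.vsU] x y P.vsU P.vsU])
     finally show "?G (?r (x \<boxtimes>[UP,F] f) (y \<boxtimes>[UP,F] g)) = SQ ?UU (%v1 v2. ev v1 (x \<boxtimes>[UP,F] f) \<boxtimes>[UP,UP] ev v2 (y \<boxtimes>[UP,F] g)) v" .
    qed
   qed
  qed
  have "?G (SP ?Z (%u1 u2. ?r (co u1) (co u2)) u) = SP ?UU (%u1 u2. SQ ?UU (%v1 v2. la v1 u1 \<boxtimes>[UP,UP] la v2 u2) v) u"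
   unfolding tensor_lift_natural[OF P.vsU P.vsU Z P.vsUU lG br cmu]
  proof (rule lift_cong)
   fix u1 u2 assume u12: "u1 <: UP" "u2 <: UP"
   show "?G (?r (co u1) (co u2)) = SQ ?UU (%v1 v2. la v1 u1 \<boxtimes>[UP,UP] la v2 u2) v"
    unfolding R[OF co(1)[OF u12(1)] co(1)[OF u12(2)]] by (rule lift_cong) (simp only: co(2) u12)
  qed
  also have "\<dots> = SQ ?UU (%v1 v2. SP ?UU (%u1 u2. la v1 u1 \<boxtimes>[UP,UP] la v2 u2) u) v"
   by (rule SQ_SP_swap[OF P.vsUU v u]) ((assumption | rule lins cls)+)
  also have "\<dots> = SP ?UU (%x y. x \<boxtimes>[UP,UP] y) (la v u)"
   by (rule la_comult[OF P.vsUU bilin_pure_tensor[OF P.vsU P.vsU] v u, symmetric])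
  also have "\<dots> = comult UP (ev v (co u))"
   unfolding co(2)[OF u v] by (rule tensor_lift_pure_self[OF P.vsU P.vsU P.comult_closed[OF la_closed[OF v u]]])
  finally show "?G (tensor_lift UP F ?Z (%x f. SP ?Z (%x1 x2. x1 \<boxtimes>[UP,UF] (x2 \<boxtimes>[UP,F] f)) x) (co u)) = ?G (SP ?Z (%u1 u2. ?r (co u1) (co u2)) u)"
   unfolding L[OF cu] by (rule HOL.sym)
 qed
qed

lemma co_counit_coalgebra_eq:
 assumes u: "u <: UP"
 shows "tensor_lift UP F F (%x f. counit UP x .[F] f) (co u) = counit UP u .[F] 1[F]"
proof -
 have b: "bilin UP F F (%x f. counit UP x .[F] f)" by ((assumption | rule lins cls)+)
 note cu = co(1)[OF u]
 show ?thesis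
 proof (rule Q.H_eqI[OF tensor_lift_closed[OF P.vsU Q.vsH Q.vsH b cu] vs_closed(3)[OF Q.vsH Q.H_one_closed]])
  fix v assume v: "v <: UQ"
  have "tensor_lift UP F F (%x f. counit UP x .[F] f) (co u) v = tensor_lift UP F cpx (%x f. counit UP (f v .[UP] x)) (co u)"
   unfolding Q.H_lift_eval[OF P.vsU Q.vsH b cu v]
   by (rule lift_cong) (simp only: Q.H_eval v lin_smult[OF P.lin_counit[OF lin_id]] cpx_simps mult.commute)
  also have "\<dots> = counit UP (ev v (co u))"
   unfolding ev_def by (rule tensor_lift_natural[OF P.vsU Q.vsH P.vsU vs_cpx P.lin_counit[OF lin_id] bilin_ev[OF v] cu, symmetric])
  finally show "tensor_lift UP F F (%x f. counit UP x .[F] f) (co u) v = (counit UP u .[F] 1[F]) v"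
   unfolding co(2)[OF u v] counit_la[OF v u] Q.H_eval[OF v] by (simp only: mult.commute)
 qed
qed

lemma comult_act_eq:
 assumes u: "u <: UP" and f: "f <: F"
 shows "comult F (act u f) = sweedler UP (tensor F F) (%u1 u2. tensor_lift UP F (tensor F F) (%x g.
  sweedler F (tensor F F) (%f1 f2. act x f1 \<boxtimes>[F,F] (g *[F] act u2 f2)) f) (co u1)) u"
 unfolding sweedler_def
proof -
 let ?FF = "tensor F F"
 let ?m = "%u2 x g. Q.RH ?FF (%f1 f2. act x f1 \<boxtimes>[F,F] (g *[F] act u2 f2)) (comult F f)"
 note cf = Q.comult_H(1)[OF f] and cmu = P.comult_closed[OF u]
 have bi: "bilin F F ?FF (%f1 f2. act x f1 \<boxtimes>[F,F] (g *[F] act u2 f2))" if "x <: UP" "g <: F" "u2 <: UP" for x g u2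
  by ((assumption | rule that lins cls)+)
 have bm: "bilin UP F ?FF (?m u2)" if "u2 <: UP" for u2 by ((assumption | rule that f lins cls)+)
 have bo: "bilin UP UP ?FF (%u1 u2. tensor_lift UP F ?FF (?m u2) (co u1))" by ((assumption | rule f lins cls)+)
 show "comult F (act u f) = SP ?FF (%u1 u2. tensor_lift UP F ?FF (?m u2) (co u1)) u"
 proof (rule Q.comult_H_eqI[OF tensor_lift_closed[OF P.vsU P.vsU Q.vsHH bo cmu]])
  fix v w assume v: "v <: UQ" and w: "w <: UQ"
  note le = Q.lin_ev2[OF v w lin_id] and cw = Q.comult_closed[OF w]
  have bt: "bilin UQ UQ cpx (%w1 w2. f (ra v (ev w1 t) *[UQ] ra w2 u2))" if "t <: UF" "u2 <: UP" for t u2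
   by ((assumption | rule that v bilinI Q.H_lin[OF f] lins cls)+)
  have key: "Q.ev2 v w (tensor_lift UP F ?FF (?m u2) t) = SQ cpx (%w1 w2. f (ra v (ev w1 t) *[UQ] ra w2 u2)) w"
   if t: "t <: UF" and u2: "u2 <: UP" for t u2
  proof -
   have l: "lin UF cpx (%t. SQ cpx (%w1 w2. f (ra v (ev w1 t) *[UQ] ra w2 u2)) w)"
    by (rule lin_tensor_lift_fun[OF Q.vsU Q.vsU vsUF vs_cpx cw bt]) (assumption | rule u2 v Q.H_lin[OF f] lins cls)+
   show ?thesis
   proof (rule tensor_ext[OF P.vsU Q.vsH vs_cpx lin_comp[OF le tensor_lift_lin[OF P.vsU Q.vsH Q.vsHH bm[OF u2]]] l _ t])
    fix x g assume x: "x <: UP" and g: "g <: F"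
    note av = ra_closed[OF v x]
    have "Q.ev2 v w (tensor_lift UP F ?FF (?m u2) (x \<boxtimes>[UP,F] g)) =
      Q.RH cpx (%f1 f2. Q.ev2 v w (act x f1 \<boxtimes>[F,F] (g *[F] act u2 f2))) (comult F f)"
     unfolding tensor_lift_pure[OF P.vsU Q.vsH Q.vsHH bm[OF u2] x g]
     by (rule tensor_lift_natural[OF Q.vsH Q.vsH Q.vsHH vs_cpx le bi[OF x g u2] cf])
    also have "\<dots> = Q.RH cpx (%f1 f2. SQ cpx (%w1 w2. g w1 * (f1 (ra v x) * f2 (ra w2 u2))) w) (comult F f)"
    proof (rule lift_cong)
     fix f1 f2 assume f1: "f1 <: F" and f2: "f2 <: F"
     note a2 = act_closed[OF u2 f2]
     have "Q.ev2 v w (act x f1 \<boxtimes>[F,F] (g *[F] act u2 f2)) = f1 (ra v x) * SQ cpx (%w1 w2. g w1 * act u2 f2 w2) w"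
      unfolding Q.ev2_pure[OF v w act_closed[OF x f1] Q.H_mult_closed[OF g a2]] act_eval[OF x v] Q.H_eval(1)[OF w] by (rule refl)
     also have "\<dots> = SQ cpx (%w1 w2. f1 (ra v x) * (g w1 * act u2 f2 w2)) w"
      by (rule tensor_lift_natural[OF Q.vsU Q.vsU vs_cpx vs_cpx lin_cpx_mult(2)[OF lin_id] Q.bilin_H_product[OF g a2] cw])
     also have "\<dots> = SQ cpx (%w1 w2. g w1 * (f1 (ra v x) * f2 (ra w2 u2))) w"
      by (rule lift_cong) (simp only: act_eval u2 mult.left_commute)
     finally show "Q.ev2 v w (act x f1 \<boxtimes>[F,F] (g *[F] act u2 f2)) = SQ cpx (%w1 w2. g w1 * (f1 (ra v x) * f2 (ra w2 u2))) w" .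
    qed
    also have "\<dots> = SQ cpx (%w1 w2. Q.RH cpx (%f1 f2. g w1 * (f1 (ra v x) * f2 (ra w2 u2))) (comult F f)) w"
    proof (rule tensor_lift_swap[OF Q.vsH Q.vsH Q.vsU Q.vsU vs_cpx cf cw])
     fix f1 f2 assume f12: "f1 <: F" "f2 <: F"
     show "bilin UQ UQ cpx (%w1 w2. g w1 * (f1 (ra v x) * f2 (ra w2 u2)))"
      by (rule bilinI, intro lin_cpx_mult(2) Q.H_lin[OF f12(2)] lin_ra(1)[OF u2 lin_id], intro lin_cpx_mult(1) Q.H_lin[OF g lin_id])
    next
     fix w1 w2 assume w12: "w1 <: UQ" "w2 <: UQ"
     show "bilin F F cpx (%f1 f2. g w1 * (f1 (ra v x) * f2 (ra w2 u2)))"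
      by (rule bilinI, intro lin_cpx_mult(2) Q.lin_eval[OF ra_closed[OF w12(2) u2] lin_id],
        rule lin_cpx_mult(2), rule lin_cpx_mult(1), rule Q.lin_eval[OF av lin_id])
    qed
    also have "\<dots> = SQ cpx (%w1 w2. f (ra v (ev w1 (x \<boxtimes>[UP,F] g)) *[UQ] ra w2 u2)) w"
    proof (rule lift_cong)
     fix w1 w2 assume w1: "w1 <: UQ" and w2: "w2 <: UQ"
     note a2 = ra_closed[OF w2 u2]
     have "Q.RH cpx (%f1 f2. g w1 * (f1 (ra v x) * f2 (ra w2 u2))) (comult F f) = g w1 * Q.RH cpx (%f1 f2. f1 (ra v x) * f2 (ra w2 u2)) (comult F f)"
      by (rule tensor_lift_natural[OF Q.vsH Q.vsH vs_cpx vs_cpx lin_cpx_mult(2)[OF lin_id] Q.bilin_ev2[OF av a2] cf, symmetric])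
     also have "\<dots> = g w1 * f (ra v x *[UQ] ra w2 u2)" unfolding Q.RH_comult_cpx[OF f av a2] by (rule refl)
     finally show "Q.RH cpx (%f1 f2. g w1 * (f1 (ra v x) * f2 (ra w2 u2))) (comult F f) = f (ra v (ev w1 (x \<boxtimes>[UP,F] g)) *[UQ] ra w2 u2)"
      unfolding ev_pure[OF w1 x g] lin_smult[OF lin_ra(2)[OF v lin_id] x] alg_smult_mult(1)[OF Q.algU av a2]
       lin_smult[OF Q.H_lin[OF f lin_id] alg_closed(2)[OF Q.algU av a2]] cpx_simps .
    qed
    finally show "Q.ev2 v w (tensor_lift UP F ?FF (?m u2) (x \<boxtimes>[UP,F] g)) =
     SQ cpx (%w1 w2. f (ra v (ev w1 (x \<boxtimes>[UP,F] g)) *[UQ] ra w2 u2)) w" .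
   qed
  qed
  have bb: "bilin UP UP UQ (%u1 u2. ra v (la w1 u1) *[UQ] ra w2 u2)" if "w1 <: UQ" "w2 <: UQ" for w1 w2
   by ((assumption | rule that v lins cls)+)
  have bs: "bilin UQ UQ UQ (%w1 w2. SP UQ (%u1 u2. ra v (la w1 u1) *[UQ] ra w2 u2) u)"
   by ((assumption | rule v u lins cls)+)
  note lf = Q.H_lin[OF f lin_id]
  have "Q.ev2 v w (SP ?FF (%u1 u2. tensor_lift UP F ?FF (?m u2) (co u1)) u) =
    SP cpx (%u1 u2. SQ cpx (%w1 w2. f (ra v (la w1 u1) *[UQ] ra w2 u2)) w) u"
   unfolding tensor_lift_natural[OF P.vsU P.vsU Q.vsHH vs_cpx le bo cmu]
  proof (rule lift_cong)
   fix u1 u2 assume u1: "u1 <: UP" and u2: "u2 <: UP"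
   show "Q.ev2 v w (tensor_lift UP F ?FF (?m u2) (co u1)) = SQ cpx (%w1 w2. f (ra v (la w1 u1) *[UQ] ra w2 u2)) w"
    unfolding key[OF co(1)[OF u1] u2] by (rule lift_cong) (simp only: co(2) u1)
  qed
  also have "\<dots> = SQ cpx (%w1 w2. SP cpx (%u1 u2. f (ra v (la w1 u1) *[UQ] ra w2 u2)) u) w"
   by (rule SQ_SP_swap[OF vs_cpx w u]) ((assumption | rule v bilinI Q.H_lin[OF f] lins cls)+)
  also have "\<dots> = SQ cpx (%w1 w2. f (SP UQ (%u1 u2. ra v (la w1 u1) *[UQ] ra w2 u2) u)) w"
   by (rule lift_cong) (rule tensor_lift_natural[OF P.vsU P.vsU Q.vsU vs_cpx lf bb cmu, symmetric])
  also have "\<dots> = f (ra (v *[UQ] w) u)"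
   unfolding ra_of_mult[OF v w u] by (rule tensor_lift_natural[OF Q.vsU Q.vsU Q.vsU vs_cpx lf bs cw, symmetric])
  finally show "Q.ev2 v w (SP ?FF (%u1 u2. tensor_lift UP F ?FF (?m u2) (co u1)) u) = act u f (v *[UQ] w)"
   unfolding act_eval[OF u alg_closed(2)[OF Q.algU v w]] .
 qed
qed

lemma act_co_commute_eq:
 assumes u: "u <: UP" and f: "f <: F"
 shows "sweedler UP UF (%u1 u2. tensor_lift UP F UF (%x g. x \<boxtimes>[UP,F] (act u1 f *[F] g)) (co u2)) u =
  sweedler UP UF (%u1 u2. tensor_lift UP F UF (%x g. x \<boxtimes>[UP,F] (g *[F] act u2 f)) (co u1)) u"
proof -
 note cmu = P.comult_closed[OF u]
 have b: "bilin UP F UF (%x g. x \<boxtimes>[UP,F] (k *[F] g))" "bilin UP F UF (%x g. x \<boxtimes>[UP,F] (g *[F] k))" if "k <: F" for k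
  by ((assumption | rule that lins cls)+)
 have bl: "bilin UP UP UF (%u1 u2. tensor_lift UP F UF (%x g. x \<boxtimes>[UP,F] (act u1 f *[F] g)) (co u2))"
  and br: "bilin UP UP UF (%u1 u2. tensor_lift UP F UF (%x g. x \<boxtimes>[UP,F] (g *[F] act u2 f)) (co u1))"
  by ((assumption | rule f lins cls)+)
 show ?thesis unfolding sweedler_def
 proof (rule UF_eqI[OF tensor_lift_closed[OF P.vsU P.vsU vsUF bl cmu] tensor_lift_closed[OF P.vsU P.vsU vsUF br cmu]])
  fix v assume v: "v <: UQ"
  note lv = lin_ev[OF v lin_id] and cv = Q.comult_closed[OF v]
  have bq: "bilin UQ UQ UP (%v1 v2. k v1 .[UP] ev v2 t)" if k: "k <: F" and t: "t <: UF" for k t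
   by (intro bilinI lin_smult_left[OF P.vsU ev_closed] lin_pointwise_smult[OF P.vsU] lin_ev_left[OF t lin_id] Q.H_lin[OF k lin_id] t; assumption)
  have key: "ev v (tensor_lift UP F UF (%x g. x \<boxtimes>[UP,F] (k *[F] g)) t) = SQ UP (%v1 v2. k v1 .[UP] ev v2 t) v"
   "ev v (tensor_lift UP F UF (%x g. x \<boxtimes>[UP,F] (g *[F] k)) t) = SQ UP (%v1 v2. k v1 .[UP] ev v2 t) v"
   if t: "t <: UF" and k: "k <: F" for t k
  proof -
   have l: "lin UF UP (%t. SQ UP (%v1 v2. k v1 .[UP] ev v2 t) v)"
    by (rule lin_tensor_lift_fun[OF Q.vsU Q.vsU vsUF P.vsU cv bq[OF k]]) (assumption | rule lin_pointwise_smult P.vsU lin_ev lin_id)+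
   have pure: "SQ cpx (%v1 v2. k v1 * g v2) v .[UP] x = SQ UP (%v1 v2. k v1 .[UP] ev v2 (x \<boxtimes>[UP,F] g)) v"
    if x: "x <: UP" and g: "g <: F" for x g
    unfolding tensor_lift_natural[OF Q.vsU Q.vsU vs_cpx P.vsU lin_smult_left[OF P.vsU x lin_id] Q.bilin_H_product[OF k g] cv]
    by (rule lift_cong) (simp only: ev_pure x g vs_smult_smult[OF P.vsU x])
   have com: "SQ cpx (%v1 v2. g v1 * k v2) v = SQ cpx (%v1 v2. k v1 * g v2) v" if g: "g <: F" for g
    unfolding Q.cocommutative[OF vs_cpx Q.bilin_H_product[OF g k] v] by (simp only: mult.commute)
   show "ev v (tensor_lift UP F UF (%x g. x \<boxtimes>[UP,F] (k *[F] g)) t) = SQ UP (%v1 v2. k v1 .[UP] ev v2 t) v"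
    by (rule tensor_ext[OF P.vsU Q.vsH P.vsU lin_comp[OF lv tensor_lift_lin[OF P.vsU Q.vsH vsUF b(1)[OF k]]] l _ t])
     (simp only: tensor_lift_pure[OF P.vsU Q.vsH vsUF b(1)[OF k]] ev_pure[OF v] Q.H_mult_closed k Q.H_eval(1)[OF v], rule pure)
   show "ev v (tensor_lift UP F UF (%x g. x \<boxtimes>[UP,F] (g *[F] k)) t) = SQ UP (%v1 v2. k v1 .[UP] ev v2 t) v"
   proof (rule tensor_ext[OF P.vsU Q.vsH P.vsU lin_comp[OF lv tensor_lift_lin[OF P.vsU Q.vsH vsUF b(2)[OF k]]] l _ t])
    fix x g assume x: "x <: UP" and g: "g <: F"
    show "ev v (tensor_lift UP F UF (%x g. x \<boxtimes>[UP,F] (g *[F] k)) (x \<boxtimes>[UP,F] g)) = SQ UP (%v1 v2. k v1 .[UP] ev v2 (x \<boxtimes>[UP,F] g)) v"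
     unfolding tensor_lift_pure[OF P.vsU Q.vsH vsUF b(2)[OF k] x g] ev_pure[OF v x Q.H_mult_closed[OF g k]] Q.H_eval(1)[OF v] com[OF g]
     by (rule pure[OF x g])
   qed
  qed
  have bu: "bilin UP UP UP (%u1 u2. SQ UP (%v1 v2. act u1 f v1 .[UP] ev v2 (co u2)) v)"
  proof (rule bilinI)
   fix u1 assume u1: "u1 <: UP"
   show "lin UP UP (%u2. SQ UP (%v1 v2. act u1 f v1 .[UP] ev v2 (co u2)) v)"
    by (rule lin_tensor_lift_fun[OF Q.vsU Q.vsU P.vsU P.vsU cv bq[OF act_closed[OF u1 f] co(1)]], assumption)
     (assumption | rule lin_pointwise_smult P.vsU lin_ev lin_co lin_id)+
   show "lin UP UP (%u2. SQ UP (%v1 v2. act u2 f v1 .[UP] ev v2 (co u1)) v)"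
    by (rule lin_tensor_lift_fun[OF Q.vsU Q.vsU P.vsU P.vsU cv bq[OF act_closed[OF _ f] co(1)[OF u1]]], assumption)
     (assumption | rule lin_smult_left P.vsU ev_closed co(1)[OF u1] Q.lin_eval lin_act f lin_id)+
  qed
  have L: "ev v (SP UF (%u1 u2. tensor_lift UP F UF (%x g. x \<boxtimes>[UP,F] (act u1 f *[F] g)) (co u2)) u) =
    SP UP (%u1 u2. SQ UP (%v1 v2. act u1 f v1 .[UP] ev v2 (co u2)) v) u"
   unfolding tensor_lift_natural[OF P.vsU P.vsU vsUF P.vsU lv bl cmu]
   by (rule lift_cong) (rule key(1)[OF co(1) act_closed[OF _ f]])
  have R: "ev v (SP UF (%u1 u2. tensor_lift UP F UF (%x g. x \<boxtimes>[UP,F] (g *[F] act u2 f)) (co u1)) u) =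
    SP UP (%u1 u2. SQ UP (%v1 v2. act u2 f v1 .[UP] ev v2 (co u1)) v) u"
   unfolding tensor_lift_natural[OF P.vsU P.vsU vsUF P.vsU lv br cmu]
   by (rule lift_cong) (rule key(2)[OF co(1) act_closed[OF _ f]])
  show "ev v (SP UF (%u1 u2. tensor_lift UP F UF (%x g. x \<boxtimes>[UP,F] (act u1 f *[F] g)) (co u2)) u) =
    ev v (SP UF (%u1 u2. tensor_lift UP F UF (%x g. x \<boxtimes>[UP,F] (g *[F] act u2 f)) (co u1)) u)"
   unfolding L R by (rule P.cocommutative[OF P.vsU bu u])
 qed
qed

theorem matched_pair: "matched_pair_hopf F UP act co"
proof (rule matched_pair_hopf.intro[OF Q.hopf_algebra_rep P.hopf_algebra_uea], rule matched_pair_hopf_axioms.intro)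
 note one = alg_closed(1)[OF P.algU] and oneQ = alg_closed(1)[OF Q.algU]
 show "lin UP UF co" by (rule lin_co[OF lin_id])
 show "co 1[UP] = 1[UP] \<boxtimes>[UP,F] 1[F]" by (rule co_one_eq)
 fix f assume f: "f <: F"
 show "lin UP F (%u. act u f)" by (rule lin_act(2)[OF f lin_id])
 show "act 1[UP] f = f" by (rule Q.H_eqI[OF act_closed[OF one f] f]) (simp only: act_eval one ra_one)
next
 note one = alg_closed(1)[OF P.algU] and oneQ = alg_closed(1)[OF Q.algU]
 fix u assume u: "u <: UP"
 show "lin F F (act u)" by (rule lin_act(1)[OF u lin_id])
 show "act u 1[F] = counit UP u .[F] 1[F]"
  by (rule Q.H_eqI[OF act_closed[OF u Q.H_one_closed] vs_closed(3)[OF Q.vsH Q.H_one_closed]])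
   (simp only: act_eval u Q.H_eval ra_closed counit_ra mult.commute)
 have "tensor_lift UP F UP (%x f. counit F f .[UP] x) (co u) = ev 1[UQ] (co u)" unfolding ev_def Q.H_hopf_ops by (rule refl)
 then show "tensor_lift UP F UP (%x f. counit F f .[UP] x) (co u) = u" unfolding co(2)[OF u oneQ] la_one(1)[OF u] .
 fix f assume f: "f <: F"
 show "counit F (act u f) = counit UP u * counit F f"
  unfolding Q.H_hopf_ops act_eval[OF u oneQ] ra_one(2)[OF u] lin_smult[OF Q.H_lin[OF f lin_id] oneQ] by simp
qed ((rule co_coassociative_eq co_comult_eq co_counit_coalgebra_eq comult_act_eq co_mult_eq act_co_commute_eq act_on_mult_eq act_mult_eq, assumption+)+)

end

lemma (in matched_pair_lie) matched_brackets: "matched_brackets g1 g2 lact ract"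
proof (rule matched_brackets.intro[OF g1.bracket_space g2.bracket_space], rule matched_brackets_axioms.intro)
 note V1 = g1.vectorspace_axioms and V2 = g2.vectorspace_axioms
 interpret B1: bracket_space g1 by (rule g1.bracket_space)
 interpret B2: bracket_space g2 by (rule g2.bracket_space)
 have c: "X <: g1 ==> \<xi> <: g2 ==> lact \<xi> X <: g1" "X <: g1 ==> \<xi> <: g2 ==> ract \<xi> X <: g2" for X \<xi>
  by (rule lin_closed[OF lact_linear_right] lin_closed[OF ract_linear_right]; assumption)+
 note cl = c B1.bracket_closed B2.bracket_closed vs_closed(2)[OF V1] vs_closed(2)[OF V2]
 show "bilin g1 g1 g1 (bracket g1)" by (rule bilinI[OF g1.bracket_linear_right g1.bracket_linear_left])
 show "bilin g2 g2 g2 (bracket g2)" by (rule bilinI[OF g2.bracket_linear_right g2.bracket_linear_left])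
 show "bilin g2 g1 g1 lact" by (rule bilinI[OF lact_linear_right lact_linear_left])
 show "bilin g2 g1 g2 ract" by (rule bilinI[OF ract_linear_right ract_linear_left])
 fix \<zeta> \<xi> X Y assume z: "\<zeta> <: g2" and X: "X <: g1"
 { assume xi: "\<xi> <: g2"
  show "lact \<zeta> (lact \<xi> X) = lact (bracket g2 \<zeta> \<xi>) X +[g1] lact \<xi> (lact \<zeta> X)"
   unfolding lact_bracket[OF z xi X] by (rule vs_minus_add_cancel[OF V1, symmetric]) (intro cl z xi X)+
  show "ract (bracket g2 \<zeta> \<xi>) X +[g2] ract \<xi> (lact \<zeta> X) =
    (bracket g2 (ract \<zeta> X) \<xi> +[g2] bracket g2 \<zeta> (ract \<xi> X)) +[g2] ract \<zeta> (lact \<xi> X)"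
   unfolding ract_of_bracket[OF z xi X] by (rule vs_minus_add_cancel[OF V2]) (intro cl z xi X)+
 next
  assume Y: "Y <: g1"
  show "ract (ract \<zeta> X) Y = ract \<zeta> (bracket g1 X Y) +[g2] ract (ract \<zeta> Y) X"
   unfolding ract_bracket[OF z X Y] by (rule vs_minus_add_cancel[OF V2, symmetric]) (intro cl z X Y)+
  show "lact \<zeta> (bracket g1 X Y) +[g1] lact (ract \<zeta> Y) X =
    (bracket g1 (lact \<zeta> X) Y +[g1] bracket g1 X (lact \<zeta> Y)) +[g1] lact (ract \<zeta> X) Y"
   unfolding lact_of_bracket[OF z X Y] by (rule vs_minus_add_cancel[OF V1]) (intro cl z X Y)+
 }
qed

theorem theorem3p2p10:
 fixes g1 :: "'a lie" and g2 :: "'b lie"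
  and lact :: "'b \<Rightarrow> 'a \<Rightarrow> 'a" and ract :: "'b \<Rightarrow> 'a \<Rightarrow> 'b"
  and B :: "'a set"
 assumes "matched_pair_lie g1 g2 lact ract"
  and "vectorspace.basis cpx g1 B"
 shows "(\<exists>!co. is_canonical_coaction g1 g2 lact ract B co) \<and>
  matched_pair_hopf (rep_hopf g2) (uea g1)
   (canonical_action g1 g2 lact ract) (canonical_coaction g1 g2 lact ract B)"
proof -
 interpret matched_pair_lie g1 g2 lact ract by (rule assms(1))
 note V = g1.vectorspace_axioms and fin = g1.finite_basis[OF assms(2)]
 obtain \<delta> where d: "\<forall>b\<in>B. lin (uea g1) cpx (\<delta> b) \<and> (\<forall>c\<in>B. \<delta> b (uea_incl g1 c) = (if b = c then 1 else 0))"
  using g1.dual_functionals[OF assms(2)] by (rule exE)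
 obtain cf where cf: "(\<forall>b\<in>B. lin g1 cpx (cf b)) \<and> (\<forall>x\<in>carrier g1. x = (\<Oplus>\<^bsub>g1\<^esub>b\<in>B. cf b x .[g1] b)) \<and>
  (\<forall>b\<in>B. \<forall>c\<in>B. cf b c = (if b = c then 1 else 0))" using coordinates_exist[OF V assms(2) fin] by (rule exE)
 interpret M: based_matched_brackets g1 g2 lact ract B \<delta>
 proof (rule based_matched_brackets.intro[OF matched_brackets], rule based_matched_brackets_axioms.intro)
  show "finite B" by (rule fin)
  show "B \<subseteq> carrier g1" using assms(2) by (simp add: g1.basis_def)
  show "lin (uea g1) cpx (\<delta> b)" if "b \<in> B" for b using bspec[OF d that] by (rule conjunct1)
  show "\<delta> b (uea_incl g1 c) = (if b = c then 1 else 0)" if "b \<in> B" "c \<in> B" for b c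
   using conjunct2[OF bspec[OF d that(1)]] that(2) by (rule bspec)
  show "\<exists>k. X = (\<Oplus>\<^bsub>g1\<^esub>b\<in>B. k b .[g1] b)" if "X <: g1" for X
   by (rule exI[of _ "%b. cf b X"]) (rule bspec[OF conjunct1[OF conjunct2[OF cf]] that])
 qed
 show ?thesis unfolding M.canonical_coaction_eq
  by (intro conjI M.matched_pair ex1I[where P = "is_canonical_coaction g1 g2 lact ract B", OF M.canonical_co M.canonical_co_unique])
qed

end
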